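(* Let $T$ be a non-unary string and suppose its run-length encoding $\mathrm{rle}(T)$, consisting of $m$ runs, is given as input. Then the set of all longest unbordered factors of $T$ (i.e., all occurrences of unbordered factors of $T$ of maximum length) can be computed in $O(m\sqrt{m}\log^2 m)$ time using $O(m\log^2 m)$ space.
   Context: A border of a string $w$ is a non-empty string that is both a proper prefix and a proper suffix of $w$; $w$ is bordered if it has a border and unbordered otherwise. A factor of $T$ is a contiguous substring $T[i..j]$. The run-length encoding $\mathrm{rle}(T)$ of $T$ represents each maximal run of a repeated character $c$ of length $e$ as the pair $c^e$; the number of runs is the RLE size $m$ of $T$. A string is unary if all its characters are identical. *)

theory Defs
  imports Complex_Main "HOL-Library.Sublist" "HOL-Library.Landau_Symbols"
begin

section \<open>Strings\<close>

definition border :: "'a list \<Rightarrow> 'a list \<Rightarrow> bool" where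
  "border b w \<longleftrightarrow> b \<noteq> [] \<and> strict_prefix b w \<and> strict_suffix b w"

definition bordered :: "'a list \<Rightarrow> bool" where
  "bordered w \<longleftrightarrow> (\<exists>b. border b w)"

abbreviation unbordered :: "'a list \<Rightarrow> bool" where
  "unbordered w \<equiv> \<not> bordered w"

definition unary :: "'a list \<Rightarrow> bool" where
  "unary T \<longleftrightarrow> (\<forall>x\<in>set T. \<forall>y\<in>set T. x = y)"

text \<open>Positions are counted from 1: \<open>factor T i j\<close> is \<open>T[i..j]\<close>, for \<open>1 \<le> i \<le> j \<le> length T\<close>.\<close>

definition factor :: "'a list \<Rightarrow> nat \<Rightarrow> nat \<Rightarrow> 'a list" where
  "factor T i j = drop (i - 1) (take j T)"

definition unbordered_occs :: "'a list \<Rightarrow> (nat \<times> nat) set" where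
  "unbordered_occs T =
     {(i, j). 1 \<le> i \<and> i \<le> j \<and> j \<le> length T \<and> unbordered (factor T i j)}"

definition longest_unbordered_occs :: "'a list \<Rightarrow> (nat \<times> nat) set" where
  "longest_unbordered_occs T =
     {(i, j) \<in> unbordered_occs T.
        \<forall>(i', j') \<in> unbordered_occs T. length (factor T i' j') \<le> length (factor T i j)}"

function rle :: "'a list \<Rightarrow> ('a \<times> nat) list" where
  "rle [] = []"
| "rle (c # T) =
     (c, Suc (length (takeWhile (\<lambda>x. x = c) T))) # rle (dropWhile (\<lambda>x. x = c) T)"
  by pat_completeness auto
termination
  by (relation "measure length") (auto simp: le_imp_less_Suc length_dropWhile_le)

lemma rle_decode: "concat (map (\<lambda>(c, e). replicate e c) (rle T)) = T"
proof (induction T rule: rle.induct)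
  case (2 c T)
  have "replicate (length (takeWhile (\<lambda>x. x = c) T)) c = takeWhile (\<lambda>x. x = c) T"
    by (rule replicate_eqI[symmetric]) (auto dest: set_takeWhileD)
  with 2 show ?case by simp
qed simp

lemma rle_runs_maximal: "distinct_adj (map fst (rle T))"
proof (induction T rule: rle.induct)
  case (2 c T)
  show ?case
  proof (cases "dropWhile (\<lambda>x. x = c) T")
    case (Cons d U)
    then have "d \<noteq> c" by (metis (full_types) hd_dropWhile list.discI list.sel(1))
    with 2 Cons show ?thesis by simp
  next
    case Nil
    show ?thesis by (simp only: rle.simps Nil) simp
  qed
qed simp

section \<open>The word RAM\<close>

text \<open>
  A program is a structured program over registers, each holding one machine word; as a program is
  finite, it uses a constant number of registers. A state consists of the registers and of a
  random-access memory, addressed by words. Every primitive operation and every test costs one time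
  unit.
\<close>

datatype opd = Reg nat | Const nat

datatype arith = Add | Sub | Mul | Div | Mod | BitAnd | BitOr | BitXor | Shl | Shr

datatype test = Less opd opd | Equal opd opd

datatype com =
    Skip
  | Move nat opd
  | Arith arith nat opd opd
  | Load nat opd
  | Store opd opd
  | Seq com com
  | Cond test com com
  | While test com

type_synonym state = "(nat \<Rightarrow> nat) \<times> (nat \<Rightarrow> nat)"

text \<open>The parameter \<open>w\<close> is the word length in bits; all arithmetic is modulo \<open>2 ^ w\<close>.\<close>

fun opd_val :: "nat \<Rightarrow> (nat \<Rightarrow> nat) \<Rightarrow> opd \<Rightarrow> nat" where
  "opd_val w R (Reg r) = R r"
| "opd_val w R (Const k) = k mod 2 ^ w"

fun arith_val :: "nat \<Rightarrow> arith \<Rightarrow> nat \<Rightarrow> nat \<Rightarrow> nat" where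
  "arith_val w Add x y = (x + y) mod 2 ^ w"
| "arith_val w Sub x y = (x + 2 ^ w - y) mod 2 ^ w"
| "arith_val w Mul x y = (x * y) mod 2 ^ w"
| "arith_val w Div x y = x div y"
| "arith_val w Mod x y = x mod y"
| "arith_val w BitAnd x y = and x y"
| "arith_val w BitOr x y = or x y"
| "arith_val w BitXor x y = xor x y"
| "arith_val w Shl x y = push_bit y x mod 2 ^ w"
| "arith_val w Shr x y = drop_bit y x"

fun test_val :: "nat \<Rightarrow> (nat \<Rightarrow> nat) \<Rightarrow> test \<Rightarrow> bool" where
  "test_val w R (Less a b) \<longleftrightarrow> opd_val w R a < opd_val w R b"
| "test_val w R (Equal a b) \<longleftrightarrow> opd_val w R a = opd_val w R b"

text \<open>
  \<open>exec w S c s t s'\<close>: on the machine with \<open>w\<close>-bit words and \<open>S\<close> memory cells (addresses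
  \<open>0, \<dots>, S - 1\<close>), program \<open>c\<close> started in \<open>s\<close> halts after \<open>t\<close> time units in \<open>s'\<close>. An access outside
  the \<open>S\<close> cells has no rule, so a run that attempts one is not derivable. Bounding addresses, rather
  than counting the cells touched, excludes sparse use of a larger address space.
\<close>

inductive exec :: "nat \<Rightarrow> nat \<Rightarrow> com \<Rightarrow> state \<Rightarrow> nat \<Rightarrow> state \<Rightarrow> bool" for w S :: nat where
  Skip: "exec w S Skip s 1 s"
| Move: "exec w S (Move r a) (R, M) 1 (R(r := opd_val w R a), M)"
| Arith: "exec w S (Arith f r a b) (R, M) 1
            (R(r := arith_val w f (opd_val w R a) (opd_val w R b)), M)"
| Load: "opd_val w R a < S \<Longrightarrow>
         exec w S (Load r a) (R, M) 1 (R(r := M (opd_val w R a)), M)"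
| Store: "opd_val w R a < S \<Longrightarrow>
          exec w S (Store a b) (R, M) 1 (R, M(opd_val w R a := opd_val w R b))"
| Seq: "exec w S c1 s1 t1 s2 \<Longrightarrow> exec w S c2 s2 t2 s3 \<Longrightarrow>
        exec w S (Seq c1 c2) s1 (t1 + t2) s3"
| CondTrue: "test_val w (fst s) b \<Longrightarrow> exec w S c1 s t s' \<Longrightarrow>
           exec w S (Cond b c1 c2) s (Suc t) s'"
| CondFalse: "\<not> test_val w (fst s) b \<Longrightarrow> exec w S c2 s t s' \<Longrightarrow>
            exec w S (Cond b c1 c2) s (Suc t) s'"
| WhileFalse: "\<not> test_val w (fst s) b \<Longrightarrow> exec w S (While b c) s 1 s"
| WhileTrue: "test_val w (fst s1) b \<Longrightarrow> exec w S c s1 t1 s2 \<Longrightarrow>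
              exec w S (While b c) s2 t2 s3 \<Longrightarrow>
              exec w S (While b c) s1 (Suc (t1 + t2)) s3"

inductive_cases exec_SkipE: "exec w S Skip s t s'"
inductive_cases exec_MoveE: "exec w S (Move r a) s t s'"
inductive_cases exec_ArithE: "exec w S (Arith f r a b) s t s'"
inductive_cases exec_LoadE: "exec w S (Load r a) s t s'"
inductive_cases exec_StoreE: "exec w S (Store a b) s t s'"
inductive_cases exec_SeqE: "exec w S (Seq c1 c2) s t s'"
inductive_cases exec_CondE: "exec w S (Cond b c1 c2) s t s'"
inductive_cases exec_WhileE: "exec w S (While b c) s t s'"

lemma exec_deterministic:
  "exec w S c s t s' \<Longrightarrow> exec w S c s u s'' \<Longrightarrow> u = t \<and> s'' = s'"
proof (induction arbitrary: u s'' rule: exec.induct)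
  case (Skip s)
  then show ?case by (auto elim: exec_SkipE)
next
  case (Move r a R M)
  then show ?case by (auto elim: exec_MoveE)
next
  case (Arith f r a b R M)
  then show ?case by (auto elim: exec_ArithE)
next
  case (Load R a r M)
  from Load.prems show ?case by (rule exec_LoadE) auto
next
  case (Store R a b M)
  from Store.prems show ?case by (rule exec_StoreE) auto
next
  case (Seq c1 s1 t1 s2 c2 t2 s3)
  from Seq.prems show ?case by (rule exec_SeqE) (use Seq.IH in blast)
next
  case (CondTrue s b c1 t s' c2)
  from CondTrue.prems show ?case by (rule exec_CondE) (use CondTrue in blast)+
next
  case (CondFalse s b c2 t s' c1)
  from CondFalse.prems show ?case by (rule exec_CondE) (use CondFalse in blast)+
next
  case (WhileFalse s b c)
  from WhileFalse.prems show ?case by (rule exec_WhileE) (use WhileFalse in auto)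
next
  case (WhileTrue s1 b c t1 s2 t2 s3)
  from WhileTrue.prems show ?case by (rule exec_WhileE) (use WhileTrue in blast)+
qed

text \<open>
  Input: register 0 holds the number of runs and the memory starts with
  \<open>c\<^sub>1, e\<^sub>1, c\<^sub>2, e\<^sub>2, \<dots>\<close>; all other registers and cells hold arbitrary words.
  Output: register 0 holds the number of occurrences and register 1 the address of an array
  \<open>i\<^sub>1, j\<^sub>1, i\<^sub>2, j\<^sub>2, \<dots>\<close> listing them without repetition, in any order.
  The cells of both arrays count towards the space.
\<close>

definition rle_input :: "nat \<Rightarrow> (nat \<times> nat) list \<Rightarrow> state \<Rightarrow> bool" where
  "rle_input w X s \<longleftrightarrow>
     (case s of (R, M) \<Rightarrow>
       (\<forall>r. R r < 2 ^ w) \<and> (\<forall>a. M a < 2 ^ w) \<and>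
       R 0 = length X \<and>
       (\<forall>k<length X. M (2 * k) = fst (X ! k) \<and> M (2 * k + 1) = snd (X ! k)))"

definition occs_output :: "nat \<Rightarrow> (nat \<times> nat) set \<Rightarrow> state \<Rightarrow> bool" where
  "occs_output S A s \<longleftrightarrow>
     (case s of (R, M) \<Rightarrow>
       \<exists>xs. distinct xs \<and> set xs = A \<and>
         R 0 = length xs \<and> R 1 + 2 * length xs \<le> S \<and>
         (\<forall>k<length xs. M (R 1 + 2 * k) = fst (xs ! k) \<and> M (R 1 + 2 * k + 1) = snd (xs ! k)))"

end

theory Submission
  imports Defs
begin

text \<open>
  Only factors that start and end at run boundaries matter, so the task is to find, for every run \<open>i\<close>, the last run \<open>j\<close>
  such that no proper suffix of the runs \<open>i, \<dots>, j\<close> matches a prefix of them up to the exponents of the two outer runs.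
  Let \<open>k \<ge> sqrt m\<close>.

  Borders of at most \<open>k\<close> runs are handled by a sweep over the runs in the lexicographic order of the sequences of
  characters and exponents that follow them. A pair of a start \<open>p\<close> and a number \<open>r\<close> of runs that is a candidate border for
  the current run raises, in a segment tree over the possible ends, the leaf of its end to the exponent of \<open>p\<close>. In the
  sweep the candidates behave like a stack, so they are removed by undoing a log. Each candidate class is created
  once, which gives \<open>O(m k)\<close> operations; only unbordered candidates change the tree, and they are so sparse that, by a
  harmonic sum, the log has only \<open>O(m log\<^sup>2 m)\<close> entries.

  A shortest border is unbordered, hence its occurrences do not overlap. If it has more than \<open>k\<close> runs then it has at most
  \<open>k + 1\<close> occurrences, so it is among the \<open>k\<close> nearest suitable neighbours in the lexicographic order, on one of the two sides;
  longest common extensions are read off the tables of a prefix doubling sort.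
\<close>

text \<open>The exponent of the first run of a border enters only through the inequality
  \<open>e i <= e p\<close>, and a border of one letter ignores exponents altogether. So the first
  exponent is kept out of the sorted sequences and becomes the value that a candidate stores in the
  tree; a start \<open>i\<close> then asks for the last end whose value is below \<open>e i\<close>.
  The obstacle to the space bound is that there may be about m * k candidates. A bordered candidate
  is dominated by one with fewer runs and the same end, so a test before each write keeps it out of
  the log. Among the unbordered candidates with r >= 2 runs, no three start within r - 1 runs of
  each other, although two may: their first exponents would have to decrease strictly and to repeat
  at the same time. A candidate may also lie at or before \<open>i\<close>, where it is no border.
  For ends from \<open>i + k\<close> on this cannot happen, because a candidate has at most
  \<open>k\<close> runs; the nearer ends are decided by direct comparison. In the walks, one factor
  log m comes from splitting an interval of ends into nodes, the other from the way to the root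
  after each node.\<close>

abbreviation (input) equ :: "bool => bool => bool" (infixr \<open><->\<close> 25) where
 "P <-> Q == P = Q"

text \<open>The frame condition of the specifications: \<open>X\<close> lists the registers or
  arrays that a program may change.\<close>

abbreviation (input) sm :: "'a set => ('a => 'b) => ('a => 'b) => bool" where
 "sm X f g == ALL y. y \<notin> X --> f y = g y"

section \<open>Programs with named arrays\<close>

text \<open>The program must not depend on the word length, so the largest word cannot be a literal;
  \<open>Ones\<close> produces it as 0 - 1 modulo \<open>2 ^ w\<close>.\<close>

datatype ex = Num nat | Var nat | Ar nat ex | Op arith ex ex | Ones

datatype cnd = Lt ex ex | Eq ex ex

datatype stm =
  Nop
 | Asg nat ex (\<open>_ ::= _\<close> [61, 61] 61)
 | Sto nat ex ex
 | Sq stm stm (infixr \<open>;;\<close> 60)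
 | Ite cnd stm stm
 | Wh cnd stm

text \<open>
 The registers from 80 on are scratch space for the evaluation of expressions; register \<open>60 + k\<close>
 holds the base address of array \<open>k\<close>.
\<close>

fun cexp :: "ex => nat => com" where
 "cexp (Num k) d = Move d (Const k)"
| "cexp (Var r) d = Move d (Reg r)"
| "cexp (Ar k a) d = Seq (cexp a d) (Seq (Arith Add d (Reg d) (Reg (60 + k))) (Load d (Reg d)))"
| "cexp (Op f a b) d = Seq (cexp a d) (Seq (cexp b (Suc d)) (Arith f d (Reg d) (Reg (Suc d))))"
| "cexp Ones d = Arith Sub d (Const 0) (Const 1)"

fun xc :: "ex => nat" where
 "xc (Num k) = 1"
| "xc (Var r) = 1"
| "xc (Ar k a) = xc a + 2"
| "xc (Op f a b) = xc a + xc b + 1"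
| "xc Ones = 1"

fun xk :: "cnd => nat" where
 "xk (Lt a b) = xc a + xc b"
| "xk (Eq a b) = xc a + xc b"

fun ccnd :: "cnd => com" where
 "ccnd (Lt a b) = Seq (cexp a 80) (cexp b 81)"
| "ccnd (Eq a b) = Seq (cexp a 80) (cexp b 81)"

fun tst :: "cnd => test" where
 "tst (Lt a b) = Less (Reg 80) (Reg 81)"
| "tst (Eq a b) = Equal (Reg 80) (Reg 81)"

text \<open>A machine test only compares two operands. The code that evaluates a loop condition
  therefore occurs twice: before the loop and at the end of its body.\<close>

fun comp :: "stm => com" where
 "comp Nop = Skip"
| "comp (Asg x e) = Seq (cexp e 80) (Move x (Reg 80))"
| "comp (Sto k a b) = Seq (cexp a 80) (Seq (cexp b 81)
  (Seq (Arith Add 80 (Reg 80) (Reg (60 + k))) (Store (Reg 80) (Reg 81))))"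
| "comp (Sq a b) = Seq (comp a) (comp b)"
| "comp (Ite c a b) = Seq (ccnd c) (Cond (tst c) (comp a) (comp b))"
| "comp (Wh c a) = Seq (ccnd c) (While (tst c) (Seq (comp a) (ccnd c)))"

fun aop :: "arith => nat => nat => nat" where
 "aop Add x y = x + y"
| "aop Sub x y = x - y"
| "aop Mul x y = x * y"
| "aop Div x y = x div y"
| "aop Mod x y = x mod y"
| "aop _ x y = 0"

type_synonym regs = "nat => nat"
type_synonym arrs = "nat => nat => nat"

section \<open>Exact arithmetic and timed specifications of programs\<close>

locale machine =
 fixes w S :: nat and base len :: "nat => nat"
 assumes base_len: "k < 20 ==> 0 < len k ==> base k + len k <= S"
  and disj: "k < 20 ==> l < 20 ==> k ~= l ==> x < len k ==> y < len l ==> base k + x ~= base l + y"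
  and S_le: "S <= 2 ^ w"
  and w_pos: "0 < w"
begin

fun ev :: "regs => arrs => ex => nat" where
 "ev R A (Num k) = k"
| "ev R A (Var r) = R r"
| "ev R A (Ar k a) = A k (ev R A a)"
| "ev R A (Op f a b) = aop f (ev R A a) (ev R A b)"
| "ev R A Ones = 2 ^ w - 1"

text \<open>The side conditions under which the modular operation of the machine equals the exact
  operation \<open>aop\<close>. With them, all later reasoning is about plain natural
  numbers.\<close>

fun okf :: "arith => nat => nat => bool" where
 "okf Add x y <-> x + y < 2 ^ w"
| "okf Sub x y <-> y <= x"
| "okf Mul x y <-> x * y < 2 ^ w"
| "okf Div x y <-> True"
| "okf Mod x y <-> True"
| "okf _ x y <-> False"

fun okx :: "regs => arrs => ex => bool" where
 "okx R A (Num k) <-> k < 2 ^ w"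
| "okx R A (Var r) <-> r < 80"
| "okx R A (Ar k a) <-> okx R A a & k < 20 & ev R A a < len k"
| "okx R A (Op f a b) <-> okx R A a & okx R A b & okf f (ev R A a) (ev R A b)"
| "okx R A Ones <-> True"

fun holds :: "regs => arrs => cnd => bool" where
 "holds R A (Lt a b) <-> ev R A a < ev R A b"
| "holds R A (Eq a b) <-> ev R A a = ev R A b"

fun okc :: "regs => arrs => cnd => bool" where
 "okc R A (Lt a b) <-> okx R A a & okx R A b"
| "okc R A (Eq a b) <-> okx R A a & okx R A b"

text \<open>The abstract state forgets the scratch registers and the cells outside the arrays. A
  base register is fixed only through the cells of its array, so an array of length 0 leaves its
  register free.\<close>

definition agree :: "regs => regs => regs => arrs => bool" where
 "agree R0 M0 R A <-> (ALL r<80. R0 r = R r) & (ALL r. R0 r < 2 ^ w) & (ALL a. M0 a < 2 ^ w) &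
  (ALL k<20. ALL x<len k. R0 (60 + k) = base k & M0 (base k + x) = A k x)"

text \<open>A total correctness triple; as execution is deterministic, the existential quantifier
  speaks of the only run. The time is an argument of the postcondition, so a bound may refer to the
  final state, as amortised bounds do.\<close>

definition runs :: "stm => regs => arrs => (nat => regs => arrs => bool) => bool" where
 "runs c R A Q <-> (ALL R0 M0. agree R0 M0 R A -->
  (EX t R0' M0' R' A'. exec w S (comp c) (R0, M0) t (R0', M0') & agree R0' M0' R' A' & Q t R' A'))"

lemma arith_aop:
 assumes "okf f x y" "x < 2 ^ w" "y < 2 ^ w"
 shows "arith_val w f x y = aop f x y & aop f x y < 2 ^ w"
proof (cases f)
 case Sub
 then have "x + 2 ^ w - y = (x - y) + 2 ^ w" using assms by auto
 then have "(x + 2 ^ w - y) mod 2 ^ w = (x - y) mod 2 ^ w" by simp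
 then show ?thesis using Sub assms by (simp add: less_imp_diff_less)
next
 case Div
 then show ?thesis using assms by (auto intro: le_less_trans[OF div_le_dividend])
next
 case Mod
 then show ?thesis using assms by (auto intro: le_less_trans[OF mod_less_eq_dividend])
qed (use assms in auto)

lemma exec_Arith':
 "s' = (R(r := arith_val w f (opd_val w R a) (opd_val w R b)), M) ==> exec w S (Arith f r a b) (R, M) 1 s'"
 using exec.Arith by auto

lemma exec_Load':
 "opd_val w R a < S ==> s' = (R(r := M (opd_val w R a)), M) ==> exec w S (Load r a) (R, M) 1 s'"
 using exec.Load by auto

lemma exec_exprI:
 assumes "exec w S c (R1, M0) t (R2, M0)" "R2 d = v" "ALL r<d. R2 r = R1 r" "ALL r. R2 r < 2 ^ w"
 shows "EX R2. exec w S c (R1, M0) t (R2, M0) & R2 d = v & (ALL r<d. R2 r = R1 r) & (ALL r. R2 r < 2 ^ w)"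
 using assms by blast

text \<open>Evaluation follows a stack discipline: the code for target \<open>d\<close> writes only
  registers from \<open>d\<close> on, so the value of a left operand survives the evaluation of the
  right one, and the registers below 80 are never touched.\<close>

lemma exec_cexp:
 assumes "agree R0 M0 R A" "okx R A e" "80 <= d"
  "ALL r<80. R1 r = R0 r" "ALL r. R1 r < 2 ^ w"
 shows "EX R2. exec w S (cexp e d) (R1, M0) (xc e) (R2, M0) & R2 d = ev R A e &
  (ALL r<d. R2 r = R1 r) & (ALL r. R2 r < 2 ^ w)"
 using assms(2-)
proof (induction e arbitrary: d R1)
 case (Num k)
 have "exec w S (Move d (Const k)) (R1, M0) 1 (R1(d := k mod 2 ^ w), M0)"
  using exec.Move[of w S d "Const k" R1 M0] by simp
 moreover have "k mod 2 ^ w = k" using Num by simp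
 ultimately have "exec w S (cexp (Num k) d) (R1, M0) (xc (Num k)) (R1(d := k), M0)" by simp
 then show ?case using Num by - (rule exec_exprI, assumption, auto)
next
 case (Var r)
 have "exec w S (Move d (Reg r)) (R1, M0) 1 (R1(d := R1 r), M0)"
  using exec.Move[of w S d "Reg r" R1 M0] by simp
 then have "exec w S (cexp (Var r) d) (R1, M0) (xc (Var r)) (R1(d := R1 r), M0)" by simp
 moreover have "R1 r = R r" "R r < 2 ^ w" using Var assms(1) unfolding agree_def by (auto, metis)
 ultimately show ?case using Var by - (rule exec_exprI, assumption, auto)
next
 case (Ar k a)
 obtain R2 where R2: "exec w S (cexp a d) (R1, M0) (xc a) (R2, M0)" "R2 d = ev R A a"
  "ALL r<d. R2 r = R1 r" "ALL r. R2 r < 2 ^ w"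
  using Ar.IH[of d R1] Ar.prems by auto
 have k: "k < 20" "ev R A a < len k" using Ar.prems by auto
 have "R2 (60 + k) = R0 (60 + k)" using R2(3) Ar.prems(2,3) k(1) by simp
 then have b: "R2 (60 + k) = base k" using assms(1) k unfolding agree_def by auto
 have lt: "base k + ev R A a < S" using base_len[of k] k by (cases "len k") auto
 then have lt2: "ev R A a + base k < 2 ^ w" using S_le by linarith
 let ?R3 = "R2(d := ev R A a + base k)" and ?R4 = "R2(d := A k (ev R A a))"
 have e1: "exec w S (Arith Add d (Reg d) (Reg (60 + k))) (R2, M0) 1 (?R3, M0)"
  by (rule exec_Arith') (use R2(2) b lt2 in auto)
 have mm: "M0 (base k + ev R A a) = A k (ev R A a)" "ALL a. M0 a < 2 ^ w"
  using assms(1) k unfolding agree_def by auto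
 have e2: "exec w S (Load d (Reg d)) (?R3, M0) 1 (?R4, M0)"
  by (rule exec_Load') (use lt mm in "auto simp: add.commute")
 have "exec w S (cexp (Ar k a) d) (R1, M0) (xc a + (1 + 1)) (?R4, M0)"
  unfolding cexp.simps by (intro exec.Seq[OF R2(1)] exec.Seq[OF e1 e2])
 then have ex: "exec w S (cexp (Ar k a) d) (R1, M0) (xc (Ar k a)) (?R4, M0)" by simp
 have "A k (ev R A a) < 2 ^ w" using mm by metis
 then show ?case using R2(3,4) by (intro exec_exprI[OF ex]) auto
next
 case (Op f a b)
 obtain R2 where R2: "exec w S (cexp a d) (R1, M0) (xc a) (R2, M0)" "R2 d = ev R A a"
  "ALL r<d. R2 r = R1 r" "ALL r. R2 r < 2 ^ w"
  using Op.IH(1)[of d R1] Op.prems by auto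
 obtain R3 where R3: "exec w S (cexp b (Suc d)) (R2, M0) (xc b) (R3, M0)" "R3 (Suc d) = ev R A b"
  "ALL r<Suc d. R3 r = R2 r" "ALL r. R3 r < 2 ^ w"
  using Op.IH(2)[of "Suc d" R2] Op.prems R2 by auto
 have v: "arith_val w f (R3 d) (R3 (Suc d)) = aop f (ev R A a) (ev R A b)"
  "aop f (ev R A a) (ev R A b) < 2 ^ w"
 proof -
  have "R3 d = ev R A a" using R3(3) R2(2) by simp
  moreover have "R3 d < 2 ^ w" "R3 (Suc d) < 2 ^ w" using R3(4) by blast+
  moreover have "okf f (ev R A a) (ev R A b)" using Op.prems by simp
  ultimately show "arith_val w f (R3 d) (R3 (Suc d)) = aop f (ev R A a) (ev R A b)"
   "aop f (ev R A a) (ev R A b) < 2 ^ w"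
   using arith_aop[of f "ev R A a" "ev R A b"] R3(2) by simp_all
 qed
 let ?R4 = "R3(d := aop f (ev R A a) (ev R A b))"
 have e1: "exec w S (Arith f d (Reg d) (Reg (Suc d))) (R3, M0) 1 (?R4, M0)"
  by (rule exec_Arith') (use v in auto)
 have "exec w S (cexp (Op f a b) d) (R1, M0) (xc a + (xc b + 1)) (?R4, M0)"
  unfolding cexp.simps by (intro exec.Seq[OF R2(1)] exec.Seq[OF R3(1) e1])
 then have ex: "exec w S (cexp (Op f a b) d) (R1, M0) (xc (Op f a b)) (?R4, M0)" by (simp add: add.assoc)
 then show ?case using R2(3) R3(3,4) v(2) by (intro exec_exprI[OF ex]) auto
next
 case Ones
 have o: "(1::nat) < 2 ^ w" using w_pos by (metis one_less_numeral_iff one_less_power semiring_norm(76))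
 have "exec w S (Arith Sub d (Const 0) (Const 1)) (R1, M0) 1 (R1(d := 2 ^ w - 1), M0)"
  by (rule exec_Arith') (use o in auto)
 then have "exec w S (cexp Ones d) (R1, M0) (xc Ones) (R1(d := 2 ^ w - 1), M0)" by simp
 then show ?case using Ones by - (rule exec_exprI, assumption, auto)
qed

lemma exec_ccnd:
 assumes "agree R0 M0 R A" "okc R A c"
 shows "EX R2. exec w S (ccnd c) (R0, M0) (xk c) (R2, M0) & agree R2 M0 R A &
  (test_val w R2 (tst c) <-> holds R A c)"
proof -
 have *: "EX R2. exec w S (Seq (cexp a 80) (cexp b 81)) (R0, M0) (xc a + xc b) (R2, M0) &
   agree R2 M0 R A & R2 80 = ev R A a & R2 81 = ev R A b" if ok: "okx R A a" "okx R A b" for a b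
 proof -
  have "ALL r. R0 r < 2 ^ w" using assms(1) by (auto simp: agree_def)
  then obtain R2 where R2: "exec w S (cexp a 80) (R0, M0) (xc a) (R2, M0)" "R2 80 = ev R A a"
   "ALL r<80. R2 r = R0 r" "ALL r. R2 r < 2 ^ w" using exec_cexp[OF assms(1) ok(1), of 80 R0] by auto
  obtain R3 where R3: "exec w S (cexp b 81) (R2, M0) (xc b) (R3, M0)" "R3 81 = ev R A b"
   "ALL r<81. R3 r = R2 r" "ALL r. R3 r < 2 ^ w" using exec_cexp[OF assms(1) ok(2), of 81 R2] R2 by auto
  have "agree R3 M0 R A" using assms(1) R2 R3 unfolding agree_def by auto
  moreover have "R3 80 = ev R A a" using R2(2) R3(3) by simp
  ultimately show ?thesis using exec.Seq[OF R2(1) R3(1)] R3(2) by blast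
 qed
 show ?thesis
 proof (cases c)
  case (Lt a b)
  with assms(2) have "okx R A a" "okx R A b" by auto
  from *[OF this] obtain R2 where "exec w S (Seq (cexp a 80) (cexp b 81)) (R0, M0) (xc a + xc b) (R2, M0)"
   "agree R2 M0 R A" "R2 80 = ev R A a" "R2 81 = ev R A b" by blast
  then have "exec w S (ccnd c) (R0, M0) (xk c) (R2, M0) & agree R2 M0 R A &
   (test_val w R2 (tst c) <-> holds R A c)" using Lt by simp
  then show ?thesis by blast
 next
  case (Eq a b)
  with assms(2) have "okx R A a" "okx R A b" by auto
  from *[OF this] obtain R2 where "exec w S (Seq (cexp a 80) (cexp b 81)) (R0, M0) (xc a + xc b) (R2, M0)"
   "agree R2 M0 R A" "R2 80 = ev R A a" "R2 81 = ev R A b" by blast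
  then have "exec w S (ccnd c) (R0, M0) (xk c) (R2, M0) & agree R2 M0 R A &
   (test_val w R2 (tst c) <-> holds R A c)" using Eq by simp
  then show ?thesis by blast
 qed
qed

lemma runs_mono: "runs c R A Q ==> (!!t R' A'. Q t R' A' ==> Q' t R' A') ==> runs c R A Q'"
 unfolding runs_def by meson

lemma runs_exI:
 assumes "exec w S c (R0, M0) t (R0', M0')" "agree R0' M0' R' A'" "Q t R' A'"
 shows "EX t R0' M0' R' A'. exec w S c (R0, M0) t (R0', M0') & agree R0' M0' R' A' & Q t R' A'"
 using assms by blast

lemma runs_Nop: "Q 1 R A ==> runs Nop R A Q"
 unfolding runs_def comp.simps by (intro allI impI) (rule runs_exI[OF exec.Skip])

text \<open>A register from 60 on holds the base of an array and may be assigned only while that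
  array has length 0. This is how the prologue computes the layout: it runs in an instance in which
  only the input array has positive length.\<close>

lemma runs_Asg:
 assumes "okx R A e" "x < 80" "x < 60 \<or> len (x - 60) = 0" "Q (xc e + 1) (R(x := ev R A e)) A"
 shows "runs (x ::= e) R A Q"
 unfolding runs_def
proof (intro allI impI)
 fix R0 M0 assume ag: "agree R0 M0 R A"
 have "ALL r. R0 r < 2 ^ w" using ag by (auto simp: agree_def)
 then obtain R2 where R2: "exec w S (cexp e 80) (R0, M0) (xc e) (R2, M0)" "R2 80 = ev R A e"
  "ALL r<80. R2 r = R0 r" "ALL r. R2 r < 2 ^ w" using exec_cexp[OF ag assms(1), of 80 R0] by auto
 have e: "exec w S (Move x (Reg 80)) (R2, M0) 1 (R2(x := R2 80), M0)"
  using exec.Move[of w S x "Reg 80" R2 M0] by simp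
 have "ev R A e < 2 ^ w" using R2(2,4) by metis
 then have "agree (R2(x := R2 80)) M0 (R(x := ev R A e)) A"
  using ag R2 assms(2,3) unfolding agree_def by (auto simp: less_diff_conv)
 then show "EX t R0' M0' R' A'. exec w S (comp (x ::= e)) (R0, M0) t (R0', M0') & agree R0' M0' R' A' & Q t R' A'"
  unfolding comp.simps using exec.Seq[OF R2(1) e] assms(4) by (intro runs_exI)
qed

lemma runs_Sto:
 assumes "okx R A a" "okx R A b" "k < 20" "ev R A a < len k"
  "Q (xc a + xc b + 2) R (A(k := (A k)(ev R A a := ev R A b)))"
 shows "runs (Sto k a b) R A Q"
 unfolding runs_def
proof (intro allI impI)
 fix R0 M0 assume ag: "agree R0 M0 R A"
 have "ALL r. R0 r < 2 ^ w" using ag by (auto simp: agree_def)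
 then obtain R2 where R2: "exec w S (cexp a 80) (R0, M0) (xc a) (R2, M0)" "R2 80 = ev R A a"
  "ALL r<80. R2 r = R0 r" "ALL r. R2 r < 2 ^ w" using exec_cexp[OF ag assms(1), of 80 R0] by auto
 obtain R3 where R3: "exec w S (cexp b 81) (R2, M0) (xc b) (R3, M0)" "R3 81 = ev R A b"
  "ALL r<81. R3 r = R2 r" "ALL r. R3 r < 2 ^ w" using exec_cexp[OF ag assms(2), of 81 R2] R2 by auto
 have k: "k < 20" "ev R A a < len k" using assms by auto
 have "R3 (60 + k) = R0 (60 + k)" using R3(3) R2(3) k(1) by simp
 then have b: "R3 (60 + k) = base k" using ag k unfolding agree_def by auto
 have vb: "ev R A b < 2 ^ w" using R3(2,4) by metis
 have lt: "base k + ev R A a < S" using base_len[of k] k by (cases "len k") auto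
 then have lt2: "ev R A a + base k < 2 ^ w" using S_le by linarith
 let ?R4 = "R3(80 := base k + ev R A a)" and ?M = "M0(base k + ev R A a := ev R A b)"
 have e1: "exec w S (Arith Add 80 (Reg 80) (Reg (60 + k))) (R3, M0) 1 (?R4, M0)"
  by (rule exec_Arith') (use R2(2) R3(3) b lt2 in "auto simp: add.commute")
 have e2: "exec w S (Store (Reg 80) (Reg 81)) (?R4, M0) 1 (?R4, ?M)"
  using exec.Store[of w ?R4 "Reg 80" S "Reg 81" M0] lt R3(2) by auto
 have "exec w S (comp (Sto k a b)) (R0, M0) (xc a + (xc b + (1 + 1))) (?R4, ?M)"
  unfolding comp.simps by (intro exec.Seq[OF R2(1)] exec.Seq[OF R3(1)] exec.Seq[OF e1 e2])
 then have "exec w S (comp (Sto k a b)) (R0, M0) (xc a + xc b + 2) (?R4, ?M)" by (simp add: add.assoc)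
 moreover have "agree ?R4 ?M R (A(k := (A k)(ev R A a := ev R A b)))"
  unfolding agree_def
 proof (intro conjI allI impI)
  fix r show "?R4 r < 2 ^ w" using R3(4) lt2 by (auto simp: add.commute)
 next
  fix l x assume l: "l < 20" "x < len l"
  show "?R4 (60 + l) = base l" using ag l R2(3) R3(3) unfolding agree_def by auto
  show "?M (base l + x) = (A(k := (A k)(ev R A a := ev R A b))) l x"
  proof (cases "l = k")
   case True
   then show ?thesis using ag l unfolding agree_def by simp
  next
   case False
   then have "base l + x ~= base k + ev R A a" using disj[of k l "ev R A a" x] k l by metis
   then show ?thesis using ag l False unfolding agree_def by simp
  qed
 qed (use ag R2(3) R3(3,4) vb in "auto simp: agree_def")
 ultimately show "EX t R0' M0' R' A'. exec w S (comp (Sto k a b)) (R0, M0) t (R0', M0') & agree R0' M0' R' A' & Q t R' A'"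
  using assms(5) by (intro runs_exI)
qed

lemma runs_SqM:
 assumes "runs a R A Q1" "!!t R' A'. Q1 t R' A' ==> runs b R' A' (%t'. Q (t + t'))"
 shows "runs (a ;; b) R A Q"
 unfolding runs_def
proof (intro allI impI)
 fix R0 M0 assume "agree R0 M0 R A"
 then obtain t R0' M0' R' A' where 1: "exec w S (comp a) (R0, M0) t (R0', M0')" "agree R0' M0' R' A'" "Q1 t R' A'"
  using assms(1) unfolding runs_def by blast
 then obtain u R0'' M0'' R'' A'' where 2: "exec w S (comp b) (R0', M0') u (R0'', M0'')" "agree R0'' M0'' R'' A''" "Q (t + u) R'' A''"
  using assms(2)[OF 1(3)] unfolding runs_def by blast
 then show "EX t R0' M0' R' A'. exec w S (comp (a ;; b)) (R0, M0) t (R0', M0') & agree R0' M0' R' A' & Q t R' A'"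
  unfolding comp.simps using exec.Seq[OF 1(1) 2(1)] 2(2,3) by (intro runs_exI)
qed

text \<open>The premises of \<open>runs_SqM\<close> in the other order, so that a known
  specification of the first program can be supplied directly and the continuation is left as the
  first goal.\<close>

lemma runs_SqM':
 "(!!t R' A'. Q1 t R' A' ==> runs b R' A' (%t'. Q (t + t'))) ==> runs a R A Q1 ==> runs (a ;; b) R A Q"
 by (rule runs_SqM)

lemma runs_mono': "(!!t R' A'. Q t R' A' ==> Q' t R' A') ==> runs c R A Q ==> runs c R A Q'"
 by (rule runs_mono)

lemma runs_Sq: "runs a R A (%t R' A'. runs b R' A' (%t'. Q (t + t'))) ==> runs (a ;; b) R A Q"
 by (rule runs_SqM)

lemmas runs_SqA = runs_Sq[of "_ ::= _"]

lemma runs_Ite: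
 assumes "okc R A c"
  "holds R A c ==> runs a R A (%t. Q (t + xk c + 1))"
  "\<not> holds R A c ==> runs b R A (%t. Q (t + xk c + 1))"
 shows "runs (Ite c a b) R A Q"
 unfolding runs_def
proof (intro allI impI)
 fix R0 M0 assume ag: "agree R0 M0 R A"
 then obtain R2 where R2: "exec w S (ccnd c) (R0, M0) (xk c) (R2, M0)" "agree R2 M0 R A"
  "test_val w R2 (tst c) <-> holds R A c" using exec_ccnd assms(1) by blast
 obtain t R3 M3 R' A' where 3: "exec w S (comp (if holds R A c then a else b)) (R2, M0) t (R3, M3)"
  "agree R3 M3 R' A'" "Q (t + xk c + 1) R' A'"
  using assms(2,3) R2(2) unfolding runs_def by (cases "holds R A c") (simp_all, blast+)
 have "exec w S (Cond (tst c) (comp a) (comp b)) (R2, M0) (Suc t) (R3, M3)"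
  using 3(1) R2(3) by (cases "holds R A c") (auto intro: exec.CondTrue exec.CondFalse)
 then have "exec w S (comp (Ite c a b)) (R0, M0) (xk c + Suc t) (R3, M3)"
  unfolding comp.simps by (rule exec.Seq[OF R2(1)])
 then have "exec w S (comp (Ite c a b)) (R0, M0) (t + xk c + 1) (R3, M3)" by (simp add: add.commute)
 then show "EX t R0' M0' R' A'. exec w S (comp (Ite c a b)) (R0, M0) t (R0', M0') & agree R0' M0' R' A' & Q t R' A'"
  using 3(2,3) by (intro runs_exI)
qed

text \<open>The invariant carries the elapsed time \<open>T\<close>, so that costs can be amortised
  over the passes. Each pass is charged its body, one evaluation of the condition and one test; the
  term \<open>xk c + 1\<close> at the end pays for the initial evaluation and the failing
  test.\<close>

lemma runs_Wh:
 assumes "I 0 R A 0"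
  and step: "!!z R A T. z < cnt ==> I z R A T ==>
   okc R A c & holds R A c & runs body R A (%t R' A'. I (Suc z) R' A' (T + (t + xk c + 1)))"
  and fin: "!!R A T. I cnt R A T ==> okc R A c & \<not> holds R A c"
 shows "runs (Wh c body) R A (%t R' A'. EX T. t = T + xk c + 1 & I cnt R' A' T)"
proof -
 let ?W = "While (tst c) (Seq (comp body) (ccnd c))"
 have loop: "EX t R3 M3 R' A'. exec w S ?W (R2, M2) t (R3, M3) & agree R3 M3 R' A' & I cnt R' A' (T + t - 1) & 1 <= t"
  if "z <= cnt" "I z R A T" "agree R2 M2 R A" "test_val w R2 (tst c) <-> holds R A c" for z R A T R2 M2
  using that
 proof (induction "cnt - z" arbitrary: z R A T R2 M2)
  case 0
  then have "z = cnt" by simp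
  with 0 have i: "I cnt R A T" by simp
  have nh: "\<not> holds R A c" "I cnt R A T" using fin[OF i] i by blast+
  then have "exec w S ?W (R2, M2) 1 (R2, M2)" using 0 by (intro exec.WhileFalse) simp
  then show ?case using nh(2) 0(4) by (intro exI conjI) (assumption, assumption, simp_all)
 next
  case (Suc d)
  then have z: "z < cnt" by simp
  note st = step[OF z Suc.prems(2)]
  have "runs body R A (%t R' A'. I (Suc z) R' A' (T + (t + xk c + 1)))" using st by blast
  then obtain t R3 M3 R' A' where 1: "exec w S (comp body) (R2, M2) t (R3, M3)" "agree R3 M3 R' A'"
   "I (Suc z) R' A' (T + (t + xk c + 1))" using Suc.prems(3) unfolding runs_def by blast
  have "okc R' A' c"
  proof (cases "Suc z = cnt")
   case True
   with 1(3) have "I cnt R' A' (T + (t + xk c + 1))" by simp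
   from fin[OF this] show ?thesis by blast
  next
   case False
   with z have "Suc z < cnt" by simp
   from step[OF this 1(3)] show ?thesis by blast
  qed
  then obtain R4 where 2: "exec w S (ccnd c) (R3, M3) (xk c) (R4, M3)" "agree R4 M3 R' A'"
   "test_val w R4 (tst c) <-> holds R' A' c" using exec_ccnd 1(2) by blast
  have "d = cnt - Suc z" using Suc.hyps(2) by simp
  from Suc.hyps(1)[OF this _ 1(3) 2(2,3)] z obtain u R5 M5 R'' A'' where
   3: "exec w S ?W (R4, M3) u (R5, M5)" "agree R5 M5 R'' A''" "I cnt R'' A'' (T + (t + xk c + 1) + u - 1)" "1 <= u" by auto
  have "exec w S ?W (R2, M2) (Suc ((t + xk c) + u)) (R5, M5)"
   using st Suc.prems(4) by (intro exec.WhileTrue[OF _ exec.Seq[OF 1(1) 2(1)] 3(1)]) auto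
  moreover have "T + (t + xk c + 1) + u - 1 = T + Suc ((t + xk c) + u) - 1" by simp
  with 3(3) have "I cnt R'' A'' (T + Suc ((t + xk c) + u) - 1)" by metis
  ultimately show ?case using 3(2) by (intro exI conjI) (assumption, assumption, assumption, simp)
 qed
 show ?thesis unfolding runs_def
 proof (intro allI impI)
  fix R0 M0 assume ag: "agree R0 M0 R A"
  have "okc R A c"
  proof (cases "cnt = 0")
   case True
   with assms(1) have "I cnt R A 0" by simp
   from fin[OF this] show ?thesis by blast
  next
   case False
   then have "0 < cnt" by simp
   from step[OF this assms(1)] show ?thesis by blast
  qed
  then obtain R2 where R2: "exec w S (ccnd c) (R0, M0) (xk c) (R2, M0)" "agree R2 M0 R A"
   "test_val w R2 (tst c) <-> holds R A c" using exec_ccnd ag by blast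
  from loop[OF _ assms(1) R2(2,3)] obtain t R3 M3 R' A' where
   1: "exec w S ?W (R2, M0) t (R3, M3)" "agree R3 M3 R' A'" "I cnt R' A' (t - 1)" "1 <= t" by auto
  have "xk c + t = t - 1 + xk c + 1" using 1(4) by simp
  then show "EX t R0' M0' R' A'. exec w S (comp (Wh c body)) (R0, M0) t (R0', M0') & agree R0' M0' R' A' &
    (EX T. t = T + xk c + 1 & I cnt R' A' T)"
   using exec.Seq[OF R2(1) 1(1)] 1(2,3) unfolding comp.simps by blast
 qed
qed

lemma runs_For:
 assumes "I 0 R A"
  and step: "!!z R A. z < cnt ==> I z R A ==>
   okc R A c & holds R A c & runs body R A (%t R' A'. t <= B & I (Suc z) R' A')"
  and fin: "!!R A. I cnt R A ==> okc R A c & \<not> holds R A c"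
 shows "runs (Wh c body) R A (%t R' A'. t <= cnt * (B + xk c + 1) + xk c + 1 & I cnt R' A')"
proof -
 have "runs (Wh c body) R A (%t R' A'. EX T. t = T + xk c + 1 & (I cnt R' A' & T <= cnt * (B + xk c + 1)))"
 proof (rule runs_Wh[where I = "%z R A T. I z R A & T <= z * (B + xk c + 1)"])
  fix z R A T assume z: "z < cnt" "I z R A & T <= z * (B + xk c + 1)"
  have "runs body R A (%t R' A'. I (Suc z) R' A' & T + (t + xk c + 1) <= Suc z * (B + xk c + 1))"
   by (rule runs_mono[of _ _ _ "%t R' A'. t <= B & I (Suc z) R' A'"]) (use step z in auto)
  then show "okc R A c & holds R A c & runs body R A (%t R' A'. I (Suc z) R' A' & T + (t + xk c + 1) <= Suc z * (B + xk c + 1))"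
   using step z by blast
 qed (use assms(1) fin in auto)
 then show ?thesis by (rule runs_mono) auto
qed

end

section \<open>Borders at the level of runs\<close>

lemma length_factor: "length (factor T i j) = min (length T) j - (i - 1)"
 by (simp add: factor_def)

lemma bordered_factor_iff:
 assumes "a < z" "z <= length T"
 shows "bordered (factor T (Suc a) z) <-> (EX l. 1 <= l & l < z - a & (ALL d<l. T ! (a + d) = T ! (z - l + d)))"
proof -
 define v where "v = factor T (Suc a) z"
 have lv: "length v = z - a" using assms by (simp add: v_def length_factor)
 have nv: "v ! d = T ! (a + d)" if "d < z - a" for d
  using that assms by (simp add: v_def factor_def)
 show ?thesis
 proof
  assume "bordered (factor T (Suc a) z)"
  then obtain b where b: "b ~= []" "strict_prefix b v" "strict_suffix b v"
   by (auto simp: bordered_def border_def v_def)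
  obtain p where p: "v = b @ p" "p ~= []" using b(2) by (auto elim: strict_prefixE')
  obtain u where u: "v = u @ b" "u ~= []" using b(3) by (auto simp: strict_suffix_def suffix_def)
  have len: "length b < z - a" using lv p by (cases p) auto
  have lu: "length u = z - a - length b" using lv u by auto
  have "T ! (a + d) = T ! (z - length b + d)" if d: "d < length b" for d
  proof -
   have "v ! d = b ! d" using p d by (simp add: nth_append)
   moreover have "v ! (length u + d) = b ! d" using u by simp
   ultimately have "T ! (a + d) = T ! (a + (length u + d))" using nv d len lu by simp
   moreover have "a + (length u + d) = z - length b + d" using lu len assms(1) by simp
   ultimately show ?thesis by simp
  qed
  moreover have "1 <= length b" using b(1) by (cases b) auto
  ultimately show "EX l. 1 <= l & l < z - a & (ALL d<l. T ! (a + d) = T ! (z - l + d))" using len by blast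
 next
  assume "EX l. 1 <= l & l < z - a & (ALL d<l. T ! (a + d) = T ! (z - l + d))"
  then obtain l where l: "1 <= l" "l < z - a" "ALL d<l. T ! (a + d) = T ! (z - l + d)" by blast
  have eq: "drop (z - a - l) v = take l v"
  proof (rule nth_equalityI)
   show "length (drop (z - a - l) v) = length (take l v)" using l lv by simp
   fix d assume "d < length (drop (z - a - l) v)"
   then have d: "d < l" using l lv by simp
   have "drop (z - a - l) v ! d = v ! (z - a - l + d)" using l lv by simp
   also have "\<dots> = T ! (a + (z - a - l + d))" using d l by (intro nv) linarith
   also have "a + (z - a - l + d) = z - l + d" using l by simp
   also have "T ! (z - l + d) = T ! (a + d)" using l d by simp
   also have "\<dots> = take l v ! d" using nv d l by simp
   finally show "drop (z - a - l) v ! d = take l v ! d" .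
  qed
  have "take l v ~= []" using l lv by auto
  moreover have "strict_prefix (take l v) v"
   using l lv by (auto simp: strict_prefix_def take_is_prefix)
  moreover have "suffix (take l v) v" using eq suffix_drop by metis
  moreover have "take l v ~= v" using l lv by auto
  ultimately show "bordered (factor T (Suc a) z)"
   unfolding v_def[symmetric] bordered_def border_def strict_suffix_def by blast
 qed
qed

text \<open>Borders by indices, counted from 0: the factor occupies the positions from
  \<open>a\<close> to \<open>z - 1\<close>, and \<open>l\<close> is the length of the
  border.\<close>

definition ibord :: "'a list => nat => nat => bool" where
 "ibord T a z <-> (EX l. 1 <= l & l < z - a & (ALL d<l. T ! (a + d) = T ! (z - l + d)))"

text \<open>A border of the longer factor without its first letter is a border of the shorter one.
  Only a border of length 1 leaves nothing; it is the letter \<open>T ! (a - 1) = T ! a\<close>,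
  which is itself a border of the shorter factor once that has length at least 2.\<close>

lemma ibord_extend_left:
 assumes "0 < a" "T ! (a - 1) = T ! a" "a + 2 <= z" "\<not> ibord T a z"
 shows "\<not> ibord T (a - 1) z"
proof
 assume "ibord T (a - 1) z"
 then obtain l where l: "1 <= l" "l < z - (a - 1)" "ALL d<l. T ! (a - 1 + d) = T ! (z - l + d)"
  unfolding ibord_def by blast
 show False
 proof (cases "l = 1")
  case True
  then have "T ! (a + 0) = T ! (z - 1 + 0)" using l(3)[rule_format, of 0] assms by simp
  then have "ibord T a z" unfolding ibord_def using assms(3) by (intro exI[of _ 1]) simp
  with assms show False by simp
 next
  case False
  have "T ! (a + d) = T ! (z - (l - 1) + d)" if "d < l - 1" for d
  proof -
   have "T ! (a - 1 + Suc d) = T ! (z - l + Suc d)" by (rule l(3)[rule_format]) (use that in simp)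
   moreover have "a - 1 + Suc d = a + d" "z - l + Suc d = z - (l - 1) + d" using assms l by auto
   ultimately show ?thesis by (simp only:)
  qed
  then have "ibord T a z" unfolding ibord_def using l False by (intro exI[of _ "l - 1"]) auto
  with assms show False by simp
 qed
qed

lemma ibord_extend_right:
 assumes "T ! z = T ! (z - 1)" "a + 2 <= z" "\<not> ibord T a z"
 shows "\<not> ibord T a (Suc z)"
proof
 assume "ibord T a (Suc z)"
 then obtain l where l: "1 <= l" "l < Suc z - a" "ALL d<l. T ! (a + d) = T ! (Suc z - l + d)"
  unfolding ibord_def by blast
 show False
 proof (cases "l = 1")
  case True
  then have "T ! (a + 0) = T ! (z - 1 + 0)" using l(3)[rule_format, of 0] assms by simp
  then have "ibord T a z" unfolding ibord_def using assms(2) by (intro exI[of _ 1]) simp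
  with assms show False by simp
 next
  case False
  have "T ! (a + d) = T ! (z - (l - 1) + d)" if "d < l - 1" for d
  proof -
   have "T ! (a + d) = T ! (Suc z - l + d)" using l(3) that by simp
   moreover have "Suc z - l + d = z - (l - 1) + d" using assms l by auto
   ultimately show ?thesis by (simp only:)
  qed
  then have "ibord T a z" unfolding ibord_def using l False by (intro exI[of _ "l - 1"]) auto
  with assms show False by simp
 qed
qed

locale runseq =
 fixes m :: nat and c e :: "nat => nat"
 assumes c_adj: "Suc x < m ==> c x ~= c (Suc x)"
  and e_pos: "x < m ==> 1 <= e x"
  and m_ge: "2 <= m"
begin

definition pos :: "nat => nat" where "pos x = (\<Sum>y<x. e y)"

text \<open>
 \<open>match i p r\<close>: the last \<open>e i\<close> letters of run \<open>p\<close> followed by the runs \<open>p + 1, \<dots>, p + r - 1\<close> form a prefix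
 of the text starting with run \<open>i\<close>. For \<open>r = 1\<close> a single letter is a border, whatever the exponents.
\<close>
definition match :: "nat => nat => nat => bool" where
 "match i p r <-> c p = c i & (r = 1 \<or> e i <= e p &
  (ALL t. 1 <= t & t + 2 <= r --> c (p + t) = c (i + t) & e (p + t) = e (i + t)) &
  c (p + r - 1) = c (i + r - 1) & e (p + r - 1) <= e (i + r - 1))"

text \<open>The condition \<open>r + i <= j\<close> keeps the start \<open>j + 1 - r\<close> of the
  last copy strictly to the right of run \<open>i\<close>.\<close>

definition bord :: "nat => nat => bool" where
 "bord i j <-> (EX r. 1 <= r & r + i <= j & match i (j + 1 - r) r)"

lemma pos_Suc [simp]: "pos (Suc x) = pos x + e x"
 by (simp add: pos_def)

lemma pos_0 [simp]: "pos 0 = 0"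
 by (simp add: pos_def)

lemma pos_mono: "x <= y ==> pos x <= pos y"
 by (simp add: pos_def sum_mono2)

lemma pos_less: "x < y ==> y <= m ==> pos x < pos y"
 using pos_mono[of "Suc x" y] e_pos[of x] by simp

lemma run_of: "q < pos k ==> EX x<k. pos x <= q & q < pos (Suc x)"
proof (induction k)
 case (Suc k)
 then show ?case by (cases "q < pos k") (use less_SucI in "blast, auto")
qed simp

end

locale runtext = runseq +
 fixes T :: "nat list"
 assumes T_nth: "x < m ==> d < e x ==> T ! (pos x + d) = c x"
  and T_len: "length T = pos m"
begin

lemma T_start: "x < m ==> T ! pos x = c x"
 using T_nth[of x 0] e_pos[of x] by simp

lemma T_in: "x < m ==> pos x <= q ==> q < pos (Suc x) ==> T ! q = c x"
 using T_nth[of x "q - pos x"] by simp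

text \<open>The \<open>u\<close> letters from offset \<open>s\<close> of the border are read twice:
  in the prefix copy they begin at the start of run \<open>x\<close>, in the suffix copy they end at
  the end of run \<open>p\<close>. Maximality of run \<open>x\<close> prevents \<open>u\<close> from
  exceeding \<open>e x\<close>. If the border continues, maximality of run \<open>p\<close> forces
  equality, because the suffix copy changes its letter there.\<close>

lemma align:
 assumes al: "ALL d<l. T ! (a + d) = T ! (q + d)"
  and x: "a + s = pos x" "x < p" "p < m" and p: "pos p <= q + s" "q + s + u = pos (Suc p)"
  and u: "1 <= u" "s + u <= l"
 shows "c x = c p & u <= e x & (s + u < l & Suc p < m --> u = e x)"
proof -
 have cx: "T ! (a + (s + d)) = c x" if "d < e x" for d
  using T_nth[of x d] that x by (simp add: add.assoc[symmetric])
 have cp: "T ! (q + (s + d)) = c p" if "d < u" for d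
 proof -
  have "q + (s + d) = pos p + (q + s - pos p + d)" using p by simp
  moreover have "q + s - pos p + d < e p" using p that by simp
  ultimately show ?thesis using T_nth[OF x(3), of "q + s - pos p + d"] by (simp only:)
 qed
 have ex: "1 <= e x" using e_pos[of x] x by simp
 have eq: "T ! (a + (s + d)) = T ! (q + (s + d))" if "d < u" for d using al u that by simp
 have cc: "c x = c p" using eq[of 0] cx[of 0] cp[of 0] ex u by simp
 have 2: "u <= e x"
 proof (rule ccontr)
  assume "\<not> u <= e x"
  then have "T ! (a + (s + e x)) = c p" using eq[of "e x"] cp[of "e x"] by simp
  moreover have "a + (s + e x) = pos (Suc x)" using x by simp
  ultimately have "c (Suc x) = c p" using T_start[of "Suc x"] x by simp
  then show False using cc c_adj[of x] x by simp
 qed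
 have "u = e x" if "s + u < l" "Suc p < m"
 proof (rule ccontr)
  assume "u ~= e x"
  with 2 have "T ! (a + (s + u)) = c x" using cx by simp
  moreover have "T ! (a + (s + u)) = T ! (q + (s + u))" using al that by simp
  moreover have "T ! (q + (s + u)) = c (Suc p)" using p T_start[of "Suc p"] that by (simp add: add.assoc)
  ultimately show False using cc c_adj[of p] that by simp
 qed
 with cc 2 show ?thesis by blast
qed

text \<open>If the outer letters agree, a single letter is a border. Otherwise the suffix copy
  begins inside a run \<open>p\<close> strictly between \<open>x\<close> and \<open>y\<close> and
  covers exactly its last \<open>e x\<close> letters. From there on whole runs are compared, up to
  run \<open>y\<close>, whose counterpart may be longer because the prefix copy may stop inside
  it.\<close>

lemma ibord_imp_bord:
 assumes xy: "x < y" "y < m" and "ibord T (pos x) (pos (Suc y))"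
 shows "bord x y"
proof (cases "c x = c y")
 case True
 then show ?thesis unfolding bord_def match_def using xy by (intro exI[of _ 1]) simp
next
 case False
 let ?a = "pos x" and ?z = "pos (Suc y)"
 obtain l where l: "1 <= l" "l < ?z - ?a" "ALL d<l. T ! (?a + d) = T ! (?z - l + d)"
  using assms(3) unfolding ibord_def by blast
 define q where "q = ?z - l"
 have q: "q + l = ?z" "?a < q" using l by (auto simp: q_def)
 have al: "ALL d<l. T ! (?a + d) = T ! (q + d)" using l q_def by simp
 have "q < ?z" using q l by simp
 then obtain p where p: "p < Suc y" "pos p <= q" "q < pos (Suc p)" using run_of by blast
 have pm: "p < m" using p xy by simp
 have "T ! q = c p" using T_nth[of p "q - pos p"] p pm by simp
 moreover have "T ! q = c x" using al[rule_format, of 0] l T_start[of x] xy by simp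
 ultimately have cpx: "c p = c x" by simp
 have py: "p < y" using False cpx p by (metis less_SucE)
 have "x <= p"
 proof (rule ccontr)
  assume "\<not> x <= p"
  then have "pos (Suc p) <= ?a" by (intro pos_mono) simp
  then show False using p q by simp
 qed
 \<comment> \<open>A border that begins inside run \<open>x\<close> would meet the first letter of
   run \<open>x + 1\<close> at an offset at which its prefix copy is still inside run
   \<open>x\<close>.\<close>
 have xp: "x < p"
 proof (rule ccontr)
  assume "\<not> x < p"
  with \<open>x <= p\<close> have [simp]: "p = x" by simp
  let ?d = "pos (Suc x) - q"
  have d: "0 < ?d" "?d < e x" using p q by auto
  have "pos (Suc x) < ?z" using pos_less[of "Suc x" "Suc y"] xy by simp
  then have dl: "?d < l" using q p by simp
  have "T ! (?a + ?d) = c x" by (rule T_nth) (use d xy in auto)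
  moreover have "q + ?d = pos (Suc x)" using p by simp
  then have "T ! (q + ?d) = c (Suc x)" using T_start[of "Suc x"] xy by simp
  ultimately have "c x = c (Suc x)" using al dl by simp
  then show False using c_adj[of x] xy by simp
 qed
 define u where "u = pos (Suc p) - q"
 have "pos (Suc p) < ?z" using pos_less[of "Suc p" "Suc y"] py xy by simp
 then have ul: "u < l" "1 <= u" "q + u = pos (Suc p)" using q p by (auto simp: u_def)
 have "u = e x" using align[OF al, of 0 x p u] xp pm p ul py xy by simp
 have ep: "e x <= e p" using \<open>u = e x\<close> ul p by simp
 \<comment> \<open>From run \<open>p + 1\<close> on both copies are at the same offset of the border
   when a run begins, because all runs compared so far have equal exponents.\<close>
 have st: "pos (x + t) + q = ?a + pos (p + t)" if "1 <= t" "p + t <= y" for t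
  using that
 proof (induction t rule: nat_induct_at_least[of 1])
  case base
  then show ?case using ul \<open>u = e x\<close> by simp
 next
  case (Suc t)
  then have IH: "pos (x + t) + q = ?a + pos (p + t)" by simp
  have g: "q <= pos (p + t)" using ul pos_mono[of "Suc p" "p + t"] Suc by simp
  have lt: "pos (Suc (p + t)) < ?z" using pos_less[of "Suc (p + t)" "Suc y"] Suc xy by simp
  have "c (x + t) = c (p + t) & e (p + t) <= e (x + t) & (pos (p + t) - q + e (p + t) < l & Suc (p + t) < m --> e (p + t) = e (x + t))"
   by (rule align[OF al]) (use IH g lt q xp Suc xy e_pos[of "p + t"] in auto)
  moreover have "pos (p + t) - q + e (p + t) < l" using g lt q by simp
  ultimately have "e (p + t) = e (x + t)" using Suc xy by simp
  then show ?case using IH by simp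
 qed
 have eqs: "c (x + t) = c (p + t) & e (p + t) <= e (x + t) & (p + t < y --> e (p + t) = e (x + t))"
  if t: "1 <= t" "p + t <= y" for t
 proof -
  have IH: "pos (x + t) + q = ?a + pos (p + t)" using st t by simp
  have g: "q <= pos (p + t)" using ul pos_mono[of "Suc p" "p + t"] t by simp
  have le: "pos (Suc (p + t)) <= ?z" using pos_mono[of "Suc (p + t)" "Suc y"] t by simp
  have A: "c (x + t) = c (p + t) & e (p + t) <= e (x + t) & (pos (p + t) - q + e (p + t) < l & Suc (p + t) < m --> e (p + t) = e (x + t))"
   by (rule align[OF al]) (use IH g le q xp t xy e_pos[of "p + t"] in auto)
  have "pos (p + t) - q + e (p + t) < l" if "p + t < y"
   using g pos_less[of "Suc (p + t)" "Suc y"] that q xy by simp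
  then show ?thesis using A t xy by auto
 qed
 define r where "r = y - p + 1"
 have r: "2 <= r" "y + 1 - r = p" "p + r - 1 = y" "x + r - 1 = x + (y - p)" "r + x <= y" using py xp by (auto simp: r_def)
 have "match x p r" unfolding match_def
  using cpx ep eqs[of "y - p"] eqs py r by (auto simp: r_def)
 then show ?thesis unfolding bord_def using r by (intro exI[of _ r]) auto
qed

lemma bord_imp_ibord:
 assumes xy: "x < y" "y < m" and "bord x y"
 shows "ibord T (pos x) (pos (Suc y))"
proof -
 let ?a = "pos x" and ?z = "pos (Suc y)"
 obtain r where r: "1 <= r" "r + x <= y" "match x (y + 1 - r) r" using assms(3) unfolding bord_def by blast
 define p where "p = y + 1 - r"
 have p: "x < p" "p <= y" "p + r = y + 1" using r by (auto simp: p_def)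
 show ?thesis
 proof (cases "r = 1")
  case True
  then have "c y = c x" using r unfolding match_def by simp
  moreover have "T ! ?a = c x" using T_start xy by simp
  moreover have "T ! (?z - 1) = c y" using T_nth[of y "e y - 1"] e_pos[of y] xy by simp
  moreover have "?a + 1 < ?z" using pos_less[of x y] e_pos[of y] xy by simp
  ultimately show ?thesis unfolding ibord_def by (intro exI[of _ 1]) auto
 next
  case False
  with r have r2: "2 <= r" by simp
  have M: "c p = c x" "e x <= e p"
   "!!t. 1 <= t ==> t + 2 <= r ==> c (p + t) = c (x + t) & e (p + t) = e (x + t)"
   "c y = c (x + r - 1)" "e y <= e (x + r - 1)"
   using r(3) False p unfolding match_def p_def[symmetric] by auto
  have st: "pos (x + t) + pos (Suc p) = pos (p + t) + pos (Suc x)" if "1 <= t" "t + 1 <= r" for t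
   using that
  proof (induction t rule: nat_induct_at_least[of 1])
   case (Suc t)
   then show ?case using M(3)[of t] by simp
  qed simp
  \<comment> \<open>The border consists of the last \<open>e x\<close> letters of run
    \<open>p\<close> and of everything behind that run.\<close>
  define l where "l = e x + (?z - pos (Suc p))"
  have zp: "pos (Suc p) <= ?z" using p by (intro pos_mono) simp
  have lz: "?z - l = pos (Suc p) - e x" using zp by (simp add: l_def)
  have ps: "pos (Suc x) < pos (Suc p)" using p xy by (intro pos_less) auto
  have "T ! (?a + d) = T ! (?z - l + d)" if d: "d < l" for d
  proof (cases "d < e x")
   case True
   have "pos (Suc p) - e x + d = pos p + (e p - e x + d)" "e p - e x + d < e p" using M(2) True by auto
   moreover have "p < m" using p xy by simp
   ultimately have "T ! (pos (Suc p) - e x + d) = c p" using T_nth[of p "e p - e x + d"] by (simp only:)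
   then show ?thesis using lz M(1) T_nth[of x d] True xy by simp
  next
   case False
   define q where "q = pos (Suc p) - e x + d"
   have q: "pos (Suc p) <= q" "q < ?z" using False d zp M(2) by (auto simp: q_def l_def)
   obtain v where v: "v < Suc y" "pos v <= q" "q < pos (Suc v)" using run_of q(2) by blast
   have "p < v"
   proof (rule ccontr)
    assume "\<not> p < v"
    then have "pos (Suc v) <= pos (Suc p)" by (intro pos_mono) simp
    then show False using q v by simp
   qed
   define t where "t = v - p"
   have t: "1 <= t" "t + 1 <= r" "v = p + t" using \<open>p < v\<close> v p by (auto simp: t_def)
   have ce: "c (p + t) = c (x + t) & e (p + t) <= e (x + t)"
   proof (cases "t + 2 <= r")
    case True
    then show ?thesis using M(3)[of t] t by simp
   next
    case False
    then have "t = r - 1" using t by simp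
    then have "p + t = y" "x + t = x + r - 1" using p r by auto
    then show ?thesis using M(4,5) by simp
   qed
   have "?a + d = pos (x + t) + (q - pos (p + t))"
   proof -
    have "q + e x = pos (Suc p) + d" using M(2) by (simp add: q_def)
    then show ?thesis using st[of t] t v(2) by simp
   qed
   moreover have "q - pos (p + t) < e (x + t)" using v t(3) conjunct2[OF ce] by simp
   moreover have "x + t < m" using t p xy by simp
   ultimately have "T ! (?a + d) = c (x + t)" using T_nth by (simp only:)
   moreover have "T ! q = c (p + t)" using T_nth[of "p + t" "q - pos (p + t)"] v t xy by simp
   ultimately show ?thesis using conjunct1[OF ce] unfolding lz q_def by (simp only:)
  qed
  moreover have "l < ?z - ?a" using ps zp by (simp add: l_def)
  moreover have "1 <= l" using e_pos[of x] xy by (simp add: l_def)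
  ultimately show ?thesis unfolding ibord_def by blast
 qed
qed

lemma unbordered_occs_iff:
 "(i, j) \<in> unbordered_occs T <-> 1 <= i & i <= j & j <= length T & \<not> ibord T (i - 1) j"
proof (cases "1 <= i & i <= j & j <= length T")
 case True
 have "bordered (factor T (Suc (i - 1)) j) <-> ibord T (i - 1) j"
  unfolding ibord_def by (rule bordered_factor_iff) (use True in auto)
 then show ?thesis using True by (simp add: unbordered_occs_def)
next
 case False
 then show ?thesis by (auto simp: unbordered_occs_def)
qed

text \<open>An unbordered factor of length at least 2 remains unbordered when it is extended inside
  its first or its last run, so a longest one fills both runs. Length 2 is always reached: the two
  letters around the first run boundary are distinct.\<close>

lemma longest_aligned:
 assumes "(i, j) \<in> longest_unbordered_occs T"
 shows "EX x y. x < y & y < m & \<not> bord x y & i = Suc (pos x) & j = pos (Suc y)"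
proof -
 have occ: "1 <= i" "i <= j" "j <= length T" "\<not> ibord T (i - 1) j"
  using assms unbordered_occs_iff by (auto simp: longest_unbordered_occs_def)
 have mx: "j' - (i' - 1) <= j - (i - 1)" if "(i', j') \<in> unbordered_occs T" for i' j'
 proof -
  have "j' <= length T" using that unbordered_occs_iff by blast
  moreover have "length (factor T i' j') <= length (factor T i j)"
   using assms that unfolding longest_unbordered_occs_def by fast
  ultimately show ?thesis using occ by (simp add: length_factor min_def split: if_splits)
 qed
 have p1: "1 <= pos 1" "pos 1 < pos m" using e_pos[of 0] m_ge pos_less[of 1 m] by auto
 have "T ! (pos 1 - 1) = c 0" using T_nth[of 0 "e 0 - 1"] e_pos[of 0] m_ge by simp
 moreover have "T ! pos 1 = c 1" using m_ge by (intro T_start) simp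
 ultimately have ne: "T ! (pos 1 - 1) ~= T ! pos 1" using c_adj[of 0] m_ge by simp
 have "\<not> ibord T (pos 1 - 1) (pos 1 + 1)"
 proof
  assume "ibord T (pos 1 - 1) (pos 1 + 1)"
  then obtain l where l: "1 <= l" "l < pos 1 + 1 - (pos 1 - 1)" "ALL d<l. T ! (pos 1 - 1 + d) = T ! (pos 1 + 1 - l + d)"
   unfolding ibord_def by blast
  then have "l = 1" using p1 by simp
  then show False using l(3)[rule_format, of 0] ne by simp
 qed
 then have "(pos 1, pos 1 + 1) \<in> unbordered_occs T" using p1 T_len unbordered_occs_iff by auto
 from mx[OF this] have two: "i - 1 + 2 <= j" using p1 by simp
 have "i - 1 < pos m" "j - 1 < pos m" using two occ(3) T_len by linarith+
 then obtain x y where x: "x < m" "pos x <= i - 1" "i - 1 < pos (Suc x)"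
  and y: "y < m" "pos y <= j - 1" "j - 1 < pos (Suc y)" using run_of by meson
 have ix: "i - 1 = pos x"
 proof (rule ccontr)
  assume "i - 1 ~= pos x"
  with x have g: "pos x < i - 1" by simp
  have "T ! (i - 1) = c x" by (rule T_in) (use x in auto)
  moreover have "T ! (i - 1 - 1) = c x" by (rule T_in) (use x g in linarith)+
  ultimately have "\<not> ibord T (i - 1 - 1) j" using occ two g by (intro ibord_extend_left[of "i - 1" T j]) auto
  then have "(i - 1, j) \<in> unbordered_occs T" using unbordered_occs_iff occ g by auto
  from mx[OF this] show False using g two by simp
 qed
 have jy: "j = pos (Suc y)"
 proof (rule ccontr)
  assume "j ~= pos (Suc y)"
  with y have g: "j < pos (Suc y)" by simp
  have "T ! j = c y" by (rule T_in) (use y g in linarith)+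
  moreover have "T ! (j - 1) = c y" by (rule T_in) (use y g in linarith)+
  ultimately have "\<not> ibord T (i - 1) (Suc j)" using occ two by (intro ibord_extend_right) auto
  moreover have "Suc j <= length T" using g pos_mono[of "Suc y" m] y T_len by simp
  ultimately have "(i, Suc j) \<in> unbordered_occs T" using unbordered_occs_iff occ by auto
  from mx[OF this] show False using two by simp
 qed
 have "x ~= y"
 proof
  assume "x = y"
  moreover have "T ! (i - 1) = c x" by (rule T_in) (use x in auto)
  moreover have "T ! (j - 1) = c y" by (rule T_in) (use y in auto)
  ultimately have "T ! (i - 1) = T ! (j - 1)" by simp
  then have "ibord T (i - 1) j" unfolding ibord_def using two by (intro exI[of _ 1]) auto
  then show False using occ by simp
 qed
 moreover have "x <= y"
 proof (rule ccontr)
  assume "\<not> x <= y"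
  then have "pos (Suc y) <= pos x" by (intro pos_mono) simp
  then show False using ix jy two by simp
 qed
 ultimately have xy: "x < y" by simp
 then have "\<not> bord x y" using bord_imp_ibord y ix jy occ by auto
 then show ?thesis using xy y(1) ix jy occ by (intro exI[of _ x] exI[of _ y]) auto
qed

definition best :: "nat => nat => bool" where
 "best x y <-> x < y & y < m & \<not> bord x y &
  (ALL x' y'. x' < y' & y' < m & \<not> bord x' y' --> pos (Suc y') - pos x' <= pos (Suc y) - pos x)"

lemma aligned_occ:
 assumes "x < y" "y < m" "\<not> bord x y"
 shows "(Suc (pos x), pos (Suc y)) \<in> unbordered_occs T" "length (factor T (Suc (pos x)) (pos (Suc y))) = pos (Suc y) - pos x"
proof -
 have "pos (Suc y) <= length T" using T_len pos_mono[of "Suc y" m] assms by simp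
 moreover have "pos x < pos (Suc y)" using pos_less[of x "Suc y"] assms by simp
 ultimately show "(Suc (pos x), pos (Suc y)) \<in> unbordered_occs T" "length (factor T (Suc (pos x)) (pos (Suc y))) = pos (Suc y) - pos x"
  using unbordered_occs_iff ibord_imp_bord[of x y] assms by (auto simp: length_factor)
qed

theorem longest_unbordered_occs_eq:
 "longest_unbordered_occs T = {(Suc (pos x), pos (Suc y)) |x y. best x y}" (is "?L = ?R")
proof
 have mx: "length (factor T i' j') <= length (factor T i j)"
  if "(i, j) \<in> ?L" "(i', j') \<in> unbordered_occs T" for i j i' j'
  using that unfolding longest_unbordered_occs_def by fast
 show sub: "?L \<subseteq> ?R"
 proof
  fix o' assume "o' \<in> ?L"
  moreover obtain i j where ij: "o' = (i, j)" by (cases o')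
  ultimately have L: "(i, j) \<in> ?L" by simp
  obtain x y where xy: "x < y" "y < m" "\<not> bord x y" "i = Suc (pos x)" "j = pos (Suc y)" using longest_aligned[OF L] by blast
  have "best x y" unfolding best_def
  proof (intro conjI allI impI)
   fix x' y' assume "x' < y' & y' < m & \<not> bord x' y'"
   then show "pos (Suc y') - pos x' <= pos (Suc y) - pos x"
    using mx[OF L, of "Suc (pos x')" "pos (Suc y')"] aligned_occ[of x' y'] aligned_occ[of x y] xy by simp
  qed (use xy in auto)
  then show "o' \<in> ?R" using ij xy by auto
 qed
 show "?R \<subseteq> ?L"
 proof
  fix o' assume "o' \<in> ?R"
  then obtain x y where o': "o' = (Suc (pos x), pos (Suc y))" and b: "best x y" by blast
  note ao = aligned_occ[of x y]
  have bb: "x < y" "y < m" "\<not> bord x y" using b by (auto simp: best_def)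
  \<comment> \<open>Finiteness provides a longest occurrence. By the first inclusion it comes from a
    \<open>best\<close> pair, and all \<open>best\<close> pairs have the same length, so the given
    pair is a longest one too.\<close>
  have fin: "finite (unbordered_occs T)"
   by (rule finite_subset[of _ "{..length T} \<times> {..length T}"]) (auto simp: unbordered_occs_def)
  let ?f = "%(i, j). length (factor T i j)"
  have ne: "unbordered_occs T ~= {}" using ao bb by blast
  have "Max (?f ` unbordered_occs T) \<in> ?f ` unbordered_occs T" using fin ne by (intro Max_in) auto
  then obtain i j where ij: "(i, j) \<in> unbordered_occs T" "length (factor T i j) = Max (?f ` unbordered_occs T)" by auto
  have all: "length (factor T i' j') <= length (factor T i j)" if "(i', j') \<in> unbordered_occs T" for i' j'
  proof -
   have "?f (i', j') <= Max (?f ` unbordered_occs T)" using fin that by (intro Max_ge imageI) auto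
   then show ?thesis using ij(2) by simp
  qed
  then have "(i, j) \<in> ?L" using ij unfolding longest_unbordered_occs_def by auto
  then obtain x' y' where x': "best x' y'" "i = Suc (pos x')" "j = pos (Suc y')" using sub by blast
  then have "pos (Suc y') - pos x' <= pos (Suc y) - pos x" using b unfolding best_def by blast
  moreover have "length (factor T i j) = pos (Suc y') - pos x'" using aligned_occ(2)[of x' y'] x' by (simp add: best_def)
  ultimately have "length (factor T i' j') <= length (factor T (Suc (pos x)) (pos (Suc y)))" if "(i', j') \<in> unbordered_occs T" for i' j'
   using all[OF that] ao(2) bb by simp
  then show "o' \<in> ?L" using o' ao(1) bb unfolding longest_unbordered_occs_def by auto
 qed
qed

end

section \<open>Run-length encodings as run sequences\<close>

lemma rle_snd_pos: "x < length (rle T) ==> 1 <= snd (rle T ! x)"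
proof (induction T arbitrary: x rule: rle.induct)
 case (2 c T)
 then show ?case by (cases x) auto
qed simp

lemma rle_length_ge:
 assumes "\<not> unary T"
 shows "2 <= length (rle T)"
proof (rule ccontr)
 assume "\<not> 2 <= length (rle T)"
 then consider "rle T = []" | a where "rle T = [a]" by (cases "rle T"; cases "tl (rle T)") auto
 then show False
 proof cases
  case 1
  then have "T = []" using rle_decode[of T] by simp
  then show ?thesis using assms by (simp add: unary_def)
 next
  case (2 a)
  then have "T = replicate (snd a) (fst a)" using rle_decode[of T] by (cases a) simp
  then have "unary T" unfolding unary_def by (metis in_set_replicate)
  then show ?thesis using assms by simp
 qed
qed

lemma nth_concat_runs:
 "x < length X ==> d < snd (X ! x) ==>
  concat (map (%(c, e). replicate e c) X) ! ((\<Sum>y<x. snd (X ! y)) + d) = fst (X ! x)"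
proof (induction X arbitrary: x)
 case (Cons a X)
 obtain c e where a: "a = (c, e)" by (cases a)
 show ?case
 proof (cases x)
  case 0
  then show ?thesis using Cons.prems a by (simp add: nth_append)
 next
  case (Suc x')
  have "(\<Sum>y<x. snd ((a # X) ! y)) = e + (\<Sum>y<x'. snd (X ! y))"
   unfolding Suc using a by (simp add: sum.lessThan_Suc_shift del: sum.lessThan_Suc)
  then show ?thesis using Cons.IH[of x'] Cons.prems Suc a by (simp add: nth_append add.assoc)
 qed
qed simp

lemma length_concat_runs:
 "length (concat (map (%(c, e). replicate e c) X)) = (\<Sum>y<length X. snd (X ! y))"
proof (induction X)
 case (Cons a X)
 then show ?case by (cases a) (simp add: sum.lessThan_Suc_shift del: sum.lessThan_Suc)
qed simp

lemma runtext_rle: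
 assumes "\<not> unary T"
 shows "runtext (length (rle T)) (%x. fst (rle T ! x)) (%x. snd (rle T ! x)) T"
proof -
 interpret runseq "length (rle T)" "%x. fst (rle T ! x)" "%x. snd (rle T ! x)"
 proof
  fix x assume "Suc x < length (rle T)"
  then show "fst (rle T ! x) ~= fst (rle T ! Suc x)"
   using rle_runs_maximal[of T] by (auto simp: distinct_adj_conv_nth)
 qed (use rle_snd_pos rle_length_ge assms in auto)
 show ?thesis
 proof
  fix x d assume "x < length (rle T)" "d < snd (rle T ! x)"
  then show "T ! (pos x + d) = fst (rle T ! x)"
   using nth_concat_runs[of x "rle T" d] rle_decode[of T] by (simp add: pos_def)
 next
  show "length T = pos (length (rle T))" using length_concat_runs[of "rle T"] rle_decode[of T] by (simp add: pos_def)
 qed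
qed

section \<open>A segment tree with raise operations and undo\<close>

locale segtree =
 fixes h N :: nat
 assumes N_def: "N = 2 ^ h"
begin

text \<open>
 Leaf \<open>j\<close> is node \<open>N + j\<close>, and node \<open>v\<close> has the children \<open>2 * v\<close> and \<open>2 * v + 1\<close>. The value of a leaf is the maximum
 of \<open>V\<close> over its ancestors, so that raising a whole subtree is a single write.
\<close>
definition blk :: "(nat => nat) => nat => nat => bool" where
 "blk V y j <-> (EX t<=h. y <= V ((N + j) div 2 ^ t))"

definition anc :: "nat => nat => bool" where
 "anc v j <-> (EX t<=h. v = (N + j) div 2 ^ t)"

text \<open>An inequality and not an equation, since a raise of a whole subtree is recorded only at
  its top node. It is what a search needs: below a node with value under \<open>y\<close> there is a
  child with value under \<open>y\<close>.\<close>

definition heap_at :: "(nat => nat) => nat => bool" where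
 "heap_at V v <-> min (V (2 * v)) (V (2 * v + 1)) <= V v"

text \<open>The situation on the way to the root: after a change at \<open>u\<close> the invariant
  may fail at the parent of \<open>u\<close> and nowhere else.\<close>

definition heap_but :: "(nat => nat) => nat => bool" where
 "heap_but V u <-> (ALL v. 1 <= v & v < N & v ~= u div 2 --> heap_at V v)"

definition tr :: "(nat => nat) => (nat => nat) => bool" where
 "tr V f <-> (ALL v. 1 <= v & v < N --> heap_at V v) & (ALL j<N. ALL y. blk V y j <-> y <= f j)"

definition lw :: "(nat => nat) => nat => nat => nat => nat" where
 "lw V v x = (if V v < x then V(v := x) else V)"

lemma N_pos: "0 < N"
 by (simp add: N_def)

lemma blk_lw: "blk (lw V v x) y j <-> blk V y j \<or> anc v j & y <= x"
proof (cases "V v < x")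
 case True
 show ?thesis
 proof
  assume "blk (lw V v x) y j"
  then obtain t where t: "t <= h" "y <= lw V v x ((N + j) div 2 ^ t)" unfolding blk_def by blast
  then have "y <= V ((N + j) div 2 ^ t) \<or> v = (N + j) div 2 ^ t & y <= x"
   using True unfolding lw_def by (auto split: if_splits)
  then show "blk V y j \<or> anc v j & y <= x" using t(1) unfolding blk_def anc_def by blast
 next
  assume "blk V y j \<or> anc v j & y <= x"
  then obtain t where t: "t <= h" "y <= V ((N + j) div 2 ^ t) \<or> v = (N + j) div 2 ^ t & y <= x"
   unfolding blk_def anc_def by blast
  then have "y <= lw V v x ((N + j) div 2 ^ t)" using True unfolding lw_def by auto
  then show "blk (lw V v x) y j" using t(1) unfolding blk_def by blast
 qed
next
 case False
 then show ?thesis unfolding blk_def anc_def lw_def by auto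
qed

lemma heap_but_lw: "(ALL v. 1 <= v & v < N --> heap_at V v) ==> heap_but (lw V v x) v"
 unfolding heap_but_def
proof (intro allI impI)
 fix u assume a: "ALL v. 1 <= v & v < N --> heap_at V v" "1 <= u & u < N & u ~= v div 2"
 then have "2 * u ~= v" "2 * u + 1 ~= v" "heap_at V u" by auto
 then show "heap_at (lw V v x) u" unfolding heap_at_def lw_def by auto
qed

lemma heap_but_1: "heap_but V 1 ==> 1 <= v & v < N ==> heap_at V v"
 by (simp add: heap_but_def)

text \<open>Pulling the minimum up repairs the parent of \<open>u\<close>. A larger value there can
  only harm the node for which it is a child, so the possible violation moves up by one
  level.\<close>

lemma heap_but_pull:
 assumes "heap_but V u" "1 < u"
 shows "heap_but (lw V (u div 2) (min (V (2 * (u div 2))) (V (2 * (u div 2) + 1)))) (u div 2)"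
 unfolding heap_but_def
proof (intro allI impI)
 let ?z = "u div 2"
 let ?V = "lw V ?z (min (V (2 * ?z)) (V (2 * ?z + 1)))"
 fix v assume v: "1 <= v & v < N & v ~= ?z div 2"
 have z: "2 * ?z ~= ?z" "2 * ?z + 1 ~= ?z" "2 * v ~= ?z" "2 * v + 1 ~= ?z" using assms(2) v by auto
 show "heap_at ?V v"
 proof (cases "v = ?z")
  case True
  then show ?thesis using z unfolding heap_at_def lw_def by auto
 next
  case False
  then have "heap_at V v" using assms(1) v unfolding heap_but_def by blast
  then show ?thesis using z False unfolding heap_at_def lw_def by auto
 qed
qed

lemma anc_child:
 assumes "anc z j" "z < N"
 shows "anc (2 * z) j \<or> anc (2 * z + 1) j"
proof -
 obtain t where t: "t <= h" "z = (N + j) div 2 ^ t" using assms unfolding anc_def by blast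
 obtain t' where t': "t = Suc t'" using t assms(2) by (cases t) auto
 have "(N + j) div 2 ^ t = (N + j) div 2 ^ t' div 2" unfolding t' by (metis div_mult2_eq power_Suc2)
 then have "(N + j) div 2 ^ t' = 2 * z \<or> (N + j) div 2 ^ t' = 2 * z + 1" using t by linarith
 then show ?thesis using t t' unfolding anc_def by (metis Suc_leD)
qed

text \<open>Every leaf below \<open>z\<close> lies below one of the two children and so already has
  at least the minimum of their values; the pull changes no leaf value.\<close>

lemma blk_pull:
 assumes "z < N"
 shows "blk (lw V z (min (V (2 * z)) (V (2 * z + 1)))) y j <-> blk V y j"
proof -
 have "blk V y j" if "anc z j" "y <= min (V (2 * z)) (V (2 * z + 1))"
  using anc_child[OF that(1) assms] that(2) unfolding anc_def blk_def by auto
 then show ?thesis unfolding blk_lw by blast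
qed

lemma anc_leaf: "j < N ==> i < N ==> anc (N + i) j <-> i = j"
proof -
 assume ij: "j < N" "i < N"
 have "(N + j) div 2 ^ t < N" if "t ~= 0" for t
 proof -
  have "(N + j) div 2 ^ t <= (N + j) div 2 ^ 1" using that by (intro div_le_mono2 power_increasing) auto
  then show ?thesis using ij by simp
 qed
 then show ?thesis unfolding anc_def by (metis add_left_cancel div_by_1 leD le0 le_add1 power_0)
qed

text \<open>The nodes \<open>l, \<dots>, r - 1\<close> at height \<open>t\<close> are split into at most two nodes and a range at height \<open>t + 1\<close>.\<close>
lemma range_up:
 assumes "l < r"
 shows "(l <= u & u < r) <-> (odd l & u = l) \<or> (odd r & u = r - 1) \<or>
  ((if odd l then l + 1 else l) div 2 <= u div 2 & u div 2 < (if odd r then r - 1 else r) div (2::nat))"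
 using assms by (auto elim!: oddE evenE)

text \<open>Two facts are kept: all values on the path down to \<open>v\<close> are below
  \<open>y\<close>, and all leaves to the right of the subtree of \<open>v\<close> are blocked.
  Preferring the right child preserves both, since it is passed over only if its value is at least
  \<open>y\<close>, which blocks all its leaves.\<close>

lemma find_step:
 assumes hp: "ALL v. 1 <= v & v < N --> heap_at V v" and s: "s < h" "2 ^ s <= v" "v < 2 ^ Suc s"
  and up: "ALL t<=s. V (v div 2 ^ t) < y" and rt: "ALL j<N. v < (N + j) div 2 ^ (h - s) --> blk V y j"
  and v': "v' = (if V (2 * v + 1) < y then 2 * v + 1 else 2 * v)"
 shows "2 ^ Suc s <= v' & v' < 2 ^ Suc (Suc s) & (ALL t<=Suc s. V (v' div 2 ^ t) < y) &
  (ALL j<N. v' < (N + j) div 2 ^ (h - Suc s) --> blk V y j)"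
proof (intro conjI allI impI)
 have vN: "v < N" "1 <= v"
 proof -
  have "(2::nat) ^ Suc s <= 2 ^ h" using s by (intro power_increasing) auto
  then show "v < N" using s N_def by simp
  have "(1::nat) <= 2 ^ s" by simp
  then show "1 <= v" using s by linarith
 qed
 show "2 ^ Suc s <= v'" "v' < 2 ^ Suc (Suc s)" using s v' by auto
 fix t assume t: "t <= Suc s"
 show "V (v' div 2 ^ t) < y"
 proof (cases t)
  case 0
  have "min (V (2 * v)) (V (2 * v + 1)) < y" using hp vN up[rule_format, of 0] unfolding heap_at_def by fastforce
  then show ?thesis using 0 v' by (auto simp: min_def split: if_splits)
 next
  case (Suc t')
  have "v' div 2 ^ t = v' div 2 div 2 ^ t'" unfolding Suc by (simp add: div_mult2_eq)
  also have "v' div 2 = v" using v' by auto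
  finally show ?thesis using up Suc t by simp
 qed
next
 fix j assume j: "j < N" "v' < (N + j) div 2 ^ (h - Suc s)"
 let ?u = "(N + j) div 2 ^ (h - Suc s)"
 have "h - s = Suc (h - Suc s)" using s by simp
 then have u2: "(N + j) div 2 ^ (h - s) = ?u div 2" by (metis div_mult2_eq power_Suc2)
 show "blk V y j"
 proof (cases "v < ?u div 2")
  case True
  then show ?thesis using rt j u2 by auto
 next
  case False
  then have "?u = 2 * v + 1" "v' = 2 * v" using j v' by (auto split: if_splits)
  then have "y <= V ?u" using v' by (auto split: if_splits)
  then show ?thesis unfolding blk_def by (metis diff_le_self)
 qed
qed

lemma find_final:
 assumes "2 ^ h <= v" "v < 2 ^ Suc h" "ALL t<=h. V (v div 2 ^ t) < y" "ALL j<N. v < (N + j) div 2 ^ (h - h) --> blk V y j"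
 shows "v - N < N & \<not> blk V y (v - N) & (ALL j<N. v - N < j --> blk V y j)"
proof -
 have v: "N + (v - N) = v" "v - N < N" using assms N_def by auto
 then have "\<not> blk V y (v - N)" unfolding blk_def using assms(3) by (auto simp: not_le)
 moreover have "ALL j<N. v - N < j --> blk V y j" using assms(4) v by auto
 ultimately show ?thesis using v by simp
qed

lemma root_le: "j < N ==> y <= V 1 ==> blk V y j"
proof -
 assume "j < N" "y <= V 1"
 then have "(N + j) div 2 ^ h = 1" unfolding N_def by (simp add: div_nat_eqI)
 then show ?thesis using \<open>y <= V 1\<close> unfolding blk_def by (metis order_refl)
qed

end

section \<open>The undo log and the nested versions of the tree\<close>

fun undo :: "(nat \<times> nat \<times> nat) list => (nat => nat) => nat => nat" where
 "undo [] V = V"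
| "undo ((q, a, x) # L) V = undo L (V(a := x))"

lemma undo_append: "undo (K @ L) V = undo L (undo K V)"
 by (induction K arbitrary: V) auto

context segtree begin

definition ext :: "nat => (nat => nat) => (nat \<times> nat \<times> nat) list => (nat => nat) => (nat \<times> nat \<times> nat) list => nat => bool" where
 "ext g V L V' L' B <-> (EX K. L' = K @ L & (ALL x:set K. fst x = g & fst (snd x) < 2 * N) & undo K V' = V & length K <= B)"

lemma ext_refl: "ext g V L V L B"
 unfolding ext_def by (intro exI[of _ "[]"]) auto

lemma ext_trans:
 assumes "ext g V L V' L' B" "ext g V' L' V'' L'' B'"
 shows "ext g V L V'' L'' (B + B')"
proof -
 obtain K where K: "L' = K @ L" "ALL x:set K. fst x = g & fst (snd x) < 2 * N" "undo K V' = V" "length K <= B" using assms unfolding ext_def by blast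
 obtain K' where K': "L'' = K' @ L'" "ALL x:set K'. fst x = g & fst (snd x) < 2 * N" "undo K' V'' = V'" "length K' <= B'" using assms unfolding ext_def by blast
 show ?thesis unfolding ext_def using K K' by (intro exI[of _ "K' @ K"]) (auto simp: undo_append)
qed

lemma ext_one: "v < 2 * N ==> V v = x ==> ext g V L (V(v := y)) ((g, v, x) # L) 1"
 unfolding ext_def by (intro exI[of _ "[(g, v, x)]"]) auto

lemma ext_mono: "ext g V L V' L' B ==> B <= B' ==> ext g V L V' L' B'"
 unfolding ext_def by (elim exE conjE) (rule exI, auto)

lemma ext_adr: "ext g V L V' L' B ==> ALL x:set L. fst (snd x) < 2 * N ==> ALL x:set L'. fst (snd x) < 2 * N"
 unfolding ext_def by (elim exE conjE) (simp add: ball_Un)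

lemma ext_length: "ext g V L V' L' B ==> length L <= length L' & length L' <= length L + B"
 unfolding ext_def by auto

abbreviation above :: "nat => nat \<times> nat \<times> nat => bool" where
 "above q x \<equiv> q < fst x"

text \<open>Undoing the entries with request above \<open>q\<close> gives a tree for \<open>F q\<close> and leaves at most \<open>C q\<close> entries.\<close>
definition stk :: "(nat => nat) => (nat \<times> nat \<times> nat) list => (nat => nat => nat) => (nat => nat) => bool" where
 "stk V L F C <-> sorted_wrt (%x y. fst y <= fst x) L &
  (ALL q. tr (undo (takeWhile (above q) L) V) (F q) & length (dropWhile (above q) L) <= C q)"

lemma takeWhile_above_split:
 "q <= x ==> takeWhile (above q) L = takeWhile (above x) L @ takeWhile (above q) (dropWhile (above x) L)"
 by (induction L) auto

lemma dropWhile_above: "sorted_wrt (%x y. fst y <= fst x) L ==>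
 dropWhile (above q) (dropWhile (above x) L) = dropWhile (above (min q x)) L"
 by (induction L) (auto simp: min_def)

lemma takeWhile_above_drop: "sorted_wrt (%x y. fst y <= fst x) L ==> x <= q ==>
 takeWhile (above q) (dropWhile (above x) L) = []"
 by (induction L) auto

text \<open>Once the entries above \<open>x\<close> are gone, a request above \<open>x\<close> sees
  the same version as \<open>x\<close> itself; this is the reason for
  \<open>min q x\<close>.\<close>

lemma stk_pop:
 assumes "stk V L F C"
 shows "stk (undo (takeWhile (above x) L) V) (dropWhile (above x) L) (%q. F (min q x)) (%q. C (min q x))"
proof -
 have so: "sorted_wrt (%x y. fst y <= fst x) L" using assms unfolding stk_def by blast
 have "sorted_wrt (%x y. fst y <= fst x) (dropWhile (above x) L)"
  using so by (metis sorted_wrt_append takeWhile_dropWhile_id)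
 moreover have "undo (takeWhile (above q) (dropWhile (above x) L)) (undo (takeWhile (above x) L) V) = undo (takeWhile (above (min q x)) L) V" for q
 proof (cases "q <= x")
  case True
  then show ?thesis unfolding undo_append[symmetric] takeWhile_above_split[OF True, symmetric] by (simp add: min_def)
 next
  case False
  then show ?thesis using takeWhile_above_drop[OF so, of x q] by (simp add: min_def)
 qed
 ultimately show ?thesis using assms dropWhile_above[OF so] unfolding stk_def by simp
qed

text \<open>No old entry has a request above \<open>g\<close>, so the new entries form a block on
  top of the log. A version below \<open>g\<close> is reached by undoing the whole block first, and
  therefore stays as it was.\<close>

lemma stk_push:
 assumes st: "stk V L F C" and g: "ALL x:set L. fst x <= g" and e: "ext g V L V' L' B" and t: "tr V' f"
 shows "stk V' L' (%q. if q < g then F q else f) (%q. if q < g then C q else C q + B)"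
proof -
 obtain K where K: "L' = K @ L" "ALL x:set K. fst x = g & fst (snd x) < 2 * N" "undo K V' = V" "length K <= B" using e unfolding ext_def by blast
 have so: "sorted_wrt (%x y. fst y <= fst x) L" using st unfolding stk_def by blast
 have "sorted_wrt (%x y. fst y <= fst x) K" using K(2) by (induction K) auto
 then have "sorted_wrt (%x y. fst y <= fst x) L'" using so K g by (auto simp: sorted_wrt_append)
 moreover have "takeWhile (above q) L' = K @ takeWhile (above q) L & dropWhile (above q) L' = dropWhile (above q) L" if "q < g" for q
  using K that by (auto simp: takeWhile_append2 dropWhile_append2)
 moreover have "takeWhile (above q) L' = [] & dropWhile (above q) L' = L' & dropWhile (above q) L = L" if "\<not> q < g" for q
 proof -
  have "ALL x:set L'. \<not> above q x" "ALL x:set L. \<not> above q x" using K(1,2) g that by auto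
  then show ?thesis by (cases L'; cases L) simp_all
 qed
 moreover have "length L' <= C q + B" if "\<not> q < g" for q
 proof -
  have "length (dropWhile (above q) L) <= C q" using st unfolding stk_def by blast
  moreover have "ALL x:set L. \<not> above q x" using g that by auto
  then have "dropWhile (above q) L = L" by (cases L) simp_all
  ultimately show ?thesis using K by simp
 qed
 ultimately show ?thesis using st t K(3) unfolding stk_def by (simp add: undo_append)
qed

end

section \<open>The token order\<close>

lemma card_sparse:
 assumes "Q \<subseteq> {..<m}" "1 <= r" "!!p q. p \<in> Q ==> q \<in> Q ==> p < q ==> p + r <= (q::nat)"
 shows "card Q <= m div r + 1"
proof -
 have "inj_on (%p. p div r) Q"
 proof (rule inj_onI)
  fix x y assume xy: "x \<in> Q" "y \<in> Q" "x div r = y div r"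
  have False if "p \<in> Q" "q \<in> Q" "p div r = q div r" "p < q" for p q
  proof -
   have "(p + r) div r <= q div r" using assms(3)[of p q] that by (intro div_le_mono) auto
   then show False using that assms(2) by simp
  qed
  then show "x = y" using xy by (metis linorder_neqE_nat)
 qed
 moreover have "(%p. p div r) ` Q \<subseteq> {..m div r}" using assms(1) by (auto intro!: div_le_mono)
 ultimately have "card Q <= card {..m div r}" by (metis card_image card_mono finite_atMost)
 then show ?thesis by simp
qed

text \<open>A block of \<open>s\<close> consecutive positions contains at most two elements: with a
  third one, its least and its greatest element would have to be \<open>s\<close> apart.\<close>

lemma card_no_three:
 assumes "P \<subseteq> {..<m}" "1 <= (s::nat)"
  "!!p q r. p \<in> P ==> q \<in> P ==> r \<in> P ==> p < q ==> q < r ==> p + s <= (r::nat)"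
 shows "card P <= 2 * (m div s + 1)"
proof -
 have fin: "finite P" using assms(1) finite_subset by blast
 have two: "card {p \<in> P. p div s = u} <= 2" for u
 proof (rule ccontr)
  let ?A = "{p \<in> P. p div s = u}"
  assume "\<not> card ?A <= 2"
  then have "3 <= card ?A" by simp
  then obtain B where B: "B \<subseteq> ?A" "card B = 3" using obtain_subset_with_card_n by metis
  have fB: "finite B" using B(2) card.infinite[of B] by fastforce
  define a b where "a = Min B" and "b = Max B"
  have ab: "a \<in> B" "b \<in> B" using fB B unfolding a_def b_def by (auto intro!: Min_in Max_in)
  have "card {a, b} <= 2" by (simp add: card_insert_if)
  moreover have "card (B - {a, b}) = card B - card {a, b}" using ab by (intro card_Diff_subset) auto
  ultimately have "card (B - {a, b}) \<ge> 1" using B by simp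
  then obtain d where d: "d \<in> B" "d ~= a" "d ~= b" by (metis Diff_iff card.empty ex_in_conv insertCI not_one_le_zero)
  have "a < d" "d < b" using d fB unfolding a_def b_def by (auto simp: le_neq_trans Min_le Max_ge order_less_le)
  then have "a + s <= b" using assms(3)[of a d b] ab d B by auto
  then have "(a + s) div s <= b div s" by (rule div_le_mono)
  moreover have "a div s = b div s" using ab B by auto
  ultimately show False using assms(2) by simp
 qed
 have "p div s <= m div s" if "p \<in> P" for p
 proof -
  have "p < m" using that assms(1) by auto
  then show ?thesis by (intro div_le_mono) simp
 qed
 then have eq: "P = (\<Union>u\<in>{..m div s}. {p \<in> P. p div s = u})" by auto
 have "card P = card (\<Union>u\<in>{..m div s}. {p \<in> P. p div s = u})" by (rule arg_cong[OF eq])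
 also have "\<dots> <= (\<Sum>u\<in>{..m div s}. card {p \<in> P. p div s = u})" by (rule card_UN_le) simp
 also have "\<dots> <= (\<Sum>u\<in>{..m div s}. 2)" using two by (intro sum_mono) auto
 finally show ?thesis by simp
qed

text \<open>A harmonic sum by dyadic blocks: between \<open>2 ^ a\<close> and
  \<open>2 ^ Suc a\<close> there are \<open>2 ^ a\<close> terms of at most
  \<open>m div 2 ^ a\<close>, together at most \<open>m\<close>.\<close>

lemma harmonic_div: "(\<Sum>s\<in>{1..<2 ^ a}. m div s) <= a * (m::nat)"
proof (induction a)
 case (Suc a)
 have "{1..<2 ^ Suc a} = {1..<2 ^ a} \<union> {2 ^ a..<(2::nat) ^ Suc a}"
  by (rule ivl_disj_un_two(3)[symmetric]) auto
 then have "(\<Sum>s\<in>{1..<2 ^ Suc a}. m div s) = (\<Sum>s\<in>{1..<2 ^ a}. m div s) + (\<Sum>s\<in>{2 ^ a..<2 ^ Suc a}. m div s)"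
  by (simp add: sum.union_disjoint)
 also have "(\<Sum>s\<in>{2 ^ a..<2 ^ Suc a}. m div s) <= (\<Sum>s\<in>{2 ^ a..<(2::nat) ^ Suc a}. m div 2 ^ a)"
  by (intro sum_mono div_le_mono2) auto
 also have "\<dots> = 2 ^ a * (m div 2 ^ a)" by simp
 also have "\<dots> <= m" by simp
 finally show ?case using Suc by simp
qed simp

section \<open>Token sequences and candidate borders\<close>

locale ordered = runseq +
 fixes Cn ORD :: "nat => nat" and k infy :: nat
 assumes Cn_eq: "x < m ==> y < m ==> Cn x = Cn y <-> c x = c y"
  and Cn_pos: "x < m ==> 1 <= Cn x"
  and Cn_out: "m <= x ==> Cn x = 0"
  and k_sq: "m <= k * k" and k_pos: "1 <= k"
  and e_INF: "x < m ==> e x < infy"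
begin

definition ee :: "nat => nat" where "ee x = (if x < m then e x else 0)"

text \<open>Token 0 is the letter of run \<open>p\<close>; the tokens \<open>2 * t - 1\<close> and
  \<open>2 * t\<close> are letter and exponent of run \<open>p + t\<close> for positive
  \<open>t\<close>. The exponent of run \<open>p\<close> itself is left out, because a border only
  compares it by an inequality.\<close>

definition tk :: "nat => nat => nat" where
 "tk p d = (if d = 0 then Cn p else if odd d then Cn (p + (d + 1) div 2) else ee (p + d div 2))"

definition eqd :: "nat => nat => nat => bool" where
 "eqd n p q <-> (ALL d<n. tk p d = tk q d)"

definition lexless :: "nat => nat => bool" where
 "lexless p q <-> (EX d. eqd d p q & tk p d < tk q d)"

definition tok :: "nat => nat => nat" where
 "tok p q = (LEAST d. tk p d ~= tk q d)"

text \<open>The condition for a border of \<open>r\<close> runs without the comparison of the first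
  exponents. It makes sense for every position \<open>p\<close>, also at or before \<open>i\<close>;
  behind \<open>i\<close>, and together with \<open>e i <= e p\<close> for longer borders, it
  amounts to \<open>match\<close>.\<close>

definition act :: "nat => nat => nat => bool" where
 "act i p r <-> p + r <= m & (if r = 1 then eqd 1 p i else eqd (2 * r - 2) p i & tk p (2 * r - 2) <= tk i (2 * r - 2))"

text \<open>The number of tokens that neighbouring starts must share for the pair to stay active.
  The final exponent is only compared by an inequality, which survives because the starts are
  visited in increasing order; so it is not counted.\<close>

definition req :: "nat => nat" where "req r = (if r = 1 then 1 else 2 * r - 2)"

text \<open>A candidate blocks the starts \<open>i\<close> with \<open>e i\<close> at most its
  weight. A single equal letter blocks every start, so its weight exceeds all exponents.\<close>

definition wt :: "nat => nat => nat" where "wt p r = (if r = 1 then infy else e p)"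

lemma tk_0 [simp]: "tk p 0 = Cn p" by (simp add: tk_def)
lemma tk_odd [simp]: "tk p (Suc (2 * s)) = Cn (Suc (p + s))" by (simp add: tk_def)
lemma tk_even [simp]: "tk p (Suc (Suc (2 * s))) = ee (Suc (p + s))" by (simp add: tk_def)

lemma tk_shift: "1 <= d ==> tk (p + s) d = tk p (d + 2 * s)"
 unfolding tk_def by (simp add: ac_simps)

lemma tk_c: "1 <= t ==> tk p (2 * t - 1) = Cn (p + t)"
 by (cases t) (simp_all add: tk_def)

lemma tk_e: "1 <= t ==> tk p (2 * t) = ee (p + t)"
 by (simp add: tk_def)

lemma eqd_sym: "eqd n p q <-> eqd n q p" unfolding eqd_def by auto
lemma eqd_trans: "eqd n p q ==> eqd n q r ==> eqd n p r" unfolding eqd_def by simp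
lemma eqd_mono: "eqd n p q ==> n' <= n ==> eqd n' p q" unfolding eqd_def by simp
lemma eqd_refl [simp]: "eqd n p p" unfolding eqd_def by simp
lemma eqd_Suc: "eqd (Suc n) p q <-> eqd n p q & tk p n = tk q n" unfolding eqd_def by (auto simp: less_Suc_eq)

text \<open>At the letter token at which the later start has just run past the last run, it reads
  the sentinel 0, while the earlier start still reads a positive name.\<close>

lemma tk_differ:
 assumes "p < m" "q < m" "p ~= q"
 shows "EX d. tk p d ~= tk q d"
proof -
 have *: "EX d. tk p d ~= tk q d" if "p < q" "q < m" for p q
 proof -
  have "tk q (2 * (m - q) - 1) = Cn (q + (m - q))" "tk p (2 * (m - q) - 1) = Cn (p + (m - q))" using that by (intro tk_c; simp)+
  moreover have "Cn (q + (m - q)) = 0" using that by (intro Cn_out) simp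
  moreover have "1 <= Cn (p + (m - q))" using that by (intro Cn_pos) simp
  ultimately show ?thesis by (metis not_one_le_zero)
 qed
 show ?thesis using *[of p q] *[of q p] assms by (metis linorder_neqE_nat)
qed

lemma le_tok:
 assumes "p < m" "q < m" "p ~= q"
 shows "n <= tok p q <-> eqd n p q"
proof -
 have L: "tk p (tok p q) ~= tk q (tok p q)" unfolding tok_def by (rule LeastI_ex) (rule tk_differ[OF assms])
 have M: "tk p d = tk q d" if "d < tok p q" for d using not_less_Least[of d] that unfolding tok_def by blast
 show ?thesis unfolding eqd_def using L M by (meson leI le_trans not_less order_less_le_trans)
qed

lemma tok_eqI:
 assumes "eqd n p q" "tk p n ~= tk q n"
 shows "tok p q = n"
 unfolding tok_def
proof (rule Least_equality)
 fix y assume "tk p y ~= tk q y"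
 then show "n <= y" using assms(1) unfolding eqd_def by (meson not_less)
qed (rule assms(2))

lemma lex_le: "lexless a b ==> eqd n a b ==> tk a n <= tk b n"
proof -
 assume "lexless a b" "eqd n a b"
 then obtain d where d: "eqd d a b" "tk a d < tk b d" unfolding lexless_def by blast
 have "n <= d" using d(2) \<open>eqd n a b\<close> unfolding eqd_def by (metis nat_neq_iff not_le)
 then show ?thesis using d unfolding eqd_def by (cases "n = d") auto
qed

text \<open>A first difference of \<open>a\<close> and \<open>b\<close> among the first
  \<open>n\<close> tokens is an increase, and \<open>d\<close> is not below \<open>b\<close>; hence
  it would also separate \<open>a\<close> from \<open>d\<close>.\<close>

lemma lex_sandwich:
 assumes "lexless a b" "lexless b d" "eqd n a d"
 shows "eqd n a b & eqd n b d"
proof -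
 obtain x where x: "eqd x a b" "tk a x < tk b x" using assms unfolding lexless_def by blast
 obtain y where y: "eqd y b d" "tk b y < tk d y" using assms unfolding lexless_def by blast
 have "n <= x"
 proof (rule ccontr)
  assume n: "\<not> n <= x"
  show False
  proof (cases "x <= y")
   case True
   have "tk b x <= tk d x" using y True unfolding eqd_def by (cases "x = y") auto
   then show False using x assms(3) n unfolding eqd_def by auto
  next
   case False
   then have "tk a y = tk b y" using x unfolding eqd_def by auto
   then show False using y assms(3) n False unfolding eqd_def by auto
  qed
 qed
 then have "eqd n a b" using x eqd_mono by blast
 then show ?thesis using assms(3) eqd_sym eqd_trans by blast
qed

lemma lex_asym: "lexless a b ==> \<not> lexless b a"
proof
 assume ab: "lexless a b" "lexless b a"
 then obtain x where x: "eqd x a b" "tk a x < tk b x" unfolding lexless_def by blast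
 have "tk b x <= tk a x" using lex_le[OF ab(2)] x(1) eqd_sym by blast
 then show False using x by simp
qed

lemma act_iff_match:
 assumes "i < p" "1 <= r" "p + r <= m"
 shows "match i p r <-> act i p r & (r = 1 \<or> e i <= e p)"
proof (cases "r = 1")
 case True
 then show ?thesis using assms Cn_eq[of p i] by (auto simp: match_def act_def eqd_def)
next
 case False
 with assms have r: "2 <= r" by simp
 have "eqd (2 * r - 2) p i <-> c p = c i & (ALL t. 1 <= t & t + 2 <= r --> c (p + t) = c (i + t) & e (p + t) = e (i + t)) & c (p + r - 1) = c (i + r - 1)"
  (is "?L <-> ?R")
 proof
  assume L: ?L
  have 0: "c p = c i" using L[unfolded eqd_def, rule_format, of 0] r assms Cn_eq by simp
  have ct: "c (p + t) = c (i + t)" if "1 <= t" "t < r" for t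
   using L[unfolded eqd_def, rule_format, of "2 * t - 1"] that tk_c[of t] Cn_eq[of "p + t" "i + t"] assms by simp
  have et: "e (p + t) = e (i + t)" if "1 <= t" "t + 2 <= r" for t
   using L[unfolded eqd_def, rule_format, of "2 * t"] that tk_e[of t] assms by (simp add: ee_def)
  show ?R using 0 ct et ct[of "r - 1"] r by auto
 next
  assume R: ?R
  show ?L unfolding eqd_def
  proof (intro allI impI)
   fix d assume d: "d < 2 * r - 2"
   have "d = 0 \<or> (EX t. 1 <= t & d = 2 * t - 1) \<or> (EX t. 1 <= t & d = 2 * t)" by presburger
   then consider "d = 0" | t where "1 <= t" "d = 2 * t - 1" | t where "1 <= t" "d = 2 * t" by blast
   then show "tk p d = tk i d"
   proof cases
    case 1
    then show ?thesis using R Cn_eq[of p i] assms by simp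
   next
    case (2 t)
    then have t: "t < r" using d by simp
    have "c (p + t) = c (i + t)" using R 2 t r by (cases "t = r - 1") auto
    then show ?thesis using 2 t tk_c[of t] Cn_eq[of "p + t" "i + t"] assms by simp
   next
    case (3 t)
    then have t: "t + 2 <= r" using d by simp
    then show ?thesis using 3 R tk_e[of t] assms by (simp add: ee_def)
   qed
  qed
 qed
 moreover have "tk p (2 * r - 2) = e (p + r - 1)" "tk i (2 * r - 2) = e (i + r - 1)"
  using tk_e[of "r - 1"] r assms by (auto simp: ee_def diff_mult_distrib2)
 ultimately show ?thesis using False assms unfolding match_def act_def by auto
qed

lemma act_cong:
 assumes "eqd (2 * r - 1) i i'" "1 <= r"
 shows "act i p r <-> act i' p r"
proof -
 have "eqd (Suc (2 * r - 2)) i i'" by (rule eqd_mono[OF assms(1)]) (use assms(2) in simp)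
 then have "tk i (2 * r - 2) = tk i' (2 * r - 2)" "eqd (2 * r - 2) i i'" unfolding eqd_Suc by auto
 moreover have "eqd 1 i i'" by (rule eqd_mono[OF assms(1)]) (use assms(2) in simp)
 ultimately show ?thesis unfolding act_def using eqd_trans eqd_sym by metis
qed

lemma act_refl: "p + r <= m ==> act p p r"
 by (simp add: act_def)

lemma act_exact: "1 <= r ==> p + r <= m ==> eqd (2 * r - 1) p i ==> act i p r"
 using act_cong[of r p i p] act_refl[of p r] by simp

text \<open>A border of the runs from \<open>p\<close> on is transferred to \<open>i\<close>, since
  exact copies agree on all tokens that it involves. The end is the same and the weight is no
  smaller: either \<open>e p <= e p'\<close>, or the shorter candidate is a single letter and has
  the maximal weight.\<close>

lemma act_dominated:
 assumes "eqd (2 * r - 1) p i" "p + r <= m" "2 <= r" "bord p (p + r - 1)"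
 shows "EX p' r'. 1 <= r' & r' < r & p' + r' = p + r & act i p' r' & wt p r <= wt p' r'"
proof -
 obtain r' where r': "1 <= r'" "r' + p <= p + r - 1" "match p (p + r - 1 + 1 - r') r'" using assms(4) unfolding bord_def by blast
 define p' where "p' = p + r - r'"
 have p': "p' + r' = p + r" "p < p'" "r' < r" "p + r - 1 + 1 - r' = p'" using r' assms(3) by (auto simp: p'_def)
 have "act p p' r'" "r' = 1 \<or> e p <= e p'" using act_iff_match[of p p' r'] r' p' assms(2) by auto
 moreover have "act i p' r'" using act_cong[of r' p i p'] eqd_mono[OF assms(1), of "2 * r' - 1"] p' r'(1) calculation(1) by auto
 moreover have "wt p r <= wt p' r'" using calculation(2) assms(2,3) e_INF[of p] by (auto simp: wt_def)
 ultimately show ?thesis using r' p' by blast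
qed

text \<open>Both starts are compared with \<open>i\<close> and therefore with each other. If
  \<open>e p <= e q\<close>, the part from \<open>q\<close> on would be a border of the runs of
  \<open>p\<close>.\<close>

lemma act_decreasing:
 assumes "act i p r" "act i q r" "p < q" "q + 2 <= p + r" "\<not> bord p (p + r - 1)"
 shows "e q < e p"
proof (rule ccontr)
 assume "\<not> e q < e p"
 then have le: "e p <= e q" by simp
 define r' where "r' = p + r - q"
 have r': "2 <= r'" "r' < r" "q + r' = p + r" using assms by (auto simp: r'_def)
 have pm: "p + r <= m" using assms(1) by (simp add: act_def)
 have "eqd (2 * r - 2) p i" "eqd (2 * r - 2) q i" using assms r' by (auto simp: act_def)
 then have E: "eqd (2 * r - 2) q p" using eqd_sym eqd_trans by blast
 have "act p q r'" unfolding act_def using r' pm eqd_mono[OF E, of "2 * r' - 2"] E by (auto simp: eqd_def)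
 then have "match p q r'" using act_iff_match[of p q r'] assms r' pm le by simp
 moreover have "p + r - 1 + 1 - r' = q" using r' by simp
 ultimately have "bord p (p + r - 1)" unfolding bord_def using r' assms by (intro exI[of _ r']) auto
 then show False using assms by simp
qed

text \<open>Let \<open>p < q < s\<close> be three such starts within fewer than \<open>r - 1\<close>
  runs, with gaps \<open>x\<close> and \<open>y\<close>. The preceding lemma gives
  \<open>e s < e q\<close>. On the other hand, run \<open>q + x + y\<close> is run
  \<open>s + x\<close>: read from \<open>q\<close> it has the exponent of run
  \<open>i + (x + y)\<close>, which is \<open>e s\<close>; read from \<open>s\<close> it has the
  exponent of run \<open>i + x\<close>, which is \<open>e q\<close>.\<close>

lemma card_active_unbordered:
 assumes "2 <= r"
 shows "card {p. act i p r & \<not> bord p (p + r - 1)} <= 2 * (m div (r - 1) + 1)"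
proof (rule card_no_three)
 show "{p. act i p r & \<not> bord p (p + r - 1)} \<subseteq> {..<m}" using assms by (auto simp: act_def)
 fix p q s assume a: "p \<in> {p. act i p r & \<not> bord p (p + r - 1)}" "q \<in> {p. act i p r & \<not> bord p (p + r - 1)}"
  "s \<in> {p. act i p r & \<not> bord p (p + r - 1)}" "p < q" "q < s"
 show "p + (r - 1) <= s"
 proof (rule ccontr)
  assume "\<not> p + (r - 1) <= s"
  then have w: "s + 2 <= p + r" using assms by linarith
  have lt: "e s < e q" using act_decreasing[of i q r s] a w by simp
  define x y where "x = q - p" and "y = s - q"
  have xy: "1 <= x" "1 <= y" "x + y + 2 <= r" "q = p + x" "s = q + y" "s = p + (x + y)" using a w by (auto simp: x_def y_def)
  have E: "eqd (2 * r - 2) p i" "eqd (2 * r - 2) q i" "eqd (2 * r - 2) s i" using a assms by (auto simp: act_def)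
  have ev: "ee (u + t) = ee (i + t)" if "eqd (2 * r - 2) u i" "1 <= t" "t + 2 <= r" for u t
   using that(1)[unfolded eqd_def, rule_format, of "2 * t"] that tk_e by simp
  have "ee q = ee (i + x)" using ev[OF E(1), of x] xy by simp
  moreover have "ee s = ee (i + (x + y))" using ev[OF E(1), of "x + y"] xy by simp
  moreover have "ee (i + (x + y)) = ee (q + (x + y))" using ev[OF E(2), of "x + y"] xy by simp
  moreover have "ee (i + x) = ee (s + x)" using ev[OF E(3), of x] xy(1,3) by simp
  moreover have "q + (x + y) = s + x" using xy by simp
  ultimately have "ee s = ee q" by simp
  moreover have "s < m" "q < m" using a w by (auto simp: act_def)
  ultimately show False using lt by (simp add: ee_def)
 qed
qed (use assms in auto)

end

section \<open>Ranks, classes of exact copies and the number of long candidates\<close>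

locale sweep = ordered +
 assumes ORD_bij: "bij_betw ORD {..<m} {..<m}"
  and ORD_lex: "x < y ==> y < m ==> lexless (ORD x) (ORD y)"
begin

text \<open>The value 0 at rank 0 and from rank \<open>m\<close> on makes every class begin and end
  without a special case.\<close>

definition Xr :: "nat => nat" where
 "Xr x = (if x = 0 \<or> m <= x then 0 else tok (ORD (x - 1)) (ORD x))"

lemma ORD_lt: "x < m ==> ORD x < m"
 using ORD_bij by (auto simp: bij_betw_def)

lemma ORD_inj: "x < m ==> y < m ==> ORD x = ORD y ==> x = y"
 using ORD_bij by (auto simp: bij_betw_def inj_on_def)

lemma ORD_surj: "p < m ==> EX x<m. ORD x = p"
proof -
 assume "p < m"
 then have "p \<in> ORD ` {..<m}" using ORD_bij by (simp add: bij_betw_def)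
 then show ?thesis by auto
qed

lemma ORD_less: "x < m ==> y < m ==> lexless (ORD x) (ORD y) ==> x < y"
proof (rule ccontr)
 assume a: "x < m" "y < m" "lexless (ORD x) (ORD y)" "\<not> x < y"
 then consider "y = x" | "y < x" by linarith
 then show False using a ORD_lex[of y x] lex_asym by cases blast+
qed

lemma le_Xr: "0 < x ==> x < m ==> n <= Xr x <-> eqd n (ORD (x - 1)) (ORD x)"
proof -
 assume x: "0 < x" "x < m"
 then have x1: "x - 1 < m" "x - 1 ~= x" by auto
 then have "ORD (x - 1) ~= ORD x" using ORD_inj x by blast
 then have "n <= tok (ORD (x - 1)) (ORD x) <-> eqd n (ORD (x - 1)) (ORD x)" using le_tok ORD_lt x1 x by blast
 then show ?thesis using x by (simp add: Xr_def)
qed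

lemma Xr_chain: "x <= y ==> y < m ==> (!!z. x < z ==> z <= y ==> n <= Xr z) ==> eqd n (ORD x) (ORD y)"
proof (induction y rule: dec_induct)
 case (step y)
 have "eqd n (ORD x) (ORD y)" using step by simp
 moreover have "n <= Xr (Suc y)" using step by simp
 ultimately show ?case using le_Xr[of "Suc y" n] step eqd_trans by auto
qed simp

definition ACT :: "nat => (nat \<times> nat) set" where
 "ACT i = {(p, r). 1 <= r & r <= k & act i p r}"

definition NEW :: "nat => nat => nat set" where
 "NEW x r = {p. p + r <= m & eqd (2 * r - 1) p (ORD x)}"

definition OLD :: "nat => (nat \<times> nat) set" where
 "OLD x = (if x = 0 then {} else {(p, r). (p, r) \<in> ACT (ORD (x - 1)) & req r <= Xr x})"

text \<open>
 The entries for neighbouring ranks differ only in the entries whose request exceeds \<open>Xr\<close> (which become inactive)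
 and in the classes of exact copies that begin at the current rank: an entry that is active but not exact belongs to
 a smaller rank, hence by the sandwich property it is also active at the preceding rank.
\<close>
lemma ACT_step:
 assumes x: "x < m"
 shows "ACT (ORD x) = OLD x \<union> {(p, r). 1 <= r & r <= k & Xr x < 2 * r - 1 & p \<in> NEW x r}"
proof (intro equalityI subsetI)
 let ?i = "ORD x"
 fix a assume "a \<in> ACT ?i"
 then obtain p r where a: "a = (p, r)" and r: "1 <= r" "r <= k" and act: "act ?i p r" unfolding ACT_def by blast
 have pm: "p + r <= m" using act by (simp add: act_def)
 show "a \<in> OLD x \<union> {(p, r). 1 <= r & r <= k & Xr x < 2 * r - 1 & p \<in> NEW x r}"
 proof (cases "eqd (2 * r - 1) p ?i")
  case True
  show ?thesis
  proof (cases "Xr x < 2 * r - 1")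
   case True
   then show ?thesis using a r pm \<open>eqd (2 * r - 1) p ?i\<close> by (simp add: NEW_def)
  next
   case False
   then have x0: "x ~= 0" using r by (cases "x = 0") (simp_all add: Xr_def)
   then have "eqd (2 * r - 1) (ORD (x - 1)) ?i" using le_Xr[of x "2 * r - 1"] x False by simp
   then have "act (ORD (x - 1)) p r" using act act_cong r(1) by blast
   moreover have "req r <= Xr x" using False r by (auto simp: req_def)
   ultimately show ?thesis using a r x0 by (simp add: OLD_def ACT_def)
  qed
 next
  case False
  then have r2: "2 <= r" using act r by (cases "r = 1") (auto simp: act_def)
  then have E: "eqd (2 * r - 2) p ?i" "tk p (2 * r - 2) <= tk ?i (2 * r - 2)" using act by (auto simp: act_def)
  have "2 * r - 1 = Suc (2 * r - 2)" using r2 by simp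
  then have "tk p (2 * r - 2) ~= tk ?i (2 * r - 2)" using False E(1) by (simp add: eqd_Suc)
  then have "tk p (2 * r - 2) < tk ?i (2 * r - 2)" using E(2) by simp
  then have lx: "lexless p ?i" using E(1) unfolding lexless_def by blast
  obtain y where y: "y < m" "ORD y = p" using ORD_surj[of p] pm r by auto
  have yx: "y < x" using ORD_less[of y x] y x lx by simp
  then have x0: "x ~= 0" by simp
  let ?j = "ORD (x - 1)"
  have "eqd (2 * r - 2) p ?j & eqd (2 * r - 2) ?j ?i & tk p (2 * r - 2) <= tk ?j (2 * r - 2)"
  proof (cases "y = x - 1")
   case True
   then show ?thesis using y E by simp
  next
   case False
   then have l1: "lexless p ?j" "lexless ?j ?i" using ORD_lex[of y "x - 1"] ORD_lex[of "x - 1" x] y yx x by auto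
   then have "eqd (2 * r - 2) p ?j & eqd (2 * r - 2) ?j ?i" using lex_sandwich E(1) by blast
   then show ?thesis using lex_le[OF l1(1)] by blast
  qed
  then have "act ?j p r" "2 * r - 2 <= Xr x" using pm r2 le_Xr[of x "2 * r - 2"] x x0 by (auto simp: act_def)
  then show ?thesis using a r r2 x0 by (simp add: OLD_def ACT_def req_def)
 qed
next
 let ?i = "ORD x"
 fix a assume "a \<in> OLD x \<union> {(p, r). 1 <= r & r <= k & Xr x < 2 * r - 1 & p \<in> NEW x r}"
 then consider "a \<in> OLD x" | p r where "a = (p, r)" "1 <= r" "r <= k" "p \<in> NEW x r" by auto
 then show "a \<in> ACT ?i"
 proof cases
  case 1
  obtain p r where pr: "a = (p, r)" by (cases a)
  have x0: "x ~= 0" using 1 by (cases "x = 0") (simp_all add: OLD_def)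
  then have a: "a = (p, r)" "1 <= r" "r <= k" and o: "act (ORD (x - 1)) p r" "req r <= Xr x"
   using 1 pr by (simp_all add: OLD_def ACT_def)
  have E: "eqd (req r) (ORD (x - 1)) ?i" using le_Xr[of x "req r"] x x0 o(2) by simp
  have "act ?i p r"
  proof (cases "r = 1")
   case True
   then show ?thesis using o E eqd_trans by (auto simp: act_def req_def)
  next
   case False
   then have E2: "eqd (2 * r - 2) (ORD (x - 1)) ?i" using E by (simp add: req_def)
   have "lexless (ORD (x - 1)) ?i" using ORD_lex[of "x - 1" x] x x0 by simp
   then have "tk (ORD (x - 1)) (2 * r - 2) <= tk ?i (2 * r - 2)" using lex_le E2 by blast
   then show ?thesis using o False E2 eqd_trans by (auto simp: act_def)
  qed
  then show ?thesis using a by (simp add: ACT_def)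
 next
  case (2 p r)
  then show ?thesis using act_exact[of r p ?i] by (simp add: ACT_def NEW_def)
 qed
qed

text \<open>If a class of starts that agree on \<open>2 * r - 1\<close> tokens begins at rank
  \<open>x\<close>, this is its size.\<close>

definition gs :: "nat => nat => nat" where
 "gs x r = (LEAST g. 1 <= g & Xr (x + g) < 2 * r - 1)"

lemma gs:
 assumes "x < m" "1 <= r"
 shows "1 <= gs x r" "x + gs x r <= m" "Xr (x + gs x r) < 2 * r - 1"
  "!!g. 1 <= g ==> g < gs x r ==> 2 * r - 1 <= Xr (x + g)"
proof -
 let ?P = "%g. 1 <= g & Xr (x + g) < 2 * r - 1"
 have P: "?P (m - x)" using assms by (auto simp: Xr_def)
 show "1 <= gs x r" "Xr (x + gs x r) < 2 * r - 1" using LeastI[of ?P, OF P] unfolding gs_def by auto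
 have "gs x r <= m - x" unfolding gs_def by (rule Least_le[of ?P, OF P])
 then show "x + gs x r <= m" using assms by simp
 show "2 * r - 1 <= Xr (x + g)" if "1 <= g" "g < gs x r" for g
  using not_less_Least[of g ?P] that unfolding gs_def by auto
qed

text \<open>Starts with a common prefix of tokens are consecutive in the lexicographic order, so the
  class is an interval of ranks, delimited by the places where the agreement drops.\<close>

lemma group_eq:
 assumes x: "x < m" and r: "1 <= r" and st: "Xr x < 2 * r - 1"
 shows "{p. p < m & eqd (2 * r - 1) p (ORD x)} = ORD ` {x..<x + gs x r}"
proof (intro equalityI subsetI)
 fix p assume "p \<in> {p. p < m & eqd (2 * r - 1) p (ORD x)}"
 then have p: "p < m" "eqd (2 * r - 1) p (ORD x)" by auto
 obtain y where y: "y < m" "ORD y = p" using ORD_surj p by blast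
 have "x <= y"
 proof (rule ccontr)
  assume "\<not> x <= y"
  then have yx: "y < x" by simp
  have "eqd (2 * r - 1) (ORD (x - 1)) (ORD x)"
  proof (cases "y = x - 1")
   case True
   then show ?thesis using p y by simp
  next
   case False
   then show ?thesis using lex_sandwich[of p "ORD (x - 1)" "ORD x"] ORD_lex[of y "x - 1"] ORD_lex[of "x - 1" x] y yx x p by auto
  qed
  then show False using le_Xr[of x "2 * r - 1"] x yx st by auto
 qed
 moreover have "y < x + gs x r"
 proof (rule ccontr)
  assume "\<not> y < x + gs x r"
  then have yg: "x + gs x r <= y" by simp
  let ?z = "x + gs x r"
  have z: "x < ?z" "?z < m" using gs[OF x r] yg y by auto
  have E: "eqd (2 * r - 1) (ORD x) (ORD ?z)"
  proof (cases "?z = y")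
   case True
   then show ?thesis using p y eqd_sym by simp
  next
   case False
   then show ?thesis using lex_sandwich[of "ORD x" "ORD ?z" p "2 * r - 1"] ORD_lex[of x ?z] ORD_lex[of ?z y] y yg z p eqd_sym by auto
  qed
  have "eqd (2 * r - 1) (ORD (?z - 1)) (ORD ?z)"
  proof (cases "x = ?z - 1")
   case True
   then show ?thesis using E by metis
  next
   case False
   then show ?thesis using lex_sandwich[of "ORD x" "ORD (?z - 1)" "ORD ?z" "2 * r - 1"] ORD_lex[of x "?z - 1"] ORD_lex[of "?z - 1" ?z] z E by auto
  qed
  then have "2 * r - 1 <= Xr ?z" using le_Xr[of ?z "2 * r - 1"] z by auto
  then show False using gs(3)[OF x r] by simp
 qed
 ultimately show "p \<in> ORD ` {x..<x + gs x r}" using y by auto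
next
 fix p assume "p \<in> ORD ` {x..<x + gs x r}"
 then obtain y where y: "x <= y" "y < x + gs x r" "p = ORD y" by auto
 have ym: "y < m" using y gs(2)[OF x r] by simp
 have "eqd (2 * r - 1) (ORD x) (ORD y)"
 proof (rule Xr_chain[OF y(1) ym])
  fix z assume "x < z" "z <= y"
  then show "2 * r - 1 <= Xr z" using gs(4)[OF x r, of "z - x"] y by simp
 qed
 then show "p \<in> {p. p < m & eqd (2 * r - 1) p (ORD x)}" using y ym ORD_lt eqd_sym by auto
qed

text \<open>For fixed \<open>r\<close> the classes are disjoint intervals of ranks.\<close>

lemma sum_gs_le:
 assumes r: "1 <= r"
 shows "(\<Sum>x\<in>{x. x < m & Xr x < 2 * r - 1}. gs x r) <= m"
proof -
 let ?A = "{x. x < m & Xr x < 2 * r - 1}"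
 have sep: "x + gs x r <= y" if "x \<in> ?A" "y \<in> ?A" "x < y" for x y
 proof (rule ccontr)
  assume "\<not> x + gs x r <= y"
  then have "1 <= y - x" "y - x < gs x r" using that by linarith+
  then have "2 * r - 1 <= Xr (x + (y - x))" using gs(4)[of x r "y - x"] that r by blast
  then show False using that by simp
 qed
 have "(\<Sum>x\<in>?A. gs x r) = (\<Sum>x\<in>?A. card {x..<x + gs x r})" by simp
 also have "\<dots> = card (\<Union>x\<in>?A. {x..<x + gs x r})"
 proof (rule card_UN_disjoint[symmetric])
  show "ALL x:?A. ALL y:?A. x ~= y --> {x..<x + gs x r} \<inter> {y..<y + gs y r} = {}"
  proof (intro ballI impI)
   fix x y assume xy: "x \<in> ?A" "y \<in> ?A" "x ~= y"
   then consider "x + gs x r <= y" | "y + gs y r <= x" using sep[of x y] sep[of y x] by (metis linorder_neqE_nat)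
   then show "{x..<x + gs x r} \<inter> {y..<y + gs y r} = {}" by cases auto
  qed
 qed auto
 also have "\<dots> <= card {..<m}" using gs(2)[OF _ r] by (intro card_mono) (auto intro: order_less_le_trans)
 finally show ?thesis by simp
qed

text \<open>Single letters contribute at most \<open>m\<close>. For \<open>r >= 2\<close> the bounds
  \<open>2 * (m div (r - 1) + 1)\<close> add up to a harmonic sum, where \<open>h\<close> is at
  least the binary logarithm of \<open>k\<close>.\<close>

lemma card_unbordered:
 assumes kh: "k <= 2 ^ h"
 shows "card {(p, r). (p, r) \<in> ACT i & \<not> bord p (p + r - 1)} <= m + 2 * (h * m + k)"
proof -
 let ?U = "%r. {p. act i p r & \<not> bord p (p + r - 1)}"
 have fin: "finite (?U r)" if "1 <= r" for r
  by (rule finite_subset[of _ "{..<m}"]) (use that in "auto simp: act_def")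
 have eq: "{(p, r). (p, r) \<in> ACT i & \<not> bord p (p + r - 1)} = (\<Union>r\<in>{1..k}. (%p. (p, r)) ` ?U r)"
  by (auto simp: ACT_def)
 have "card {(p, r). (p, r) \<in> ACT i & \<not> bord p (p + r - 1)} <= (\<Sum>r\<in>{1..k}. card ((%p. (p, r)) ` ?U r))"
  unfolding eq by (rule card_UN_le) simp
 also have "\<dots> <= (\<Sum>r\<in>{1..k}. card (?U r))" using fin by (intro sum_mono card_image_le) auto
 also have "\<dots> = card (?U 1) + (\<Sum>r\<in>{2..k}. card (?U r))"
  using k_pos by (simp add: sum.atLeast_Suc_atMost numeral_2_eq_2)
 also have "card (?U 1) <= card {..<m}" by (intro card_mono) (auto simp: act_def)
 also have "(\<Sum>r\<in>{2..k}. card (?U r)) <= (\<Sum>r\<in>{2..k}. 2 * (m div (r - 1) + 1))"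
  using card_active_unbordered by (intro sum_mono) auto
 also have "\<dots> = (\<Sum>s\<in>{1..<k}. 2 * (m div s + 1))"
  by (rule sum.reindex_bij_witness[of _ Suc "%r. r - 1"]) auto
 also have "\<dots> = (\<Sum>s\<in>{1..<k}. 2 * (m div s)) + (\<Sum>s\<in>{1..<k}. 2)"
  unfolding sum.distrib[symmetric] by (intro sum.cong) auto
 also have "\<dots> = 2 * (\<Sum>s\<in>{1..<k}. m div s) + 2 * (k - 1)" by (simp add: sum_distrib_left)
 also have "(\<Sum>s\<in>{1..<k}. m div s) <= (\<Sum>s\<in>{1..<2 ^ h}. m div s)" using kh by (intro sum_mono2) auto
 also have "\<dots> <= h * m" by (rule harmonic_div)
 finally show ?thesis by simp
qed

text \<open>
 Occurrences of a shortest (hence unbordered) border do not overlap, so a border of more than \<open>k\<close> runs has fewer than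
 \<open>k\<close> occurrences between \<open>i\<close> and the one in question.
\<close>
lemma good_sparse:
 assumes i: "i < p0" and r: "2 <= r" "p0 + r = j + 1" "j < m"
  and mn: "!!r'. 1 <= r' ==> r' < r ==> \<not> match i (j + 1 - r') r'"
  and E0: "eqd (2 * r - 2) p0 i"
  and E1: "eqd (2 * r - 2) p1 i" "e i <= ee p1" "tk p0 (2 * r - 2) <= tk p1 (2 * r - 2)"
  and E2: "eqd (2 * r - 2) p2 i" "e i <= ee p2" and p: "p1 < p2"
 shows "p1 + r <= p2"
proof (rule ccontr)
 assume "\<not> p1 + r <= p2"
 define s where "s = p2 - p1"
 have s: "1 <= s" "s < r" "p2 = p1 + s" using p \<open>\<not> p1 + r <= p2\<close> by (auto simp: s_def)
 have c2: "Cn p2 = Cn i" using E2(1)[unfolded eqd_def, rule_format, of 0] r by simp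
 have cs: "Cn (q + s) = Cn (i + s)" if "eqd (2 * r - 2) q i" for q
  using that[unfolded eqd_def, rule_format, of "2 * s - 1"] tk_c[of s] s by simp
 have es: "ee (q + s) = ee (i + s)" if "eqd (2 * r - 2) q i" "s + 2 <= r" for q
  using that(1)[unfolded eqd_def, rule_format, of "2 * s"] tk_e[of s] s that(2) by simp
 \<comment> \<open>If \<open>p1\<close> and \<open>p2\<close> overlap, the true border start
   \<open>p0\<close>, shifted by the same distance \<open>s\<close>, matches with
   \<open>r - s\<close> runs and the same end \<open>j\<close>. This contradicts the minimality of
   \<open>r\<close>.\<close>
 define r' where "r' = r - s"
 have r': "1 <= r'" "r' < r" "p0 + s + r' = j + 1" "j + 1 - r' = p0 + s" using s r by (auto simp: r'_def)
 have c0: "Cn (p0 + s) = Cn i" using cs[OF E0] cs[OF E1(1)] c2 s by simp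
 have "act i (p0 + s) r' & (r' = 1 \<or> e i <= e (p0 + s))"
 proof (cases "r' = 1")
  case True
  then show ?thesis using c0 r' r by (simp add: act_def eqd_def)
 next
  case False
  then have s2: "s + 2 <= r" using r' by (simp add: r'_def)
  have d2: "2 * r' - 2 + 2 * s = 2 * r - 2" using r' s s2 by (simp add: r'_def)
  \<comment> \<open>The comparison runs from \<open>p0 + s\<close> through \<open>p0\<close>,
    \<open>i\<close> and \<open>p1\<close> to \<open>p2 = p1 + s\<close>, and from there back to
    \<open>i\<close>, without the shift.\<close>
  have tq: "tk (p0 + s) d = tk i d" if d: "d < 2 * r' - 2" for d
  proof (cases "d = 0")
   case False
   have dd: "d + 2 * s < 2 * r - 2" "d < 2 * r - 2" using d d2 by auto
   have "tk (p0 + s) d = tk p0 (d + 2 * s)" using False by (intro tk_shift) simp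
   also have "\<dots> = tk i (d + 2 * s)" using E0 dd unfolding eqd_def by simp
   also have "\<dots> = tk p1 (d + 2 * s)" using E1(1) dd unfolding eqd_def by simp
   also have "\<dots> = tk p2 d" using False unfolding s(3) by (intro tk_shift[symmetric]) simp
   also have "\<dots> = tk i d" using E2(1) dd unfolding eqd_def by simp
   finally show ?thesis .
  qed (use c0 in simp)
  have pos: "1 <= 2 * r' - 2" "2 * r' - 2 < 2 * r - 2" using False r' s by (auto simp: r'_def)
  have "tk (p0 + s) (2 * r' - 2) = tk p0 (2 * r - 2)" using tk_shift[OF pos(1), of p0 s] d2 by simp
  also have "\<dots> <= tk p1 (2 * r - 2)" by (rule E1)
  also have "\<dots> = tk p2 (2 * r' - 2)" using tk_shift[OF pos(1), of p1 s] d2 s by simp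
  also have "\<dots> = tk i (2 * r' - 2)" using E2(1) pos unfolding eqd_def by simp
  finally have last: "tk (p0 + s) (2 * r' - 2) <= tk i (2 * r' - 2)" .
  have "ee (p0 + s) = ee p2" using es[OF E0 s2] es[OF E1(1) s2] s by simp
  then have "e i <= ee (p0 + s)" using E2 by simp
  moreover have "p0 + s < m" using r' r by simp
  ultimately show ?thesis using tq last r' r False by (simp add: act_def eqd_def ee_def)
 qed
 then have "match i (p0 + s) r'" using act_iff_match[of i "p0 + s" r'] i r' r by simp
 then show False using mn[of r'] r' by simp
qed

text \<open>Let \<open>y\<close> be the rank of the shortest border. By the sandwich property every
  rank between \<open>x\<close> and \<open>y\<close> shares the tokens of the border, so those with
  first exponent at least \<open>e i\<close> are subject to \<open>good_sparse\<close> and there are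
  few of them. A walk from \<open>x\<close> that skips smaller exponents thus reaches
  \<open>y\<close> within \<open>k\<close> hits.\<close>

lemma long_visited:
 assumes x: "x < m" and i: "i = ORD x" and j: "i < j" "j < m" and b: "bord i j"
  and short: "!!r. 1 <= r ==> r <= k ==> r + i <= j ==> \<not> match i (j + 1 - r) r"
 shows "EX y<m. i < ORD y & ORD y <= j & match i (ORD y) (j + 1 - ORD y) & e i <= e (ORD y) &
  (x < y & card {z. x < z & z < y & e i <= e (ORD z)} < k \<or> y < x & card {z. y < z & z < x & e i <= e (ORD z)} < k)"
proof -
 let ?P = "%r. 1 <= r & r + i <= j & match i (j + 1 - r) r"
 define r where "r = (LEAST r. ?P r)"
 have P: "?P r" unfolding r_def by (rule LeastI_ex) (use b in "simp add: bord_def")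
 have mn: "\<not> match i (j + 1 - r') r'" if "1 <= r'" "r' < r" for r'
  using not_less_Least[of r' ?P] that P unfolding r_def by auto
 have rk: "k < r" using short[of r] P by (meson not_le)
 then have r2: "2 <= r" using k_pos by simp
 define p0 where "p0 = j + 1 - r"
 have p0: "p0 + r = j + 1" "i < p0" "p0 <= j" "p0 < m" "j + 1 - p0 = r" using P j by (auto simp: p0_def)
 have mt: "match i p0 r" using P by (simp add: p0_def)
 then have act: "act i p0 r" and e0: "e i <= e p0" using act_iff_match[of i p0 r] p0 P j r2 by auto
 then have E0: "eqd (2 * r - 2) p0 i" "tk p0 (2 * r - 2) <= tk i (2 * r - 2)" using r2 by (auto simp: act_def)
 have im: "i < m" using j by simp
 obtain y where y: "y < m" "ORD y = p0" using ORD_surj p0 by blast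
 have yx: "y ~= x" using y i p0 by auto
 \<comment> \<open>Together with the starts of ranks \<open>x\<close> and \<open>y\<close>, the
   starts in \<open>Z\<close> are pairwise at least \<open>r\<close> runs apart, so there are at
   most \<open>m div r + 1\<close> of them. This is at most \<open>k + 1\<close>, because
   \<open>r > k\<close> and \<open>m <= k * k\<close>.\<close>
 have key: "card Z < k" if Z: "finite Z" "!!z. z \<in> Z ==> z < m & z ~= x & z ~= y & e i <= e (ORD z) &
   eqd (2 * r - 2) (ORD z) i & tk p0 (2 * r - 2) <= tk (ORD z) (2 * r - 2)" for Z
 proof (rule ccontr)
  assume "\<not> card Z < k"
  let ?Q = "ORD ` insert x (insert y Z)"
  have ins: "insert x (insert y Z) \<subseteq> {..<m}" using Z x y by auto
  have "card ?Q = card (insert x (insert y Z))"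
   using ins ORD_inj by (intro card_image) (auto simp: inj_on_def)
  also have "\<dots> = card Z + 2" using Z yx by (subst card_insert_disjoint, auto)+
  finally have cQ: "k + 2 <= card ?Q" using \<open>\<not> card Z < k\<close> by simp
  have good: "eqd (2 * r - 2) q i & e i <= ee q & tk p0 (2 * r - 2) <= tk q (2 * r - 2)" if "q \<in> ?Q" for q
   using that Z i y E0 e0 p0 im ORD_lt by (auto simp: ee_def)
  have "card ?Q <= m div r + 1"
  proof (rule card_sparse)
   show "?Q \<subseteq> {..<m}" using ins ORD_lt by auto
   fix p q assume "p \<in> ?Q" "q \<in> ?Q" "p < q"
   then show "p + r <= q" using good_sparse[OF p0(2) r2 p0(1) j(2) mn E0(1)] good by blast
  qed (use P in auto)
  moreover have "m div r <= k"
  proof -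
   have "m div r <= k * k div r" using k_sq by (rule div_le_mono)
   also have "\<dots> <= k * r div r" using rk by (intro div_le_mono mult_le_mono) auto
   finally show ?thesis using r2 by simp
  qed
  ultimately show False using cQ by simp
 qed
 show ?thesis
 proof (cases "x < y")
  case True
  have "card {z. x < z & z < y & e i <= e (ORD z)} < k"
  proof (rule key)
   fix z assume z: "z \<in> {z. x < z & z < y & e i <= e (ORD z)}"
   then have l: "lexless i (ORD z)" "lexless (ORD z) p0" using ORD_lex[of x z] ORD_lex[of z y] y i by auto
   then have E: "eqd (2 * r - 2) i (ORD z)" using lex_sandwich E0(1) eqd_sym by blast
   then have "tk i (2 * r - 2) <= tk (ORD z) (2 * r - 2)" using lex_le l by blast
   then show "z < m & z ~= x & z ~= y & e i <= e (ORD z) & eqd (2 * r - 2) (ORD z) i & tk p0 (2 * r - 2) <= tk (ORD z) (2 * r - 2)"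
    using z E E0 eqd_sym y by auto
  qed simp
  then show ?thesis using True y p0 mt e0 by (intro exI[of _ y]) simp
 next
  case False
  then have yx: "y < x" using yx by simp
  have "card {z. y < z & z < x & e i <= e (ORD z)} < k"
  proof (rule key)
   fix z assume z: "z \<in> {z. y < z & z < x & e i <= e (ORD z)}"
   then have l: "lexless p0 (ORD z)" "lexless (ORD z) i" using ORD_lex[of y z] ORD_lex[of z x] y i x by auto
   then have E: "eqd (2 * r - 2) p0 (ORD z)" "eqd (2 * r - 2) (ORD z) i" using lex_sandwich E0(1) by blast+
   then have "tk p0 (2 * r - 2) <= tk (ORD z) (2 * r - 2)" using lex_le l by blast
   then show "z < m & z ~= x & z ~= y & e i <= e (ORD z) & eqd (2 * r - 2) (ORD z) i & tk p0 (2 * r - 2) <= tk (ORD z) (2 * r - 2)"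
    using z E x by auto
  qed simp
  then show ?thesis using yx y p0 mt e0 by (intro exI[of _ y]) simp
 qed
qed

end

section \<open>The program\<close>

text \<open>
 Arrays: 0 input, 1 sort keys, 2 names of letters, 3 order, 4 names, 5 segment tree, 6 to 8 undo log, 9 names of
 blocks of length \<open>2 ^ t\<close>, 10 maxima of exponents over \<open>2 ^ t\<close> ranks, 11 token agreement of neighbouring ranks,
 12 positions, 13 output.
 Registers: 0 \<open>m\<close>, 1 \<open>N\<close>, 2 \<open>h\<close>, 3 \<open>k\<close>, 4 \<open>n\<close>, 5 the largest word, 6 the length of the log; the remaining ones are local.
\<close>

abbreviation Plus :: "ex => ex => ex" where "Plus \<equiv> Op Add"
abbreviation Minus :: "ex => ex => ex" where "Minus \<equiv> Op Sub"
abbreviation Times :: "ex => ex => ex" where "Times \<equiv> Op Mul"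
abbreviation Half :: "ex => ex" where "Half a \<equiv> Op Div a (Num 2)"
abbreviation Twice :: "ex => ex" where "Twice a \<equiv> Op Mul (Num 2) a"
abbreviation inc :: "nat => stm" where "inc r \<equiv> r ::= Plus (Var r) (Num 1)"

declare One_nat_def [simp del] add_2_eq_Suc [simp del] add_2_eq_Suc' [simp del]

section \<open>Raising nodes and intervals of the segment tree\<close>

definition LW :: stm where
 "LW = Ite (Lt (Ar 5 (Var 7)) (Var 8))
  (Sto 6 (Var 6) (Var 9) ;; Sto 7 (Var 6) (Var 7) ;; Sto 8 (Var 6) (Ar 5 (Var 7)) ;; Sto 5 (Var 7) (Var 8) ;; inc 6) Nop"

definition RNB :: stm where
 "RNB = 10 ::= Half (Var 10) ;; 7 ::= Var 10 ;;
  Ite (Lt (Ar 5 (Plus (Twice (Var 10)) (Num 1))) (Ar 5 (Twice (Var 10))))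
   (8 ::= Ar 5 (Plus (Twice (Var 10)) (Num 1))) (8 ::= Ar 5 (Twice (Var 10))) ;;
  LW"

definition RN :: stm where
 "RN = 7 ::= Var 10 ;; 8 ::= Var 11 ;; LW ;; Wh (Lt (Num 1) (Var 10)) RNB"

definition RRl :: stm where
 "RRl = Ite (Eq (Op Mod (Var 12) (Num 2)) (Num 1)) (10 ::= Var 12 ;; 11 ::= Var 14 ;; RN ;; inc 12) Nop"

definition RRr :: stm where
 "RRr = Ite (Eq (Op Mod (Var 13) (Num 2)) (Num 1))
  (13 ::= Minus (Var 13) (Num 1) ;; 10 ::= Var 13 ;; 11 ::= Var 14 ;; RN) Nop"

definition RRB :: stm where
 "RRB = Ite (Lt (Var 12) (Var 13)) (RRl ;; RRr) Nop ;; 12 ::= Half (Var 12) ;; 13 ::= Half (Var 13) ;; inc 15"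

definition RR :: stm where
 "RR = 12 ::= Plus (Var 12) (Var 1) ;; 13 ::= Plus (Var 13) (Var 1) ;; 15 ::= Num 0 ;;
  Wh (Lt (Var 15) (Plus (Var 2) (Num 1))) RRB"

definition FIND :: stm where
 "FIND = 17 ::= Num 1 ;;
  Wh (Lt (Var 17) (Var 1))
   (Ite (Lt (Ar 5 (Plus (Twice (Var 17)) (Num 1))) (Var 16))
     (17 ::= Plus (Twice (Var 17)) (Num 1)) (17 ::= Twice (Var 17))) ;;
  17 ::= Minus (Var 17) (Var 1)"

text \<open>The dummy entry with request 0 is never popped, so the top of the log can be inspected
  without a test for emptiness. The padding leaves from \<open>m\<close> on receive the largest word
  and are never returned by a search.\<close>

definition INIT :: stm where
 "INIT = 18 ::= Num 0 ;; Wh (Lt (Var 18) (Twice (Var 1))) (Sto 5 (Var 18) (Num 0) ;; inc 18) ;;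
  6 ::= Num 1 ;; Sto 6 (Num 0) (Num 0) ;; Sto 7 (Num 0) (Num 0) ;; Sto 8 (Num 0) (Num 0) ;;
  9 ::= Num 0 ;; 12 ::= Var 0 ;; 13 ::= Var 1 ;; 14 ::= Var 5 ;; RR"

text \<open>The two last assumptions make room for all addresses and for the products of two numbers
  of the order of \<open>n\<close>, so that no operation overflows. The capacity \<open>LG\<close>
  has to cover the initialisation, all unbordered candidates of one start and its two walks.\<close>

locale prog = machine w S base len + segtree h N
 for w S :: nat and base len :: "nat => nat" and h N :: nat +
 fixes m n k LG :: nat
 assumes lens: "len 0 = 2 * m" "len 1 = m" "len 2 = m + 1" "len 3 = 2 * m" "len 4 = m" "len 5 = 2 * N"
   "len 6 = LG" "len 7 = LG" "len 8 = LG" "len 9 = (h + 1) * (2 * N)" "len 10 = (h + 1) * (2 * m)"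
   "len 11 = m + 1" "len 12 = m + 1" "len 13 = 2 * m"
  and mN: "m <= N" "N <= 2 * m" and m2: "2 <= m" and k1: "1 <= k" "k <= m" "m <= k * k" and mn: "m <= n"
  and LG: "LG = 32 * (h + 2) * (h + 2) * (m + 2)" and S_less: "S < 2 ^ w" and big: "64 * (n + 2) * (n + 2) <= 2 ^ w"
begin

definition env :: "regs => bool" where
 "env R <-> R 0 = m & R 1 = N & R 2 = h & R 3 = k & R 4 = n & R 5 = 2 ^ w - 1"

text \<open>The list has its newest entry in front, whereas the arrays grow at the end; hence
  \<open>rev\<close>.\<close>

definition logr :: "regs => arrs => (nat \<times> nat \<times> nat) list => bool" where
 "logr R A L <-> R 6 = length L & (ALL z<length L. rev L ! z = (A 6 z, A 7 z, A 8 z))"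

abbreviation hp :: "(nat => nat) => bool" where
 "hp V \<equiv> ALL v. 1 <= v & v < N --> heap_at V v"

lemma LG_less: "LG < 2 ^ w"
proof -
 have "LG <= S" using base_len[of 6] lens by (cases "LG = 0") auto
 then show ?thesis using S_less by simp
qed

lemma lin_bound: "x <= 64 * (n + 2) ==> x < 2 ^ w"
proof -
 assume "x <= 64 * (n + 2)"
 also have "64 * (n + 2) < 64 * (n + 2) * (n + 2)" by simp
 also have "\<dots> <= 2 ^ w" by (rule big)
 finally show ?thesis .
qed

lemma h_less: "h < N"
 by (simp add: N_def)

lemma small [simp]: "0 < (2::nat) ^ w" "1 < (2::nat) ^ w" "Suc 0 < 2 ^ w" "2 < (2::nat) ^ w"
 using lin_bound[of 0] lin_bound[of 1] lin_bound[of 2] by (auto simp: One_nat_def)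

lemmas runs_intros = runs_Sq runs_Asg runs_Sto runs_Ite runs_Nop

lemma LW:
 assumes "R 7 = v" "R 8 = x" "R 9 = g" "v < 2 * N" "logr R A L" "length L < LG"
 shows "runs LW R A (%t R' A'. t <= 30 & A' 5 = lw (A 5) v x &
  (EX L'. logr R' A' L' & ext g (A 5) L (A' 5) L' 1 & (x <= A 5 v --> L' = L)) &
  (ALL y. y ~= 6 --> R' y = R y) & sm {5, 6, 7, 8} A' A)"
proof (cases "A 5 v < x")
 case True
 let ?L = "(g, v, A 5 v) # L"
 have 6: "R 6 = length L" using assms by (simp add: logr_def)
 have "logr (R(6 := length L + 1)) (A(6 := (A 6)(length L := g), 7 := (A 7)(length L := v), 8 := (A 8)(length L := A 5 v), 5 := (A 5)(v := x))) ?L"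
  using assms(5) by (auto simp: logr_def nth_append less_Suc_eq)
 moreover have "ext g (A 5) L ((A 5)(v := x)) ?L 1" by (rule ext_one) (use assms in simp_all)
 ultimately show ?thesis
  unfolding LW_def using True assms 6 LG_less
  by (intro runs_intros) (auto simp: lens lw_def intro!: exI[of _ ?L])
next
 case False
 then show ?thesis unfolding LW_def using assms
  by (intro runs_intros) (auto simp: lens lw_def intro!: exI[of _ L] ext_refl)
qed

lemma N_small: "2 * N + 2 < 2 ^ w"
 using mN mn by (intro lin_bound) simp

text \<open>The common interface of all raise operations. It mentions leaves instead of nodes, and
  it composes: the sets of leaves are united and the bounds on the log are added.\<close>

definition raised :: "nat => nat => nat set => nat => arrs => (nat \<times> nat \<times> nat) list => regs => arrs => (nat \<times> nat \<times> nat) list => bool" where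
 "raised g x U B A L R' A' L' <-> hp (A' 5) & (ALL y j. blk (A' 5) y j <-> blk (A 5) y j \<or> j \<in> U & y <= x) &
  logr R' A' L' & ext g (A 5) L (A' 5) L' B & sm {5, 6, 7, 8} A' A"

lemma raised_refl: "hp (A 5) ==> logr R A L ==> raised g x {} 0 A L R A L"
 unfolding raised_def using ext_refl by auto

lemma raised_trans:
 "raised g x U B A L R1 A1 L1 ==> raised g x U' B' A1 L1 R2 A2 L2 ==> raised g x (U \<union> U') (B + B') A L R2 A2 L2"
 unfolding raised_def using ext_trans by auto

lemma raised_regs: "raised g x U B A L R A' L' ==> R' 6 = R 6 ==> raised g x U B A L R' A' L'"
 unfolding raised_def logr_def by simp

lemma raised_mono: "raised g x U B A L R A' L' ==> B <= B' ==> raised g x U B' A L R A' L'"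
 using ext_mono[of g "A 5" L "A' 5" L' B B'] by (simp add: raised_def)

lemma raised_length: "raised g x U B A L R A' L' ==> length L' <= length L + B"
 unfolding raised_def using ext_length by blast

lemma RN:
 assumes r: "R 10 = v" "R 11 = x" "R 9 = g" and v: "1 <= v" "v < 2 * N"
  and L: "logr R A L" "length L + (h + 1) <= LG" and hp: "hp (A 5)"
 shows "runs RN R A (%t R' A'. t <= 90 * (h + 1) &
  (EX L'. raised g x {j. anc v j} (h + 1) A L R' A' L' & (x <= A 5 v --> L' = L & A' 5 = A 5)) &
  sm {6, 7, 8, 10} R' R)"
proof -
 \<comment> \<open>\<open>d\<close> is the depth of \<open>v\<close>, hence the number of steps to
   the root.\<close>
 obtain d where "2 ^ d <= v" "v < 2 ^ (d + 1)" using ex_power_ivl1[of 2 v] v by auto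
 then have d: "2 ^ d <= v" "v < 2 * 2 ^ d" by (simp_all add: power_add)
 have "(2::nat) ^ d < 2 ^ Suc h" using d v N_def by simp
 then have "d < Suc h" by (rule power_less_imp_less_exp[rotated]) simp
 then have dh: "d <= h" by simp
 define I where "I = (%z R1 A1. R1 10 = v div 2 ^ z & heap_but (A1 5) (v div 2 ^ z) &
  (ALL y j. blk (A1 5) y j <-> blk (A 5) y j \<or> anc v j & y <= x) &
  (EX L'. logr R1 A1 L' & ext g (A 5) L (A1 5) L' (Suc z) & (x <= A 5 v --> L' = L & A1 5 = A 5)) &
  sm {6, 7, 8, 10} R1 R & sm {5, 6, 7, 8} A1 A)"
 let ?c = "Lt (Num 1) (Var 10)"
 have loop: "runs (Wh ?c RNB) R1 A1 (%t R' A'. t <= d * (70 + xk ?c + 1) + xk ?c + 1 & I d R' A')"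
  if I0: "I 0 R1 A1" for R1 A1
 proof (rule runs_For)
  show "I 0 R1 A1" by (rule I0)
 next
  fix z R1 A1 assume z: "z < d" and i: "I z R1 A1"
  let ?u = "v div 2 ^ z"
  have "2 ^ Suc z <= v" using z d(1) by (meson Suc_leI le_trans one_le_numeral power_increasing)
  then have u: "1 < ?u" using div_le_mono[of "2 ^ Suc z" v "2 ^ z"] by simp
  have u2: "?u div 2 = v div 2 ^ Suc z" by (metis div_mult2_eq power_Suc2)
  have uN: "1 <= ?u div 2" "?u div 2 < N" using u v(2) div_le_dividend[of v "2 ^ z"] by linarith+
  obtain L1 where L1: "logr R1 A1 L1" "ext g (A 5) L (A1 5) L1 (Suc z)" "x <= A 5 v --> L1 = L & A1 5 = A 5"
   using i unfolding I_def by blast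
  have r1: "R1 10 = ?u" "R1 9 = g" using i r unfolding I_def by auto
  have len1: "length L1 < LG" using ext_length[OF L1(2)] z dh L by simp
  define mi where "mi = min (A1 5 (2 * (?u div 2))) (A1 5 (2 * (?u div 2) + 1))"
  have hb: "heap_but (A1 5) ?u" using i unfolding I_def by blast
  have next_I: "I (Suc z) R' A'" if lw: "A' 5 = lw (A1 5) (?u div 2) mi"
   "EX L'. logr R' A' L' & ext g (A1 5) L1 (A' 5) L' 1 & (mi <= A1 5 (?u div 2) --> L' = L1)"
   "R' 10 = ?u div 2" "sm {6, 7, 8, 10} R' R1" "sm {5, 6, 7, 8} A' A1" for R' A'
  proof -
   obtain L' where L': "logr R' A' L'" "ext g (A1 5) L1 (A' 5) L' 1" "mi <= A1 5 (?u div 2) --> L' = L1" using lw(2) by blast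
   have "heap_but (A' 5) (v div 2 ^ Suc z)" using heap_but_pull[OF hb u] lw(1) u2 mi_def by simp
   moreover have "blk (A' 5) y j <-> blk (A 5) y j \<or> anc v j & y <= x" for y j
    using i blk_pull[OF uN(2), of "A1 5" y j] unfolding I_def lw(1) mi_def by blast
   moreover have "ext g (A 5) L (A' 5) L' (Suc (Suc z))" using ext_trans[OF L1(2) L'(2)] by (simp add: One_nat_def)
   moreover have "x <= A 5 v --> L' = L & A' 5 = A 5"
   proof
    assume "x <= A 5 v"
    then have e: "L1 = L" "A1 5 = A 5" using L1(3) by auto
    then have "mi <= A1 5 (?u div 2)" using hp uN unfolding mi_def heap_at_def by simp
    then show "L' = L & A' 5 = A 5" using L'(3) e lw(1) by (simp add: lw_def)
   qed
   ultimately show ?thesis using i L'(1) lw(3-5) u2 unfolding I_def by auto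
  qed
  have "runs RNB R1 A1 (%t R' A'. t <= 70 & I (Suc z) R' A')"
   unfolding RNB_def
   apply (intro runs_Sq runs_Asg runs_Ite)
   using r1 uN N_small
        apply (simp_all add: lens)
   apply (rule runs_mono[OF LW[where v = "?u div 2" and x = mi and g = g and L = L1]])
      apply (use uN L1(1) len1 in "simp_all add: mi_def min_def logr_def")[6]
   apply (elim conjE, intro conjI, simp, rule next_I, assumption, assumption)
    apply (simp_all add: r1)[3]
   apply (rule runs_mono[OF LW[where v = "?u div 2" and x = mi and g = g and L = L1]])
      apply (use uN L1(1) len1 in "simp_all add: mi_def min_def logr_def")[6]
   apply (elim conjE, intro conjI, simp, rule next_I, assumption, assumption)
    apply (simp_all add: r1)[3]
   done
  then show "okc R1 A1 ?c & holds R1 A1 ?c & runs RNB R1 A1 (%t R' A'. t <= 70 & I (Suc z) R' A')"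
   using r1 u by simp
 next
  fix R1 A1 assume "I d R1 A1"
  moreover have "v div 2 ^ d = 1" using d by (intro div_nat_eqI) auto
  ultimately show "okc R1 A1 ?c & \<not> holds R1 A1 ?c" by (simp add: I_def)
 qed
 have vd: "v div 2 ^ d = 1" using d by (intro div_nat_eqI) auto
 have fin: "EX L'. raised g x {j. anc v j} (h + 1) A L R' A' L' & (x <= A 5 v --> L' = L & A' 5 = A 5)" if i: "I d R' A'" for R' A'
 proof -
  obtain L' where L': "logr R' A' L'" "ext g (A 5) L (A' 5) L' (Suc d)" "x <= A 5 v --> L' = L & A' 5 = A 5"
   using i unfolding I_def by blast
  have "ext g (A 5) L (A' 5) L' (h + 1)" using ext_mono[OF L'(2)] dh by simp
  moreover have "hp (A' 5)" using i heap_but_1 unfolding I_def vd by blast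
  ultimately show ?thesis using i L' unfolding raised_def I_def by auto
 qed
 have tm: "d * 73 <= h * 73" using dh by simp
 show ?thesis unfolding RN_def
  apply (intro runs_Sq runs_Asg)
  using r apply (simp_all)
  apply (rule runs_mono[OF LW[where v = v and x = x and g = g and L = L]])
     apply (use v L in "simp_all add: logr_def")[6]
  apply (rule runs_mono[OF loop])
  apply (use heap_but_lw[OF hp] blk_lw[of "A 5" v x] in "auto simp: I_def r lw_def One_nat_def")[1]
  using fin tm apply (auto simp: I_def)
  done
qed

lemma raised_regs_ex: "raised g x U B A L R A' L' ==> R' 6 = R 6 ==> EX L'. raised g x U B A L R' A' L'"
 using raised_regs by blast

lemma RRl:
 assumes r: "R 9 = g" "R 14 = x" "R 12 = l" "1 <= l" "l < 2 * N"
  and L: "logr R A L" "length L + (h + 1) <= LG" and hp: "hp (A 5)"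
 shows "runs RRl R A (%t R' A'. t <= 150 * (h + 1) & R' 12 = (if odd l then l + 1 else l) &
  (EX L'. raised g x {j. odd l & anc l j} (h + 1) A L R' A' L') & sm {6, 7, 8, 10, 11, 12} R' R)"
  (is "runs _ _ _ ?Q")
proof -
 define Q where "Q = ?Q"
 have "runs RRl R A Q"
 proof (cases "odd l")
  case True
  then have o: "l mod 2 = 1" by (simp add: odd_iff_mod_2_eq_one)
  have fin: "runs (inc 12) R' A' (%t'. Q (2 + (2 + (t + t')) + 5))"
   if p: "t <= 90 * (h + 1)" "raised g x {j. anc l j} (h + 1) A L R' A' L'" "ALL y. y ~: {6, 7, 8, 10} --> R' y = (R(10 := l, 11 := x)) y" for t R' A' L'
   by (rule runs_Asg) (use p True N_small r in "auto simp: Q_def intro: raised_regs_ex")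
  show ?thesis unfolding RRl_def
   apply (intro runs_intros)
   using r o apply (simp_all)
   apply (rule runs_mono[OF RN[where v = l and x = x and g = g and L = L]])
      apply (use r L hp in "simp_all add: logr_def")[8]
   apply (elim conjE exE)
   apply (use fin in "simp add: algebra_simps")
   done
 next
  case False
  then have o: "l mod 2 ~= 1" by (simp add: odd_iff_mod_2_eq_one)
  have "raised g x {j. odd l & anc l j} (h + 1) A L R A L"
   using raised_mono[OF raised_refl[OF hp L(1)], of "h + 1" g x] False by simp
  then have "Q 6 R A" unfolding Q_def using r False by auto
  then show ?thesis unfolding RRl_def by (intro runs_intros) (use r o in simp_all)
 qed
 then show ?thesis unfolding Q_def .
qed

lemma RRr:
 assumes r: "R 9 = g" "R 14 = x" "R 13 = l" "1 < l" "l <= 2 * N"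
  and L: "logr R A L" "length L + (h + 1) <= LG" and hp: "hp (A 5)"
 shows "runs RRr R A (%t R' A'. t <= 150 * (h + 1) & R' 13 = (if odd l then l - 1 else l) &
  (EX L'. raised g x {j. odd l & anc (l - 1) j} (h + 1) A L R' A' L') & sm {6, 7, 8, 10, 11, 13} R' R)"
  (is "runs _ _ _ ?Q")
proof -
 define Q where "Q = ?Q"
 have "runs RRr R A Q"
 proof (cases "odd l")
  case True
  then have o: "l mod 2 = 1" by (simp add: odd_iff_mod_2_eq_one)
  have l1: "1 <= l - 1" "l - 1 < 2 * N" using r by auto
  have fin: "Q (t + 13) R' A'"
   if p: "t <= 90 * (h + 1)" "raised g x {j. anc (l - 1) j} (h + 1) A L R' A' L'" "ALL y. y ~: {6, 7, 8, 10} --> R' y = (R(13 := l - 1, 10 := l - 1, 11 := x)) y" for t R' A' L'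
   using p True r by (auto simp: Q_def)
  show ?thesis unfolding RRr_def
   apply (intro runs_intros)
   using r o l1 apply (simp_all)
   apply (rule runs_mono[OF RN[where v = "l - 1" and x = x and g = g and L = L]])
      apply (use r L hp in "simp_all add: logr_def")[8]
   apply (elim conjE exE)
   apply (use fin in "simp add: algebra_simps")
   done
 next
  case False
  then have o: "l mod 2 ~= 1" by (simp add: odd_iff_mod_2_eq_one)
  have "raised g x {j. odd l & anc (l - 1) j} (h + 1) A L R A L"
   using raised_mono[OF raised_refl[OF hp L(1)], of "h + 1" g x] False by simp
  then have "Q 6 R A" unfolding Q_def using r False by auto
  then show ?thesis unfolding RRr_def by (intro runs_intros) (use r o in simp_all)
 qed
 then show ?thesis unfolding Q_def .
qed

lemma RRB:
 assumes r: "R 9 = g" "R 14 = x" "R 12 = l" "R 13 = r" "1 <= l" "r <= 2 * N" "R 15 <= h"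
  and L: "logr R A L" "length L + 2 * (h + 1) <= LG" and hp: "hp (A 5)"
 shows "runs RRB R A (%t R' A'. t <= 350 * (h + 1) & R' 15 = R 15 + 1 &
  R' 12 = (if l < r & odd l then l + 1 else l) div 2 & R' 13 = (if l < r & odd r then r - 1 else r) div 2 &
  (EX L'. raised g x {j. l < r & (odd l & anc l j \<or> odd r & anc (r - 1) j)} (2 * (h + 1)) A L R' A' L') &
  sm {6, 7, 8, 10, 11, 12, 13, 15} R' R)"
  (is "runs _ _ _ ?Q")
proof -
 let ?U = "{j. l < r & (odd l & anc l j \<or> odd r & anc (r - 1) j)}"
 define Q where "Q = ?Q"
 define P where "P = (%t R' A'. t <= 300 * (h + 1) &
  R' 12 = (if l < r & odd l then l + 1 else l) & R' 13 = (if l < r & odd r then r - 1 else r) &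
  (EX L'. raised g x ?U (2 * (h + 1)) A L R' A' L') &
  sm {6, 7, 8, 10, 11, 12, 13} R' R)"
 have hw: "h + 2 < 2 ^ w" using h_less N_small by simp
 have "runs (Ite (Lt (Var 12) (Var 13)) (RRl ;; RRr) Nop) R A (%t. P (t - 3))"
 proof (rule runs_Ite)
  assume "holds R A (Lt (Var 12) (Var 13))"
  then have True: "l < r" using r by simp
  have "runs (RRl ;; RRr) R A P"
  proof (rule runs_SqM'[OF _ RRl[where g = g and x = x and l = l and L = L]], goal_cases)
   case (1 t R1 A1) note a = this
   then obtain L1 where p: "raised g x {j. odd l & anc l j} (h + 1) A L R1 A1 L1" by blast
   show ?case
   proof (rule runs_mono[OF RRr[where L = L1 and g = g and x = x and l = r]])
    fix t' R' A' assume q: "t' <= 150 * (h + 1) & R' 13 = (if odd r then r - 1 else r) &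
     (EX L'. raised g x {j. odd r & anc (r - 1) j} (h + 1) A1 L1 R' A' L') & sm {6, 7, 8, 10, 11, 13} R' R1"
    then obtain L' where "raised g x {j. odd r & anc (r - 1) j} (h + 1) A1 L1 R' A' L'" by blast
    from raised_trans[OF p this] have "raised g x ({j. odd l & anc l j} \<union> {j. odd r & anc (r - 1) j}) (2 * (h + 1)) A L R' A' L'"
     by (rule raised_mono) simp
    moreover have "{j. odd l & anc l j} \<union> {j. odd r & anc (r - 1) j} = ?U" using True by auto
    ultimately have "EX L'. raised g x ?U (2 * (h + 1)) A L R' A' L'" by metis
    then show "P (t + t') R' A'" unfolding P_def using q a True r by auto
   qed (use p r True L raised_length[OF p] a in "auto simp: raised_def")
  qed (use r True L hp in auto)
  then show "runs (RRl ;; RRr) R A (%t. P (t + xk (Lt (Var 12) (Var 13)) + 1 - 3))" by simp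
 next
  assume "\<not> holds R A (Lt (Var 12) (Var 13))"
  then have False: "\<not> l < r" using r by simp
  have "raised g x ?U (2 * (h + 1)) A L R A L"
   using raised_mono[OF raised_refl[OF hp L(1)], of "2 * (h + 1)" g x] False by simp
  then have "P (Suc 0) R A" unfolding P_def using r False by auto
  then show "runs Nop R A (%t. P (t + xk (Lt (Var 12) (Var 13)) + 1 - 3))" by (intro runs_Nop) simp
 qed (use r in simp)
 then have "runs RRB R A Q" unfolding RRB_def
 proof (rule runs_SqM)
  fix t R1 A1 assume p: "P (t - 3) R1 A1"
  then obtain L1 where L1: "raised g x ?U (2 * (h + 1)) A L R1 A1 L1" unfolding P_def by blast
  have r15: "R1 15 = R 15" "t <= 300 * (h + 1) + 3" using p unfolding P_def by auto
  define R2 where "R2 = R1(12 := R1 12 div 2, 13 := R1 13 div 2, 15 := R 15 + 1)"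
  have ex: "EX L'. raised g x ?U (2 * (h + 1)) A L R2 A1 L'" using raised_regs_ex[OF L1, of R2] by (simp add: R2_def)
  have "Q (t + 12) R2 A1" using p r15 ex unfolding P_def Q_def by (auto simp: R2_def)
  then show "runs (12 ::= Half (Var 12) ;; 13 ::= Half (Var 13) ;; inc 15) R1 A1 (%t'. Q (t + t'))"
   by (intro runs_intros) (use r r15 hw in "simp_all add: R2_def")
 qed
 then show ?thesis unfolding Q_def .
qed

lemma RR:
 assumes r: "R 9 = g" "R 14 = x" "R 12 = a" "R 13 = b" "a <= N" "b <= N" "R 1 = N" "R 2 = h"
  and L: "logr R A L" "length L + 2 * (h + 1) * (h + 1) <= LG" and hp: "hp (A 5)"
 shows "runs RR R A (%t R' A'. t <= 400 * (h + 1) * (h + 1) &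
  (EX L' U. raised g x U (2 * (h + 1) * (h + 1)) A L R' A' L' & (ALL j<N. j \<in> U <-> a <= j & j < b)) &
  sm {6, 7, 8, 10, 11, 12, 13, 15} R' R)"
proof -
 \<comment> \<open>At height \<open>z\<close>, a leaf of the interval from \<open>a\<close> to
   \<open>b - 1\<close> has either been raised already or lies below one of the nodes from register
   12 up to register 13, the latter excluded.\<close>
 define I where "I = (%z R1 A1. R1 15 = z & (z <= h --> 2 ^ (h - z) <= R1 12 & R1 13 <= 2 * 2 ^ (h - z)) & (h < z --> R1 13 <= R1 12) &
  (EX L' U. raised g x U (z * (2 * (h + 1))) A L R1 A1 L' &
   (ALL j<N. j \<in> U \<or> (R1 12 <= (N + j) div 2 ^ z & (N + j) div 2 ^ z < R1 13) <-> a <= j & j < b)) &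
  sm {6, 7, 8, 10, 11, 12, 13, 15} R1 R)"
 let ?c = "Lt (Var 15) (Plus (Var 2) (Num 1))"
 have hw: "h + 2 < 2 ^ w" using h_less N_small by simp
 have loop: "runs (Wh ?c RRB) R1 A1 (%t R' A'. t <= Suc h * (350 * (h + 1) + xk ?c + 1) + xk ?c + 1 & I (Suc h) R' A')"
  if I0: "I 0 R1 A1" for R1 A1
 proof (rule runs_For)
  show "I 0 R1 A1" by (rule I0)
 next
  fix z R1 A1 assume z: "z < Suc h" and i: "I z R1 A1"
  define l r where "l = R1 12" and "r = R1 13"
  obtain L1 U where L1: "raised g x U (z * (2 * (h + 1))) A L R1 A1 L1"
   "!!j. j < N ==> j \<in> U \<or> (l <= (N + j) div 2 ^ z & (N + j) div 2 ^ z < r) <-> a <= j & j < b"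
   using i unfolding I_def l_def r_def by blast
  have bd: "2 ^ (h - z) <= l" "r <= 2 * 2 ^ (h - z)" "R1 15 = z" using i z unfolding I_def l_def r_def by auto
  have "(2::nat) ^ (h - z) <= 2 ^ h" by (intro power_increasing) auto
  then have rN: "r <= 2 * N" using bd(2) N_def by linarith
  have "(1::nat) <= 2 ^ (h - z)" by simp
  then have l1: "1 <= l" using bd by linarith
  have "z * (2 * (h + 1)) <= h * (2 * (h + 1))" using z by (intro mult_le_mono1) simp
  moreover have "2 * (h + 1) * (h + 1) = h * (2 * (h + 1)) + 2 * (h + 1)" by (simp add: algebra_simps)
  ultimately have len: "length L1 + 2 * (h + 1) <= LG" using raised_length[OF L1(1)] L(2) by linarith
  define l1 r1 where "l1 = (if l < r & odd l then l + 1 else l)" and "r1 = (if l < r & odd r then r - 1 else r)"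
  have nxt: "I (Suc z) R' A'" if p: "R' 15 = R1 15 + 1" "R' 12 = l1 div 2" "R' 13 = r1 div 2"
   "EX L'. raised g x {j. l < r & (odd l & anc l j \<or> odd r & anc (r - 1) j)} (2 * (h + 1)) A1 L1 R' A' L'"
   "sm {6, 7, 8, 10, 11, 12, 13, 15} R' R1" for R' A'
  proof -
   let ?W = "{j. l < r & (odd l & anc l j \<or> odd r & anc (r - 1) j)}"
   obtain L' where L': "raised g x ?W (2 * (h + 1)) A1 L1 R' A' L'" using p(4) by blast
   have ra: "raised g x (U \<union> ?W) (Suc z * (2 * (h + 1))) A L R' A' L'" by (rule raised_mono[OF raised_trans[OF L1(1) L']]) simp
   \<comment> \<open>The index of a node determines its height; so a node in the index range of
     height \<open>z\<close> that is an ancestor of \<open>j\<close> is the ancestor at this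
     height.\<close>
   have an: "anc v j ==> 2 ^ (h - z) <= v ==> v < 2 * 2 ^ (h - z) ==> j < N ==> v = (N + j) div 2 ^ z" for v j
   proof -
    assume a: "anc v j" "2 ^ (h - z) <= v" "v < 2 * 2 ^ (h - z)" "j < N"
    then obtain t where t: "t <= h" "v = (N + j) div 2 ^ t" unfolding anc_def by blast
    have "2 ^ (h - t) <= v & v < 2 * 2 ^ (h - t)"
    proof
     have "N div 2 ^ t <= v" unfolding t(2) by (intro div_le_mono) simp
     then show "2 ^ (h - t) <= v" using t(1) N_def by (simp add: power_diff)
     have "N = 2 ^ (h - t) * 2 ^ t" using t(1) N_def by (simp add: power_add[symmetric])
     then have "N + j < 2 * 2 ^ (h - t) * 2 ^ t" using a(4) by linarith
     then show "v < 2 * 2 ^ (h - t)" unfolding t(2) by (simp add: less_mult_imp_div_less)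
    qed
    then have "2 ^ (h - t) < (2::nat) ^ Suc (h - z)" "2 ^ (h - z) < (2::nat) ^ Suc (h - t)" using a by auto
    then have "h - t < Suc (h - z)" "h - z < Suc (h - t)" using power_less_imp_less_exp[of "2::nat"] by (metis one_less_numeral_iff semiring_norm(76))+
    then have "t = z" using t z by linarith
    then show ?thesis using t by simp
   qed
   have mem: "j \<in> U \<union> ?W \<or> (R' 12 <= (N + j) div 2 ^ Suc z & (N + j) div 2 ^ Suc z < R' 13) <-> a <= j & j < b" if j: "j < N" for j
   proof -
    let ?u = "(N + j) div 2 ^ z"
    have u2: "(N + j) div 2 ^ Suc z = ?u div 2" by (metis div_mult2_eq power_Suc2)
    have uanc: "anc ?u j" using z unfolding anc_def by (intro exI[of _ z]) simp
    have "l < r ==> odd l ==> anc l j <-> ?u = l" using an[of l j] bd j uanc by auto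
    moreover have "l < r ==> odd r ==> anc (r - 1) j <-> ?u = r - 1" using an[of "r - 1" j] bd j uanc by auto
    ultimately have "j \<in> ?W \<or> (l1 div 2 <= ?u div 2 & ?u div 2 < r1 div 2) <-> l <= ?u & ?u < r"
     using range_up[of l r ?u] unfolding l1_def r1_def by (cases "l < r") auto
    then show ?thesis using L1(2)[OF j] p(2,3) u2 by auto
   qed
   have pw: "(2::nat) ^ (h - z) = 2 * 2 ^ (h - Suc z)" if "Suc z <= h" using that by (metis Suc_diff_le diff_Suc_Suc power_Suc)
   have b1: "2 ^ (h - Suc z) <= R' 12 & R' 13 <= 2 * 2 ^ (h - Suc z)" if "Suc z <= h"
   proof -
    have "l <= l1" "r1 <= r" by (auto simp: l1_def r1_def)
    then have "2 * 2 ^ (h - Suc z) <= l1" "r1 <= 2 * (2 * 2 ^ (h - Suc z))" using pw[OF that] bd by linarith+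
    then show ?thesis unfolding p(2,3) by linarith
   qed
   \<comment> \<open>At the height of the root at most node 1 is left. Its index is odd, so it is
     raised, and the range becomes empty.\<close>
   have b2: "R' 13 <= R' 12" if "h < Suc z"
   proof -
    have "h - z = 0" using that by simp
    then have "1 <= l" "r <= 2" using bd by auto
    then have "l < r ==> l = 1 & r = 2" by linarith
    then show ?thesis using p(2,3) unfolding l1_def r1_def by (cases "l < r") (auto simp: div_le_mono)
   qed
   show ?thesis unfolding I_def
   proof (intro conjI)
    show "R' 15 = Suc z" using p(1) bd(3) by simp
    show "EX L' U. raised g x U (Suc z * (2 * (h + 1))) A L R' A' L' &
     (ALL j<N. j \<in> U \<or> (R' 12 <= (N + j) div 2 ^ Suc z & (N + j) div 2 ^ Suc z < R' 13) <-> a <= j & j < b)"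
     using ra mem by blast
   qed (use b1 b2 p(5) i in "auto simp: I_def")
  qed
  have "runs RRB R1 A1 (%t R' A'. t <= 350 * (h + 1) & I (Suc z) R' A')"
   apply (rule runs_mono[OF RRB[where g = g and x = x and l = l and r = r and L = L1]])
        apply (use i r rN l1 len L1(1) z in "simp_all add: I_def l_def r_def raised_def")[10]
   using nxt unfolding l1_def r1_def by blast
  then show "okc R1 A1 ?c & holds R1 A1 ?c & runs RRB R1 A1 (%t R' A'. t <= 350 * (h + 1) & I (Suc z) R' A')"
   using i z r hw by (auto simp: I_def)
 next
  fix R1 A1 assume "I (Suc h) R1 A1"
  then show "okc R1 A1 ?c & \<not> holds R1 A1 ?c" using r hw by (auto simp: I_def)
 qed
 have fin: "EX L' U. raised g x U (2 * (h + 1) * (h + 1)) A L R' A' L' & (ALL j<N. j \<in> U <-> a <= j & j < b)" if i: "I (Suc h) R' A'" for R' A'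
 proof -
  obtain L' U where "raised g x U (Suc h * (2 * (h + 1))) A L R' A' L'"
   "ALL j<N. j \<in> U \<or> (R' 12 <= (N + j) div 2 ^ Suc h & (N + j) div 2 ^ Suc h < R' 13) <-> a <= j & j < b" "R' 13 <= R' 12"
   using i unfolding I_def by blast
  moreover have "Suc h * (2 * (h + 1)) = 2 * (h + 1) * (h + 1)" by (simp add: algebra_simps)
  ultimately show ?thesis by (metis leD le_less_trans)
 qed
 have I0: "I 0 (R(12 := a + N, 13 := b + N, 15 := 0)) A" (is "I 0 ?R A")
  unfolding I_def
 proof (intro conjI)
  have "raised g x {} (0 * (2 * (h + 1))) A L ?R A L" using raised_regs[OF raised_refl[OF hp L(1)], of ?R g x] by simp
  moreover have "ALL j<N. j \<in> {} \<or> (?R 12 <= (N + j) div 2 ^ 0 & (N + j) div 2 ^ 0 < ?R 13) <-> a <= j & j < b" by auto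
  ultimately show "EX L' U. raised g x U (0 * (2 * (h + 1))) A L ?R A L' &
   (ALL j<N. j \<in> U \<or> (?R 12 <= (N + j) div 2 ^ 0 & (N + j) div 2 ^ 0 < ?R 13) <-> a <= j & j < b)" by blast
 qed (use r N_def in auto)
 define Q where "Q = (%t R' A'. t <= 400 * (h + 1) * (h + 1) &
  (EX L' U. raised g x U (2 * (h + 1) * (h + 1)) A L R' A' L' & (ALL j<N. j \<in> U <-> a <= j & j < b)) &
  sm {6, 7, 8, 10, 11, 12, 13, 15} R' R)"
 have "Q (10 + t) R' A'" if p: "t <= Suc h * (350 * (h + 1) + xk ?c + 1) + xk ?c + 1" "I (Suc h) R' A'" for t R' A'
  using p fin[OF p(2)] unfolding Q_def I_def by (simp add: algebra_simps)
 then have "runs (Wh ?c RRB) (R(12 := a + N, 13 := b + N, 15 := 0)) A (%t. Q (10 + t))"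
  by (intro runs_mono[OF loop[OF I0]]) blast
 then have "runs RR R A Q" unfolding RR_def
  by (intro runs_Sq runs_Asg) (use r N_small in "simp_all add: ac_simps")
 then show ?thesis unfolding Q_def .
qed

end

section \<open>Sorting with the segment tree\<close>

definition EXB :: "nat => stm" where
 "EXB d = 23 ::= Ar 5 (Num 1) ;; 16 ::= Plus (Var 23) (Num 1) ;; FIND ;;
  Ite (Eq (Var 23) (Var 22)) Nop (inc 21 ;; 22 ::= Var 23) ;;
  Sto 3 (Var 20) (Var 17) ;; Sto d (Plus (Var 19) (Var 17)) (Var 21) ;;
  10 ::= Plus (Var 1) (Var 17) ;; 11 ::= Var 5 ;; RN ;; inc 20"

definition INS :: stm where
 "INS = 10 ::= Plus (Var 1) (Var 20) ;; 11 ::= Ar 1 (Var 20) ;; RN ;; inc 20"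

text \<open>A selection sort: the keys are the leaf values, the root value is their minimum, and an
  extracted leaf is raised to the largest word. Equal keys receive equal names. The previous key is
  initialised with the largest word, which is no key, so that the first extraction opens name 1 and
  0 remains free for positions past the end.\<close>

definition SORT :: "nat => stm" where
 "SORT d = INIT ;; 20 ::= Num 0 ;; Wh (Lt (Var 20) (Var 0)) INS ;;
  21 ::= Num 0 ;; 22 ::= Var 5 ;; 20 ::= Num 0 ;; Wh (Lt (Var 20) (Var 0)) (EXB d)"

context prog begin

abbreviation top :: nat where "top \<equiv> 2 ^ w - 1"

lemma FIND:
 assumes r: "R 16 = y" "R 1 = N" and hp: "hp (A 5)" and root: "A 5 1 < y"
 shows "runs FIND R A (%t R' A'. t <= 40 * (h + 1) & A' = A & (ALL x. x ~= 17 --> R' x = R x) &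
  R' 17 < N & \<not> blk (A 5) y (R' 17) & (ALL j<N. R' 17 < j --> blk (A 5) y j))"
  (is "runs _ _ _ ?Q")
proof -
 define Q where "Q = ?Q"
 define I where "I = (%s R1 A1. A1 = A & (ALL x. x ~= 17 --> R1 x = R x) & 2 ^ s <= R1 17 & R1 17 < 2 ^ Suc s &
  (ALL t<=s. A 5 (R1 17 div 2 ^ t) < y) & (ALL j<N. R1 17 < (N + j) div 2 ^ (h - s) --> blk (A 5) y j))"
 let ?c = "Lt (Var 17) (Var 1)"
 let ?b = "Ite (Lt (Ar 5 (Plus (Twice (Var 17)) (Num 1))) (Var 16)) (17 ::= Plus (Twice (Var 17)) (Num 1)) (17 ::= Twice (Var 17))"
 have loop: "runs (Wh ?c ?b) R1 A1 (%t R' A'. t <= h * (20 + xk ?c + 1) + xk ?c + 1 & I h R' A')" if I0: "I 0 R1 A1" for R1 A1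
 proof (rule runs_For)
  show "I 0 R1 A1" by (rule I0)
 next
  fix s R1 A1 assume s: "s < h" and i: "I s R1 A1"
  define v where "v = R1 17"
  have r1: "R1 16 = y" "R1 1 = N" "A1 = A" using i r unfolding I_def by auto
  have "(2::nat) ^ Suc s <= 2 ^ h" using s by (intro power_increasing) auto
  then have vN: "v < N" using i N_def unfolding I_def v_def by (metis less_le_trans)
  define v' where "v' = (if A 5 (2 * v + 1) < y then 2 * v + 1 else 2 * v)"
  have "2 ^ Suc s <= v' & v' < 2 ^ Suc (Suc s) & (ALL t<=Suc s. A 5 (v' div 2 ^ t) < y) &
   (ALL j<N. v' < (N + j) div 2 ^ (h - Suc s) --> blk (A 5) y j)"
   by (rule find_step[OF hp s _ _ _ _ v'_def]) (use i in "auto simp: I_def v_def")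
  then have nxt: "I (Suc s) (R1(17 := v')) A1" using i unfolding I_def by simp
  have "runs ?b R1 A1 (%t R' A'. t <= 20 & I (Suc s) R' A')"
   by (intro runs_intros) (use r1 vN N_small nxt in "simp_all add: lens v_def[symmetric] v'_def")
  then show "okc R1 A1 ?c & holds R1 A1 ?c & runs ?b R1 A1 (%t R' A'. t <= 20 & I (Suc s) R' A')"
   using r1 vN by (simp add: v_def)
 next
  fix R1 A1 assume "I h R1 A1"
  then show "okc R1 A1 ?c & \<not> holds R1 A1 ?c" using r N_def by (simp add: I_def)
 qed
 have I0: "I 0 (R(17 := 1)) A"
 proof -
  have "(N + j) div 2 ^ h = 1" if "j < N" for j using that unfolding N_def by (intro div_nat_eqI) auto
  then show ?thesis using root unfolding I_def by auto
 qed
 have fin: "Q u (R'(17 := R' 17 - N)) A'" if i: "I h R' A'" and u: "u <= h * 23 + 20" for R' A' u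
 proof -
  have "R' 17 - N < N & \<not> blk (A 5) y (R' 17 - N) & (ALL j<N. R' 17 - N < j --> blk (A 5) y j)"
   by (rule find_final) (use i in "auto simp: I_def")
  then show ?thesis using i u unfolding Q_def I_def by auto
 qed
 have "runs (Wh ?c ?b ;; 17 ::= Minus (Var 17) (Var 1)) (R(17 := 1)) A (%t. Q (xc (Num 1) + 1 + t))"
 proof (rule runs_SqM[OF loop[OF I0]])
  fix t R' A' assume a: "t <= h * (20 + xk ?c + 1) + xk ?c + 1 & I h R' A'"
  then have "R' 1 = N" "N <= R' 17" using r N_def by (auto simp: I_def)
  then show "runs (17 ::= Minus (Var 17) (Var 1)) R' A' (%t'. Q (xc (Num 1) + 1 + (t + t')))"
   by (intro runs_Asg) (use a fin[of R' A' "xc (Num 1) + 1 + (t + (xc (Minus (Var 17) (Var 1)) + 1))"] in simp_all)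
 qed
 then have "runs FIND R A Q" unfolding FIND_def by (intro runs_Sq[of "17 ::= Num 1"] runs_Asg) simp_all
 then show ?thesis unfolding Q_def .
qed

lemma LG_ge: "2 * (h + 1) * (h + 1) + 1 + 2 * (m * (h + 1)) + (h + 1) <= LG"
 unfolding LG by (simp add: algebra_simps)

lemma INIT:
 assumes r: "env R"
 shows "runs INIT R A (%t R' A'. t <= 500 * (h + 1) * (h + 1) + 50 * N &
  (EX L'. hp (A' 5) & (ALL j<N. ALL y. blk (A' 5) y j <-> y = 0 \<or> m <= j & y <= top) & logr R' A' L' &
   (ALL e:set L'. fst e = 0 & fst (snd e) < 2 * N) & L' ~= [] & length L' <= 2 * (h + 1) * (h + 1) + 1) & R' 9 = 0 &
  sm {6, 7, 8, 9, 10, 11, 12, 13, 14, 15, 18} R' R & sm {5, 6, 7, 8} A' A)"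
  (is "runs _ _ _ ?Q")
proof -
 define Q where "Q = ?Q"
 have e: "R 0 = m" "R 1 = N" "R 2 = h" "R 5 = top" using r by (auto simp: env_def)
 define I where "I = (%z R1 A1. R1 18 = z & (ALL x. x ~= 18 --> R1 x = R x) & (ALL a. a ~= 5 --> A1 a = A a) & (ALL v<z. A1 5 v = 0))"
 let ?c = "Lt (Var 18) (Twice (Var 1))" and ?b = "Sto 5 (Var 18) (Num 0) ;; inc 18"
 have loop: "runs (Wh ?c ?b) R1 A1 (%t R' A'. t <= 2 * N * (10 + xk ?c + 1) + xk ?c + 1 & I (2 * N) R' A')" if I0: "I 0 R1 A1" for R1 A1
 proof (rule runs_For)
  show "I 0 R1 A1" by (rule I0)
 next
  fix z R1 A1 assume z: "z < 2 * N" and i: "I z R1 A1"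
  have r1: "R1 18 = z" "R1 1 = N" using i e by (auto simp: I_def)
  have "I (Suc z) (R1(18 := z + 1)) (A1(5 := (A1 5)(z := 0)))" using i unfolding I_def by (auto simp: less_Suc_eq)
  then have "runs ?b R1 A1 (%t R' A'. t <= 10 & I (Suc z) R' A')"
   by (intro runs_intros) (use r1 z N_small in "simp_all add: lens")
  then show "okc R1 A1 ?c & holds R1 A1 ?c & runs ?b R1 A1 (%t R' A'. t <= 10 & I (Suc z) R' A')"
   using r1 z N_small by simp
 next
  fix R1 A1 assume "I (2 * N) R1 A1"
  then show "okc R1 A1 ?c & \<not> holds R1 A1 ?c" using e N_small by (simp add: I_def)
 qed
 let ?rest = "6 ::= Num 1 ;; Sto 6 (Num 0) (Num 0) ;; Sto 7 (Num 0) (Num 0) ;; Sto 8 (Num 0) (Num 0) ;;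
  9 ::= Num 0 ;; 12 ::= Var 0 ;; 13 ::= Var 1 ;; 14 ::= Var 5 ;; RR"
 have rest: "runs ?rest R1 A1 (%t'. Q (2 + (t + t')))" if i: "I (2 * N) R1 A1" and t: "t <= 2 * N * 16 + 6" for t R1 A1
 proof -
  define R2 where "R2 = R1(6 := 1, 9 := 0, 12 := m, 13 := N, 14 := top)"
  define A2 where "A2 = A1(6 := (A1 6)(0 := 0), 7 := (A1 7)(0 := 0), 8 := (A1 8)(0 := 0))"
  have z0: "ALL v<2 * N. A2 5 v = 0" using i by (simp add: A2_def I_def)
  have lg: "logr R2 A2 [(0, 0, 0)]" by (simp add: logr_def R2_def A2_def)
  have hp: "hp (A2 5)" using z0 by (simp add: heap_at_def)
  have nd: "(N + j) div 2 ^ t < 2 * N" if "j < N" for j t using that div_le_dividend[of "N + j" "2 ^ t"] by linarith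
  have blk0: "blk (A2 5) y j <-> y = 0" if "j < N" for y j using z0 nd[OF that] unfolding blk_def by auto
  have R2: "R2 9 = 0" "R2 14 = top" "R2 12 = m" "R2 13 = N" "R2 1 = N" "R2 2 = h" using i e by (auto simp: R2_def I_def)
  have LGp: "0 < LG" "1 + 2 * (h + 1) * (h + 1) <= LG" using LG_ge by linarith+
  have "runs RR R2 A2 (%t'. Q (2 + (t + (t' + 22))))"
  proof (rule runs_mono[OF RR[where g = 0 and x = top and a = m and b = N and L = "[(0, 0, 0)]"]])
   fix t' R' A' assume a: "t' <= 400 * (h + 1) * (h + 1) &
    (EX L' U. raised 0 top U (2 * (h + 1) * (h + 1)) A2 [(0, 0, 0)] R' A' L' & (ALL j<N. j \<in> U <-> m <= j & j < N)) &
    sm {6, 7, 8, 10, 11, 12, 13, 15} R' R2"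
   then obtain L' U where L': "raised 0 top U (2 * (h + 1) * (h + 1)) A2 [(0, 0, 0)] R' A' L'" "ALL j<N. j \<in> U <-> m <= j & j < N" by blast
   then obtain K where K: "L' = K @ [(0, 0, 0)]" "ALL x:set K. fst x = 0 & fst (snd x) < 2 * N" "length K <= 2 * (h + 1) * (h + 1)"
    unfolding raised_def ext_def by blast
   have "hp (A' 5)" "logr R' A' L'" "sm {5, 6, 7, 8} A' A2" using L'(1) unfolding raised_def by blast+
   moreover have "blk (A' 5) y j <-> y = 0 \<or> m <= j & y <= top" if "j < N" for j y
    using L' blk0[OF that, of y] that unfolding raised_def by auto
   moreover have "sm {5, 6, 7, 8} A2 A" using i by (auto simp: A2_def I_def)
   moreover have "sm {6, 7, 8, 9, 10, 11, 12, 13, 14, 15, 18} R' R" "R' 9 = 0" using a i by (auto simp: R2_def I_def)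
   moreover have "2 + (t + (t' + 22)) <= 500 * (h + 1) * (h + 1) + 50 * N"
   proof -
    have "1 <= N" "1 <= (h + 1) * (h + 1)" using N_pos by (auto simp: One_nat_def)
    then show ?thesis using a t by (simp add: algebra_simps)
   qed
   moreover have "(ALL e:set L'. fst e = 0 & fst (snd e) < 2 * N) & L' ~= [] & length L' <= 2 * (h + 1) * (h + 1) + 1" using K N_pos by auto
   ultimately show "Q (2 + (t + (t' + 22))) R' A'" unfolding Q_def by (intro conjI exI[of _ L'] allI impI; simp)
  qed (use R2 mN lg hp LGp in auto)
  then show ?thesis
   by (intro runs_Sq runs_Asg runs_Sto) (use i e LGp in "simp_all add: lens R2_def A2_def I_def ac_simps")
 qed
 have I0: "I 0 (R(18 := 0)) A" by (simp add: I_def)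
 have "runs INIT R A Q" unfolding INIT_def
  apply (rule runs_Sq, rule runs_Asg)
   apply simp_all[3]
  apply (rule runs_SqM)
  apply (use loop[OF I0] in simp)
  using rest apply simp
  done
 then show ?thesis unfolding Q_def .
qed

definition nodes :: "(nat => nat) => (nat => nat) => bool" where
 "nodes V f <-> hp V & (ALL j<N. ALL y. blk V y j <-> y <= f j)"

lemma nodes_tr: "nodes V f <-> tr V f"
 by (simp add: nodes_def tr_def)

lemma nodes_raise_leaf:
 assumes "nodes (A 5) f" "raised g x {j. anc (N + i) j} B A L R' A' L'" "i < N"
 shows "nodes (A' 5) (f(i := max (f i) x))"
 using assms anc_leaf unfolding nodes_def raised_def by auto

lemma INS_loop:
 assumes r: "R 0 = m" "R 1 = N" "R 9 = 0" and nd: "nodes (A 5) (%j. if m <= j then top else 0)"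
  and L: "logr R A L" "length L + m * (h + 1) + (h + 1) <= LG"
 shows "runs (Wh (Lt (Var 20) (Var 0)) INS) (R(20 := 0)) A (%t R' A'. t <= m * (150 * (h + 1)) + 3 &
  nodes (A' 5) (%j. if m <= j then top else A 1 j) & (EX L'. logr R' A' L' & length L' <= length L + m * (h + 1)) &
  sm {6, 7, 8, 10, 11, 20} R' R & sm {5, 6, 7, 8} A' A)"
proof -
 define I where "I = (%z R1 A1. R1 20 = z & nodes (A1 5) (%j. if m <= j then top else if j < z then A 1 j else 0) &
  (EX L'. logr R1 A1 L' & length L' <= length L + z * (h + 1)) &
  sm {6, 7, 8, 10, 11, 20} R1 R & sm {5, 6, 7, 8} A1 A)"
 let ?c = "Lt (Var 20) (Var 0)"
 have "runs (Wh ?c INS) (R(20 := 0)) A (%t R' A'. t <= m * (130 * (h + 1) + xk ?c + 1) + xk ?c + 1 & I m R' A')"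
 proof (rule runs_For)
  have "(%j. if m <= j then top else if j < 0 then A 1 j else 0) = (%j. if m <= j then top else 0)" by auto
  then show "I 0 (R(20 := 0)) A" unfolding I_def using nd L(1) by (auto simp: logr_def intro!: exI[of _ L])
 next
  fix z R1 A1 assume z: "z < m" and i: "I z R1 A1"
  obtain L1 where L1: "logr R1 A1 L1" "length L1 <= length L + z * (h + 1)" using i unfolding I_def by blast
  have "z * (h + 1) <= m * (h + 1)" using z by (intro mult_le_mono1) simp
  then have len: "length L1 + (h + 1) <= LG" using L1 L(2) by linarith
  have r1: "R1 20 = z" "R1 0 = m" "R1 1 = N" "R1 9 = 0" "A1 1 = A 1" and nd1: "nodes (A1 5) (%j. if m <= j then top else if j < z then A 1 j else 0)"
   using i r unfolding I_def by auto
  have "runs RN (R1(10 := N + z, 11 := A 1 z)) A1 (%t R' A'. runs (inc 20) R' A' (%t'. (%t R' A'. t <= 130 * (h + 1) & I (Suc z) R' A') (4 + (4 + (t + t')))))"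
  proof (rule runs_mono[OF RN[where v = "N + z" and x = "A 1 z" and g = 0 and L = L1]])
   fix t R' A' assume a: "t <= 90 * (h + 1) & (EX L'. raised 0 (A 1 z) {j. anc (N + z) j} (h + 1) A1 L1 R' A' L' & (A 1 z <= A1 5 (N + z) --> L' = L1 & A' 5 = A1 5)) &
    (ALL y. y ~: {6, 7, 8, 10} --> R' y = (R1(10 := N + z, 11 := A 1 z)) y)"
   then obtain L' where L': "raised 0 (A 1 z) {j. anc (N + z) j} (h + 1) A1 L1 R' A' L'" by blast
   have "nodes (A' 5) ((%j. if m <= j then top else if j < z then A 1 j else 0)(z := max (if m <= z then top else if z < z then A 1 z else 0) (A 1 z)))"
    by (rule nodes_raise_leaf[OF nd1 L']) (use z mN in simp)
   also have "(%j. if m <= j then top else if j < z then A 1 j else 0)(z := max (if m <= z then top else if z < z then A 1 z else 0) (A 1 z)) = (%j. if m <= j then top else if j < Suc z then A 1 j else 0)"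
    using z by (auto simp: less_Suc_eq)
   finally have n2: "nodes (A' 5) (%j. if m <= j then top else if j < Suc z then A 1 j else 0)" .
   have l2: "logr (R'(20 := z + 1)) A' L'" "length L' <= length L + Suc z * (h + 1)" using L' raised_length[OF L'] L1 by (auto simp: raised_def logr_def)
   have "I (Suc z) (R'(20 := z + 1)) A'" unfolding I_def using n2 l2 a i L' unfolding I_def raised_def by (auto intro!: exI[of _ L'])
   then show "runs (inc 20) R' A' (%t'. (%t R' A'. t <= 130 * (h + 1) & I (Suc z) R' A') (4 + (4 + (t + t'))))"
    by (intro runs_Asg) (use a r1 z N_small mN in simp_all)
  qed (use r1 z mN L1 len nd1 in "auto simp: logr_def nodes_def")
  then have "runs INS R1 A1 (%t R' A'. t <= 130 * (h + 1) & I (Suc z) R' A')" unfolding INS_def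
   by (intro runs_Sq runs_Asg) (use r1 z mN N_small in "simp_all add: lens")
  then show "okc R1 A1 ?c & holds R1 A1 ?c & runs INS R1 A1 (%t R' A'. t <= 130 * (h + 1) & I (Suc z) R' A')"
   using r1 z by simp
 next
  fix R1 A1 assume "I m R1 A1"
  then show "okc R1 A1 ?c & \<not> holds R1 A1 ?c" using r by (simp add: I_def)
 qed
 then show ?thesis
 proof (rule runs_mono)
  fix t R' A' assume a: "t <= m * (130 * (h + 1) + xk ?c + 1) + xk ?c + 1 & I m R' A'"
  have "(%j. if m <= j then top else if j < m then A 1 j else 0) = (%j. if m <= j then top else A 1 j)" by auto
  moreover have "m * (130 * (h + 1) + xk ?c + 1) <= m * (150 * (h + 1))" by (intro mult_le_mono2) simp
  moreover have "xk ?c = 2" by simp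
  ultimately have "t <= m * (150 * (h + 1)) + 3" using conjunct1[OF a] by linarith
  moreover have "(%j. if m <= j then top else if j < m then A 1 j else 0) = (%j. if m <= j then top else A 1 j)" by auto
  ultimately show "t <= m * (150 * (h + 1)) + 3 &
   nodes (A' 5) (%j. if m <= j then top else A 1 j) & (EX L'. logr R' A' L' & length L' <= length L + m * (h + 1)) &
   sm {6, 7, 8, 10, 11, 20} R' R & sm {5, 6, 7, 8} A' A"
   using a unfolding I_def by auto
 qed
qed

text \<open>The state after \<open>z\<close> extractions: \<open>D\<close> is the array of names, with offset \<open>off\<close>.\<close>
definition sorted_upto :: "nat => (nat => nat) => (nat => nat) => (nat => nat) => nat => nat => bool" where
 "sorted_upto z K O' D cur prev <-> inj_on O' {..<z} & (ALL x<z. O' x < m) &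
  (ALL x<z. ALL j<m. j ~: O' ` {..<x} --> K (O' x) <= K j) &
  (ALL x<z. ALL y<z. K (O' x) < K (O' y) <-> D (O' x) < D (O' y)) &
  (ALL x<z. 1 <= D (O' x) & D (O' x) <= cur) & cur <= z &
  (if z = 0 then prev = top & cur = 0 else prev = K (O' (z - 1)) & cur = D (O' (z - 1)))"

lemma sorted_upto_step:
 assumes s: "sorted_upto z K O' D cur prev" and z: "z < m" and i: "i < m" "i ~: O' ` {..<z}" "K i < top"
  and mini: "!!j. j < m ==> j ~: O' ` {..<z} ==> K i <= K j"
  and cur': "cur' = (if K i = prev then cur else cur + 1)"
 shows "sorted_upto (Suc z) K (O'(z := i)) (D(i := cur')) cur' (K i)"
proof -
 let ?O = "O'(z := i)" and ?D = "D(i := cur')"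
 have inj: "inj_on O' {..<z}" "!!x. x < z ==> O' x < m" using s unfolding sorted_upto_def by auto
 have mn: "!!x j. x < z ==> j < m ==> j ~: O' ` {..<x} ==> K (O' x) <= K j" using s unfolding sorted_upto_def by blast
 have nm: "!!x y. x < z ==> y < z ==> K (O' x) < K (O' y) <-> D (O' x) < D (O' y)" using s unfolding sorted_upto_def by blast
 have rg: "!!x. x < z ==> 1 <= D (O' x) & D (O' x) <= cur" "cur <= z" using s unfolding sorted_upto_def by auto
 have ne: "O' x ~= i" if "x < z" for x using i(2) that by auto
 have im: "?O ` {..<x} = O' ` {..<x}" if "x <= z" for x using that by (intro image_cong) auto
 have pos: "1 <= cur'"
 proof (cases "z = 0")
  case True
  then show ?thesis using s i(3) cur' unfolding sorted_upto_def by auto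
 next
  case False
  then show ?thesis using rg(1)[of "z - 1"] cur' by auto
 qed
 \<comment> \<open>Keys leave in nondecreasing order, so the key extracted last is the greatest so
   far; comparing with it alone decides whether a new name is due.\<close>
 have last: "K (O' x) < K i <-> D (O' x) < cur'" "\<not> K i < K (O' x)" "D (O' x) <= cur'" if x: "x < z" for x
 proof -
  have p: "prev = K (O' (z - 1))" "cur = D (O' (z - 1))" using s x unfolding sorted_upto_def by auto
  have xi: "K (O' x) <= K i" using mn[OF x i(1)] i(2) x by (auto simp: image_iff)
  have xz: "K (O' x) <= K (O' (z - 1))"
  proof (cases "x = z - 1")
   case False
   have "O' (z - 1) ~: O' ` {..<x}"
   proof
    assume "O' (z - 1) \<in> O' ` {..<x}"
    then obtain x' where "x' < x" "O' (z - 1) = O' x'" by auto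
    then show False using inj_onD[OF inj(1), of "z - 1" x'] x by simp
   qed
   then show ?thesis using mn[OF x, of "O' (z - 1)"] inj(2)[of "z - 1"] x by simp
  qed simp
  have pi: "prev <= K i" using mn[of "z - 1" i] i x p by (auto simp: image_iff)
  show "\<not> K i < K (O' x)" "D (O' x) <= cur'" using xi rg(1)[OF x] cur' by auto
  show "K (O' x) < K i <-> D (O' x) < cur'"
  proof (cases "K i = prev")
   case True
   then show ?thesis using nm[OF x, of "z - 1"] x p cur' by simp
  next
   case False
   then have "K (O' x) < K i" using xz p pi by simp
   then show ?thesis using False rg(1)[OF x] cur' by simp
  qed
 qed
 show ?thesis unfolding sorted_upto_def
 proof (intro conjI allI impI)
  show "inj_on ?O {..<Suc z}"
  proof (rule inj_onI)
   fix x y assume "x \<in> {..<Suc z}" "y \<in> {..<Suc z}" "?O x = ?O y"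
   then show "x = y" using inj_onD[OF inj(1), of x y] ne[of x] ne[of y]
    by (cases "x = z"; cases "y = z") (auto simp: less_Suc_eq)
  qed
  show "?O x < m" if "x < Suc z" for x using inj(2) i that by (auto simp: less_Suc_eq)
  show "K (?O x) <= K j" if "x < Suc z" "j < m" "j ~: ?O ` {..<x}" for x j
   using mn[of x j] mini[of j] that im[of x] by (cases "x = z") auto
  show "K (?O x) < K (?O y) <-> ?D (?O x) < ?D (?O y)" if "x < Suc z" "y < Suc z" for x y
   using that nm[of x y] last[of x] last[of y] ne by (cases "x = z"; cases "y = z") (auto simp: not_less)
  show "1 <= ?D (?O x)" "?D (?O x) <= cur'" if "x < Suc z" for x using that rg(1)[of x] last(3)[of x] pos ne by (cases "x = z"; auto)+
  show "cur' <= Suc z" using rg(2) cur' by auto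
 qed simp
qed

lemma EXB_loop:
 assumes r: "env R" "R 9 = 0" "R 19 = off" and nd: "nodes (A 5) (%j. if m <= j then top else A 1 j)"
  and K: "!!x. x < m ==> A 1 x < top"
  and L: "logr R A L" "length L + m * (h + 1) + (h + 1) <= LG"
  and d: "d < 20" "d ~: {1, 3, 5, 6, 7, 8}" "off + m <= len d"
 shows "runs (Wh (Lt (Var 20) (Var 0)) (EXB d)) (R(21 := 0, 22 := top, 20 := 0)) A (%t R' A'. t <= m * (250 * (h + 1)) + 3 &
  (EX cur prev. sorted_upto m (A 1) (A' 3) (%j. A' d (off + j)) cur prev) &
  (ALL x. \<not> (off <= x & x < off + m) --> A' d x = A d x) &
  sm {6, 7, 8, 10, 11, 16, 17, 20, 21, 22, 23} R' R & sm {3, 5, 6, 7, 8, d} A' A)"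
proof -
 define I where "I = (%z R1 A1. R1 20 = z & sorted_upto z (A 1) (A1 3) (%j. A1 d (off + j)) (R1 21) (R1 22) &
  nodes (A1 5) (%j. if m <= j \<or> j \<in> A1 3 ` {..<z} then top else A 1 j) &
  (EX L'. logr R1 A1 L' & length L' <= length L + z * (h + 1)) &
  (ALL x. \<not> (off <= x & x < off + m) --> A1 d x = A d x) &
  sm {6, 7, 8, 10, 11, 16, 17, 20, 21, 22, 23} R1 R & sm {3, 5, 6, 7, 8, d} A1 A)"
 let ?c = "Lt (Var 20) (Var 0)"
 have e: "R 0 = m" "R 1 = N" "R 5 = top" using r(1) by (auto simp: env_def)
 have off: "off + m < 2 ^ w" using base_len[of d] d m2 S_less by (cases "len d = 0") auto
 have "runs (Wh ?c (EXB d)) (R(21 := 0, 22 := top, 20 := 0)) A (%t R' A'. t <= m * (230 * (h + 1) + xk ?c + 1) + xk ?c + 1 & I m R' A')"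
 proof (rule runs_For)
  have "sorted_upto 0 (A 1) (A 3) (%j. A d (off + j)) 0 top" by (simp add: sorted_upto_def)
  then show "I 0 (R(21 := 0, 22 := top, 20 := 0)) A" unfolding I_def using nd L(1) by (auto simp: logr_def intro!: exI[of _ L])
 next
  fix z R1 A1 assume z: "z < m" and i: "I z R1 A1"
  obtain L1 where L1: "logr R1 A1 L1" "length L1 <= length L + z * (h + 1)" using i unfolding I_def by blast
  have "z * (h + 1) <= m * (h + 1)" using z by (intro mult_le_mono1) simp
  then have len: "length L1 + (h + 1) <= LG" using L1 L(2) by linarith
  define O1 where "O1 = A1 3"
  define f where "f = (%j. if m <= j \<or> j \<in> O1 ` {..<z} then top else A 1 j)"
  have r1: "R1 20 = z" "R1 0 = m" "R1 1 = N" "R1 9 = 0" "R1 5 = top" "R1 19 = off"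
   and so: "sorted_upto z (A 1) O1 (%j. A1 d (off + j)) (R1 21) (R1 22)" and nd1: "nodes (A1 5) f"
   using i r e unfolding I_def O1_def f_def by auto
  have hp1: "hp (A1 5)" using nd1 by (simp add: nodes_def)
  \<comment> \<open>The root value is a lower bound for all leaves, so a leaf below the root value
    plus 1 attains the minimum. This turns \<open>FIND\<close> into an extraction of the
    minimum.\<close>
  have low: "A1 5 1 <= f j" if "j < N" for j using root_le[OF that, of "A1 5 1" "A1 5"] nd1 that by (simp add: nodes_def)
  \<comment> \<open>An index that is not yet extracted keeps the root value below
    \<open>top\<close>. Hence adding 1 does not overflow, and the leaf found is neither padding nor
    used up.\<close>
  have "card (O1 ` {..<z}) < card {..<m}" using card_image_le[of "{..<z}" O1] z by simp
  then have "\<not> {..<m} \<subseteq> O1 ` {..<z}" using card_mono[of "O1 ` {..<z}" "{..<m}"] by auto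
  then obtain jr where jr: "jr < m" "jr ~: O1 ` {..<z}" by auto
  then have y0: "A1 5 1 < top" using low[of jr] K[of jr] mN by (simp add: f_def)
  have c21: "R1 21 <= z" using so by (simp add: sorted_upto_def)
  have zw: "z + 1 < 2 ^ w" using z mN N_small by simp
  let ?y = "A1 5 1"
  let ?cont = "Ite (Eq (Var 23) (Var 22)) Nop (inc 21 ;; 22 ::= Var 23) ;;
   Sto 3 (Var 20) (Var 17) ;; Sto d (Plus (Var 19) (Var 17)) (Var 21) ;;
   10 ::= Plus (Var 1) (Var 17) ;; 11 ::= Var 5 ;; RN ;; inc 20"
  define Q where "Q = (%t R' A'. t <= 230 * (h + 1) & I (Suc z) R' A')"
  have "runs FIND (R1(23 := ?y, 16 := ?y + 1)) A1 (%t R' A'. runs ?cont R' A' (%t'. Q (4 + (4 + (t + t')))))"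
  proof (rule runs_mono'[OF _ FIND[where y = "?y + 1"]], goal_cases)
   case (1 t R2 A2) note a = this
   define i0 where "i0 = R2 17"
   have "\<not> ?y + 1 <= f i0" "i0 < N" using a nd1 by (auto simp: nodes_def i0_def)
   then have "f i0 = ?y" using low[of i0] by simp
   then have i0: "i0 < m" "i0 ~: O1 ` {..<z}" "A 1 i0 = ?y" using y0 by (auto simp: f_def split: if_splits)
   have mini: "A 1 i0 <= A 1 j" if "j < m" "j ~: O1 ` {..<z}" for j using low[of j] that i0 mN by (simp add: f_def)
   define cur' where "cur' = (if A 1 i0 = R1 22 then R1 21 else R1 21 + 1)"
   have so': "sorted_upto (Suc z) (A 1) (O1(z := i0)) ((%j. A1 d (off + j))(i0 := cur')) cur' (A 1 i0)"
    by (rule sorted_upto_step[OF so z i0(1,2) K[OF i0(1)] mini cur'_def])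
   define A3 where "A3 = A1(3 := O1(z := i0), d := (A1 d)(off + i0 := cur'))"
   define R3 where "R3 = R2(21 := cur', 22 := ?y, 10 := N + i0, 11 := top)"
   have A35: "A3 5 = A1 5" "A3 6 = A1 6" "A3 7 = A1 7" "A3 8 = A1 8" using d by (auto simp: A3_def)
   have R2e: "R2 23 = ?y" "R2 22 = R1 22" "R2 21 = R1 21" "R2 20 = z" "R2 17 = i0" "R2 19 = off" "R2 1 = N" "R2 5 = top" "R2 6 = R1 6" "R2 9 = 0" using a r1 by (auto simp: i0_def)
   have rn: "runs RN R3 A3 (%t' R' A'. ALL u<=70. runs (inc 20) R' A' (%t''. Q (t + t' + t'' + u)))"
   proof (rule runs_mono[OF RN[where v = "N + i0" and x = top and g = 0 and L = L1]])
    fix t' R' A' assume b: "t' <= 90 * (h + 1) & (EX L'. raised 0 top {j. anc (N + i0) j} (h + 1) A3 L1 R' A' L' & (top <= A3 5 (N + i0) --> L' = L1 & A' 5 = A3 5)) &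
     sm {6, 7, 8, 10} R' R3"
    then obtain L' where L': "raised 0 top {j. anc (N + i0) j} (h + 1) A3 L1 R' A' L'" by blast
    have nd3: "nodes (A3 5) f" using nd1 A35 by simp
    have "nodes (A' 5) (f(i0 := max (f i0) top))" by (rule nodes_raise_leaf[OF nd3 L']) (use i0 mN in simp)
    also have "f(i0 := max (f i0) top) = (%j. if m <= j \<or> j \<in> (O1(z := i0)) ` {..<Suc z} then top else A 1 j)"
    proof
     fix j
     have "(O1(z := i0)) ` {..<Suc z} = insert i0 (O1 ` {..<z})" by (auto simp: lessThan_Suc image_iff)
     then show "(f(i0 := max (f i0) top)) j = (if m <= j \<or> j \<in> (O1(z := i0)) ` {..<Suc z} then top else A 1 j)"
      using K[OF i0(1)] by (auto simp: f_def)
    qed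
    finally have n2: "nodes (A' 5) (%j. if m <= j \<or> j \<in> (O1(z := i0)) ` {..<Suc z} then top else A 1 j)" .
    have ar: "A' 3 = O1(z := i0)" "A' d = (A1 d)(off + i0 := cur')" "sm {3, 5, 6, 7, 8, d} A' A1"
     using L' d unfolding raised_def A3_def by auto
    have rr: "R' 20 = z" "R' 21 = cur'" "R' 22 = ?y" "sm {6, 7, 8, 10, 11, 16, 17, 20, 21, 22, 23} R' R1"
     using b a R2e unfolding R3_def by auto
    have dd: "(%j. A' d (off + j)) = (%j. A1 d (off + j))(i0 := cur')" unfolding ar(2) by auto
    have l2: "logr (R'(20 := z + 1)) A' L'" "length L' <= length L + Suc z * (h + 1)" using L' raised_length[OF L'] L1 by (auto simp: raised_def logr_def)
    have "I (Suc z) (R'(20 := z + 1)) A'" unfolding I_def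
    proof (intro conjI)
     show "sorted_upto (Suc z) (A 1) (A' 3) (%j. A' d (off + j)) ((R'(20 := z + 1)) 21) ((R'(20 := z + 1)) 22)"
      unfolding dd ar(1) using so' rr i0 by simp
     show "nodes (A' 5) (%j. if m <= j \<or> j \<in> A' 3 ` {..<Suc z} then top else A 1 j)" unfolding ar(1) by (rule n2)
     show "EX L'. logr (R'(20 := z + 1)) A' L' & length L' <= length L + Suc z * (h + 1)" using l2 by blast
     show "ALL x. \<not> (off <= x & x < off + m) --> A' d x = A d x" unfolding ar(2) using i i0 unfolding I_def by auto
     show "sm {3, 5, 6, 7, 8, d} A' A" using ar(3) i unfolding I_def by auto
     show "ALL y. y ~: {6, 7, 8, 10, 11, 16, 17, 20, 21, 22, 23} --> (R'(20 := z + 1)) y = R y" using rr(4) i unfolding I_def by auto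
    qed simp
    then have "Q u (R'(20 := z + 1)) A'" if "u <= 230 * (h + 1)" for u using that unfolding Q_def by simp
    then show "ALL u<=70. runs (inc 20) R' A' (%t''. Q (t + t' + t'' + u))"
     by (intro allI impI runs_Asg) (use rr zw a b in simp_all)
   qed (use R2e i0 mN L1 len hp1 A35 in "auto simp: R3_def logr_def")
   have tail: "runs (Sto 3 (Var 20) (Var 17) ;; Sto d (Plus (Var 19) (Var 17)) (Var 21) ;;
   10 ::= Plus (Var 1) (Var 17) ;; 11 ::= Var 5 ;; RN ;; inc 20) R4 A1 (%t'. Q (t + (t' + u)))"
    if R4: "R4 = R2(21 := cur', 22 := ?y)" and u: "u <= 30" for R4 u
   proof -
    have "runs RN R3 A3 (%t' R' A'. runs (inc 20) R' A' (%t''. Q (t + (16 + t' + t'' + u))))"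
     by (rule runs_mono[OF rn]) (use u in \<open>auto simp: ac_simps dest!: spec[of _ "u + 16"]\<close>)
    then show ?thesis
     by (intro runs_Sq runs_Asg runs_Sto)
      (use R2e R4 i0 z d off N_small mN in "simp_all add: lens R3_def A3_def O1_def ac_simps fun_upd_twist")
   qed
   show ?case
   proof (cases "?y = R1 22")
    case True
    then have "R2 = R2(21 := cur', 22 := ?y)" using R2e i0 by (auto simp: cur'_def)
    from tail[OF this, of 12] show ?thesis
     by (intro runs_Sq[of "Ite _ _ _"] runs_Ite runs_Nop) (use True a R2e in "simp_all add: ac_simps")
   next
    case False
    then have c: "cur' = R1 21 + 1" using i0 by (simp add: cur'_def)
    show ?thesis using tail[OF refl, of 17]
     by (intro runs_Sq[of "Ite _ _ _"] runs_Ite runs_Sq[of "inc 21"] runs_Asg) (use False a R2e c c21 zw in "simp_all add: ac_simps")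
   qed
  qed (use r1 hp1 in auto)
  then have "runs (EXB d) R1 A1 Q" unfolding EXB_def
   by (intro runs_SqA runs_Sq[of FIND] runs_Asg) (use r1 y0 N_pos in "simp_all add: lens")
  then show "okc R1 A1 ?c & holds R1 A1 ?c & runs (EXB d) R1 A1 (%t R' A'. t <= 230 * (h + 1) & I (Suc z) R' A')"
   using r1 z unfolding Q_def by simp
 next
  fix R1 A1 assume "I m R1 A1"
  then show "okc R1 A1 ?c & \<not> holds R1 A1 ?c" using e by (simp add: I_def)
 qed
 then show ?thesis
 proof (rule runs_mono)
  fix t R' A' assume a: "t <= m * (230 * (h + 1) + xk ?c + 1) + xk ?c + 1 & I m R' A'"
  have "m * (230 * (h + 1) + xk ?c + 1) <= m * (250 * (h + 1))" by (intro mult_le_mono2) simp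
  moreover have "xk ?c = 2" by simp
  ultimately have "t <= m * (250 * (h + 1)) + 3" using conjunct1[OF a] by linarith
  moreover have "sorted_upto m (A 1) (A' 3) (%j. A' d (off + j)) (R' 21) (R' 22)"
   "ALL x. \<not> (off <= x & x < off + m) --> A' d x = A d x"
   "sm {6, 7, 8, 10, 11, 16, 17, 20, 21, 22, 23} R' R" "sm {3, 5, 6, 7, 8, d} A' A"
   using a unfolding I_def by blast+
  ultimately show "t <= m * (250 * (h + 1)) + 3 &
   (EX cur prev. sorted_upto m (A 1) (A' 3) (%j. A' d (off + j)) cur prev) &
   (ALL x. \<not> (off <= x & x < off + m) --> A' d x = A d x) &
   sm {6, 7, 8, 10, 11, 16, 17, 20, 21, 22, 23} R' R & sm {3, 5, 6, 7, 8, d} A' A"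
   by blast
 qed
qed

definition sorted_by :: "(nat => nat) => (nat => nat) => (nat => nat) => bool" where
 "sorted_by K O' D <-> bij_betw O' {..<m} {..<m} & (ALL x y. x < y & y < m --> K (O' x) <= K (O' y)) &
  (ALL x<m. 1 <= D x & D x <= m) & (ALL x<m. ALL y<m. D x < D y <-> K x < K y)"

lemma sorted_upto_full:
 assumes s: "sorted_upto m K O' D cur prev"
 shows "sorted_by K O' D"
proof -
 have inj: "inj_on O' {..<m}" "ALL x<m. O' x < m" using s unfolding sorted_upto_def by auto
 have sub: "O' ` {..<m} \<subseteq> {..<m}" using inj by auto
 have eq: "O' ` {..<m} = {..<m}" by (rule card_subset_eq) (use sub card_image[OF inj(1)] in auto)
 have all: "EX x<m. O' x = j" if "j < m" for j
 proof -
  have "j \<in> O' ` {..<m}" unfolding eq using that by simp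
  then show ?thesis by auto
 qed
 have mn: "!!x j. x < m ==> j < m ==> j ~: O' ` {..<x} ==> K (O' x) <= K j" using s unfolding sorted_upto_def by blast
 have nm: "!!x y. x < m ==> y < m ==> K (O' x) < K (O' y) <-> D (O' x) < D (O' y)" using s unfolding sorted_upto_def by blast
 have rg: "!!x. x < m ==> 1 <= D (O' x) & D (O' x) <= cur" "cur <= m" using s unfolding sorted_upto_def by auto
 have srt: "K (O' x) <= K (O' y)" if "x < y" "y < m" for x y
 proof (rule mn)
  show "O' y ~: O' ` {..<x}"
  proof
   assume "O' y \<in> O' ` {..<x}"
   then obtain x' where "x' < x" "O' y = O' x'" by auto
   then show False using inj_onD[OF inj(1), of y x'] that by simp
  qed
 qed (use that inj in auto)
 have D: "1 <= D j & D j <= m" if j: "j < m" for j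
 proof -
  obtain x where x: "x < m" "O' x = j" using all[OF j] by blast
  then show ?thesis using rg(1)[OF x(1)] rg(2) by auto
 qed
 have DK: "D i < D j <-> K i < K j" if ij: "i < m" "j < m" for i j
 proof -
  obtain x y where x: "x < m" "O' x = i" and y: "y < m" "O' y = j" using all[OF ij(1)] all[OF ij(2)] by blast
  then show ?thesis using nm[OF x(1) y(1)] by simp
 qed
 show ?thesis unfolding sorted_by_def bij_betw_def using inj(1) eq srt D DK by blast
qed

lemma SORT:
 assumes r: "env R" "R 19 = off" and K: "ALL x<m. A 1 x < top"
  and d: "d < 20" "d ~: {1, 3, 5, 6, 7, 8}" "off + m <= len d"
 shows "runs (SORT d) R A (%t R' A'. t <= 1300 * (m + 1) * (h + 1) * (h + 1) &
  sorted_by (A 1) (A' 3) (%j. A' d (off + j)) &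
  (ALL x. \<not> (off <= x & x < off + m) --> A' d x = A d x) &
  sm {6, 7, 8, 9, 10, 11, 12, 13, 14, 15, 16, 17, 18, 20, 21, 22, 23} R' R & sm {3, 5, 6, 7, 8, d} A' A)"
  (is "runs _ _ _ ?Q")
proof -
 define Q where "Q = ?Q"
 let ?W = "Wh (Lt (Var 20) (Var 0)) (EXB d)"
 have e: "R 0 = m" "R 1 = N" "R 5 = top" using r by (auto simp: env_def)
 have "runs (SORT d) R A Q" unfolding SORT_def
 proof (rule runs_SqM'[OF _ INIT[OF r(1)]], goal_cases)
  case (1 t1 R1 A1) note a1 = this
  then obtain L1 where L1: "hp (A1 5)" "ALL j<N. ALL y. blk (A1 5) y j <-> y = 0 \<or> m <= j & y <= top" "logr R1 A1 L1"
   "length L1 <= 2 * (h + 1) * (h + 1) + 1" by blast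
  have f1: "R1 0 = m" "R1 1 = N" "R1 9 = 0" "A1 1 = A 1" using a1 e by auto
  have nd1: "nodes (A1 5) (%j. if m <= j then top else 0)" using L1 unfolding nodes_def by auto
  have len1: "length L1 + m * (h + 1) + (h + 1) <= LG" using LG_ge L1(4) by linarith
  have "runs (Wh (Lt (Var 20) (Var 0)) INS ;; 21 ::= Num 0 ;; 22 ::= Var 5 ;; 20 ::= Num 0 ;; ?W) (R1(20 := 0)) A1 (%t'. Q (t1 + (2 + t')))"
  proof (rule runs_SqM'[OF _ INS_loop[OF f1(1-3) nd1 L1(3) len1]], goal_cases)
   case (1 t2 R2 A2) note a2 = this
   then obtain L2 where L2: "logr R2 A2 L2" "length L2 <= length L1 + m * (h + 1)" by blast
   have f2: "env R2" "R2 9 = 0" "R2 19 = off" "A2 1 = A 1" using a1 a2 r by (auto simp: env_def)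
   have a21: "A2 1 = A1 1" using f1(4) f2(4) by simp
   have nd2: "nodes (A2 5) (%j. if m <= j then top else A2 1 j)" unfolding a21 using a2 by blast
   have len2: "length L2 + m * (h + 1) + (h + 1) <= LG" using LG_ge L1(4) L2(2) by linarith
   have K2: "!!x. x < m ==> A2 1 x < top" using K f2 by simp
   have "runs ?W (R2(21 := 0, 22 := top, 20 := 0)) A2 (%t3. Q (t1 + (2 + (t2 + (6 + t3)))))"
   proof (rule runs_mono'[OF _ EXB_loop[OF f2(1-3) nd2 K2 L2(1) len2 d]], goal_cases)
    case (1 t3 R3 A3) note a3 = this
    then have "sorted_by (A 1) (A3 3) (%j. A3 d (off + j))" using sorted_upto_full f2(4) by metis
    moreover have "A2 d = A d" using a1 a2 d by auto
    moreover have "t1 + (2 + (t2 + (6 + t3))) <= 1300 * (m + 1) * (h + 1) * (h + 1)"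
    proof -
     have "t1 <= 500 * ((h + 1) * (h + 1)) + 50 * N" using conjunct1[OF a1] by (simp only: mult.assoc)
     then have t1: "t1 <= 500 * ((h + 1) * (h + 1)) + 100 * m" using mN(2) by linarith
     have "m * (150 * (h + 1)) = 150 * (m * (h + 1))" "m * (250 * (h + 1)) = 250 * (m * (h + 1))" by (simp_all add: algebra_simps)
     then have t2: "t2 <= 150 * (m * (h + 1)) + 3" "t3 <= 250 * (m * (h + 1)) + 3" using conjunct1[OF a2] conjunct1[OF a3] by linarith+
     have "m * (h + 1) * 1 <= m * (h + 1) * (h + 1)" by (intro mult_le_mono2) simp
     then have "m * (h + 1) <= m * ((h + 1) * (h + 1))" by (simp add: mult.assoc)
     moreover have "m * 1 <= m * (h + 1)" by (intro mult_le_mono2) simp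
     moreover have "1 <= (h + 1) * (h + 1)" by (simp add: One_nat_def)
     ultimately have "t1 + (2 + (t2 + (6 + t3))) <= 1300 * ((h + 1) * (h + 1)) + 1300 * (m * ((h + 1) * (h + 1)))" using t1 t2 by linarith
     then show ?thesis by (simp add: algebra_simps)
    qed
    ultimately show ?case unfolding Q_def using a1 a2 a3 by auto
   qed
   then show ?case
    by (intro runs_Sq runs_Asg) (use f2 in "simp_all add: env_def ac_simps")
  qed
  then show ?case
   by (intro runs_SqA runs_Asg) simp_all
 qed
 then show ?thesis unfolding Q_def .
qed

end

section \<open>Prefix doubling\<close>

definition eqb :: "(nat => nat) => nat => nat => nat => bool" where
 "eqb f d x y <-> (ALL s<d. f (x + s) = f (y + s))"

definition ltb :: "(nat => nat) => nat => nat => nat => bool" where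
 "ltb f d x y <-> (EX s<d. eqb f s x y & f (x + s) < f (y + s))"

lemma eqb_add: "eqb f (d + d') x y <-> eqb f d x y & eqb f d' (x + d) (y + d)"
proof
 assume "eqb f d x y & eqb f d' (x + d) (y + d)"
 then have a: "!!s. s < d ==> f (x + s) = f (y + s)" "!!s. s < d' ==> f (x + d + s) = f (y + d + s)" by (auto simp: eqb_def)
 show "eqb f (d + d') x y" unfolding eqb_def
 proof (intro allI impI)
  fix s assume "s < d + d'"
  then show "f (x + s) = f (y + s)" using a(1)[of s] a(2)[of "s - d"] by (cases "s < d") auto
 qed
qed (auto simp: eqb_def add.assoc)

lemma ltb_trichotomy: "\<not> ltb f d x y & \<not> ltb f d y x <-> eqb f d x y"
proof
 assume n: "\<not> ltb f d x y & \<not> ltb f d y x"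
 have "s <= d ==> eqb f s x y" for s
 proof (induction s)
  case (Suc s)
  then have "eqb f s x y" "eqb f s y x" by (auto simp: eqb_def)
  then have "f (x + s) = f (y + s)" using n Suc.prems unfolding ltb_def by (metis Suc_le_lessD linorder_neqE_nat)
  then show ?case using Suc by (auto simp: eqb_def less_Suc_eq)
 qed (simp add: eqb_def)
 then show "eqb f d x y" by simp
next
 assume "eqb f d x y"
 then show "\<not> ltb f d x y & \<not> ltb f d y x" unfolding ltb_def eqb_def by auto
qed

lemma ltb_add: "ltb f (d + d') x y <-> ltb f d x y \<or> eqb f d x y & ltb f d' (x + d) (y + d)"
proof
 assume "ltb f (d + d') x y"
 then obtain s where s: "s < d + d'" "eqb f s x y" "f (x + s) < f (y + s)" unfolding ltb_def by blast
 show "ltb f d x y \<or> eqb f d x y & ltb f d' (x + d) (y + d)"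
 proof (cases "s < d")
  case True
  then show ?thesis using s unfolding ltb_def by blast
 next
  case False
  have "eqb f d x y & eqb f (s - d) (x + d) (y + d)" using eqb_add[of f d "s - d" x y] s(2) False by simp
  moreover have "f (x + d + (s - d)) < f (y + d + (s - d))" using s(3) False by simp
  moreover have "s - d < d'" using s(1) False by simp
  ultimately show ?thesis unfolding ltb_def by blast
 qed
next
 assume "ltb f d x y \<or> eqb f d x y & ltb f d' (x + d) (y + d)"
 then show "ltb f (d + d') x y"
 proof
  assume "ltb f d x y"
  then show ?thesis unfolding ltb_def by (meson trans_less_add1)
 next
  assume a: "eqb f d x y & ltb f d' (x + d) (y + d)"
  then obtain s where s: "s < d'" "eqb f s (x + d) (y + d)" "f (x + d + s) < f (y + d + s)" unfolding ltb_def by blast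
  then have "eqb f (d + s) x y" "f (x + (d + s)) < f (y + (d + s))" "d + s < d + d'" using a eqb_add by (auto simp: add.assoc)
  then show ?thesis unfolding ltb_def by blast
 qed
qed

lemma key_less:
 assumes "a' < (M::nat)" "b' < M"
 shows "a * M + a' < b * M + b' <-> a < b \<or> a = b & a' < b'"
proof -
 have *: "x * M + x' < y * M + y'" if "x < y" "x' < M" for x x' y y' :: nat
 proof -
  have "Suc x * M <= y * M" using that by (intro mult_le_mono1) simp
  then show ?thesis using that by simp
 qed
 show ?thesis using *[of a b a' b'] *[of b a b' a'] assms by (metis add_less_cancel_left linorder_neqE_nat not_less_iff_gr_or_eq)
qed

definition FILL :: "ex => stm" where
 "FILL a = 20 ::= Num 0 ;; Wh (Lt (Var 20) (Var 0)) (Sto 1 (Var 20) a ;; inc 20)"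

definition POSL :: stm where
 "POSL = Sto 12 (Num 0) (Num 0) ;; 20 ::= Num 0 ;;
  Wh (Lt (Var 20) (Var 0))
   (Sto 12 (Plus (Var 20) (Num 1)) (Plus (Ar 12 (Var 20)) (Ar 0 (Plus (Twice (Var 20)) (Num 1)))) ;; inc 20) ;;
  4 ::= Ar 12 (Var 0)"

definition ZERO :: stm where
 "ZERO = 24 ::= Num 0 ;;
  Wh (Lt (Var 24) (Times (Plus (Var 2) (Num 1)) (Twice (Var 1)))) (Sto 9 (Var 24) (Num 0) ;; inc 24)"

definition LEVB :: stm where
 "LEVB = 26 ::= Times (Var 24) (Twice (Var 1)) ;;
  FILL (Plus (Times (Ar 9 (Plus (Var 26) (Var 20))) (Plus (Var 0) (Num 1))) (Ar 9 (Plus (Var 26) (Plus (Var 20) (Var 25))))) ;;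
  inc 24 ;; 19 ::= Times (Var 24) (Twice (Var 1)) ;; SORT 9 ;; 25 ::= Twice (Var 25)"

text \<open>A letter may be any word, even the largest one, which the sort reserves for itself.
  Sorting by the upper bits first, and then by the name obtained together with the lowest bit, keeps
  all keys below it.\<close>

definition NAMES :: stm where
 "NAMES = 19 ::= Num 0 ;; FILL (Half (Ar 0 (Twice (Var 20)))) ;; SORT 4 ;;
  FILL (Plus (Twice (Ar 4 (Var 20))) (Op Mod (Ar 0 (Twice (Var 20))) (Num 2))) ;; SORT 2 ;; Sto 2 (Var 0) (Num 0)"

definition LEVELS :: stm where
 "LEVELS = ZERO ;; 19 ::= Num 0 ;;
  FILL (Plus (Times (Ar 2 (Var 20)) (Plus (Var 4) (Num 1))) (Ar 0 (Plus (Twice (Var 20)) (Num 1)))) ;; SORT 9 ;;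
  24 ::= Num 0 ;; 25 ::= Num 1 ;; Wh (Lt (Var 24) (Var 2)) LEVB"

text \<open>The key is the first letter followed by the name of the block of \<open>2 ^ h\<close>
  runs that begins one run later. The exponent of the first run is skipped, exactly as in
  \<open>tk\<close>.\<close>

definition ORDER :: stm where
 "ORDER = 19 ::= Num 0 ;; 26 ::= Times (Var 2) (Twice (Var 1)) ;;
  FILL (Plus (Times (Ar 2 (Var 20)) (Plus (Var 0) (Num 1))) (Ar 9 (Plus (Var 26) (Plus (Var 20) (Num 1))))) ;; SORT 4"

context prog begin

lemma FILL:
 assumes e: "R 0 = m" and xa: "xc a <= 40"
  and ok: "!!x R1 A1. x < m ==> R1 20 = x ==> (!!y. y ~= 20 ==> R1 y = R y) ==> (!!b. b ~= 1 ==> A1 b = A b) ==> okx R1 A1 a & ev R1 A1 a = g x"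
 shows "runs (FILL a) R A (%t R' A'. t <= 60 * (m + 1) & (ALL x<m. A' 1 x = g x) & (ALL y. y ~= 20 --> R' y = R y) & (ALL b. b ~= 1 --> A' b = A b))"
  (is "runs _ _ _ ?Q")
proof -
 define Q where "Q = ?Q"
 define I where "I = (%z R1 A1. R1 20 = z & (ALL x<z. A1 1 x = g x) & (ALL y. y ~= 20 --> R1 y = R y) & (ALL b. b ~= 1 --> A1 b = A b))"
 let ?c = "Lt (Var 20) (Var 0)" and ?b = "Sto 1 (Var 20) a ;; inc 20"
 have "runs (Wh ?c ?b) (R(20 := 0)) A (%t R' A'. t <= m * (50 + xk ?c + 1) + xk ?c + 1 & I m R' A')"
 proof (rule runs_For)
  show "I 0 (R(20 := 0)) A" by (simp add: I_def)
 next
  fix z R1 A1 assume z: "z < m" and i: "I z R1 A1"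
  have o: "okx R1 A1 a & ev R1 A1 a = g z" by (rule ok) (use z i in "auto simp: I_def")
  have "I (Suc z) (R1(20 := z + 1)) (A1(1 := (A1 1)(z := g z)))" using i unfolding I_def by (auto simp: less_Suc_eq)
  then have "runs ?b R1 A1 (%t R' A'. t <= 50 & I (Suc z) R' A')"
   by (intro runs_intros) (use i o z N_small mN xa in "simp_all add: lens I_def")
  then show "okc R1 A1 ?c & holds R1 A1 ?c & runs ?b R1 A1 (%t R' A'. t <= 50 & I (Suc z) R' A')"
   using i z e by (simp add: I_def)
 next
  fix R1 A1 assume "I m R1 A1"
  then show "okc R1 A1 ?c & \<not> holds R1 A1 ?c" using e by (simp add: I_def)
 qed
 then have "runs (Wh ?c ?b) (R(20 := 0)) A (%t. Q (2 + t))"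
  by (rule runs_mono) (auto simp: Q_def I_def)
 then have "runs (FILL a) R A Q" unfolding FILL_def by (intro runs_SqA runs_Asg) simp_all
 then show ?thesis unfolding Q_def .
qed

end

locale prog_in = prog + runseq m c e for c e +
 assumes n_pos: "n = pos m" and c_less: "x < m ==> c x < 2 ^ w"
begin

lemma e_le: "x < m ==> e x <= n"
 unfolding n_pos using pos_mono[of "Suc x" m] by simp

definition inp :: "arrs => bool" where
 "inp A <-> (ALL x<m. A 0 (2 * x) = c x & A 0 (2 * x + 1) = e x)"

text \<open>This covers every sort key, a name times a base plus a name or an exponent, and leaves
  the largest word free as the sort demands.\<close>

lemma quad: "x <= n + 1 ==> y <= n + 1 ==> z <= 8 * (n + 2) ==> x * y + z < 2 ^ w - 1"
proof -
 assume a: "x <= n + 1" "y <= n + 1" "z <= 8 * (n + 2)"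
 define P where "P = (n + 2) * (n + 2)"
 have "x * y <= P" unfolding P_def using a by (intro mult_le_mono) auto
 moreover have "n + 2 <= P" unfolding P_def by (rule le_square)
 moreover have "1 <= P" by (simp add: P_def One_nat_def)
 moreover have "64 * P <= 2 ^ w" using big by (simp only: P_def mult.assoc)
 moreover have "z <= 8 * P" using a(3) mult_le_mono2[OF calculation(2), of 8] by simp
 ultimately have "x * y + z + 1 < 2 ^ w" by linarith
 then show ?thesis by (simp add: less_diff_conv)
qed

lemma POSL:
 assumes r: "R 0 = m" and A: "inp A"
 shows "runs POSL R A (%t R' A'. t <= 50 * (m + 1) & (ALL x<=m. A' 12 x = pos x) & R' 4 = n & sm {4, 20} R' R & (ALL b. b ~= 12 --> A' b = A b))"
  (is "runs _ _ _ ?Q")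
proof -
 define Q where "Q = ?Q"
 define I where "I = (%z R1 A1. R1 20 = z & (ALL x<=z. A1 12 x = pos x) & (ALL y. y ~= 20 --> R1 y = R y) & (ALL b. b ~= 12 --> A1 b = A b))"
 let ?c = "Lt (Var 20) (Var 0)"
 let ?b = "Sto 12 (Plus (Var 20) (Num 1)) (Plus (Ar 12 (Var 20)) (Ar 0 (Plus (Twice (Var 20)) (Num 1)))) ;; inc 20"
 have loop: "runs (Wh ?c ?b) (R(20 := 0)) (A(12 := (A 12)(0 := 0))) (%t R' A'. t <= m * (30 + xk ?c + 1) + xk ?c + 1 & I m R' A')"
 proof (rule runs_For)
  show "I 0 (R(20 := 0)) (A(12 := (A 12)(0 := 0)))" by (simp add: I_def)
 next
  fix z R1 A1 assume z: "z < m" and i: "I z R1 A1"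
  have v: "A1 12 z = pos z" "A1 0 (2 * z + 1) = e z" using i A z unfolding I_def inp_def by auto
  have "pos (Suc z) <= n" unfolding n_pos using z by (intro pos_mono) simp
  then have b: "pos z + e z < 2 ^ w" by (intro lin_bound) simp
  have "I (Suc z) (R1(20 := z + 1)) (A1(12 := (A1 12)(z + 1 := pos z + e z)))" using i unfolding I_def by (auto simp: le_Suc_eq)
  then have "runs ?b R1 A1 (%t R' A'. t <= 30 & I (Suc z) R' A')"
   by (intro runs_intros) (use i v b z N_small mN in "simp_all add: lens I_def")
  then show "okc R1 A1 ?c & holds R1 A1 ?c & runs ?b R1 A1 (%t R' A'. t <= 30 & I (Suc z) R' A')"
   using i z r by (simp add: I_def)
 next
  fix R1 A1 assume "I m R1 A1"
  then show "okc R1 A1 ?c & \<not> holds R1 A1 ?c" using r by (simp add: I_def)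
 qed
 have "runs (Wh ?c ?b ;; 4 ::= Ar 12 (Var 0)) (R(20 := 0)) (A(12 := (A 12)(0 := 0))) (%t. Q (6 + t))"
 proof (rule runs_SqM'[OF _ loop], goal_cases)
  case (1 t R1 A1) note a = this
  then have "Q (6 + (t + 4)) (R1(4 := n)) A1" unfolding Q_def I_def n_pos by auto
  then show ?case
   by (intro runs_Asg) (use a r in "simp_all add: lens I_def n_pos")
 qed
 then have "runs POSL R A Q" unfolding POSL_def by (intro runs_Sq[of "Sto _ _ _"] runs_SqA runs_Asg runs_Sto) (simp_all add: lens)
 then show ?thesis unfolding Q_def .
qed

lemma ZERO:
 assumes r: "env R"
 shows "runs ZERO R A (%t R' A'. t <= 20 * ((h + 1) * (2 * N)) + 20 & (ALL x<(h + 1) * (2 * N). A' 9 x = 0) & (ALL y. y ~= 24 --> R' y = R y) & (ALL b. b ~= 9 --> A' b = A b))"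
  (is "runs _ _ _ ?Q")
proof -
 define Q where "Q = ?Q"
 have e: "R 1 = N" "R 2 = h" using r by (auto simp: env_def)
 define I where "I = (%z R1 A1. R1 24 = z & (ALL x<z. A1 9 x = 0) & (ALL y. y ~= 24 --> R1 y = R y) & (ALL b. b ~= 9 --> A1 b = A b))"
 let ?M = "(h + 1) * (2 * N)"
 let ?c = "Lt (Var 24) (Times (Plus (Var 2) (Num 1)) (Twice (Var 1)))" and ?b = "Sto 9 (Var 24) (Num 0) ;; inc 24"
 have M: "?M < 2 ^ w" "h + 1 < 2 ^ w" "2 * N < 2 ^ w" using base_len[of 9] lens S_less N_small h_less N_pos by auto
 have "runs (Wh ?c ?b) (R(24 := 0)) A (%t R' A'. t <= ?M * (10 + xk ?c + 1) + xk ?c + 1 & I ?M R' A')"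
 proof (rule runs_For)
  show "I 0 (R(24 := 0)) A" by (simp add: I_def)
 next
  fix z R1 A1 assume z: "z < ?M" and i: "I z R1 A1"
  have "I (Suc z) (R1(24 := z + 1)) (A1(9 := (A1 9)(z := 0)))" using i unfolding I_def by (auto simp: less_Suc_eq)
  then have "runs ?b R1 A1 (%t R' A'. t <= 10 & I (Suc z) R' A')"
   by (intro runs_intros) (use i z M in "simp_all add: lens I_def")
  then show "okc R1 A1 ?c & holds R1 A1 ?c & runs ?b R1 A1 (%t R' A'. t <= 10 & I (Suc z) R' A')"
   using i z e M by (simp add: I_def)
 next
  fix R1 A1 assume "I ?M R1 A1"
  then show "okc R1 A1 ?c & \<not> holds R1 A1 ?c" using e M by (simp add: I_def)
 qed
 then have "runs (Wh ?c ?b) (R(24 := 0)) A (%t. Q (2 + t))"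
  by (rule runs_mono) (auto simp: Q_def I_def)
 then have "runs ZERO R A Q" unfolding ZERO_def by (intro runs_SqA runs_Asg) simp_all
 then show ?thesis unfolding Q_def .
qed

abbreviation sort_regs :: "nat set" where
 "sort_regs \<equiv> {6, 7, 8, 9, 10, 11, 12, 13, 14, 15, 16, 17, 18, 19, 20, 21, 22, 23, 24, 25, 26}"

definition named :: "arrs => bool" where
 "named A <-> A 2 m = 0 & (ALL x<m. 1 <= A 2 x & A 2 x <= m) & (ALL x<m. ALL y<m. A 2 x = A 2 y <-> c x = c y)"

lemma NAMES:
 assumes r: "env R" and A: "inp A"
 shows "runs NAMES R A (%t R' A'. t <= 2800 * (m + 1) * (h + 1) * (h + 1) & named A' &
  sm sort_regs R' R & sm {1, 2, 3, 4, 5, 6, 7, 8} A' A)"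
  (is "runs _ _ _ ?Q")
proof -
 define Q where "Q = ?Q"
 have e: "R 0 = m" "R 5 = top" using r by (auto simp: env_def)
 have topp: "1 < top" using quad[of 0 0 1] by simp
 have lin: "x <= 8 * (n + 2) ==> x < top" for x using quad[of 0 0 x] by simp
 let ?R = "R(19 := 0)"
 let ?f1 = "FILL (Half (Ar 0 (Twice (Var 20))))"
 let ?f2 = "FILL (Plus (Twice (Ar 4 (Var 20))) (Op Mod (Ar 0 (Twice (Var 20))) (Num 2)))"
 have "runs (?f1 ;; SORT 4 ;; ?f2 ;; SORT 2 ;; Sto 2 (Var 0) (Num 0)) ?R A (%t. Q (2 + t))"
 proof (rule runs_SqM'[OF _ FILL[where g = "%x. c x div 2"]], goal_cases)
  fix x R1 A1 assume a: "x < m" "R1 20 = x" "!!y. y ~= 20 ==> R1 y = ?R y" "!!b. b ~= 1 ==> A1 b = A b"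
  then show "okx R1 A1 (Half (Ar 0 (Twice (Var 20)))) & ev R1 A1 (Half (Ar 0 (Twice (Var 20)))) = c x div 2"
   using A N_small mN by (auto simp: lens inp_def)
 next
  case (1 t1 R1 A1) note a1 = this
  have e1: "env R1" "R1 19 = 0" using a1 r by (auto simp: env_def)
  have K1: "ALL x<m. A1 1 x < top"
  proof (intro allI impI)
   fix x assume "x < m"
   then have "A1 1 x = c x div 2" "c x < 2 ^ w" using a1 c_less by auto
   then show "A1 1 x < top" using topp by linarith
  qed
  show ?case
  proof (rule runs_SqM'[OF _ SORT[where R = R1 and A = A1, OF e1 K1]], goal_cases)
   case (1 t2 R2 A2) note a2 = this
   have so1: "sorted_by (A1 1) (A2 3) (%j. A2 4 j)" using a2 by simp
   have e2: "R2 0 = m" "env R2" "R2 19 = 0" using a2 e1 by (auto simp: env_def)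
   have i2: "A2 0 = A 0" using a2 a1 by auto
   have n4: "A2 4 x <= m" if "x < m" for x using so1 that by (auto simp: sorted_by_def)
   show ?case
   proof (rule runs_SqM'[OF _ FILL[where g = "%x. 2 * A2 4 x + c x mod 2"]], goal_cases)
    fix x R3 A3 assume a: "x < m" "R3 20 = x" "!!y. y ~= 20 ==> R3 y = R2 y" "!!b. b ~= 1 ==> A3 b = A2 b"
    have "2 * A2 4 x + 2 < 2 ^ w" using n4[OF a(1)] mn by (intro lin_bound) simp
    then have "2 * A2 4 x + c x mod 2 < 2 ^ w" "2 * A2 4 x < 2 ^ w" by (auto intro: le_less_trans[rotated])
    then show "okx R3 A3 (Plus (Twice (Ar 4 (Var 20))) (Op Mod (Ar 0 (Twice (Var 20))) (Num 2))) &
     ev R3 A3 (Plus (Twice (Ar 4 (Var 20))) (Op Mod (Ar 0 (Twice (Var 20))) (Num 2))) = 2 * A2 4 x + c x mod 2"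
     using a A N_small mN i2 by (auto simp: lens inp_def)
   next
    case (1 t3 R3 A3) note a3 = this
    have e3: "env R3" "R3 19 = 0" using a3 e2 by (auto simp: env_def)
    have K3: "ALL x<m. A3 1 x < top"
    proof (intro allI impI)
     fix x assume x: "x < m"
     have "c x mod 2 < 2" by simp
     then have "2 * A2 4 x + c x mod 2 <= 8 * (n + 2)" using n4[OF x] mn by simp
     then show "A3 1 x < top" using a3 x lin by auto
    qed
    show ?case
    proof (rule runs_SqM'[OF _ SORT[where R = R3 and A = A3, OF e3 K3]], goal_cases)
     case (1 t4 R4 A4) note a4 = this
     have so2: "sorted_by (A3 1) (A4 3) (%j. A4 2 j)" using a4 by simp
     have eq: "A4 2 x = A4 2 y <-> c x = c y" if xy: "x < m" "y < m" for x y
     proof -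
      have "A4 2 x = A4 2 y <-> A3 1 x = A3 1 y" using so2 xy unfolding sorted_by_def by (metis nat_neq_iff)
      also have "\<dots> <-> 2 * A2 4 x + c x mod 2 = 2 * A2 4 y + c y mod 2" using a3 xy by simp
      also have "\<dots> <-> A2 4 x = A2 4 y & c x mod 2 = c y mod 2"
      proof -
       have "c x mod 2 < 2" "c y mod 2 < 2" by simp_all
       then show ?thesis by arith
      qed
      also have "A2 4 x = A2 4 y <-> A1 1 x = A1 1 y" using so1 xy unfolding sorted_by_def by (metis nat_neq_iff)
      also have "\<dots> <-> c x div 2 = c y div 2" using a1 xy by simp
      also have "c x div 2 = c y div 2 & c x mod 2 = c y mod 2 <-> c x = c y" by (metis div_mult_mod_eq)
      finally show ?thesis .
     qed
     define A5 where "A5 = A4(2 := (A4 2)(m := 0))"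
     have "named A5" unfolding named_def A5_def using so2 eq unfolding sorted_by_def by auto
     moreover have "2 + (t1 + (t2 + (t3 + (t4 + 4)))) <= 2800 * (m + 1) * (h + 1) * (h + 1)"
     proof -
      define M H where "M = m + 1" and "H = (h + 1) * (h + 1)"
      have "M * 1 <= M * H" unfolding H_def by (intro mult_le_mono2) (simp add: One_nat_def)
      moreover have "t2 <= 1300 * (M * H)" "t4 <= 1300 * (M * H)" "t1 <= 60 * M" "t3 <= 60 * M" "1 <= M"
       using conjunct1[OF a1] conjunct1[OF a2] conjunct1[OF a3] conjunct1[OF a4] unfolding M_def H_def by (simp_all only: mult.assoc le_add2)
      ultimately have "2 + (t1 + (t2 + (t3 + (t4 + 4)))) <= 2800 * (M * H)" by linarith
      then show ?thesis unfolding M_def H_def by (simp only: mult.assoc)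
     qed
     moreover have "sm sort_regs R4 R" using a1 a2 a3 a4 by simp
     moreover have "sm {1, 2, 3, 4, 5, 6, 7, 8} A5 A" using a1 a2 a3 a4 unfolding A5_def by simp
     ultimately have "Q (2 + (t1 + (t2 + (t3 + (t4 + 4))))) R4 A5" unfolding Q_def by blast
     then show ?case
      by (intro runs_Sto) (use a4 e3 in "simp_all add: lens env_def A5_def")
    qed (simp_all add: lens)
   qed (use e2 in simp_all)
  qed (simp_all add: lens)
 qed (use e in simp_all)
 then have "runs NAMES R A Q" unfolding NAMES_def by (intro runs_SqA runs_Asg) simp_all
 then show ?thesis unfolding Q_def .
qed

end

context ordered begin

definition ltr :: "nat => nat => nat" where "ltr n x = Cn x * (n + 1) + ee x"

lemma ltr_less:
 assumes "!!x. ee x <= n"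
 shows "ltr n x < ltr n y <-> Cn x < Cn y \<or> Cn x = Cn y & ee x < ee y"
 unfolding ltr_def by (rule key_less) (use assms in "auto simp: less_Suc_eq_le simp flip: Suc_eq_plus1")

lemma ltr_eq:
 assumes "!!x. ee x <= n"
 shows "ltr n x = ltr n y <-> Cn x = Cn y & ee x = ee y"
 using ltr_less[OF assms, of x y] ltr_less[OF assms, of y x] by (metis nat_neq_iff)

lemma ltr_pos: "x < m ==> 1 <= ltr n x"
 using Cn_pos[of x] unfolding ltr_def by (metis le_add1 le_trans mult_le_mono2 nat_mult_1_right one_le_mult_iff trans_le_add1 le_add2)

lemma ltr_out: "m <= x ==> ltr n x = 0"
 using Cn_out[of x] unfolding ltr_def ee_def by simp

text \<open>Behind a common first letter, \<open>s\<close> equal runs are \<open>s\<close> pairs of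
  equal tokens.\<close>

lemma eqd_eqb:
 assumes "!!x. ee x <= n" "Cn p = Cn q" "eqb (ltr n) s (p + 1) (q + 1)"
 shows "eqd (2 * s + 1) p q"
 unfolding eqd_def
proof (intro allI impI)
 fix d assume d: "d < 2 * s + 1"
 have e: "Cn (Suc (p + u)) = Cn (Suc (q + u))" "ee (Suc (p + u)) = ee (Suc (q + u))" if "u < s" for u
  using assms(3) that ltr_eq[OF assms(1)] unfolding eqb_def by (auto simp: One_nat_def)
 have "d = 0 \<or> (EX u. d = Suc (2 * u)) \<or> (EX u. d = Suc (Suc (2 * u)))" by presburger
 then consider "d = 0" | u where "d = Suc (2 * u)" | u where "d = Suc (Suc (2 * u))" by blast
 then show "tk p d = tk q d"
 proof cases
  case (2 u)
  then show ?thesis using e(1)[of u] d by (simp add: One_nat_def)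
 next
  case (3 u)
  then show ?thesis using e(2)[of u] d by (simp add: One_nat_def)
 qed (use assms in simp)
qed

lemma lexless_ltb:
 assumes n: "!!x. ee x <= n" and l: "Cn p < Cn q \<or> Cn p = Cn q & ltb (ltr n) d (p + 1) (q + 1)"
 shows "lexless p q"
 using l
proof
 assume "Cn p < Cn q"
 then show ?thesis unfolding lexless_def by (intro exI[of _ 0]) (simp add: eqd_def)
next
 assume a: "Cn p = Cn q & ltb (ltr n) d (p + 1) (q + 1)"
 then obtain s where s: "eqb (ltr n) s (p + 1) (q + 1)" "ltr n (p + 1 + s) < ltr n (q + 1 + s)" unfolding ltb_def by blast
 have E: "eqd (2 * s + 1) p q" using eqd_eqb[OF n] a s by blast
 have pe: "p + 1 + s = Suc (p + s)" "q + 1 + s = Suc (q + s)" "2 * s + 1 = Suc (2 * s)" by (simp_all add: One_nat_def)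
 note E = E[unfolded pe(3)]
 consider "Cn (Suc (p + s)) < Cn (Suc (q + s))" | "Cn (Suc (p + s)) = Cn (Suc (q + s))" "ee (Suc (p + s)) < ee (Suc (q + s))"
  using s(2)[unfolded ltr_less[OF n] pe(1,2)] by blast
 then show ?thesis
 proof cases
  case 1
  then show ?thesis using E unfolding lexless_def by (intro exI[of _ "Suc (2 * s)"]) simp
 next
  case 2
  have "eqd (Suc (Suc (2 * s))) p q" using E 2 eqd_Suc[of "Suc (2 * s)" p q] by simp
  then show ?thesis using 2 unfolding lexless_def by (intro exI[of _ "Suc (Suc (2 * s))"]) simp
 qed
qed

text \<open>Run numbers are positive inside the text and 0 behind it. At the place where the later
  of two different blocks leaves the text the earlier one is still inside, so equal blocks both end
  within the text.\<close>

lemma eqb_bound: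
 assumes "x <= m" "y <= m" "x ~= y" "eqb (ltr n) d x y"
 shows "x + d <= m & y + d <= m"
proof -
 have *: "y + d <= m" if "x < y" "y <= m" "eqb (ltr n) d x y" for x y
 proof (rule ccontr)
  assume "\<not> y + d <= m"
  then have "ltr n (x + (m - y)) = ltr n (y + (m - y))" using that(3)[unfolded eqb_def, rule_format, of "m - y"] that(2) by simp
  moreover have "ltr n (y + (m - y)) = 0" using that by (intro ltr_out) simp
  moreover have "1 <= ltr n (x + (m - y))" using that by (intro ltr_pos) simp
  ultimately show False by simp
 qed
 have "eqb (ltr n) d y x" using assms(4) by (auto simp: eqb_def)
 then show ?thesis using *[of x y] *[of y x] assms by (cases "x < y") auto
qed

end

context prog_in begin

definition level_ok :: "(nat => nat) => nat => (nat => nat) => bool" where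
 "level_ok f t D <-> (ALL x<2 * N. ALL y<2 * N. D x < D y <-> ltb f (2 ^ t) x y) & (ALL x<2 * N. D x <= m)"

lemma level_eq: "level_ok f t D ==> x < 2 * N ==> y < 2 * N ==> D x = D y <-> eqb f (2 ^ t) x y"
 unfolding level_ok_def using ltb_trichotomy[of f "2 ^ t" x y] by (metis nat_neq_iff)

lemma level_intro:
 assumes f: "!!x. x < m ==> 1 <= f x" "!!x. m <= x ==> f x = 0"
  and D: "!!x. x < m ==> 1 <= D x & D x <= m" "!!x. m <= x ==> x < 2 * N ==> D x = 0"
  and l: "!!x y. x < m ==> y < m ==> D x < D y <-> ltb f (2 ^ t) x y"
 shows "level_ok f t D"
 unfolding level_ok_def
proof (intro conjI allI impI)
 fix x assume "x < 2 * N"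
 then show "D x <= m" using D by (cases "x < m") auto
next
 fix x y assume xy: "x < 2 * N" "y < 2 * N"
 have p: "(0::nat) < 2 ^ t" by simp
 consider "x < m" "y < m" | "x < m" "m <= y" | "m <= x" "y < m" | "m <= x" "m <= y" by linarith
 then show "D x < D y <-> ltb f (2 ^ t) x y"
 proof cases
  case 2
  have "\<not> ltb f (2 ^ t) x y"
  proof
   assume "ltb f (2 ^ t) x y"
   then obtain s where s: "eqb f s x y" "f (x + s) < f (y + s)" unfolding ltb_def by blast
   have "f (y + s) = 0" using 2 by (intro f(2)) simp
   then show False using s(2) by simp
  qed
  then show ?thesis using D(1)[OF 2(1)] D(2)[OF 2(2) xy(2)] by simp
 next
  case 3
  have "ltb f (2 ^ t) x y" unfolding ltb_def using p f(1)[OF 3(2)] f(2)[OF 3(1)] by (intro exI[of _ 0]) (simp add: eqb_def)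
  then show ?thesis using D(1)[OF 3(2)] D(2)[OF 3(1) xy(1)] by simp
 next
  case 4
  then have "\<not> ltb f (2 ^ t) x y" unfolding ltb_def using f(2) by simp
  then show ?thesis using D(2)[OF 4(1) xy(1)] D(2)[OF 4(2) xy(2)] by simp
 qed (use l in auto)
qed

text \<open>The doubling step: blocks of twice the length are compared by the names of their first
  halves and then by those of their second halves. Names are at most \<open>m\<close>, so both fit
  into one key with base \<open>m + 1\<close>.\<close>

lemma level_step:
 assumes D: "level_ok f t D" and t: "t < h" and xy: "x < m" "y < m"
 shows "D x * (m + 1) + D (x + 2 ^ t) < D y * (m + 1) + D (y + 2 ^ t) <-> ltb f (2 ^ Suc t) x y"
proof -
 have "(2::nat) ^ t <= 2 ^ h" using t by (intro power_increasing) auto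
 then have b: "x + 2 ^ t < 2 * N" "y + 2 ^ t < 2 * N" "x < 2 * N" "y < 2 * N" using xy mN N_def by linarith+
 have "D x * (m + 1) + D (x + 2 ^ t) < D y * (m + 1) + D (y + 2 ^ t) <-> D x < D y \<or> D x = D y & D (x + 2 ^ t) < D (y + 2 ^ t)"
  by (rule key_less) (use D b in "auto simp: level_ok_def less_Suc_eq_le simp flip: Suc_eq_plus1")
 also have "\<dots> <-> ltb f (2 ^ t) x y \<or> eqb f (2 ^ t) x y & ltb f (2 ^ t) (x + 2 ^ t) (y + 2 ^ t)"
  using level_eq[OF D b(3,4)] D b unfolding level_ok_def by auto
 also have "\<dots> <-> ltb f (2 ^ t + 2 ^ t) x y" using ltb_add by blast
 finally show ?thesis by (simp add: mult_2)
qed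

text \<open>Row \<open>t\<close> of the table has \<open>2 * N\<close> columns, and those from
  \<open>m\<close> on hold 0, the name of the blocks that begin past the end. Thus the column
  \<open>x + 2 ^ t\<close> can be read without a test.\<close>

definition levels :: "(nat => nat) => nat => arrs => bool" where
 "levels f z A <-> (ALL t<=z. level_ok f t (%x. A 9 (t * (2 * N) + x))) & (ALL x. Suc z * (2 * N) <= x & x < (h + 1) * (2 * N) --> A 9 x = 0)"

lemma row_bound: "t <= h ==> x < 2 * N ==> t * (2 * N) + x < (h + 1) * (2 * N)"
proof -
 assume "t <= h" "x < 2 * N"
 then have "t * (2 * N) <= h * (2 * N)" by (intro mult_le_mono1)
 then show ?thesis using \<open>x < 2 * N\<close> unfolding add_mult_distrib mult_1 by linarith
qed

lemma len9: "(h + 1) * (2 * N) < 2 ^ w"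
 using base_len[of 9] lens S_less N_pos by auto

lemma new_level:
 assumes lv: "z ~= 0 ==> levels f (z - 1) A" and zero: "ALL x. z * (2 * N) <= x & x < (h + 1) * (2 * N) --> A 9 x = 0" and z: "z <= h"
  and f: "!!x. x < m ==> 1 <= f x" "!!x. m <= x ==> f x = 0"
  and K: "!!x y. x < m ==> y < m ==> K x < K y <-> ltb f (2 ^ z) x y"
  and so: "sorted_by K O' (%j. A' 9 (z * (2 * N) + j))"
  and fr: "ALL x. \<not> (z * (2 * N) <= x & x < z * (2 * N) + m) --> A' 9 x = A 9 x"
 shows "levels f z A'"
 unfolding levels_def
proof (intro conjI allI impI)
 fix t assume t: "t <= z"
 show "level_ok f t (%x. A' 9 (t * (2 * N) + x))"
 proof (cases "t = z")
  case True
  show ?thesis unfolding True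
  proof (rule level_intro[OF f])
   fix x assume x: "m <= x" "x < 2 * N"
   then have "A' 9 (z * (2 * N) + x) = A 9 (z * (2 * N) + x)" using fr by simp
   then show "A' 9 (z * (2 * N) + x) = 0" using zero row_bound[OF z x(2)] by simp
  qed (use so K in "auto simp: sorted_by_def")
 next
  case False
  then have tz: "Suc t <= z" using t by simp
  have lo: "level_ok f t (%x. A 9 (t * (2 * N) + x))" using lv tz unfolding levels_def by auto
  have "Suc t * (2 * N) <= z * (2 * N)" using tz by (intro mult_le_mono1)
  then have "A' 9 (t * (2 * N) + x) = A 9 (t * (2 * N) + x)" if "x < 2 * N" for x using fr that by simp
  then show ?thesis using lo unfolding level_ok_def by simp
 qed
next
 fix x assume x: "Suc z * (2 * N) <= x & x < (h + 1) * (2 * N)"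
 then have "z * (2 * N) + m <= x" using mN by simp
 then show "A' 9 x = 0" using fr zero x by simp
qed

lemma LEVELS:
 assumes r: "env R" and A: "inp A" "ALL x<m. A 2 x = Cn x" and Cn: "!!x. x < m ==> 1 <= Cn x & Cn x <= m" "!!x. m <= x ==> Cn x = 0"
  and f: "f = (%x. Cn x * (n + 1) + (if x < m then e x else 0))"
 shows "runs LEVELS R A (%t R' A'. t <= 1600 * (m + 1) * (h + 1) * (h + 1) * (h + 1) & levels f h A' &
  sm sort_regs R' R & sm {1, 3, 5, 6, 7, 8, 9} A' A)"
  (is "runs _ _ _ ?Q")
proof -
 define Q where "Q = ?Q"
 define B where "B = 1300 * (m + 1) * (h + 1) * (h + 1)"
 have e0: "R 0 = m" "R 1 = N" "R 2 = h" "R 4 = n" using r by (auto simp: env_def)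
 have fp: "1 <= f x" if "x < m" for x
 proof -
  have "1 * 1 <= Cn x * (n + 1)" using Cn(1)[OF that] by (intro mult_le_mono) auto
  then show ?thesis using that by (simp add: f)
 qed
 have fo: "f x = 0" if "m <= x" for x using Cn(2)[OF that] that by (simp add: f)
 have ltb0: "ltb f (2 ^ 0) x y <-> f x < f y" for x y unfolding ltb_def by (auto simp: eqb_def)
 let ?e0 = "Plus (Times (Ar 2 (Var 20)) (Plus (Var 4) (Num 1))) (Ar 0 (Plus (Twice (Var 20)) (Num 1)))"
 let ?e1 = "Plus (Times (Ar 9 (Plus (Var 26) (Var 20))) (Plus (Var 0) (Num 1))) (Ar 9 (Plus (Var 26) (Plus (Var 20) (Var 25))))"
 let ?c = "Lt (Var 24) (Var 2)"
 define I where "I = (%z R1 A1. R1 24 = z & R1 25 = 2 ^ z & levels f z A1 &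
  sm sort_regs R1 R & sm {1, 3, 5, 6, 7, 8, 9} A1 A)"
 have body: "runs LEVB R1 A1 (%t R' A'. t <= B + 60 * (m + 1) + 40 & I (Suc z) R' A')" if z: "z < h" and i: "I z R1 A1" for z R1 A1
 proof -
  define P where "P = (%t R' A'. t <= B + 60 * (m + 1) + 40 & I (Suc z) R' A')"
  have e1: "R1 0 = m" "R1 1 = N" "R1 2 = h" "R1 24 = z" "R1 25 = 2 ^ z" "env R1" using i r by (auto simp: I_def env_def)
  define D where "D = (%x. A1 9 (z * (2 * N) + x))"
  have lo: "level_ok f z D" using i unfolding I_def levels_def D_def by blast
  have D_le: "D x <= m" if "x < 2 * N" for x using lo that by (auto simp: level_ok_def)
  have pz: "(2::nat) ^ z <= 2 ^ h" using z by (intro power_increasing) auto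
  have xb: "x + 2 ^ z < 2 * N" "x < 2 * N" if "x < m" for x using that pz mN N_def by linarith+
  have off: "z * (2 * N) + 2 * N <= (h + 1) * (2 * N)" using row_bound[of z "2 * N - 1"] z N_pos by simp
  have offw: "z * (2 * N) + 2 * N < 2 ^ w" using off len9 by linarith
  have K: "runs (FILL ?e1) (R1(26 := z * (2 * N))) A1 (%t R' A'. t <= 60 * (m + 1) & (ALL x<m. A' 1 x = D x * (m + 1) + D (x + 2 ^ z)) & (ALL y. y ~= 20 --> R' y = (R1(26 := z * (2 * N))) y) & (ALL b. b ~= 1 --> A' b = A1 b))"
  proof (rule FILL)
   fix x R2 A2 assume a: "x < m" "R2 20 = x" "!!y. y ~= 20 ==> R2 y = (R1(26 := z * (2 * N))) y" "!!b. b ~= 1 ==> A2 b = A1 b"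
   have d: "D x <= m" "D (x + 2 ^ z) <= m" using lo xb[OF a(1)] by (auto simp: level_ok_def)
   have "D x * (m + 1) + D (x + 2 ^ z) < 2 ^ w - 1" by (rule quad) (use d mn in auto)
   then have "D x * (m + 1) + D (x + 2 ^ z) < 2 ^ w" by linarith
   moreover have "m + 1 < 2 ^ w" by (rule lin_bound) (use mn in simp)
   moreover have "z * (2 * N) + (x + 2 ^ z) < (h + 1) * (2 * N)" "z * (2 * N) + x < (h + 1) * (2 * N)" using off xb[OF a(1)] by linarith+
   ultimately show "okx R2 A2 ?e1 & ev R2 A2 ?e1 = D x * (m + 1) + D (x + 2 ^ z)"
    using a e1 len9 by (simp add: lens D_def)
  qed (use e1 in simp_all)
  have "runs (FILL ?e1 ;; inc 24 ;; 19 ::= Times (Var 24) (Twice (Var 1)) ;; SORT 9 ;; 25 ::= Twice (Var 25)) (R1(26 := z * (2 * N))) A1 (%t. P (6 + t))"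
  proof (rule runs_SqM'[OF _ K], goal_cases)
   case (1 t2 R2 A2) note a2 = this
   define R3 where "R3 = R2(24 := z + 1, 19 := (z + 1) * (2 * N))"
   have e3: "env R3" "R3 19 = (z + 1) * (2 * N)" using a2 e1 by (auto simp: R3_def env_def)
   have K3: "ALL x<m. A2 1 x < top"
   proof (intro allI impI)
    fix x assume x: "x < m"
    have "D x * (m + 1) + D (x + 2 ^ z) < 2 ^ w - 1" by (rule quad) (use D_le[OF xb(1)[OF x]] D_le[OF xb(2)[OF x]] mn in simp_all)
    then show "A2 1 x < top" using a2 x by simp
   qed
   have rb: "(z + 1) * (2 * N) + m <= len 9" using row_bound[of "z + 1" m] z mN N_pos lens by simp
   have "runs (SORT 9 ;; 25 ::= Twice (Var 25)) R3 A2 (%t. P (6 + (t2 + (10 + t))))"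
   proof (rule runs_SqM'[OF _ SORT[where R = R3 and A = A2 and d = 9, OF e3 K3]], goal_cases)
    case (1 t4 R4 A4) note a4 = this
    have sz: "z + 1 = Suc z" by simp
    have "A2 9 = A1 9" using a2 by simp
    then have lv: "levels f z A2" using i by (simp add: I_def levels_def)
    have "levels f (Suc z) A4"
    proof (rule new_level[where A = A2 and K = "A2 1" and O' = "A4 3"])
     show "A2 1 x < A2 1 y <-> ltb f (2 ^ Suc z) x y" if "x < m" "y < m" for x y
      using level_step[OF lo z that] a2 that by simp
    qed (use lv z a4[unfolded sz] fp fo in "simp_all add: levels_def")
    moreover have "R4 24 = Suc z" "R4 25 = 2 ^ z" "sm sort_regs R4 R"
     using a4 a2 i by (auto simp: R3_def I_def)
    moreover have "sm {1, 3, 5, 6, 7, 8, 9} A4 A" using a4 a2 i by (auto simp: I_def)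
    ultimately have "I (Suc z) (R4(25 := 2 * 2 ^ z)) A4" "R4 25 = 2 ^ z" unfolding I_def by auto
    moreover have "2 * 2 ^ z < (2::nat) ^ w" using pz N_def N_small by linarith
    ultimately show ?case
     by (intro runs_Asg) (use a4 a2 in "simp_all add: P_def B_def")
   qed (use rb in auto)
   moreover have "z + 1 < 2 ^ w" "(z + 1) * (2 * N) < 2 ^ w" "2 * N < 2 ^ w" using rb base_len[of 9] lens S_less z h_less N_small by auto
   ultimately show ?case
    by (intro runs_Sq[of "inc 24"] runs_SqA runs_Asg) (use a2 e1 in "simp_all add: R3_def ac_simps")
  qed
  then have "runs LEVB R1 A1 P" unfolding LEVB_def
   by (intro runs_SqA runs_Asg) (use e1 offw in "simp_all add: ac_simps")
  then show ?thesis unfolding P_def .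
 qed
 have loop: "runs (Wh ?c LEVB) R1 A1 (%t R' A'. t <= h * (B + 60 * (m + 1) + 40 + xk ?c + 1) + xk ?c + 1 & I h R' A')" if I0: "I 0 R1 A1" for R1 A1
 proof (rule runs_For)
  show "I 0 R1 A1" by (rule I0)
 next
  fix z R1 A1 assume z: "z < h" and i: "I z R1 A1"
  then show "okc R1 A1 ?c & holds R1 A1 ?c & runs LEVB R1 A1 (%t R' A'. t <= B + 60 * (m + 1) + 40 & I (Suc z) R' A')"
   using body[OF z i] e0 by (simp add: I_def)
 next
  fix R1 A1 assume "I h R1 A1"
  then show "okc R1 A1 ?c & \<not> holds R1 A1 ?c" using e0 by (simp add: I_def)
 qed
 have "runs LEVELS R A Q" unfolding LEVELS_def
 proof (rule runs_SqM'[OF _ ZERO[OF r]], goal_cases)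
  case (1 t1 R1 A1) note a1 = this
  have "runs (FILL ?e0 ;; SORT 9 ;; 24 ::= Num 0 ;; 25 ::= Num 1 ;; Wh ?c LEVB) (R1(19 := 0)) A1 (%t. Q (t1 + (2 + t)))"
  proof (rule runs_SqM'[OF _ FILL[where g = f]], goal_cases)
   fix x R2 A2 assume a: "x < m" "R2 20 = x" "!!y. y ~= 20 ==> R2 y = (R1(19 := 0)) y" "!!b. b ~= 1 ==> A2 b = A1 b"
   have "Cn x * (n + 1) + e x < 2 ^ w - 1" by (rule quad) (use Cn(1)[OF a(1)] e_le[OF a(1)] mn in auto)
   then have "Cn x * (n + 1) + e x < 2 ^ w" by linarith
   moreover have "n + 1 < 2 ^ w" by (rule lin_bound) simp
   ultimately show "okx R2 A2 ?e0 & ev R2 A2 ?e0 = f x"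
    using a a1 e0 A N_small mN by (simp add: lens f inp_def)
  next
   case (1 t2 R2 A2) note a2 = this
   have e2: "env R2" "R2 19 = 0" using a2 a1 r by (auto simp: env_def)
   have K2: "ALL x<m. A2 1 x < top"
   proof (intro allI impI)
    fix x assume x: "x < m"
    have "Cn x * (n + 1) + e x < 2 ^ w - 1" by (rule quad) (use Cn(1)[OF x] e_le[OF x] mn in auto)
    then show "A2 1 x < top" using a2 x by (simp add: f)
   qed
   have rb: "0 + m <= len 9" using row_bound[of 0 m] mN N_pos lens by simp
   show ?case
   proof (rule runs_SqM'[OF _ SORT[where R = R2 and A = A2 and d = 9, OF e2 K2]], goal_cases)
    case (1 t3 R3 A3) note a3 = this
    have lv: "levels f 0 A3"
    proof (rule new_level[where A = A2 and K = "A2 1" and O' = "A3 3"])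
     show "A2 1 x < A2 1 y <-> ltb f (2 ^ 0) x y" if "x < m" "y < m" for x y
      using a2 that ltb0 by simp
    qed (use a1 a2 a3 fp fo in auto)
    have I0: "I 0 (R3(24 := 0, 25 := 1)) A3" unfolding I_def using lv a1 a2 a3 by auto
    have "runs (Wh ?c LEVB) (R3(24 := 0, 25 := 1)) A3 (%t'. Q (t1 + (2 + (t2 + (t3 + (4 + t'))))))"
    proof (rule runs_mono'[OF _ loop[OF I0]], goal_cases)
     case (1 t4 R4 A4) note a4 = this
     have "t1 + (2 + (t2 + (t3 + (4 + t4)))) <= 1600 * (m + 1) * (h + 1) * (h + 1) * (h + 1)"
     proof -
      define M H U where "M = m + 1" and "H = (h + 1) * (h + 1)" and "U = M * H"
      have H1: "1 <= H" "h + 1 <= H" unfolding H_def by (auto simp: One_nat_def)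
      have M1: "3 <= M" "2 * N <= 4 * M" using m2 mN unfolding M_def by auto
      have MU: "M <= U" unfolding U_def using mult_le_mono2[OF H1(1), of M] by simp
      have B': "B = 1300 * U" unfolding B_def H_def U_def M_def by (simp only: mult.assoc)
      have s1: "B + 60 * (m + 1) + 40 + xk ?c + 1 <= 1420 * U" using MU B' M1 unfolding M_def[symmetric] by simp
      have "t4 <= h * (1420 * U) + 3" using conjunct1[OF a4] mult_le_mono2[OF s1, of h] by (simp only: xk.simps xc.simps)
      moreover have "t3 <= 1300 * U" using conjunct1[OF a3] unfolding H_def U_def M_def by (simp only: mult.assoc)
      moreover have "t1 <= 80 * U + 20"
      proof -
       have "(h + 1) * (2 * N) <= H * (4 * M)" by (rule mult_le_mono[OF H1(2) M1(2)])
       then have "(h + 1) * (2 * N) <= 4 * U" unfolding U_def by (simp only: ac_simps)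
       then show ?thesis using conjunct1[OF a1] by linarith
      qed
      moreover have "t2 <= 60 * U" using conjunct1[OF a2] MU unfolding M_def[symmetric] by linarith
      ultimately have "t1 + (2 + (t2 + (t3 + (4 + t4)))) <= h * (1420 * U) + 1600 * U" using MU M1 by linarith
      also have "\<dots> <= 1600 * U * (h + 1)" by (simp add: algebra_simps)
      finally show ?thesis unfolding U_def H_def M_def by (simp only: ac_simps)
     qed
     then show ?case using a4 unfolding Q_def I_def by blast
    qed
    then show ?case
     by (intro runs_SqA runs_Asg) (simp_all add: ac_simps)
   qed (use rb in auto)
  qed (use a1 e0 in simp_all)
  then show ?case
   by (intro runs_SqA runs_Asg) simp_all
 qed
 then show ?thesis unfolding Q_def .
qed

lemma ORDER:
 assumes r: "env R" and A: "ALL x<m. A 2 x = Cn x" and lv: "levels f h A" and o: "ordered m c e Cn k top" and Cm: "!!x. x < m ==> Cn x <= m"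
  and f: "f = (%x. Cn x * (n + 1) + (if x < m then e x else 0))"
 shows "runs ORDER R A (%t R' A'. t <= 1400 * (m + 1) * (h + 1) * (h + 1) & sweep m c e Cn (A' 3) k top &
  sm sort_regs R' R & sm {1, 3, 4, 5, 6, 7, 8} A' A)"
  (is "runs _ _ _ ?Q")
proof -
 define Q where "Q = ?Q"
 interpret o: ordered m c e Cn "%x. x" k top by (rule o)
 have fl: "f = o.ltr n" unfolding f o.ltr_def o.ee_def by simp
 have en: "o.ee x <= n" for x using e_le by (simp add: o.ee_def)
 have e0: "R 0 = m" "R 1 = N" "R 2 = h" using r by (auto simp: env_def)
 define D where "D = (%x. A 9 (h * (2 * N) + x))"
 have lo: "level_ok f h D" using lv unfolding levels_def D_def by blast
 have xb: "x + 1 < 2 * N" if "x < m" for x using that mN N_pos by linarith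
 have d: "D (x + 1) <= m" if "x < m" for x using lo xb[OF that] by (auto simp: level_ok_def)
 define K where "K = (%x. Cn x * (m + 1) + D (x + 1))"
 have Kq: "K x < 2 ^ w - 1" if "x < m" for x unfolding K_def by (rule quad) (use d[OF that] Cm[OF that] mn in auto)
 have less: "K x < K y <-> Cn x < Cn y \<or> Cn x = Cn y & ltb f (2 ^ h) (x + 1) (y + 1)" if xy: "x < m" "y < m" for x y
 proof -
  have "K x < K y <-> Cn x < Cn y \<or> Cn x = Cn y & D (x + 1) < D (y + 1)"
   unfolding K_def by (rule key_less) (use d xy in "auto simp: less_Suc_eq_le simp flip: Suc_eq_plus1")
  then show ?thesis using lo xb xy unfolding level_ok_def by blast
 qed
 \<comment> \<open>As \<open>2 ^ h\<close> is at least \<open>m\<close>, blocks of this length that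
   begin behind different runs cannot both end within the text, so they are never equal and the
   order has no ties.\<close>
 have inj: "K x ~= K y" if xy: "x < m" "y < m" "x ~= y" for x y
 proof
  assume "K x = K y"
  then have nl: "\<not> K x < K y" "\<not> K y < K x" by simp_all
  then have "\<not> ltb f (2 ^ h) (x + 1) (y + 1)" "\<not> ltb f (2 ^ h) (y + 1) (x + 1)"
   using less[OF xy(1,2)] less[OF xy(2,1)] by linarith+
  then have "eqb f (2 ^ h) (x + 1) (y + 1)" using ltb_trichotomy by blast
  then have "x + 1 + 2 ^ h <= m & y + 1 + 2 ^ h <= m" unfolding fl by (intro o.eqb_bound) (use xy in auto)
  then show False using mN N_def by simp
 qed
 let ?e = "Plus (Times (Ar 2 (Var 20)) (Plus (Var 0) (Num 1))) (Ar 9 (Plus (Var 26) (Plus (Var 20) (Num 1))))"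
 let ?R = "R(19 := 0, 26 := h * (2 * N))"
 have rw: "h * (2 * N) + (x + 1) < (h + 1) * (2 * N)" if "x < m" for x using row_bound[of h "x + 1"] xb[OF that] by simp
 have "runs (FILL ?e ;; SORT 4) ?R A (%t. Q (8 + t))"
 proof (rule runs_SqM'[OF _ FILL[where g = K]], goal_cases)
  fix x R2 A2 assume a: "x < m" "R2 20 = x" "!!y. y ~= 20 ==> R2 y = ?R y" "!!b. b ~= 1 ==> A2 b = A b"
  have "Cn x * (m + 1) + D (x + 1) < 2 ^ w" using Kq[OF a(1)] unfolding K_def by linarith
  moreover have "m + 1 < 2 ^ w" by (rule lin_bound) (use mn in simp)
  ultimately show "okx R2 A2 ?e & ev R2 A2 ?e = K x"
   using a e0 A len9 rw[OF a(1)] by (simp add: lens D_def K_def)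
 next
  case (1 t1 R1 A1) note a1 = this
  have e1: "env R1" "R1 19 = 0" using a1 r by (auto simp: env_def)
  have K1: "ALL x<m. A1 1 x < top" using a1 Kq by simp
  show ?case
  proof (rule runs_mono'[OF _ SORT[where R = R1 and A = A1 and d = 4, OF e1 K1]], goal_cases)
   case (1 t3 R3 A3) note a3 = this
   have bij: "bij_betw (A3 3) {..<m} {..<m}" using a3 unfolding sorted_by_def by blast
   have sw: "sweep m c e Cn (A3 3) k top"
   proof (intro sweep.intro sweep_axioms.intro)
    show "ordered m c e Cn k top" by (rule o)
    fix x y assume xy: "x < y" "y < m"
    have lt: "A3 3 x < m" "A3 3 y < m" using bij xy unfolding bij_betw_def by auto
    have "A3 3 x ~= A3 3 y" using bij xy unfolding bij_betw_def inj_on_def by (metis lessThan_iff less_trans nat_neq_iff)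
    then have "K (A3 3 x) ~= K (A3 3 y)" using inj lt by blast
    moreover have "A1 1 (A3 3 x) <= A1 1 (A3 3 y)" using conjunct1[OF conjunct2[OF a3]] xy unfolding sorted_by_def by blast
    then have "K (A3 3 x) <= K (A3 3 y)" using a1 lt by simp
    ultimately have "K (A3 3 x) < K (A3 3 y)" by simp
    then show "ordered.lexless m e Cn (A3 3 x) (A3 3 y)" using less[OF lt] o.lexless_ltb[OF en] unfolding fl by blast
   qed (use bij in auto)
   define M H where "M = m + 1" and "H = (h + 1) * (h + 1)"
   have "M * 1 <= M * H" unfolding H_def by (intro mult_le_mono2) (simp add: One_nat_def)
   moreover have "t3 <= 1300 * (M * H)" "t1 <= 60 * M" "1 <= M"
    using conjunct1[OF a1] conjunct1[OF a3] unfolding M_def H_def by (simp_all only: mult.assoc le_add2)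
   ultimately have "8 + (t1 + t3) <= 1400 * (M * H)" by linarith
   then have "8 + (t1 + t3) <= 1400 * (m + 1) * (h + 1) * (h + 1)" unfolding M_def H_def by (simp only: mult.assoc)
   then show ?case unfolding Q_def using sw a1 a3 by simp
  qed (simp_all add: lens)
 qed (use e0 in simp_all)
 moreover have "h * (2 * N) < 2 ^ w" using rw[of 0] len9 m2 by linarith
 ultimately have "runs ORDER R A Q" unfolding ORDER_def
  by (intro runs_SqA runs_Asg) (use e0 N_small in "simp_all add: ac_simps")
 then show ?thesis unfolding Q_def .
qed

end

section \<open>Reflected ranks, range maxima and common extensions\<close>

definition REFL :: stm where
 "REFL = 20 ::= Num 0 ;; Wh (Lt (Var 20) (Var 0))
  (Sto 3 (Minus (Minus (Twice (Var 0)) (Num 1)) (Var 20)) (Ar 3 (Var 20)) ;; inc 20)"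

definition MX0 :: stm where
 "MX0 = 20 ::= Num 0 ;; Wh (Lt (Var 20) (Twice (Var 0)))
  (Sto 10 (Var 20) (Ar 0 (Plus (Twice (Ar 3 (Var 20))) (Num 1))) ;; inc 20)"

definition MXB :: stm where
 "MXB = 27 ::= Ar 10 (Plus (Var 26) (Var 20)) ;;
  Ite (Lt (Plus (Var 20) (Var 25)) (Twice (Var 0)))
   (Ite (Lt (Var 27) (Ar 10 (Plus (Var 26) (Plus (Var 20) (Var 25)))))
    (27 ::= Ar 10 (Plus (Var 26) (Plus (Var 20) (Var 25)))) Nop) Nop ;;
  Sto 10 (Plus (Var 26) (Plus (Twice (Var 0)) (Var 20))) (Var 27) ;; inc 20"

definition MXL :: stm where
 "MXL = 26 ::= Times (Var 24) (Twice (Var 0)) ;; 20 ::= Num 0 ;; Wh (Lt (Var 20) (Twice (Var 0))) MXB ;;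
  25 ::= Twice (Var 25) ;; inc 24"

definition MX :: stm where
 "MX = MX0 ;; 24 ::= Num 0 ;; 25 ::= Num 1 ;; Wh (Lt (Var 24) (Var 2)) MXL"

definition LCEB :: stm where
 "LCEB = 27 ::= Minus (Var 27) (Num 1) ;; 28 ::= Times (Var 27) (Twice (Var 1)) ;;
  Ite (Eq (Ar 9 (Plus (Var 28) (Plus (Var 24) (Var 26)))) (Ar 9 (Plus (Var 28) (Plus (Var 25) (Var 26)))))
   (26 ::= Plus (Var 26) (Var 29)) Nop ;;
  29 ::= Half (Var 29)"

definition LCE :: stm where
 "LCE = 26 ::= Num 0 ;; 27 ::= Plus (Var 2) (Num 1) ;; 29 ::= Var 1 ;; Wh (Lt (Num 0) (Var 27)) LCEB"

definition XTB :: stm where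
 "XTB = 21 ::= Ar 3 (Minus (Var 40) (Num 1)) ;; 22 ::= Ar 3 (Var 40) ;;
  Ite (Eq (Ar 2 (Var 21)) (Ar 2 (Var 22)))
   (24 ::= Plus (Var 21) (Num 1) ;; 25 ::= Plus (Var 22) (Num 1) ;; LCE ;;
    27 ::= Plus (Twice (Var 26)) (Num 1) ;;
    Ite (Eq (Ar 2 (Plus (Var 24) (Var 26))) (Ar 2 (Plus (Var 25) (Var 26)))) (inc 27) Nop)
   (27 ::= Num 0) ;;
  Sto 11 (Var 40) (Var 27) ;; inc 40"

definition XT :: stm where
 "XT = Sto 11 (Num 0) (Num 0) ;; Sto 11 (Var 0) (Num 0) ;; 40 ::= Num 1 ;; Wh (Lt (Var 40) (Var 0)) XTB"

definition len_of :: "ex => ex" where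
 "len_of a = Ar 0 (Plus (Twice a) (Num 1))"

definition REACH :: stm where
 "REACH = 32 ::= Var 31 ;;
  Ite (Lt (len_of (Var 31)) (len_of (Var 30))) Nop
   (24 ::= Plus (Var 30) (Num 1) ;; 25 ::= Plus (Var 31) (Num 1) ;; LCE ;; 32 ::= Plus (Var 31) (Var 26) ;;
    Ite (Eq (Ar 2 (Plus (Var 25) (Var 26))) (Ar 2 (Plus (Var 24) (Var 26))))
     (Ite (Lt (len_of (Plus (Var 24) (Var 26))) (len_of (Plus (Var 25) (Var 26)))) Nop (inc 32)) Nop)"

definition NEXTB :: stm where
 "NEXTB = 35 ::= Minus (Var 35) (Num 1) ;;
  Ite (Lt (Var 33) (Twice (Var 0)))
   (Ite (Lt (Ar 10 (Plus (Times (Var 35) (Twice (Var 0))) (Var 33))) (Var 34)) (33 ::= Plus (Var 33) (Var 36)) Nop) Nop ;;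
  36 ::= Half (Var 36)"

definition NEXT :: stm where
 "NEXT = 35 ::= Plus (Var 2) (Num 1) ;; 36 ::= Var 1 ;; Wh (Lt (Num 0) (Var 35)) NEXTB"

locale tables = prog_in w S base len h N m n k LG c e + sweep m c e Cn ORD k "2 ^ w - 1"
 for w S base len h N m n k LG c e Cn ORD
begin

abbreviation (input) f where "f \<equiv> ltr n"

text \<open>The ranks followed by their reversal. Going down from rank \<open>x\<close> is going up
  from position \<open>2 * m - x\<close>, so one search routine serves both directions.\<close>

definition OD :: "nat => nat" where
 "OD z = (if z < m then ORD z else ORD (2 * m - 1 - z))"

lemma OD_lt: "z < 2 * m ==> OD z < m"
 using ORD_lt[of z] ORD_lt[of "2 * m - 1 - z"] m2 by (auto simp: OD_def)

definition base_tabs :: "arrs => bool" where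
 "base_tabs A <-> inp A & (ALL x<=m. A 2 x = Cn x) & levels f h A"

definition tab_O :: "arrs => bool" where
 "tab_O A <-> (ALL x<2 * m. A 3 x = OD x)"

text \<open>A maximum is fixed by its strict upper bounds. In this form a window that reaches past
  \<open>2 * m\<close> is simply cut off, without a special case.\<close>

definition row :: "arrs => nat => bool" where
 "row A t <-> (ALL x<2 * m. ALL y. A 10 (t * (2 * m) + x) < y <-> (ALL z. x <= z & z < x + 2 ^ t & z < 2 * m --> e (OD z) < y))"

lemma en: "ee x <= n" using e_le by (simp add: ee_def)

lemma m_small: "2 * m + 2 * N + 8 < 2 ^ w"
 using mN mn by (intro lin_bound) simp

lemma REFL:
 assumes r: "R 0 = m" and A: "ALL x<m. A 3 x = ORD x"
 shows "runs REFL R A (%t R' A'. t <= 30 * (m + 1) & tab_O A' & (ALL y. y ~= 20 --> R' y = R y) & (ALL b. b ~= 3 --> A' b = A b))"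
  (is "runs _ _ _ ?Q")
proof -
 define Q where "Q = ?Q"
 define I where "I = (%z R1 A1. R1 20 = z & (ALL x<m. A1 3 x = ORD x) & (ALL x<z. A1 3 (2 * m - 1 - x) = ORD x) & (ALL y. y ~= 20 --> R1 y = R y) & (ALL b. b ~= 3 --> A1 b = A b))"
 let ?c = "Lt (Var 20) (Var 0)" and ?b = "Sto 3 (Minus (Minus (Twice (Var 0)) (Num 1)) (Var 20)) (Ar 3 (Var 20)) ;; inc 20"
 have "runs (Wh ?c ?b) (R(20 := 0)) A (%t R' A'. t <= m * (20 + xk ?c + 1) + xk ?c + 1 & I m R' A')"
 proof (rule runs_For)
  show "I 0 (R(20 := 0)) A" using A by (simp add: I_def)
 next
  fix z R1 A1 assume z: "z < m" and i: "I z R1 A1"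
  have "I (Suc z) (R1(20 := z + 1)) (A1(3 := (A1 3)(2 * m - 1 - z := ORD z)))" using i z unfolding I_def by (auto simp: less_Suc_eq)
  then have "runs ?b R1 A1 (%t R' A'. t <= 20 & I (Suc z) R' A')"
   by (intro runs_intros) (use i z m_small r in "simp_all add: lens I_def")
  then show "okc R1 A1 ?c & holds R1 A1 ?c & runs ?b R1 A1 (%t R' A'. t <= 20 & I (Suc z) R' A')"
   using i z r by (simp add: I_def)
 next
  fix R1 A1 assume "I m R1 A1"
  then show "okc R1 A1 ?c & \<not> holds R1 A1 ?c" using r by (simp add: I_def)
 qed
 then have "runs (Wh ?c ?b) (R(20 := 0)) A (%t. Q (2 + t))"
 proof (rule runs_mono)
  fix t R1 A1 assume a: "t <= m * (20 + xk ?c + 1) + xk ?c + 1 & I m R1 A1"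
  have "A1 3 x = OD x" if "x < 2 * m" for x
  proof (cases "x < m")
   case False
   then have "2 * m - 1 - x < m" "2 * m - 1 - (2 * m - 1 - x) = x" using that by auto
   then show ?thesis using a False unfolding I_def OD_def by metis
  qed (use a in "simp add: I_def OD_def")
  then show "Q (2 + t) R1 A1" using a unfolding Q_def I_def tab_O_def by auto
 qed
 then have "runs REFL R A Q" unfolding REFL_def by (intro runs_SqA runs_Asg) simp_all
 then show ?thesis unfolding Q_def .
qed

lemma row10: "t <= h ==> x < 2 * m ==> t * (2 * m) + x < (h + 1) * (2 * m)"
proof -
 assume "t <= h" "x < 2 * m"
 then have "t * (2 * m) <= h * (2 * m)" by (intro mult_le_mono1)
 then show ?thesis using \<open>x < 2 * m\<close> unfolding add_mult_distrib mult_1 by linarith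
qed

lemma len10: "(h + 1) * (2 * m) < 2 ^ w"
 using base_len[of 10] lens S_less m2 by auto

lemma MX0:
 assumes r: "R 0 = m" and A: "tab_O A" "inp A"
 shows "runs MX0 R A (%t R' A'. t <= 60 * (m + 1) & row A' 0 & (ALL y. y ~= 20 --> R' y = R y) & (ALL b. b ~= 10 --> A' b = A b))"
  (is "runs _ _ _ ?Q")
proof -
 define Q where "Q = ?Q"
 define I where "I = (%z R1 A1. R1 20 = z & (ALL x<z. A1 10 x = e (OD x)) & (ALL y. y ~= 20 --> R1 y = R y) & (ALL b. b ~= 10 --> A1 b = A b))"
 let ?c = "Lt (Var 20) (Twice (Var 0))" and ?b = "Sto 10 (Var 20) (Ar 0 (Plus (Twice (Ar 3 (Var 20))) (Num 1))) ;; inc 20"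
 have "runs (Wh ?c ?b) (R(20 := 0)) A (%t R' A'. t <= (2 * m) * (18 + xk ?c + 1) + xk ?c + 1 & I (2 * m) R' A')"
 proof (rule runs_For)
  show "I 0 (R(20 := 0)) A" by (simp add: I_def)
 next
  fix z R1 A1 assume z: "z < 2 * m" and i: "I z R1 A1"
  have "I (Suc z) (R1(20 := z + 1)) (A1(10 := (A1 10)(z := e (OD z))))" using i z unfolding I_def by (auto simp: less_Suc_eq)
  then have "runs ?b R1 A1 (%t R' A'. t <= 18 & I (Suc z) R' A')"
   by (intro runs_intros) (use i z m_small r A OD_lt[OF z] row10[of 0 z] in "simp_all add: lens I_def tab_O_def inp_def")
  then show "okc R1 A1 ?c & holds R1 A1 ?c & runs ?b R1 A1 (%t R' A'. t <= 18 & I (Suc z) R' A')"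
   using i z r m_small by (simp add: I_def)
 next
  fix R1 A1 assume "I (2 * m) R1 A1"
  then show "okc R1 A1 ?c & \<not> holds R1 A1 ?c" using r m_small by (simp add: I_def)
 qed
 then have "runs (Wh ?c ?b) (R(20 := 0)) A (%t. Q (2 + t))"
 proof (rule runs_mono)
  fix t R1 A1 assume a: "t <= (2 * m) * (18 + xk ?c + 1) + xk ?c + 1 & I (2 * m) R1 A1"
  have "row A1 0" unfolding row_def
  proof (intro allI impI)
   fix x y assume "x < 2 * m"
   moreover have "x <= z & z < x + 2 ^ 0 & z < 2 * m <-> z = x & z < 2 * m" for z by auto
   ultimately show "(A1 10 (0 * (2 * m) + x) < y) = (ALL z. x <= z & z < x + 2 ^ 0 & z < 2 * m --> e (OD z) < y)"
    using a by (simp add: I_def)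
  qed
  then show "Q (2 + t) R1 A1" using a unfolding Q_def I_def by auto
 qed
 then have "runs MX0 R A Q" unfolding MX0_def by (intro runs_SqA runs_Asg) simp_all
 then show ?thesis unfolding Q_def .
qed

lemma row_step:
 assumes rw: "row A t" and x: "x < 2 * m"
 shows "(if x + 2 ^ t < 2 * m & A 10 (t * (2 * m) + x) < A 10 (t * (2 * m) + (x + 2 ^ t)) then A 10 (t * (2 * m) + (x + 2 ^ t)) else A 10 (t * (2 * m) + x)) < y
  <-> (ALL z. x <= z & z < x + 2 ^ Suc t & z < 2 * m --> e (OD z) < y)" (is "?M < y <-> ?P")
proof -
 have p: "(2::nat) ^ Suc t = 2 ^ t + 2 ^ t" by simp
 have a: "A 10 (t * (2 * m) + x) < y <-> (ALL z. x <= z & z < x + 2 ^ t & z < 2 * m --> e (OD z) < y)" using rw x unfolding row_def by blast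
 show ?thesis
 proof (cases "x + 2 ^ t < 2 * m")
  case True
  have b: "A 10 (t * (2 * m) + (x + 2 ^ t)) < y <-> (ALL z. x + 2 ^ t <= z & z < x + 2 ^ t + 2 ^ t & z < 2 * m --> e (OD z) < y)" using rw True unfolding row_def by blast
  have "?M < y <-> A 10 (t * (2 * m) + x) < y & A 10 (t * (2 * m) + (x + 2 ^ t)) < y" using True by auto
  also have "\<dots> <-> ?P" unfolding a b p
  proof (intro iffI allI impI conjI; elim conjE)
   fix z assume q: "ALL z. x <= z & z < x + 2 ^ t & z < 2 * m --> e (OD z) < y" "ALL z. x + 2 ^ t <= z & z < x + 2 ^ t + 2 ^ t & z < 2 * m --> e (OD z) < y"
    and z: "x <= z" "z < x + (2 ^ t + 2 ^ t)" "z < 2 * m"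
   show "e (OD z) < y" using q(1)[rule_format, of z] q(2)[rule_format, of z] z by (cases "z < x + 2 ^ t") auto
  qed auto
  finally show ?thesis .
 next
  case False
  then have "?M < y <-> A 10 (t * (2 * m) + x) < y" by simp
  also have "\<dots> <-> ?P" unfolding a p using False by (auto intro: order_less_le_trans)
  finally show ?thesis .
 qed
qed

lemma MXL:
 assumes r: "R 0 = m" "R 24 = t" "R 25 = 2 ^ t" and t: "t < h" and A: "!!t'. t' <= t ==> row A t'"
 shows "runs MXL R A (%u R' A'. u <= 120 * (m + 1) & (ALL t'<=Suc t. row A' t') & R' 24 = Suc t & R' 25 = 2 ^ Suc t &
  sm {20, 24, 25, 26, 27} R' R & (ALL b. b ~= 10 --> A' b = A b))"
  (is "runs _ _ _ ?Q")
proof -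
 define Q where "Q = ?Q"
 define off where "off = t * (2 * m)"
 define v where "v = (%x. if x + 2 ^ t < 2 * m & A 10 (off + x) < A 10 (off + (x + 2 ^ t)) then A 10 (off + (x + 2 ^ t)) else A 10 (off + x))"
 have pt: "(2::nat) ^ t <= N" unfolding N_def using t by (intro power_increasing) auto
 have ob: "off + (2 * m + x) < (h + 1) * (2 * m)" if "x < 2 * m" for x
  using row10[of "Suc t" x] t that by (simp add: off_def)
 define I where "I = (%z R1 A1. R1 20 = z & R1 26 = off & (ALL x<z. A1 10 (off + (2 * m + x)) = v x) & (ALL x<off + 2 * m. A1 10 x = A 10 x) &
  sm {20, 26, 27} R1 R & (ALL b. b ~= 10 --> A1 b = A b))"
 let ?c = "Lt (Var 20) (Twice (Var 0))"
 have loop: "runs (Wh ?c MXB) (R(26 := off, 20 := 0)) A (%t R' A'. t <= (2 * m) * (50 + xk ?c + 1) + xk ?c + 1 & I (2 * m) R' A')"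
 proof (rule runs_For)
  show "I 0 (R(26 := off, 20 := 0)) A" by (simp add: I_def)
 next
  fix z R1 A1 assume z: "z < 2 * m" and i: "I z R1 A1"
  have e1: "R1 0 = m" "R1 20 = z" "R1 26 = off" "R1 25 = 2 ^ t" using i r unfolding I_def by auto
  have a1: "A1 10 (off + z) = A 10 (off + z)" "z + 2 ^ t < 2 * m ==> A1 10 (off + (z + 2 ^ t)) = A 10 (off + (z + 2 ^ t))" using i z unfolding I_def by auto
  have b1: "off + z < (h + 1) * (2 * m)" "off + (2 * m + z) < (h + 1) * (2 * m)" "off + (2 * m + z) < 2 ^ w" using ob[OF z] len10 by linarith+
  have b2: "z + 2 ^ t < 2 ^ w" "2 * m + z < 2 ^ w" using z pt m_small b1 by linarith+
  have b3: "off + (z + 2 ^ t) < (h + 1) * (2 * m)" "off + (z + 2 ^ t) < 2 ^ w" if "z + 2 ^ t < 2 * m"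
   using ob[of 0] that len10 m2 by linarith+
  have II: "I (Suc z) (R1(27 := v z, 20 := z + 1)) (A1(10 := (A1 10)(off + (2 * m + z) := v z)))"
   using i unfolding I_def by (auto simp: less_Suc_eq)
  define P where "P = (%(t::nat) R' A'. t <= 50 & I (Suc z) R' A')"
  have fin: "runs (Sto 10 (Plus (Var 26) (Plus (Twice (Var 0)) (Var 20))) (Var 27) ;; inc 20) (R1(27 := v z)) A1 (%t'. P (u + t'))" if "u <= 30" for u
   by (intro runs_intros) (use e1 b1 b2 II m_small that z in "simp_all add: lens P_def")
  have "runs MXB R1 A1 P"
  proof (cases "z + 2 ^ t < 2 * m")
   case T1: True
   show ?thesis
   proof (cases "A 10 (off + z) < A 10 (off + (z + 2 ^ t))")
    case True
    then have "v z = A 10 (off + (z + 2 ^ t))" using T1 by (simp add: v_def)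
    then show ?thesis unfolding MXB_def
     by (intro runs_SqA runs_Asg runs_Sq[of "Ite _ _ _"] runs_Ite)
      (use e1 a1 T1 True b1 b2 b3 m_small fin in "simp_all add: lens")
   next
    case False
    then have "v z = A 10 (off + z)" by (simp add: v_def)
    then show ?thesis unfolding MXB_def
     by (intro runs_SqA runs_Asg runs_Sq[of "Ite _ _ _"] runs_Ite runs_Nop)
      (use e1 a1 T1 False b1 b2 b3 m_small fin in "simp_all add: lens")
   qed
  next
   case False
   then have "v z = A 10 (off + z)" by (simp add: v_def)
   then show ?thesis unfolding MXB_def
    by (intro runs_SqA runs_Asg runs_Sq[of "Ite _ _ _"] runs_Ite runs_Nop)
     (use e1 a1 False b1 b2 m_small fin in "simp_all add: lens")
  qed
  then show "okc R1 A1 ?c & holds R1 A1 ?c & runs MXB R1 A1 (%t R' A'. t <= 50 & I (Suc z) R' A')"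
   using e1 z m_small unfolding P_def by simp
 next
  fix R1 A1 assume "I (2 * m) R1 A1"
  then show "okc R1 A1 ?c & \<not> holds R1 A1 ?c" using r m_small by (simp add: I_def)
 qed
 have "runs (Wh ?c MXB ;; 25 ::= Twice (Var 25) ;; inc 24) (R(26 := off, 20 := 0)) A (%t. Q (8 + t))"
 proof (rule runs_SqM'[OF _ loop], goal_cases)
  case (1 u R1 A1) note a = this
  have "row A1 t'" if t': "t' <= Suc t" for t'
  proof (cases "t' = Suc t")
   case True
   have s: "Suc t * (2 * m) = off + 2 * m" by (simp add: off_def)
   have v1: "A1 10 (off + 2 * m + x) = v x" if "x < 2 * m" for x using a that by (simp add: I_def add.assoc)
   show ?thesis unfolding row_def True s
   proof (intro allI impI)
    fix x y assume x: "x < 2 * m"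
    show "(A1 10 (off + 2 * m + x) < y) = (ALL z. x <= z & z < x + 2 ^ Suc t & z < 2 * m --> e (OD z) < y)"
     using row_step[OF A[OF order_refl] x, of y] unfolding v1[OF x] unfolding v_def off_def .
   qed
  next
   case False
   then have tt: "t' <= t" using t' by simp
   then have "t' * (2 * m) <= off" unfolding off_def by (intro mult_le_mono1)
   then have "A1 10 (t' * (2 * m) + x) = A 10 (t' * (2 * m) + x)" if "x < 2 * m" for x using a that by (simp add: I_def)
   then show ?thesis using A[OF tt] unfolding row_def by simp
  qed
  moreover have "8 + (u + 8) <= 120 * (m + 1)" using a by simp
  ultimately have "Q (8 + (u + 8)) (R1(25 := 2 ^ Suc t, 24 := t + 1)) A1" unfolding Q_def using a by (auto simp: I_def)
  then show ?case
   by (intro runs_SqA runs_Asg) (use a r t h_less pt m_small in "simp_all add: I_def")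
 qed
 moreover have "off < 2 ^ w" using ob[of 0] len10 m2 by linarith
 ultimately have "runs MXL R A Q" unfolding MXL_def
  by (intro runs_SqA runs_Asg) (use r m_small in "simp_all add: off_def ac_simps")
 then show ?thesis unfolding Q_def .
qed

lemma MX:
 assumes r: "env R" and A: "tab_O A" "inp A"
 shows "runs MX R A (%u R' A'. u <= 250 * (m + 1) * (h + 1) & (ALL t<=h. row A' t) &
  sm {20, 24, 25, 26, 27} R' R & (ALL b. b ~= 10 --> A' b = A b))"
  (is "runs _ _ _ ?Q")
proof -
 define Q where "Q = ?Q"
 have e0: "R 0 = m" "R 2 = h" using r by (auto simp: env_def)
 define I where "I = (%z R1 A1. R1 24 = z & R1 25 = 2 ^ z & (ALL t<=z. row A1 t) &
  sm {20, 24, 25, 26, 27} R1 R & (ALL b. b ~= 10 --> A1 b = A b))"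
 let ?c = "Lt (Var 24) (Var 2)"
 have loop: "runs (Wh ?c MXL) R1 A1 (%t R' A'. t <= h * (120 * (m + 1) + xk ?c + 1) + xk ?c + 1 & I h R' A')" if I0: "I 0 R1 A1" for R1 A1
 proof (rule runs_For)
  show "I 0 R1 A1" by (rule I0)
 next
  fix z R1 A1 assume z: "z < h" and i: "I z R1 A1"
  have "runs MXL R1 A1 (%t R' A'. t <= 120 * (m + 1) & I (Suc z) R' A')"
   by (rule runs_mono[OF MXL[where t = z]]) (use i z e0 in "auto simp: I_def")
  then show "okc R1 A1 ?c & holds R1 A1 ?c & runs MXL R1 A1 (%t R' A'. t <= 120 * (m + 1) & I (Suc z) R' A')"
   using i z e0 by (simp add: I_def)
 next
  fix R1 A1 assume "I h R1 A1"
  then show "okc R1 A1 ?c & \<not> holds R1 A1 ?c" using e0 by (simp add: I_def)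
 qed
 have "runs MX R A Q" unfolding MX_def
 proof (rule runs_SqM'[OF _ MX0[where R = R and A = A, OF e0(1) A]], goal_cases)
  case (1 t1 R1 A1) note a1 = this
  have I0: "I 0 (R1(24 := 0, 25 := 1)) A1" using a1 by (auto simp: I_def)
  have "runs (Wh ?c MXL) (R1(24 := 0, 25 := 1)) A1 (%t'. Q (t1 + (4 + t')))"
  proof (rule runs_mono[OF loop[OF I0]])
   fix t2 R2 A2 assume a2: "t2 <= h * (120 * (m + 1) + xk ?c + 1) + xk ?c + 1 & I h R2 A2"
   define M where "M = m + 1"
   have s1: "120 * (m + 1) + xk ?c + 1 <= 123 * M" unfolding M_def by simp
   have "t2 <= h * (123 * M) + 3" using conjunct1[OF a2] mult_le_mono2[OF s1, of h] unfolding xk.simps xc.simps by linarith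
   moreover have "t1 <= 60 * M" "1 <= M" using a1 unfolding M_def by auto
   ultimately have "t1 + (4 + t2) <= 123 * (M * h) + 70 * M" by (simp add: ac_simps)
   also have "\<dots> <= 250 * M * (h + 1)" by (simp add: algebra_simps)
   finally show "Q (t1 + (4 + t2)) R2 A2" unfolding Q_def M_def using a2 by (simp add: I_def)
  qed
  then show ?case
   by (intro runs_SqA runs_Asg) (simp_all add: ac_simps)
 qed
 then show ?thesis unfolding Q_def .
qed

lemma LCE:
 assumes r: "env R" "R 24 = a" "R 25 = b" and ab: "a <= m" "b <= m" "a ~= b" and A: "levels f h A"
 shows "runs LCE R A (%u R' A'. u <= 70 * (h + 1) & eqb f (R' 26) a b & f (a + R' 26) ~= f (b + R' 26) &
  sm {26, 27, 28, 29} R' R & A' = A)"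
  (is "runs _ _ _ ?Q")
proof -
 define Q where "Q = ?Q"
 have e0: "R 1 = N" "R 2 = h" using r by (auto simp: env_def)
 \<comment> \<open>A binary descent: the common extension is at least the value of register 26 and
   less than this value plus \<open>2 ^ (h + 1 - z)\<close>. In the end the gap is 1.\<close>
 define I where "I = (%z R1 A1. R1 27 = h + 1 - z & (z <= h --> R1 29 = 2 ^ (h - z)) & eqb f (R1 26) a b & \<not> eqb f (R1 26 + 2 ^ (h + 1 - z)) a b &
  sm {26, 27, 28, 29} R1 R & A1 = A)"
 let ?c = "Lt (Num 0) (Var 27)"
 have loop: "runs (Wh ?c LCEB) R1 A1 (%t R' A'. t <= (h + 1) * (50 + xk ?c + 1) + xk ?c + 1 & I (h + 1) R' A')" if I0: "I 0 R1 A1" for R1 A1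
 proof (rule runs_For)
  show "I 0 R1 A1" by (rule I0)
 next
  fix z R1 A1 assume z: "z < h + 1" and i: "I z R1 A1"
  define L t where "L = R1 26" and "t = h - z"
  have t: "t <= h" "h + 1 - z = t + 1" "h + 1 - Suc z = t" using z by (auto simp: t_def)
  have e1: "R1 1 = N" "R1 24 = a" "R1 25 = b" "R1 27 = t + 1" "R1 29 = 2 ^ t" "R1 26 = L" "A1 = A" using i r e0 z unfolding I_def L_def t_def by auto
  have p2: "(2::nat) ^ (t + 1) = 2 ^ t + 2 ^ t" by (simp add: power_add)
  have q: "eqb f L a b" "\<not> eqb f (L + (2 ^ t + 2 ^ t)) a b" using i unfolding I_def L_def t p2 by auto
  have lb: "a + L <= m" "b + L <= m" using eqb_bound[OF ab q(1)] by auto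
  then have lN: "a + L < 2 * N" "b + L < 2 * N" using mN N_pos by linarith+
  have lo: "level_ok f t (%x. A 9 (t * (2 * N) + x))" using A t unfolding levels_def by blast
  have eq: "A 9 (t * (2 * N) + (a + L)) = A 9 (t * (2 * N) + (b + L)) <-> eqb f (2 ^ t) (a + L) (b + L)" by (rule level_eq[OF lo lN])
  have pt: "(2::nat) ^ t <= N" unfolding N_def using t by (intro power_increasing) auto
  have rb: "t * (2 * N) + (a + L) < (h + 1) * (2 * N)" "t * (2 * N) + (b + L) < (h + 1) * (2 * N)" using row_bound[OF t(1)] lN by auto
  have wb: "t * (2 * N) + (a + L) < 2 ^ w" "t * (2 * N) + (b + L) < 2 ^ w" "t * (2 * N) < 2 ^ w" "a + L < 2 ^ w" "b + L < 2 ^ w" "L + 2 ^ t < 2 ^ w" "2 * N < 2 ^ w"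
   using rb len9 lb pt m_small by linarith+
  define P where "P = (%(t::nat) R' A'. t <= 50 & I (Suc z) R' A')"
  have half: "Suc z <= h ==> 2 ^ t div 2 = (2::nat) ^ (h - Suc z)"
  proof -
   assume "Suc z <= h"
   then have "t = Suc (h - Suc z)" by (simp add: t_def)
   then show ?thesis by simp
  qed
  have "runs LCEB R1 A1 P"
  proof (cases "eqb f (2 ^ t) (a + L) (b + L)")
   case True
   then have "I (Suc z) (R1(27 := t, 28 := t * (2 * N), 26 := L + 2 ^ t, 29 := 2 ^ t div 2)) A1"
    using i q eqb_add[of f L "2 ^ t" a b] half unfolding I_def t(3) by (auto simp: add.assoc)
   then show ?thesis unfolding LCEB_def
    by (intro runs_intros) (use e1 rb wb True eq in "simp_all add: lens P_def")
  next
   case False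
   then have "I (Suc z) (R1(27 := t, 28 := t * (2 * N), 29 := 2 ^ t div 2)) A1"
    using i q e1 eqb_add[of f L "2 ^ t" a b] half unfolding I_def t(3) by auto
   then show ?thesis unfolding LCEB_def
    by (intro runs_intros) (use e1 rb wb False eq in "simp_all add: lens P_def")
  qed
  then show "okc R1 A1 ?c & holds R1 A1 ?c & runs LCEB R1 A1 (%t R' A'. t <= 50 & I (Suc z) R' A')"
   using e1 unfolding P_def by simp
 next
  fix R1 A1 assume "I (h + 1) R1 A1"
  then show "okc R1 A1 ?c & \<not> holds R1 A1 ?c" by (simp add: I_def)
 qed
 have ne: "\<not> eqb f (2 ^ (h + 1)) a b"
 proof
  assume "eqb f (2 ^ (h + 1)) a b"
  then have "a + 2 ^ (h + 1) <= m" using eqb_bound[OF ab] by blast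
  then show False using mN N_def N_pos by (simp add: power_add)
 qed
 have I0: "I 0 (R(26 := 0, 27 := h + 1, 29 := N)) A" using ne by (auto simp: I_def N_def eqb_def)
 have "runs (Wh ?c LCEB) (R(26 := 0, 27 := h + 1, 29 := N)) A (%t. Q (8 + t))"
 proof (rule runs_mono'[OF _ loop[OF I0]], goal_cases)
  case (1 t R1 A1) note a = this
  then have q: "eqb f (R1 26) a b" "\<not> eqb f (R1 26 + 1) a b" by (auto simp: I_def)
  then have "f (a + R1 26) ~= f (b + R1 26)" using eqb_add[of f "R1 26" 1 a b] by (auto simp: eqb_def)
  then show ?case using a q(1) unfolding Q_def by (simp add: I_def)
 qed
 then have "runs LCE R A Q" unfolding LCE_def
  by (intro runs_SqA runs_Asg) (use e0 m_small h_less in "simp_all add: ac_simps")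
 then show ?thesis unfolding Q_def .
qed

lemma lce_tokens:
 assumes c: "Cn p = Cn q" and E: "eqb f L (p + 1) (q + 1)" and ne: "f (p + 1 + L) ~= f (q + 1 + L)"
 shows "eqd (2 * L + 1) p q" "tk p (2 * L + 1) = Cn (p + 1 + L)" "tk q (2 * L + 1) = Cn (q + 1 + L)"
  "tk p (2 * L + 2) = ee (p + 1 + L)" "tk q (2 * L + 2) = ee (q + 1 + L)"
  "Cn (p + 1 + L) ~= Cn (q + 1 + L) \<or> ee (p + 1 + L) ~= ee (q + 1 + L)"
 using eqd_eqb[OF en c E] tk_odd[of p L] tk_odd[of q L] tk_even[of p L] tk_even[of q L] ne ltr_eq[OF en, of "p + 1 + L" "q + 1 + L"]
 by (simp_all add: One_nat_def numeral_2_eq_2)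

text \<open>The first letter and \<open>L\<close> equal runs account for \<open>2 * L + 1\<close>
  tokens. If the next letters agree as well, they add one token, and then the exponents must
  differ.\<close>

lemma tok_lce:
 assumes c: "Cn p = Cn q" and E: "eqb f L (p + 1) (q + 1)" and ne: "f (p + 1 + L) ~= f (q + 1 + L)"
 shows "tok p q = (if Cn (p + 1 + L) = Cn (q + 1 + L) then 2 * L + 2 else 2 * L + 1)"
proof (cases "Cn (p + 1 + L) = Cn (q + 1 + L)")
 case True
 have "eqd (Suc (2 * L + 1)) p q" unfolding eqd_Suc using lce_tokens[OF assms] True by simp
 then have "eqd (2 * L + 2) p q" by (simp add: numeral_2_eq_2 One_nat_def)
 then have "tok p q = 2 * L + 2" by (rule tok_eqI) (use lce_tokens[OF assms] True in simp)
 then show ?thesis using True by simp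
next
 case False
 have "tok p q = 2 * L + 1" by (rule tok_eqI) (use lce_tokens[OF assms] False in simp_all)
 then show ?thesis using False by simp
qed

definition tab_X :: "arrs => bool" where
 "tab_X A <-> (ALL x<=m. A 11 x = Xr x)"

lemma XT:
 assumes r: "env R" and A: "base_tabs A" "tab_O A"
 shows "runs XT R A (%u R' A'. u <= 160 * (m + 1) * (h + 1) & tab_X A' &
  sm {21, 22, 24, 25, 26, 27, 28, 29, 40} R' R & (ALL b. b ~= 11 --> A' b = A b))"
  (is "runs _ _ _ ?Q")
proof -
 define Q where "Q = ?Q"
 have e0: "R 0 = m" using r by (auto simp: env_def)
 define I where "I = (%z R1 A1. R1 40 = z + 1 & (ALL x<=z. A1 11 x = Xr x) & A1 11 m = 0 &
  sm {21, 22, 24, 25, 26, 27, 28, 29, 40} R1 R & (ALL b. b ~= 11 --> A1 b = A b))"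
 let ?c = "Lt (Var 40) (Var 0)"
 define B where "B = 70 * (h + 1) + 60"
 let ?A = "A(11 := (A 11)(0 := 0, m := 0))"
 have loop: "runs (Wh ?c XTB) (R(40 := 1)) ?A (%t R' A'. t <= (m - 1) * (B + xk ?c + 1) + xk ?c + 1 & I (m - 1) R' A')"
 proof (rule runs_For)
  show "I 0 (R(40 := 1)) ?A" by (auto simp: I_def Xr_def)
 next
  fix z R1 A1 assume z: "z < m - 1" and i: "I z R1 A1"
  define p q where "p = ORD z" and "q = ORD (z + 1)"
  have zm: "z < m" "z + 1 < m" "z ~= z + 1" using z by auto
  have pq: "p < m" "q < m" "p ~= q" using ORD_lt ORD_inj zm unfolding p_def q_def by blast+
  have e1: "env R1" "R1 0 = m" "R1 40 = z + 1" using i r unfolding I_def env_def by auto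
  have t1: "A1 3 z = p" "A1 3 (z + 1) = q" "A1 2 p = Cn p" "A1 2 q = Cn q" "!!x. x <= m ==> A1 2 x = Cn x"
   using i A zm pq unfolding I_def tab_O_def base_tabs_def p_def q_def by (auto simp: OD_def)
  have lv: "levels f h A1" using i A unfolding I_def base_tabs_def levels_def by auto
  have X1: "Xr (z + 1) = tok p q" using zm by (simp add: Xr_def p_def q_def)
  define P where "P = (%(t::nat) R' A'. t <= B & I (Suc z) R' A')"
  let ?R1 = "R1(21 := p, 22 := q)"
  let ?I = "Ite (Eq (Ar 2 (Plus (Var 24) (Var 26))) (Ar 2 (Plus (Var 25) (Var 26)))) (inc 27) Nop"
  let ?T = "24 ::= Plus (Var 21) (Num 1) ;; 25 ::= Plus (Var 22) (Num 1) ;; LCE ;; 27 ::= Plus (Twice (Var 26)) (Num 1) ;; ?I"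
  let ?J = "Ite (Eq (Ar 2 (Var 21)) (Ar 2 (Var 22))) ?T (27 ::= Num 0)"
  define P2 where "P2 = (%(u::nat) R' A'. A' = A1 & u <= 70 * (h + 1) + 40 & R' 27 = tok p q & sm {21, 22, 24, 25, 26, 27, 28, 29} R' R1)"
  have J: "runs ?J ?R1 A1 P2"
  proof (cases "Cn p = Cn q")
   case False
   have "tok p q = 0" by (rule tok_eqI) (use False in "simp_all add: eqd_def")
   then show ?thesis
    by (intro runs_Ite runs_Asg) (use e1 t1(1-4) pq zm False in "simp_all add: lens P2_def")
  next
   case True
   let ?R = "R1(21 := p, 22 := q, 24 := p + 1, 25 := q + 1)"
   have "runs (LCE ;; 27 ::= Plus (Twice (Var 26)) (Num 1) ;; ?I) ?R A1 (%t. P2 (15 + t))"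
   proof (rule runs_SqM'[OF _ LCE[where a = "p + 1" and b = "q + 1"]], goal_cases)
    case (1 t2 R2 A2) note a2 = this
    define L where "L = R2 26"
    have bd: "p + 1 + L <= m" "q + 1 + L <= m" using eqb_bound[of "p + 1" "q + 1"] a2 pq unfolding L_def by auto
    have tl: "tok p q = (if Cn (p + 1 + L) = Cn (q + 1 + L) then 2 * L + 2 else 2 * L + 1)"
     using tok_lce[OF True, of L] a2 unfolding L_def by simp
    have w1: "2 * L + 1 < 2 ^ w" "2 * L + 2 < 2 ^ w" "p + 1 + L < 2 ^ w" "q + 1 + L < 2 ^ w" using bd m_small by linarith+
    have r2: "R2 24 = p + 1" "R2 25 = q + 1" "R2 26 = L" "A2 = A1" "t2 <= 70 * (h + 1)" "!!y. y ~: {21, 22, 24, 25, 26, 27, 28, 29} ==> R2 y = R1 y"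
     using a2 L_def by auto
    have c2: "A1 2 (p + 1 + L) = Cn (p + 1 + L)" "A1 2 (q + 1 + L) = Cn (q + 1 + L)" using t1(5) bd by blast+
    show ?case
     by (intro runs_intros) (use r2 bd tl w1 c2 in "simp_all add: lens P2_def")
   qed (use e1 pq lv in "auto simp: env_def")
   then show ?thesis
    by (intro runs_SqA runs_Ite runs_Asg)
     (use t1(1-4) pq True m_small in "simp_all add: lens ac_simps")
  qed
  have "runs (?J ;; Sto 11 (Var 40) (Var 27) ;; inc 40) ?R1 A1 (%t. P (10 + t))"
  proof (rule runs_SqM'[OF _ J], goal_cases)
   case (1 u R2 A2)
   then have a: "A2 = A1" "u <= 70 * (h + 1) + 40" "R2 27 = tok p q" "!!y. y ~: {21, 22, 24, 25, 26, 27, 28, 29} ==> R2 y = R1 y" unfolding P2_def by auto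
   have "I (Suc z) (R2(40 := z + 1 + 1)) (A1(11 := (A1 11)(z + 1 := tok p q)))"
    using i a(4) zm X1 X1[unfolded Suc_eq_plus1[symmetric]] unfolding I_def by (auto simp: le_Suc_eq)
   then show ?case
    by (intro runs_intros) (use e1 a zm m_small in "simp_all add: lens P_def B_def")
  qed
  then have "runs XTB R1 A1 P" unfolding XTB_def
   by (intro runs_SqA runs_Asg) (use e1 t1(1-4) pq zm in "simp_all add: lens ac_simps")
  then show "okc R1 A1 ?c & holds R1 A1 ?c & runs XTB R1 A1 (%t R' A'. t <= B & I (Suc z) R' A')"
   using e1 zm unfolding P_def by simp
 next
  fix R1 A1 assume "I (m - 1) R1 A1"
  then show "okc R1 A1 ?c & \<not> holds R1 A1 ?c" using e0 m2 by (simp add: I_def)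
 qed
 have "runs (Wh ?c XTB) (R(40 := 1)) ?A (%t. Q (10 + t))"
 proof (rule runs_mono'[OF _ loop], goal_cases)
  case (1 t R1 A1) note a = this
  have "tab_X A1" unfolding tab_X_def
  proof (intro allI impI)
   fix x assume "x <= m"
   then show "A1 11 x = Xr x" using a by (cases "x = m") (auto simp: I_def Xr_def)
  qed
  moreover have "10 + t <= 160 * (m + 1) * (h + 1)"
  proof -
   define H where "H = h + 1"
   have "B + xk ?c + 1 <= 133 * H" unfolding B_def H_def by simp
   then have "(m - 1) * (B + xk ?c + 1) <= m * (133 * H)" by (intro mult_le_mono) auto
   then have "10 + t <= m * (133 * H) + 13" using conjunct1[OF a] by simp
   also have "\<dots> <= 160 * (m + 1) * H" unfolding H_def by (simp add: algebra_simps)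
   finally show ?thesis unfolding H_def .
  qed
  ultimately show ?case using a unfolding Q_def by (simp add: I_def)
 qed
 then have "runs XT R A Q" unfolding XT_def
  by (intro runs_Sq[of "Sto _ _ _"] runs_SqA runs_Sto runs_Asg) (use e0 in "simp_all add: lens ac_simps")
 then show ?thesis unfolding Q_def .
qed

text \<open>For fixed \<open>p\<close> the ends for which \<open>p\<close> starts a border form an
  interval beginning at \<open>p\<close>; this allows all of them to be raised at once.\<close>

definition reach :: "nat => nat => nat => bool" where
 "reach i p u <-> p <= u & u < m & (ALL j. p <= j & j < m --> (match i p (j + 1 - p) <-> j <= u))"

lemma reach_short:
 assumes ip: "i < p" "p < m" "Cn p = Cn i" "e p < e i"
 shows "reach i p p"
 unfolding reach_def
proof (intro conjI allI impI)
 fix j assume j: "p <= j & j < m"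
 have "match i p (j + 1 - p) <-> act i p (j + 1 - p) & (j + 1 - p = 1 \<or> e i <= e p)"
  by (rule act_iff_match) (use ip j in auto)
 also have "\<dots> <-> j <= p" using ip j by (auto simp: act_def eqd_def)
 finally show "match i p (j + 1 - p) <-> j <= p" .
qed (use ip in auto)

text \<open>The last run of a border may be shorter than its counterpart. So the first run at which
  the extensions differ still serves as a last run if its letter agrees and its exponent is not
  larger, and nothing behind it does.\<close>

lemma reach_long:
 assumes ip: "i < p" "p < m" "Cn p = Cn i" "e i <= e p"
  and E: "eqb f L (i + 1) (p + 1)" and ne: "f (i + 1 + L) ~= f (p + 1 + L)"
  and u: "u = (if Cn (p + 1 + L) = Cn (i + 1 + L) & ee (p + 1 + L) <= ee (i + 1 + L) then p + L + 1 else p + L)"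
 shows "reach i p u"
proof -
 have E': "eqb f L (p + 1) (i + 1)" "f (p + 1 + L) ~= f (i + 1 + L)" using E ne by (auto simp: eqb_def)
 note tk = lce_tokens[OF ip(3) E']
 have bd: "p + 1 + L <= m" using eqb_bound[OF _ _ _ E] ip by auto
 have "p + 1 + L < m" if "Cn (p + 1 + L) = Cn (i + 1 + L)"
 proof (rule ccontr)
  assume "\<not> p + 1 + L < m"
  then have "Cn (p + 1 + L) = 0" using bd by (intro Cn_out) simp
  moreover have "1 <= Cn (i + 1 + L)" using bd ip by (intro Cn_pos) simp
  ultimately show False using that by simp
 qed
 then have um: "p <= u" "u < m" using u bd by (auto split: if_splits)
 have "match i p (j + 1 - p) <-> j <= u" if j: "p <= j" "j < m" for j
 proof -
  define v where "v = j - p"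
  have jv: "j = p + v" "j + 1 - p = v + 1" using j by (auto simp: v_def)
  have mt: "match i p (v + 1) <-> act i p (v + 1) & (v + 1 = 1 \<or> e i <= e p)"
   by (rule act_iff_match) (use ip j jv in auto)
  show ?thesis
  proof (cases "v = 0")
   case True
   then have "match i p (v + 1)" using mt ip j jv by (simp add: act_def eqd_def)
   then show ?thesis using True jv um by simp
  next
   case False
   have "match i p (v + 1) <-> eqd (2 * v) p i & ee (p + v) <= ee (i + v)"
    using mt False ip j jv tk_e[of v p] tk_e[of v i] by (simp add: act_def)
   also have "\<dots> <-> p + v <= u"
   proof -
    consider "v <= L" | "v = L + 1" | "L + 2 <= v" by linarith
    then show ?thesis
    proof cases
     case 1
     have "eqd (2 * v) p i" by (rule eqd_mono[OF tk(1)]) (use 1 in simp)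
     moreover have "tk p (2 * v) = tk i (2 * v)" using tk(1) 1 unfolding eqd_def by simp
     then have "ee (p + v) = ee (i + v)" using False tk_e[of v p] tk_e[of v i] by simp
     moreover have "p + v <= u" using 1 u by auto
     ultimately show ?thesis by simp
    next
     case 2
     have v2: "2 * v = Suc (2 * L + 1)" using 2 by simp
     have "eqd (2 * v) p i <-> eqd (2 * L + 1) p i & tk p (2 * L + 1) = tk i (2 * L + 1)" by (simp only: v2 eqd_Suc)
     then have q: "eqd (2 * v) p i <-> Cn (p + 1 + L) = Cn (i + 1 + L)" using tk(1-3) by simp
     have pv: "p + v = p + 1 + L" "i + v = i + 1 + L" using 2 by auto
     show ?thesis unfolding pv q using u by auto
    next
     case 3
     have "\<not> eqd (2 * v) p i"
     proof
      assume "eqd (2 * v) p i"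
      then have "tk p (2 * L + 1) = tk i (2 * L + 1)" "tk p (2 * L + 2) = tk i (2 * L + 2)" using 3 unfolding eqd_def by auto
      then show False using tk by simp
     qed
     then show ?thesis using 3 u by auto
    qed
   qed
   finally show ?thesis using jv by simp
  qed
 qed
 then show ?thesis using um unfolding reach_def by blast
qed

lemma okx_len_of [simp]: "okx R A (len_of a) <-> okx R A a & 2 * ev R A a + 1 < 2 ^ w & ev R A a < m"
 by (auto simp: len_of_def lens)

lemma ev_len_of [simp]: "ev R A (len_of a) = A 0 (2 * ev R A a + 1)"
 by (simp add: len_of_def)

lemma xc_len_of [simp]: "xc (len_of a) = xc a + 6"
 by (simp add: len_of_def)

lemma REACH:
 assumes r: "env R" "R 30 = i" "R 31 = p" and ip: "i < p" "p < m" "Cn p = Cn i" and A: "base_tabs A"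
 shows "runs REACH R A (%u R' A'. u <= 140 * (h + 1) & reach i p (R' 32) &
  sm {24, 25, 26, 27, 28, 29, 32} R' R & A' = A)"
  (is "runs _ _ _ ?Q")
proof -
 define Q where "Q = ?Q"
 have t1: "A 0 (2 * x + 1) = e x" if "x < m" for x using A that unfolding base_tabs_def inp_def by auto
 have t2: "A 2 x = Cn x" if "x <= m" for x using A that unfolding base_tabs_def by auto
 have lv: "levels f h A" using A unfolding base_tabs_def by auto
 have im: "i < m" using ip by simp
 have "runs REACH R A Q"
 proof (cases "e p < e i")
  case True
  have "Q 18 (R(32 := p)) A" using reach_short[OF ip True] unfolding Q_def by simp
  then show ?thesis unfolding REACH_def
   by (intro runs_SqA runs_Asg runs_Ite runs_Nop) (use r ip im t1 True m_small in simp_all)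
 next
  case False
  let ?R = "R(32 := p, 24 := i + 1, 25 := p + 1)"
  let ?I = "Ite (Eq (Ar 2 (Plus (Var 25) (Var 26))) (Ar 2 (Plus (Var 24) (Var 26))))
     (Ite (Lt (len_of (Plus (Var 24) (Var 26))) (len_of (Plus (Var 25) (Var 26)))) Nop (inc 32)) Nop"
  have "runs (LCE ;; 32 ::= Plus (Var 31) (Var 26) ;; ?I) ?R A (%t. Q (25 + t))"
  proof (rule runs_SqM[OF LCE[where a = "i + 1" and b = "p + 1"]])
   fix t2' R2 A2 assume a2: "t2' <= 70 * (h + 1) & eqb f (R2 26) (i + 1) (p + 1) & f (i + 1 + R2 26) ~= f (p + 1 + R2 26) &
     sm {26, 27, 28, 29} R2 ?R & A2 = A"
   define L where "L = R2 26"
   have bd: "p + 1 + L <= m" "i + 1 + L < m" using eqb_bound[of "i + 1" "p + 1" n L] a2 ip unfolding L_def by auto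
   define u where "u = (if Cn (p + 1 + L) = Cn (i + 1 + L) & ee (p + 1 + L) <= ee (i + 1 + L) then p + L + 1 else p + L)"
   have re: "reach i p u" by (rule reach_long[OF ip, of L]) (use False a2 L_def u_def in auto)
   have eq: "p + 1 + L < m" if "Cn (p + 1 + L) = Cn (i + 1 + L)"
   proof (rule ccontr)
    assume "\<not> p + 1 + L < m"
    then have "Cn (p + 1 + L) = 0" using bd by (intro Cn_out) simp
    moreover have "1 <= Cn (i + 1 + L)" using bd by (intro Cn_pos) simp
    ultimately show False using that by simp
   qed
   have e2: "R2 31 = p" "R2 24 = i + 1" "R2 25 = p + 1" "R2 26 = L" "A2 = A" using a2 r L_def by auto
   have fin: "Q t' (R2(32 := u)) A2" if "t' <= t2' + 70" for t' unfolding Q_def using a2 re that by auto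
   have w1: "p + 1 + L < 2 ^ w" "i + 1 + L < 2 ^ w" "p + L + 1 < 2 ^ w" using bd m_small by linarith+
   show "runs (32 ::= Plus (Var 31) (Var 26) ;; ?I) R2 A2 (%t'. Q (25 + (t2' + t')))"
   proof (cases "Cn (p + 1 + L) = Cn (i + 1 + L)")
    case c: True
    have ei: "ee (p + 1 + L) = e (p + 1 + L)" "ee (i + 1 + L) = e (i + 1 + L)" using eq[OF c] bd by (auto simp: ee_def)
    have w2: "2 * (p + 1 + L) + 1 < 2 ^ w" "2 * (i + 1 + L) + 1 < 2 ^ w" using bd m_small by simp_all
    show ?thesis
    proof (cases "ee (p + 1 + L) <= ee (i + 1 + L)")
     case True
     have "u = p + L + 1" using u_def c True by simp
     then show ?thesis
      by (intro runs_intros) (use e2 bd w1 w2 c True ei eq[OF c] t1[of "p + 1 + L"] t1[of "i + 1 + L"] t2 fin in "simp_all add: lens fun_upd_twist")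
    next
     case False
     then have "u = p + L" using u_def by simp
     then show ?thesis
      by (intro runs_intros) (use e2 bd w1 w2 c False ei eq[OF c] t1[of "p + 1 + L"] t1[of "i + 1 + L"] t2 fin in "simp_all add: lens fun_upd_twist")
    qed
   next
    case False
    then have "u = p + L" using u_def by simp
    then show ?thesis
     by (intro runs_intros) (use e2 bd w1 False t2 fin in "simp_all add: lens fun_upd_twist")
   qed
  qed (use r ip im lv in "auto simp: env_def")
  then show ?thesis unfolding REACH_def
   by (intro runs_SqA runs_Asg runs_Ite)
    (use r ip im t1 False m_small in "simp_all add: ac_simps")
 qed
 then show ?thesis unfolding Q_def .
qed

lemma NEXT:
 assumes r: "env R" "R 33 = x" "R 34 = y" and x: "1 <= x" "x <= 2 * m + N" and A: "ALL t<=h. row A t"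
 shows "runs NEXT R A (%u R' A'. u <= 70 * (h + 1) & x <= R' 33 & R' 33 <= 2 * m + N & (ALL z. x <= z & z < R' 33 & z < 2 * m --> e (OD z) < y) &
  (R' 33 < 2 * m --> y <= e (OD (R' 33))) & sm {33, 35, 36} R' R & A' = A)"
  (is "runs _ _ _ ?Q")
proof -
 define Q where "Q = ?Q"
 have e0: "R 0 = m" "R 1 = N" "R 2 = h" using r by (auto simp: env_def)
 \<comment> \<open>Positions from \<open>2 * m\<close> on count as hits, so that the search always
   succeeds; such a result means that the list is exhausted.\<close>
 define good where "good = (%q. 2 * m <= q \<or> y <= e (OD q))"
 define I where "I = (%z R1 A1. R1 35 = h + 1 - z & (z <= h --> R1 36 = 2 ^ (h - z)) & x <= R1 33 & R1 33 <= 2 * m + N &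
  (ALL z. x <= z & z < R1 33 & z < 2 * m --> e (OD z) < y) & (EX q. R1 33 <= q & q < R1 33 + 2 ^ (h + 1 - z) & good q) &
  sm {33, 35, 36} R1 R & A1 = A)"
 let ?c = "Lt (Num 0) (Var 35)"
 have loop: "runs (Wh ?c NEXTB) R1 A1 (%t R' A'. t <= (h + 1) * (50 + xk ?c + 1) + xk ?c + 1 & I (h + 1) R' A')" if I0: "I 0 R1 A1" for R1 A1
 proof (rule runs_For)
  show "I 0 R1 A1" by (rule I0)
 next
  fix z R1 A1 assume z: "z < h + 1" and i: "I z R1 A1"
  define x1 t where "x1 = R1 33" and "t = h - z"
  have t: "t <= h" "h + 1 - z = t + 1" "h + 1 - Suc z = t" using z by (auto simp: t_def)
  have e1: "R1 0 = m" "R1 34 = y" "R1 35 = t + 1" "R1 36 = 2 ^ t" "R1 33 = x1" "A1 = A" using i r e0 z unfolding I_def x1_def t_def by auto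
  have x1: "x <= x1" "x1 <= 2 * m + N" using i unfolding I_def x1_def by auto
  have old: "e (OD u) < y" if "x <= u" "u < x1" "u < 2 * m" for u using i that unfolding I_def x1_def by blast
  have p2: "(2::nat) ^ (t + 1) = 2 ^ t + 2 ^ t" by (simp add: power_add)
  obtain q where q: "x1 <= q" "q < x1 + (2 ^ t + 2 ^ t)" "good q" using i unfolding I_def x1_def t p2 by auto
  have pt: "(2::nat) ^ t <= N" unfolding N_def using t by (intro power_increasing) auto
  have half: "Suc z <= h ==> 2 ^ t div 2 = (2::nat) ^ (h - Suc z)"
  proof -
   assume "Suc z <= h"
   then have "t = Suc (h - Suc z)" by (simp add: t_def)
   then show ?thesis by simp
  qed
  define P where "P = (%(t::nat) R' A'. t <= 50 & I (Suc z) R' A')"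
  have stay: "I (Suc z) (R1(35 := t, 36 := 2 ^ t div 2)) A1" if "EX q. x1 <= q & q < x1 + 2 ^ t & good q"
   using i that e1 half unfolding I_def t(3) by auto
  have "runs NEXTB R1 A1 P"
  proof (cases "x1 < 2 * m")
   case False
   then have "good x1" by (simp add: good_def)
   then have "I (Suc z) (R1(35 := t, 36 := 2 ^ t div 2)) A1" by (intro stay exI[of _ x1]) simp
   then show ?thesis unfolding NEXTB_def
    by (intro runs_intros) (use e1 False m_small in "simp_all add: lens P_def")
  next
   case x1m: True
   have rb: "t * (2 * m) + x1 < (h + 1) * (2 * m)" using row10[OF t(1) x1m] .
   have wb: "t * (2 * m) + x1 < 2 ^ w" "t * (2 * m) < 2 ^ w" "x1 + 2 ^ t < 2 ^ w" using rb len10 x1m pt m_small by linarith+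
   have rw: "A 10 (t * (2 * m) + x1) < y <-> (ALL u. x1 <= u & u < x1 + 2 ^ t & u < 2 * m --> e (OD u) < y)"
    using A t(1) x1m unfolding row_def by blast
   show ?thesis
   proof (cases "A 10 (t * (2 * m) + x1) < y")
    case True
    then have nw: "e (OD u) < y" if "x1 <= u" "u < x1 + 2 ^ t" "u < 2 * m" for u using rw that by blast
    have "EX q. x1 + 2 ^ t <= q & q < x1 + 2 ^ t + 2 ^ t & good q"
    proof (cases "x1 + 2 ^ t <= q")
     case True
     then show ?thesis using q by auto
    next
     case False
     have "2 * m <= q"
     proof (rule ccontr)
      assume "\<not> 2 * m <= q"
      then show False using q nw[of q] False unfolding good_def by simp
     qed
     then have "good (x1 + 2 ^ t)" using False unfolding good_def by simp
     then show ?thesis by (intro exI[of _ "x1 + 2 ^ t"]) simp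
    qed
    moreover have "e (OD u) < y" if "x <= u" "u < x1 + 2 ^ t" "u < 2 * m" for u
     using old[of u] nw[of u] that by (cases "u < x1") auto
    ultimately have "I (Suc z) (R1(35 := t, 33 := x1 + 2 ^ t, 36 := 2 ^ t div 2)) A1"
     using i x1 x1m pt half unfolding I_def t(3) by auto
    then show ?thesis unfolding NEXTB_def
     by (intro runs_intros) (use e1 x1m rb wb True m_small in "simp_all add: lens P_def")
   next
    case False
    then obtain u where u: "x1 <= u" "u < x1 + 2 ^ t" "u < 2 * m" "\<not> e (OD u) < y" using rw by blast
    have "I (Suc z) (R1(35 := t, 36 := 2 ^ t div 2)) A1" by (rule stay) (use u in "auto simp: good_def intro!: exI[of _ u]")
    then show ?thesis unfolding NEXTB_def
     by (intro runs_intros) (use e1 x1m rb wb False m_small in "simp_all add: lens P_def")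
   qed
  qed
  then show "okc R1 A1 ?c & holds R1 A1 ?c & runs NEXTB R1 A1 (%t R' A'. t <= 50 & I (Suc z) R' A')"
   using e1 unfolding P_def by simp
 next
  fix R1 A1 assume "I (h + 1) R1 A1"
  then show "okc R1 A1 ?c & \<not> holds R1 A1 ?c" by (simp add: I_def)
 qed
 have "max x (2 * m) < x + 2 ^ (h + 1)" using x mN N_def N_pos by (auto simp: power_add)
 then have "EX q. x <= q & q < x + 2 ^ (h + 1) & good q" by (intro exI[of _ "max x (2 * m)"]) (simp add: good_def)
 then have I0: "I 0 (R(35 := h + 1, 36 := N)) A" using r x by (auto simp: I_def N_def)
 have "runs (Wh ?c NEXTB) (R(35 := h + 1, 36 := N)) A (%t. Q (6 + t))"
 proof (rule runs_mono'[OF _ loop[OF I0]], goal_cases)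
  case (1 t R1 A1) note a = this
  then obtain q where "R1 33 <= q" "q < R1 33 + 1" "good q" unfolding I_def by auto
  then have "good (R1 33)" by (metis Suc_eq_plus1 le_antisym less_Suc_eq_le)
  then show ?case using a unfolding Q_def good_def by (auto simp: I_def)
 qed
 then have "runs NEXT R A Q" unfolding NEXT_def
  by (intro runs_SqA runs_Asg) (use e0 m_small h_less in "simp_all add: ac_simps")
 then show ?thesis unfolding Q_def .
qed

end

section \<open>Undoing and pushing candidates\<close>

definition POPB :: stm where
 "POPB = 6 ::= Minus (Var 6) (Num 1) ;; Sto 5 (Ar 7 (Var 6)) (Ar 8 (Var 6))"

definition POP :: stm where
 "POP = Wh (Lt (Var 42) (Ar 6 (Minus (Var 6) (Num 1)))) POPB"

definition BLKB :: stm where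
 "BLKB = Ite (Lt (Ar 5 (Var 37)) (Var 11)) Nop (38 ::= Num 1) ;; 37 ::= Half (Var 37)"

text \<open>The test before a write, on which the size of the log depends: a leaf that already has
  the weight is left alone, so a dominated candidate leaves no trace.\<close>

definition BLKQ :: stm where
 "BLKQ = 37 ::= Var 10 ;; 38 ::= Num 0 ;; Wh (Lt (Num 0) (Var 37)) BLKB"

definition PUSH1 :: stm where
 "PUSH1 = 46 ::= Minus (Plus (Ar 3 (Var 44)) (Var 43)) (Num 1) ;;
  Ite (Lt (Var 46) (Var 0))
   (Ite (Eq (Var 43) (Num 1)) (11 ::= Var 5 ;; 9 ::= Num 1)
     (11 ::= len_of (Ar 3 (Var 44)) ;; 9 ::= Minus (Twice (Var 43)) (Num 2)) ;;
    10 ::= Plus (Var 1) (Var 46) ;; BLKQ ;; Ite (Eq (Var 38) (Num 1)) Nop RN) Nop"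

definition PUSHB :: stm where
 "PUSHB = PUSH1 ;; inc 44 ;; Ite (Lt (Ar 11 (Var 44)) (Minus (Twice (Var 43)) (Num 1))) (45 ::= Num 0) Nop"

definition PUSHR :: stm where
 "PUSHR = 44 ::= Var 40 ;; 45 ::= Num 1 ;; Wh (Eq (Var 45) (Num 1)) PUSHB"

text \<open>The initial value is the least \<open>r\<close> with \<open>Xr x < 2 * r - 1\<close>,
  that is, the smallest number of runs whose class begins at the current rank. The increasing order
  matters: the candidate that dominates a bordered one has fewer runs and is already in
  place.\<close>

definition PUSHALL :: stm where
 "PUSHALL = 43 ::= Plus (Half (Plus (Var 42) (Num 1))) (Num 1) ;;
  Wh (Lt (Var 43) (Plus (Var 3) (Num 1))) (PUSHR ;; inc 43)"

lemma nat_eqI_le: "(!!y::nat. y <= a <-> y <= b) ==> a = b"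
 by (metis le_antisym order_refl)

context prog begin

lemma logr_Cons:
 assumes "logr R A (z # L)"
 shows "R 6 = length L + 1" "A 6 (length L) = fst z" "A 7 (length L) = fst (snd z)" "A 8 (length L) = snd (snd z)"
  "logr (R(6 := length L)) (A(5 := V)) L"
proof -
 have n: "rev (z # L) ! u = (A 6 u, A 7 u, A 8 u)" if "u < length (z # L)" for u using assms that by (simp add: logr_def)
 show "R 6 = length L + 1" using assms by (simp add: logr_def)
 have "z = (A 6 (length L), A 7 (length L), A 8 (length L))" using n[of "length L"] by (simp add: nth_append)
 then show "A 6 (length L) = fst z" "A 7 (length L) = fst (snd z)" "A 8 (length L) = snd (snd z)" by (metis fst_conv snd_conv)+
 have "rev L ! u = (A 6 u, A 7 u, A 8 u)" if "u < length L" for u using n[of u] that by (simp add: nth_append)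
 then show "logr (R(6 := length L)) (A(5 := V)) L" by (simp add: logr_def)
qed

lemma POP:
 assumes r: "R 42 = x" and L: "logr R A L" "length L <= LG" "ALL z:set L. fst (snd z) < 2 * N" and ne: "dropWhile (above x) L ~= []"
 shows "runs POP R A (%t R' A'. t <= 30 * length (takeWhile (above x) L) + 10 & logr R' A' (dropWhile (above x) L) &
  A' 5 = undo (takeWhile (above x) L) (A 5) & (ALL y. y ~= 6 --> R' y = R y) & (ALL a. a ~= 5 --> A' a = A a))"
  (is "runs _ _ _ ?Q")
proof -
 define Q where "Q = ?Q"
 define n' where "n' = length (takeWhile (above x) L)"
 have dn: "drop n' L = dropWhile (above x) L" by (simp add: n'_def dropWhile_eq_drop)
 have tn: "take n' L = takeWhile (above x) L" unfolding n'_def by (rule takeWhile_eq_take[symmetric])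
 have nL: "n' <= length L" by (simp add: n'_def length_takeWhile_le)
 define I where "I = (%z R1 A1. logr R1 A1 (drop z L) & A1 5 = undo (take z L) (A 5) & (ALL y. y ~= 6 --> R1 y = R y) & (ALL a. a ~= 5 --> A1 a = A a))"
 let ?c = "Lt (Var 42) (Ar 6 (Minus (Var 6) (Num 1)))"
 have "runs (Wh ?c POPB) R A (%t R' A'. t <= n' * (15 + xk ?c + 1) + xk ?c + 1 & I n' R' A')"
 proof (rule runs_For)
  show "I 0 R A" using L by (simp add: I_def)
 next
  fix z R1 A1 assume z: "z < n'" and i: "I z R1 A1"
  define K where "K = drop (Suc z) L"
  have dz: "drop z L = L ! z # K" using z nL by (simp add: K_def Cons_nth_drop_Suc)
  have lg: "logr R1 A1 (L ! z # K)" using i dz by (simp add: I_def)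
  note lc = logr_Cons[OF lg]
  have ab: "above x (L ! z)" using z unfolding n'_def by (metis nth_mem set_takeWhileD takeWhile_nth)
  have ad: "fst (snd (L ! z)) < 2 * N" using L(3) z nL by (meson nth_mem order_less_le_trans)
  have kl: "length K < LG" using L(2) z nL by (simp add: K_def)
  have tk: "take (Suc z) L = take z L @ [L ! z]" using z nL by (simp add: take_Suc_conv_app_nth)
  have un: "undo (take (Suc z) L) (A 5) = (A1 5)(fst (snd (L ! z)) := snd (snd (L ! z)))"
   using i unfolding I_def tk undo_append by (cases "L ! z") simp
  have II: "I (Suc z) (R1(6 := length K)) (A1(5 := (A1 5)(fst (snd (L ! z)) := snd (snd (L ! z)))))"
   unfolding I_def using i lc(5) un by (simp add: I_def K_def)
  have "runs POPB R1 A1 (%t R' A'. t <= 15 & I (Suc z) R' A')" unfolding POPB_def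
   by (intro runs_intros) (use lc(1-4) ad kl II in "simp_all add: lens")
  then show "okc R1 A1 ?c & holds R1 A1 ?c & runs POPB R1 A1 (%t R' A'. t <= 15 & I (Suc z) R' A')"
   using i lc(1,2) ab kl r by (simp add: lens I_def)
 next
  fix R1 A1 assume i: "I n' R1 A1"
  obtain y K where yK: "dropWhile (above x) L = y # K" using ne by (cases "dropWhile (above x) L") auto
  have "\<not> above x y" using yK by (simp add: dropWhile_eq_Cons_conv)
  moreover have lg: "logr R1 A1 (y # K)" using i dn yK by (simp add: I_def)
  moreover have "length K < LG"
  proof -
   have "length (y # K) <= length L" unfolding yK[symmetric] by (rule length_dropWhile_le)
   then show ?thesis using L(2) by simp
  qed
  ultimately show "okc R1 A1 ?c & \<not> holds R1 A1 ?c" using logr_Cons(1,2)[OF lg] i r by (simp add: lens I_def)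
 qed
 then have "runs POP R A Q" unfolding POP_def by (rule runs_mono) (auto simp: Q_def I_def dn tn n'_def[symmetric])
 then show ?thesis unfolding Q_def .
qed

lemma BLKQ:
 assumes r: "R 10 = N + j" "R 11 = y" and j: "j < N"
 shows "runs BLKQ R A (%t R' A'. t <= 30 * (h + 1) & R' 38 = (if blk (A 5) y j then 1 else 0) &
  sm {37, 38} R' R & A' = A)"
  (is "runs _ _ _ ?Q")
proof -
 define Q where "Q = ?Q"
 define I where "I = (%z R1 A1. R1 37 = (N + j) div 2 ^ z & R1 38 = (if EX t<z. y <= A 5 ((N + j) div 2 ^ t) then 1 else 0) &
  sm {37, 38} R1 R & A1 = A)"
 let ?c = "Lt (Num 0) (Var 37)"
 have "runs (Wh ?c BLKB) (R(37 := N + j, 38 := 0)) A (%t R' A'. t <= (h + 1) * (16 + xk ?c + 1) + xk ?c + 1 & I (h + 1) R' A')"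
 proof (rule runs_For)
  show "I 0 (R(37 := N + j, 38 := 0)) A" by (simp add: I_def)
 next
  fix z R1 A1 assume z: "z < h + 1" and i: "I z R1 A1"
  let ?v = "(N + j) div 2 ^ z"
  have "(2::nat) ^ z <= 2 ^ h" using z by (intro power_increasing) auto
  then have "(2::nat) ^ z <= N + j" using N_def by linarith
  then have v: "0 < ?v" by (simp add: div_greater_zero_iff)
  have v2: "?v < 2 * N" using j div_le_dividend[of "N + j" "2 ^ z"] by linarith
  have d: "?v div 2 = (N + j) div 2 ^ Suc z" by (metis div_mult2_eq power_Suc2)
  have e1: "R1 37 = ?v" "R1 11 = y" "A1 = A" using i r by (auto simp: I_def)
  have "runs BLKB R1 A1 (%t R' A'. t <= 16 & I (Suc z) R' A')"
  proof (cases "A 5 ?v < y")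
   case True
   then have "I (Suc z) (R1(37 := ?v div 2)) A1" using i d unfolding I_def by (auto simp: less_Suc_eq)
   then show ?thesis unfolding BLKB_def by (intro runs_intros) (use e1 v2 True in "simp_all add: lens")
  next
   case False
   then have "I (Suc z) (R1(38 := 1, 37 := ?v div 2)) A1" using i d unfolding I_def by (auto simp: less_Suc_eq)
   then show ?thesis unfolding BLKB_def by (intro runs_intros) (use e1 v2 False in "simp_all add: lens")
  qed
  then show "okc R1 A1 ?c & holds R1 A1 ?c & runs BLKB R1 A1 (%t R' A'. t <= 16 & I (Suc z) R' A')"
   using e1 v by simp
 next
  fix R1 A1 assume "I (h + 1) R1 A1"
  moreover have "(N + j) div 2 ^ (h + 1) = 0" using j N_def by (simp add: power_add)
  ultimately show "okc R1 A1 ?c & \<not> holds R1 A1 ?c" by (simp add: I_def)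
 qed
 then have "runs (Wh ?c BLKB) (R(37 := N + j, 38 := 0)) A (%t. Q (4 + t))"
 proof (rule runs_mono)
  fix t R1 A1 assume a: "t <= (h + 1) * (16 + xk ?c + 1) + xk ?c + 1 & I (h + 1) R1 A1"
  have "(EX t<h + 1. y <= A 5 ((N + j) div 2 ^ t)) <-> blk (A 5) y j" unfolding blk_def by (simp add: less_Suc_eq_le flip: Suc_eq_plus1)
  then show "Q (4 + t) R1 A1" using a unfolding Q_def I_def by simp
 qed
 then have "runs BLKQ R A Q" unfolding BLKQ_def
  by (intro runs_SqA runs_Asg) (use r in "simp_all add: ac_simps")
 then show ?thesis unfolding Q_def .
qed

end

context tables begin

definition tabs :: "arrs => bool" where
 "tabs A <-> base_tabs A & tab_O A & (ALL t<=h. row A t) & tab_X A & (ALL x<=m. A 12 x = pos x)"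

lemma tabs_cong: "tabs A ==> (!!b. b ~: {5, 6, 7, 8, 13} ==> A' b = A b) ==> tabs A'"
 unfolding tabs_def base_tabs_def inp_def levels_def tab_O_def row_def tab_X_def by simp

lemma tabs_simps:
 assumes "tabs A"
 shows "x < m ==> A 0 (2 * x + 1) = e x" "x <= m ==> A 2 x = Cn x" "x < 2 * m ==> A 3 x = OD x" "x < m ==> A 3 x = ORD x"
  "x <= m ==> A 11 x = Xr x" "x <= m ==> A 12 x = pos x"
 using assms unfolding tabs_def base_tabs_def inp_def tab_O_def tab_X_def by (auto simp: OD_def)

text \<open>The leaf values seen by request \<open>q\<close>. Padding leaves hold the largest word;
  the inserted 0 is the value of a leaf without candidates.\<close>

definition FG :: "(nat \<times> nat) set => nat => nat => nat" where
 "FG G q j = (if m <= j then top else Max (insert 0 {wt p r |p r. (p, r) \<in> G & p + r = j + 1 & req r <= q}))"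

lemma le_FG:
 assumes "finite G"
 shows "y <= FG G q j <-> (if m <= j then y <= top else y = 0 \<or> (EX p r. (p, r) \<in> G & p + r = j + 1 & req r <= q & y <= wt p r))"
proof -
 have "finite {wt p r |p r. (p, r) \<in> G & p + r = j + 1 & req r <= q}"
  by (rule finite_subset[of _ "(%(p, r). wt p r) ` G"]) (use assms in auto)
 then show ?thesis unfolding FG_def by (auto simp: Max_ge_iff)
qed

lemma FG_low: "q < req r ==> FG (insert (p, r) G) q = FG G q"
proof -
 assume q: "q < req r"
 have "{wt p' r' |p' r'. (p', r') \<in> insert (p, r) G & p' + r' = j + 1 & req r' <= q} = {wt p r |p r. (p, r) \<in> G & p + r = j + 1 & req r <= q}" for j
  using q by auto
 then show ?thesis unfolding FG_def by (simp only:)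
qed

lemma FG_ins:
 assumes "finite G" "1 <= r" "p + r <= m" "req r <= q"
 shows "FG (insert (p, r) G) q = (FG G q)(p + r - 1 := max (FG G q (p + r - 1)) (wt p r))"
proof (rule ext, rule nat_eqI_le)
 fix j y
 have f: "finite (insert (p, r) G)" using assms by simp
 show "y <= FG (insert (p, r) G) q j <-> y <= ((FG G q)(p + r - 1 := max (FG G q (p + r - 1)) (wt p r))) j"
 proof (cases "j = p + r - 1")
  case True
  then have "j < m" "p + r = j + 1" using assms by auto
  moreover from this have e1: "y <= FG (insert (p, r) G) q j <-> y = 0 \<or> (EX p' r'. (p', r') \<in> insert (p, r) G & p' + r' = j + 1 & req r' <= q & y <= wt p' r')"
   and e2: "y <= FG G q j <-> y = 0 \<or> (EX p' r'. (p', r') \<in> G & p' + r' = j + 1 & req r' <= q & y <= wt p' r')"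
   using le_FG[OF f, of y q j] le_FG[OF assms(1), of y q j] by simp_all
  have e3: "y <= ((FG G q)(p + r - 1 := max (FG G q (p + r - 1)) (wt p r))) j <-> y <= FG G q j \<or> y <= wt p r"
   using True by (simp add: le_max_iff_disj)
  show ?thesis unfolding e3 e1 e2 using calculation(2) assms(4) by blast
 next
  case False
  then have "p + r ~= j + 1" using assms by auto
  then show ?thesis using False by (auto simp: le_FG[OF f] le_FG[OF assms(1)])
 qed
qed

lemma FG_high: "g <= q ==> ALL (p, r):G. req r <= g ==> FG G q = FG G g"
proof -
 assume q: "g <= q" "ALL (p, r):G. req r <= g"
 have "{wt p r |p r. (p, r) \<in> G & p + r = j + 1 & req r <= q} = {wt p r |p r. (p, r) \<in> G & p + r = j + 1 & req r <= g}" for j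
  using q by fastforce
 then show ?thesis unfolding FG_def by (simp only:)
qed

text \<open>The size of the log up to request \<open>q\<close>: the entries of the initialisation,
  and one path to the root for each unbordered candidate. Bordered candidates are never written and
  do not count.\<close>

definition CN :: "(nat \<times> nat) set => nat => nat" where
 "CN G q = 2 * (h + 1) * (h + 1) + 1 + (h + 1) * card {(p, r). (p, r) \<in> G & \<not> bord p (p + r - 1) & req r <= q}"

lemma CN_mono: "finite G' ==> G \<subseteq> G' ==> q <= q' ==> CN G q <= CN G' q'"
 unfolding CN_def by (intro add_left_mono mult_le_mono2 card_mono) (auto elim: finite_subset[rotated])

lemma finite_ACT: "finite (ACT i)"
 by (rule finite_subset[of _ "{..<m} \<times> {..k}"]) (auto simp: ACT_def act_def)

text \<open>The capacity suffices. By \<open>card_unbordered\<close> there are at most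
  \<open>3 * (m * (h + 1))\<close> unbordered candidates, each with \<open>h + 1\<close> entries;
  the remaining summands reserve the entries of two walks with \<open>k\<close> interval raises
  each, and of one further push.\<close>

lemma CN_ACT: "G \<subseteq> ACT i ==> CN G q + 4 * (k + 1) * (h + 1) * (h + 1) + (h + 1) <= LG"
proof -
 assume G: "G \<subseteq> ACT i"
 have "k <= 2 ^ h" using k1 mN N_def by simp
 then have c: "card {(p, r). (p, r) \<in> ACT i & \<not> bord p (p + r - 1)} <= m + 2 * (h * m + k)" by (rule card_unbordered)
 have "card {(p, r). (p, r) \<in> G & \<not> bord p (p + r - 1) & req r <= q} <= card {(p, r). (p, r) \<in> ACT i & \<not> bord p (p + r - 1)}"
  using G by (intro card_mono finite_subset[OF _ finite_ACT[of i]]) auto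
 also note c
 also have "m + 2 * (h * m + k) <= 3 * (m * (h + 1))" using k1 by (simp add: algebra_simps)
 finally have "(h + 1) * card {(p, r). (p, r) \<in> G & \<not> bord p (p + r - 1) & req r <= q} <= (h + 1) * (3 * (m * (h + 1)))" by (intro mult_le_mono2)
 moreover define H where "H = (h + 1) * (h + 1)"
 ultimately have "CN G q <= 2 * H + 1 + 3 * (m * H)" unfolding CN_def by (simp add: ac_simps)
 moreover have "4 * (k + 1) * (h + 1) * (h + 1) <= 4 * (m * H) + 4 * H"
 proof -
  have "(k + 1) * H <= (m + 1) * H" using k1 by (intro mult_le_mono1) simp
  then have "(k + 1) * H <= m * H + H" by (simp only: add_mult_distrib mult_1)
  moreover have "4 * (k + 1) * (h + 1) * (h + 1) = 4 * ((k + 1) * H)" by (simp only: H_def mult.assoc)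
  ultimately show ?thesis by linarith
 qed
 moreover have "h + 1 <= H" "1 <= H" unfolding H_def by (simp_all add: One_nat_def)
 ultimately have "CN G q + 4 * (k + 1) * (h + 1) * (h + 1) + (h + 1) <= 7 * (m * H) + 8 * H" by linarith
 also have "\<dots> <= 32 * (H * (m + 2))" by (simp add: algebra_simps)
 also have "\<dots> <= 32 * ((h + 2) * (h + 2) * (m + 2))" unfolding H_def by (intro mult_le_mono) auto
 also have "\<dots> = LG" unfolding LG by simp
 finally show ?thesis .
qed

text \<open>The log \<open>L\<close> represents the set \<open>G\<close> of pushed pairs, all of which have request at most \<open>g\<close>.\<close>
definition PI :: "(nat \<times> nat) set => nat => regs => arrs => (nat \<times> nat \<times> nat) list => bool" where
 "PI G g R A L <-> logr R A L & stk (A 5) L (FG G) (CN G) & (ALL z:set L. fst z <= g & fst (snd z) < 2 * N) &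
  (ALL (p, r):G. req r <= g) & L ~= [] & fst (last L) = 0"

lemma PI_mono: "PI G g R A L ==> g <= g' ==> PI G g' R A L"
 unfolding PI_def by (auto split: prod.splits)

lemma PI_regs: "PI G g R A L ==> R' 6 = R 6 ==> PI G g R' A L"
 unfolding PI_def logr_def by simp

lemma above_none: "ALL z:set L. fst z <= g ==> takeWhile (above g) L = [] & dropWhile (above g) L = L"
 by (cases L) auto

lemma PI_tr: "PI G g R A L ==> tr (A 5) (FG G g) & length L <= CN G g"
proof -
 assume p: "PI G g R A L"
 have "takeWhile (above g) L = [] & dropWhile (above g) L = L" using p unfolding PI_def by (intro above_none) auto
 moreover have "tr (undo (takeWhile (above g) L) (A 5)) (FG G g) & length (dropWhile (above g) L) <= CN G g" using p unfolding PI_def stk_def by blast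
 ultimately show ?thesis by simp
qed

lemma stk_weaken: "stk V L F C ==> (!!q. C q <= C' q) ==> stk V L F C'"
 unfolding stk_def using le_trans by blast

text \<open>A candidate whose leaf is already blocked joins \<open>G\<close> without a write.
  Requests below its own do not see it, and for all others the leaf value is at least its weight
  already, so no version changes.\<close>

lemma PI_skip:
 assumes p: "PI G g R A L" and g: "g = req r" and G: "finite G" "p + r <= m" "1 <= r" and b: "blk (A 5) (wt p r) (p + r - 1)"
 shows "PI (insert (p, r) G) g R A L"
proof -
 have jN: "p + r - 1 < N" using G mN by linarith
 have tr: "tr (A 5) (FG G g)" using PI_tr[OF p] by blast
 then have w: "wt p r <= FG G g (p + r - 1)" using b jN unfolding tr_def by blast
 have rq: "ALL (p, r):G. req r <= g" using p unfolding PI_def by blast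
 have "FG (insert (p, r) G) q = FG G q" for q
 proof (cases "q < req r")
  case False
  then have "FG G q = FG G g" using FG_high[OF _ rq, of q] g by simp
  then show ?thesis using FG_ins[OF G(1,3,2), of q] False w by (simp add: max_def fun_upd_idem)
 qed (rule FG_low)
 then have "FG (insert (p, r) G) = FG G" by (rule ext)
 moreover have "CN G q <= CN (insert (p, r) G) q" for q using G(1) by (intro CN_mono) auto
 moreover have "stk (A 5) L (FG G) (CN G)" using p unfolding PI_def by blast
 ultimately have "stk (A 5) L (FG (insert (p, r) G)) (CN (insert (p, r) G))" using stk_weaken[of "A 5" L "FG G" "CN G" "CN (insert (p, r) G)"] by simp
 then show ?thesis using p g unfolding PI_def by auto
qed

lemma PI_push:
 assumes p: "PI G g R A L" and g: "g = req r" and G: "finite G" "p + r <= m" "1 <= r" "(p, r) ~: G" and nb: "\<not> bord p (p + r - 1)"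
  and ra: "raised g (wt p r) {j. anc (N + (p + r - 1)) j} (h + 1) A L R' A' L'"
 shows "PI (insert (p, r) G) g R' A' L'"
proof -
 have jN: "p + r - 1 < N" using G mN by linarith
 have "nodes (A 5) (FG G g)" using PI_tr[OF p] nodes_tr by blast
 then have "nodes (A' 5) ((FG G g)(p + r - 1 := max (FG G g (p + r - 1)) (wt p r)))" by (rule nodes_raise_leaf[OF _ ra jN])
 then have t: "tr (A' 5) (FG (insert (p, r) G) g)" using FG_ins[OF G(1,3,2), of g] g nodes_tr by simp
 have ex: "ext g (A 5) L (A' 5) L' (h + 1)" and lg: "logr R' A' L'" using ra unfolding raised_def by auto
 have st: "stk (A 5) L (FG G) (CN G)" "ALL z:set L. fst z <= g" "ALL (p, r):G. req r <= g" "ALL z:set L. fst (snd z) < 2 * N" "L ~= []" "fst (last L) = 0" using p unfolding PI_def by auto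
 note s' = stk_push[OF st(1,2) ex t]
 have F: "(if q < g then FG G q else FG (insert (p, r) G) g) = FG (insert (p, r) G) q" for q
 proof (cases "q < g")
  case True
  then show ?thesis using FG_low g by simp
 next
  case False
  have "ALL (p, r):insert (p, r) G. req r <= g" using st(3) g by auto
  then show ?thesis using FG_high[of g q "insert (p, r) G"] False by simp
 qed
 have C: "(if q < g then CN G q else CN G q + (h + 1)) <= CN (insert (p, r) G) q" for q
 proof (cases "q < g")
  case True
  then show ?thesis using G(1) CN_mono[of "insert (p, r) G" G q q] by auto
 next
  case False
  have "{(p', r'). (p', r') \<in> insert (p, r) G & \<not> bord p' (p' + r' - 1) & req r' <= q} = insert (p, r) {(p', r'). (p', r') \<in> G & \<not> bord p' (p' + r' - 1) & req r' <= q}"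
   using nb False g by auto
  moreover have "finite {(p', r'). (p', r') \<in> G & \<not> bord p' (p' + r' - 1) & req r' <= q}" by (rule finite_subset[OF _ G(1)]) auto
  ultimately show ?thesis using False G(4) unfolding CN_def by simp
 qed
 have "stk (A' 5) L' (FG (insert (p, r) G)) (CN (insert (p, r) G))" by (rule stk_weaken[OF s'[unfolded F]]) (rule C)
 moreover obtain K where K: "L' = K @ L" "ALL x:set K. fst x = g & fst (snd x) < 2 * N" using ex unfolding ext_def by blast
 then have "(ALL z:set L'. fst z <= g & fst (snd z) < 2 * N)" "L' ~= [] & fst (last L') = 0" using st by (auto simp: ball_Un)
 ultimately show ?thesis using lg st(3) g unfolding PI_def by auto
qed

lemma PUSH1:
 assumes r: "env R" "R 43 = r" "R 44 = y" and t: "tabs A" and y: "y < m" "p = ORD y" and rk: "1 <= r" "r <= k"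
  and G: "finite G" "PI G (req r) R A L" "length L + (h + 1) <= LG"
  and dom: "p + r <= m ==> bord p (p + r - 1) ==> EX p' r'. (p', r') \<in> G & p' + r' = p + r & wt p r <= wt p' r'"
 shows "runs PUSH1 R A (%t R' A'. t <= 180 * (h + 1) & (EX L'. PI (if p + r <= m then insert (p, r) G else G) (req r) R' A' L' & length L' <= length L + (h + 1)) &
  sm {6, 7, 8, 9, 10, 11, 37, 38, 46} R' R & sm {5, 6, 7, 8} A' A)"
  (is "runs _ _ _ ?Q")
proof -
 define Q where "Q = ?Q"
 have e0: "R 0 = m" "R 1 = N" "R 5 = top" using r by (auto simp: env_def)
 have pm: "p < m" using ORD_lt y by simp
 have a0: "A 3 y = p" "A 0 (2 * p + 1) = e p" using tabs_simps[OF t] y pm by auto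
 have w1: "p + r < 2 ^ w" "2 * r < 2 ^ w" "2 * p + 1 < 2 ^ w" using pm rk k1 m_small by linarith+
 have "runs PUSH1 R A Q"
 proof (cases "p + r <= m")
  case False
  have "Q 12 (R(46 := p + r - 1)) A" unfolding Q_def using False PI_regs[OF G(2), of "R(46 := p + r - 1)"] by (auto intro: exI[of _ L])
  then show ?thesis unfolding PUSH1_def
   by (intro runs_Sq[of "46 ::= _"] runs_Asg runs_Ite runs_Nop) (use r y rk e0 a0 w1 False in "simp_all add: lens")
 next
  case True
  define j where "j = p + r - 1"
  have j: "j < m" "j < N" "N + j < 2 * N" "j + N < 2 ^ w" using True rk mN m_small by (auto simp: j_def)
  let ?R = "R(46 := j, 11 := wt p r, 9 := req r, 10 := N + j)"
  let ?I = "Ite (Eq (Var 38) (Num 1)) Nop RN"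
  have tr: "tr (A 5) (FG G (req r))" using PI_tr[OF G(2)] by blast
  have G1: "PI G (req r) ?R A L" using G(2) by (rule PI_regs) simp
  have rq: "ALL (p, r'):G. req r' <= req r" using G(2) unfolding PI_def by blast
  have main: "runs (BLKQ ;; ?I) ?R A (%t R' A'. ALL u<=t + 40. Q u R' A')"
  proof (rule runs_SqM'[OF _ BLKQ[where j = j and y = "wt p r"]], goal_cases)
   case (1 t2 R2 A2) note a2 = this
   show ?case
   proof (cases "blk (A 5) (wt p r) j")
    case b: True
    have "PI (insert (p, r) G) (req r) R2 A L" using PI_skip[OF G1 refl G(1) True rk(1)] b a2 unfolding j_def by (auto intro: PI_regs)
    then show ?thesis
     by (intro runs_Ite runs_Nop) (use a2 b True in "auto simp: Q_def intro: exI[of _ L]")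
   next
    case b: False
    \<comment> \<open>A bordered candidate would be dominated by a member of \<open>G\<close> with
      the same end, and then the test would have found the leaf blocked. Only unbordered candidates
      are written.\<close>
    have nb: "\<not> bord p (p + r - 1)"
    proof
     assume "bord p (p + r - 1)"
     then obtain p' r' where q: "(p', r') \<in> G" "p' + r' = p + r" "wt p r <= wt p' r'" using dom True by blast
     then have "req r' <= req r" using rq by auto
     moreover have "p' + r' = j + 1" using q rk unfolding j_def by simp
     ultimately have "wt p r <= FG G (req r) j" using q j(1) unfolding le_FG[OF G(1)] by auto
     then show False using b tr j unfolding tr_def by blast
    qed
    have ng: "(p, r) ~: G"
    proof
     assume q: "(p, r) \<in> G"
     have "p + r = j + 1" using rk unfolding j_def by simp
     then have "wt p r <= FG G (req r) j" using q j(1) unfolding le_FG[OF G(1)] by auto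
     then show False using b tr j unfolding tr_def by blast
    qed
    have "runs RN R2 A2 (%t' R' A'. ALL u<=t2 + (t' + 3) + 40. Q u R' A')"
    proof (rule runs_mono'[OF _ RN[where v = "N + j" and x = "wt p r" and g = "req r" and L = L]], goal_cases)
     case (1 t3 R3 A3) note a3 = this
     then obtain L' where L': "raised (req r) (wt p r) {ja. anc (N + j) ja} (h + 1) A L R3 A3 L'" using a2 by blast
     have "PI (insert (p, r) G) (req r) R3 A3 L'" by (rule PI_push[OF G(2) refl G(1) True rk(1) ng nb L'[unfolded j_def]])
     moreover have "sm {5, 6, 7, 8} A3 A" using L' unfolding raised_def by blast
     moreover have "length L' <= length L + (h + 1)" by (rule raised_length[OF L'])
     ultimately show ?case using a2 a3 True unfolding Q_def by auto
    qed (use a2 j G1 G(3) tr in "auto simp: PI_def logr_def tr_def")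
    then show ?thesis
     by (intro runs_Ite runs_Nop) (use a2 b in "simp_all add: ac_simps")
   qed
  qed (use j in simp_all)
  have main': "runs (BLKQ ;; ?I) R3 A (%t. Q (v + t))" if "R3 = ?R" "v <= 40" for R3 v
   unfolding that(1) by (rule runs_mono[OF main]) (use that in auto)
  have sp: "runs (10 ::= Plus (Var 1) (Var 46) ;; BLKQ ;; ?I) R3 A (%t. Q (v + t))" if "R3 = R(46 := j, 11 := wt p r, 9 := req r)" "v <= 30" for R3 v
   by (intro runs_SqA runs_Asg) (use e0 j main'[of _ "v + 4"] that in "simp_all add: add.assoc ac_simps(1)")
  show ?thesis
  proof (cases "r = 1")
   case r1: True
   then have "wt p r = top" "req r = 1" by (auto simp: wt_def req_def)
   then show ?thesis unfolding PUSH1_def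
    by (intro runs_Sq[of "46 ::= _"] runs_Sq[of "11 ::= _"] runs_Sq[of "Ite _ _ _"] runs_Asg runs_Ite)
     (use r y rk e0 a0 w1 r1 True j sp in "simp_all add: lens j_def flip: add.assoc")
  next
   case r1: False
   then have "wt p r = e p" "req r = 2 * r - 2" by (auto simp: wt_def req_def)
   then show ?thesis unfolding PUSH1_def
    by (intro runs_Sq[of "46 ::= _"] runs_Sq[of "11 ::= _"] runs_Sq[of "Ite _ _ _"] runs_Asg runs_Ite)
     (use r y rk e0 a0 w1 r1 pm True j sp in "simp_all add: lens j_def flip: add.assoc")
  qed
 qed
 then show ?thesis unfolding Q_def .
qed

lemma finite_sub_ACT: "G \<subseteq> ACT i ==> finite G"
 using finite_ACT finite_subset by blast

text \<open>The class is found while it is being pushed: its ranks are consecutive and end where the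
  stored agreement first drops below \<open>2 * r - 1\<close>.\<close>

lemma PUSHR:
 assumes r: "env R" "R 43 = r" "R 40 = x" and t: "tabs A" and x: "x < m" "Xr x < 2 * r - 1" and rk: "1 <= r" "r <= k"
  and G: "PI G (req r) R A L" "G \<subseteq> ACT (ORD x)" "!!p' r'. (p', r') \<in> ACT (ORD x) ==> r' < r ==> (p', r') \<in> G"
 shows "runs PUSHR R A (%t R' A'. t <= gs x r * (220 * (h + 1)) + 10 & (EX L'. PI (G \<union> {(p, r') |p r'. r' = r & p \<in> NEW x r}) (req r) R' A' L' & length L' <= length L + gs x r * (h + 1)) &
  sm {6, 7, 8, 9, 10, 11, 37, 38, 44, 45, 46} R' R & sm {5, 6, 7, 8} A' A)"
  (is "runs _ _ _ ?Q")
proof -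
 define Q where "Q = ?Q"
 define n' where "n' = gs x r"
 note gsx = gs[OF x(1) rk(1), folded n'_def]
 have grp: "eqd (2 * r - 1) (ORD y) (ORD x)" if "x <= y" "y < x + n'" for y
  using group_eq[OF x(1) rk(1) x(2)] that unfolding n'_def by auto
 define GG where "GG = (%z. G \<union> {(ORD y, r) |y. x <= y & y < x + z & ORD y + r <= m})"
 have sub: "GG z \<subseteq> ACT (ORD x)" if "z <= n'" for z
 proof -
  have "(ORD y, r) \<in> ACT (ORD x)" if "x <= y" "y < x + z" "ORD y + r <= m" for y
   using act_exact[OF rk(1) that(3) grp[of y]] that rk \<open>z <= n'\<close> by (auto simp: ACT_def)
  then show ?thesis using G(2) unfolding GG_def by auto
 qed
 have GGS: "GG (Suc z) = (if ORD (x + z) + r <= m then insert (ORD (x + z), r) (GG z) else GG z)" for z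
  unfolding GG_def by (auto simp: less_Suc_eq)
 define I where "I = (%z R1 A1. R1 44 = x + z & R1 45 = (if z = n' then 0 else 1) & (EX L'. PI (GG z) (req r) R1 A1 L' & length L' <= length L + z * (h + 1)) &
  sm {6, 7, 8, 9, 10, 11, 37, 38, 44, 45, 46} R1 R & sm {5, 6, 7, 8} A1 A)"
 let ?c = "Eq (Var 45) (Num 1)"
 have loop: "runs (Wh ?c PUSHB) (R(44 := x, 45 := 1)) A (%t R' A'. t <= n' * (180 * (h + 1) + 30 + xk ?c + 1) + xk ?c + 1 & I n' R' A')"
 proof (rule runs_For)
  have "GG 0 = G" unfolding GG_def by auto
  moreover have "PI G (req r) (R(44 := x, 45 := 1)) A L" using G(1) by (rule PI_regs) simp
  ultimately show "I 0 (R(44 := x, 45 := 1)) A" using gsx(1) by (auto simp: I_def)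
 next
  fix z R1 A1 assume z: "z < n'" and i: "I z R1 A1"
  define p where "p = ORD (x + z)"
  have e1: "env R1" "R1 43 = r" "R1 44 = x + z" "R1 45 = 1" using i r z by (auto simp: I_def env_def)
  have ar: "!!b. b ~: {5, 6, 7, 8} ==> A1 b = A b" using i by (simp add: I_def)
  have t1: "tabs A1" by (rule tabs_cong[OF t]) (use ar in simp)
  have xz: "x + z < m" using z gsx(2) by linarith
  obtain L1 where L1: "PI (GG z) (req r) R1 A1 L1" and l1: "length L1 <= length L + z * (h + 1)" using i unfolding I_def by blast
  have sz: "GG z \<subseteq> ACT (ORD x)" using sub z by simp
  have len: "length L1 + (h + 1) <= LG" using PI_tr[OF L1] CN_ACT[OF sz, of "req r"] by linarith
  have dm: "EX p' r'. (p', r') \<in> GG z & p' + r' = p + r & wt p r <= wt p' r'" if pb: "p + r <= m" "bord p (p + r - 1)"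
  proof -
   have "2 <= r"
   proof (rule ccontr)
    assume "\<not> 2 <= r"
    then have "r = 1" using rk by simp
    then show False using pb(2) by (auto simp: bord_def)
   qed
   moreover have "eqd (2 * r - 1) p (ORD x)" using grp[of "x + z"] z unfolding p_def by simp
   ultimately obtain p' r' where q: "1 <= r'" "r' < r" "p' + r' = p + r" "act (ORD x) p' r'" "wt p r <= wt p' r'"
    using act_dominated[OF _ pb(1) _ pb(2), of "ORD x"] by blast
   then have "(p', r') \<in> ACT (ORD x)" using rk by (simp add: ACT_def)
   then show ?thesis using G(3)[of p' r'] q unfolding GG_def by blast
  qed
  define P where "P = (%(t::nat) R' A'. t <= 180 * (h + 1) + 30 & I (Suc z) R' A')"
  have "runs PUSHB R1 A1 P" unfolding PUSHB_def
  proof (rule runs_SqM'[OF _ PUSH1[where r = r and y = "x + z" and p = p and G = "GG z" and L = L1]], goal_cases)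
   case (1 t2 R2 A2) note a2 = this
   then obtain L2 where L2: "PI (GG (Suc z)) (req r) R2 A2 L2" and "length L2 <= length L1 + (h + 1)" unfolding GGS p_def by blast
   then have l2: "length L2 <= length L + Suc z * (h + 1)" using l1 by simp
   have e2: "R2 43 = r" "R2 44 = x + z" "R2 45 = 1" using a2 e1 by auto
   have X2: "A2 11 (x + z + 1) = Xr (x + z + 1)" using tabs_simps(5)[OF t1, of "x + z + 1"] xz a2 by simp
   have w1: "2 * r < 2 ^ w" "x + z + 1 < 2 ^ w" using rk k1 xz m_small by linarith+
   have fin: "I (Suc z) R3 A2" if "R3 44 = x + z + 1" "R3 45 = (if Suc z = n' then 0 else 1)" "!!y. y ~: {44, 45} ==> R3 y = R2 y" for R3
   proof -
    have "PI (GG (Suc z)) (req r) R3 A2 L2" using L2 by (rule PI_regs) (use that(3) in simp)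
    then show ?thesis using that a2 i l2 unfolding I_def by auto
   qed
   show ?case
   proof (cases "Suc z = n'")
    case True
    then have xn: "x + n' = x + z + 1" by simp
    have "Xr (x + z + 1) < 2 * r - 1" using gsx(3) unfolding xn .
    moreover have "I (Suc z) (R2(44 := x + z + 1, 45 := 0)) A2" by (rule fin) (use True in auto)
    ultimately show ?thesis
     by (intro runs_intros) (use e2 X2 w1 a2 xz rk in "simp_all add: lens P_def")
   next
    case False
    then have "\<not> Xr (x + (z + 1)) < 2 * r - 1" using gsx(4)[of "z + 1"] z by simp
    then have "\<not> Xr (x + z + 1) < 2 * r - 1" by (simp add: add.assoc)
    moreover have "I (Suc z) (R2(44 := x + z + 1)) A2" by (rule fin) (use False e2 in auto)
    ultimately show ?thesis
     by (intro runs_intros) (use e2 X2 w1 a2 xz rk in "simp_all add: lens P_def")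
   qed
  qed (use e1 t1 xz p_def rk L1 len dm finite_sub_ACT[OF sz] in auto)
  then show "okc R1 A1 ?c & holds R1 A1 ?c & runs PUSHB R1 A1 (%t R' A'. t <= 180 * (h + 1) + 30 & I (Suc z) R' A')"
   using e1 unfolding P_def by simp
 next
  fix R1 A1 assume "I n' R1 A1"
  then show "okc R1 A1 ?c & \<not> holds R1 A1 ?c" by (simp add: I_def)
 qed
 have GN: "GG n' = G \<union> {(p, r') |p r'. r' = r & p \<in> NEW x r}"
 proof -
  have "p \<in> NEW x r <-> (EX y. p = ORD y & x <= y & y < x + n' & ORD y + r <= m)" for p
  proof -
   have "p \<in> NEW x r <-> p + r <= m & p \<in> {p. p < m & eqd (2 * r - 1) p (ORD x)}" using rk by (auto simp: NEW_def)
   also have "\<dots> <-> p + r <= m & p \<in> ORD ` {x..<x + n'}" unfolding group_eq[OF x(1) rk(1) x(2)] n'_def ..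
   finally show ?thesis by auto
  qed
  then show ?thesis unfolding GG_def by auto
 qed
 have "runs (Wh ?c PUSHB) (R(44 := x, 45 := 1)) A (%t. Q (4 + t))"
 proof (rule runs_mono'[OF _ loop], goal_cases)
  case (1 t R1 A1) note a = this
  have "180 * (h + 1) + 30 + xk ?c + 1 <= 220 * (h + 1)" by simp
  then have "n' * (180 * (h + 1) + 30 + xk ?c + 1) <= n' * (220 * (h + 1))" by (rule mult_le_mono2)
  then have "4 + t <= n' * (220 * (h + 1)) + 10" using conjunct1[OF a] unfolding xk.simps xc.simps by linarith
  moreover have "EX L'. PI (G \<union> {(p, r') |p r'. r' = r & p \<in> NEW x r}) (req r) R1 A1 L' & length L' <= length L + n' * (h + 1)" using a unfolding I_def GN by blast
  ultimately show ?case using a unfolding Q_def I_def n'_def[symmetric] by blast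
 qed
 then have "runs PUSHR R A Q" unfolding PUSHR_def
  by (intro runs_SqA runs_Asg) (use r in "simp_all add: ac_simps")
 then show ?thesis unfolding Q_def .
qed

definition rs :: "nat => nat" where "rs x = (Xr x + 1) div 2 + 1"

lemma rs_iff: "Xr x < 2 * r - 1 <-> rs x <= r"
 unfolding rs_def by (simp add: One_nat_def) arith

definition work :: "nat => nat" where
 "work x = (\<Sum>r\<in>{r. 1 <= r & r <= k & Xr x < 2 * r - 1}. gs x r)"

text \<open>After exchanging the sums, each of the \<open>k\<close> values of \<open>r\<close>
  contributes disjoint classes of total size at most \<open>m\<close>.\<close>

lemma sum_work: "(\<Sum>x<m. work x) <= k * m"
proof -
 have "(\<Sum>x<m. work x) = (\<Sum>x<m. \<Sum>r\<in>{1..k}. if Xr x < 2 * r - 1 then gs x r else 0)"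
 proof (rule sum.cong)
  fix x
  have "{r. 1 <= r & r <= k & Xr x < 2 * r - 1} = {r \<in> {1..k}. Xr x < 2 * r - 1}" by auto
  then show "work x = (\<Sum>r\<in>{1..k}. if Xr x < 2 * r - 1 then gs x r else 0)" unfolding work_def by (simp only: sum.inter_filter finite_atLeastAtMost)
 qed simp
 also have "\<dots> = (\<Sum>r\<in>{1..k}. \<Sum>x<m. if Xr x < 2 * r - 1 then gs x r else 0)" by (rule sum.swap)
 also have "\<dots> <= (\<Sum>r\<in>{1..k}. m)"
 proof (rule sum_mono)
  fix r assume "r \<in> {1..k}"
  then have "(\<Sum>x\<in>{x. x < m & Xr x < 2 * r - 1}. gs x r) <= m" by (intro sum_gs_le) simp
  moreover have "{..<m} \<inter> {x. Xr x < 2 * r - 1} = {x. x < m & Xr x < 2 * r - 1}" by auto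
  ultimately show "(\<Sum>x<m. if Xr x < 2 * r - 1 then gs x r else 0) <= m" by (simp add: sum.If_cases)
 qed
 finally show ?thesis by simp
qed

lemma PUSHALL:
 assumes r: "env R" "R 40 = x" "R 42 = Xr x" and t: "tabs A" and x: "x < m" "Xr x <= 2 * m"
  and G: "PI (OLD x) (Xr x) R A L"
 shows "runs PUSHALL R A (%t R' A'. t <= work x * (220 * (h + 1)) + 40 * (k + 1) & (EX L'. PI (ACT (ORD x)) (2 * m) R' A' L' & length L' <= length L + work x * (h + 1)) &
  sm {6, 7, 8, 9, 10, 11, 37, 38, 43, 44, 45, 46} R' R & sm {5, 6, 7, 8} A' A)"
  (is "runs _ _ _ ?Q")
proof -
 define Q where "Q = ?Q"
 have e0: "R 3 = k" using r by (simp add: env_def)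
 define s where "s = rs x"
 have s1: "1 <= s" by (simp add: s_def rs_def)
 define GG where "GG = (%r. OLD x \<union> {(p, r') |p r'. s <= r' & r' < r & p \<in> NEW x r'})"
 have ACT: "ACT (ORD x) = OLD x \<union> {(p, r'). 1 <= r' & r' <= k & s <= r' & p \<in> NEW x r'}"
  using ACT_step[OF x(1)] by (simp only: rs_iff s_def)
 have sub: "GG r \<subseteq> ACT (ORD x)" if "r <= k + 1" for r unfolding ACT GG_def using that s1 by auto
 have full: "(p', r') \<in> GG r" if "(p', r') \<in> ACT (ORD x)" "r' < r" for p' r' r using that unfolding ACT GG_def by auto
 \<comment> \<open>An upper bound for the requests in the log: \<open>Xr x\<close> for what has
   survived from the preceding rank, afterwards the request of the class pushed last. It never
   exceeds the request of the next class, so new entries always go on top.\<close>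
 define g where "g = (%z. if z = 0 then Xr x else req (s + z - 1))"
 define n' where "n' = k + 1 - s"
 define W where "W = (%z. \<Sum>r\<in>{s..<s + z}. gs x r)"
 have Xs: "Xr x <= req s"
 proof -
  have "Xr x < 2 * s - 1" unfolding rs_iff s_def ..
  then show ?thesis using s1 by (auto simp: req_def)
 qed
 define I where "I = (%z R1 A1 T. R1 43 = s + z & T <= W z * (220 * (h + 1)) + 25 * z & (EX L'. PI (GG (s + z)) (g z) R1 A1 L' & length L' <= length L + W z * (h + 1)) &
  sm {6, 7, 8, 9, 10, 11, 37, 38, 43, 44, 45, 46} R1 R & sm {5, 6, 7, 8} A1 A)"
 let ?c = "Lt (Var 43) (Plus (Var 3) (Num 1))" and ?b = "PUSHR ;; inc 43"
 have sk: "s < 2 ^ w" "k + 2 < 2 ^ w" "Xr x + 1 < 2 ^ w" "s <= m + 1" using x(2) k1 m_small unfolding s_def rs_def by auto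
 have loop: "runs (Wh ?c ?b) (R(43 := s)) A (%t R' A'. EX T. t = T + xk ?c + 1 & I n' R' A' T)"
 proof (rule runs_Wh)
  have "GG (s + 0) = OLD x" unfolding GG_def by auto
  moreover have "PI (OLD x) (Xr x) (R(43 := s)) A L" using G by (rule PI_regs) simp
  ultimately show "I 0 (R(43 := s)) A 0" unfolding I_def g_def by (auto intro: exI[of _ L])
 next
  fix z R1 A1 T assume z: "z < n'" and i: "I z R1 A1 T"
  define r' where "r' = s + z"
  have rk: "1 <= r'" "r' <= k" "s <= r'" using z s1 unfolding r'_def n'_def by auto
  have e1: "env R1" "R1 43 = r'" "R1 40 = x" using i r unfolding I_def r'_def env_def by auto
  have ar: "!!b. b ~: {5, 6, 7, 8} ==> A1 b = A b" using i by (simp add: I_def)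
  have t1: "tabs A1" by (rule tabs_cong[OF t]) (use ar in simp)
  have Xr': "Xr x < 2 * r' - 1" using rk(3) unfolding rs_iff s_def .
  obtain L1 where L1: "PI (GG r') (g z) R1 A1 L1" and l1: "length L1 <= length L + W z * (h + 1)" using i unfolding I_def r'_def by blast
  have "g z <= req r'" using Xs s1 unfolding g_def r'_def by (auto simp: req_def)
  then have L1': "PI (GG r') (req r') R1 A1 L1" by (rule PI_mono[OF L1])
  have GS: "GG r' \<union> {(p, r'') |p r''. r'' = r' & p \<in> NEW x r'} = GG (Suc r')" unfolding GG_def using rk by (auto simp: less_Suc_eq)
  have WS: "W (Suc z) = W z + gs x r'" unfolding W_def r'_def by simp
  have "runs ?b R1 A1 (%t R' A'. I (Suc z) R' A' (T + (t + xk ?c + 1)))"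
  proof (rule runs_SqM'[OF _ PUSHR[where r = r' and x = x and G = "GG r'" and L = L1]], goal_cases)
   case (1 t2 R2 A2) note a2 = this
   then obtain L2 where L2: "PI (GG (Suc r')) (req r') R2 A2 L2" and l2: "length L2 <= length L1 + gs x r' * (h + 1)" unfolding GS by blast
   have l2': "length L2 <= length L + W (Suc z) * (h + 1)" using l1 l2 unfolding WS add_mult_distrib by linarith
   from L2 have L2': "PI (GG (s + Suc z)) (g (Suc z)) (R2(43 := r' + 1)) A2 L2" unfolding r'_def g_def by (auto intro: PI_regs)
   have "T + (t2 + 4 + xk ?c + 1) <= W (Suc z) * (220 * (h + 1)) + 25 * Suc z"
    using a2 i unfolding I_def WS add_mult_distrib by simp
   then have "I (Suc z) (R2(43 := r' + 1)) A2 (T + (t2 + 4 + xk ?c + 1))"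
    unfolding I_def using a2 i L2' l2' by (auto simp: I_def r'_def)
   then show ?case
    by (intro runs_Asg) (use a2 e1 rk sk in simp_all)
  qed (use e1 t1 x Xr' rk L1' sub[of r'] full in auto)
  then show "okc R1 A1 ?c & holds R1 A1 ?c & runs ?b R1 A1 (%t R' A'. I (Suc z) R' A' (T + (t + xk ?c + 1)))"
   using i e0 rk sk unfolding I_def r'_def by simp
 next
  fix R1 A1 T assume "I n' R1 A1 T"
  then show "okc R1 A1 ?c & \<not> holds R1 A1 ?c" using e0 sk by (simp add: I_def n'_def)
 qed
 have "runs (Wh ?c ?b) (R(43 := s)) A (%t. Q (8 + t))"
 proof (rule runs_mono'[OF _ loop], goal_cases)
  case (1 t R1 A1)
  then obtain T where T: "t = T + 5" "I n' R1 A1 T" by auto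
  have Wn: "W n' = work x"
  proof -
   have "{s..<s + n'} = {r. 1 <= r & r <= k & Xr x < 2 * r - 1}" unfolding rs_iff n'_def using s1 by (auto simp: s_def)
   then show ?thesis unfolding W_def work_def by simp
  qed
  have Gn: "GG (s + n') = ACT (ORD x)"
  proof (cases "s <= k + 1")
   case True
   then have "s + n' = k + 1" by (simp add: n'_def)
   then show ?thesis using sub[of "k + 1"] full[of _ _ "k + 1"] by (auto simp: ACT_def)
  next
   case False
   then show ?thesis unfolding ACT GG_def n'_def by auto
  qed
  obtain L1 where L1: "PI (GG (s + n')) (g n') R1 A1 L1" and l1: "length L1 <= length L + work x * (h + 1)" using T unfolding I_def Wn by blast
  have "g n' <= 2 * m" using x(2) k1 unfolding g_def n'_def req_def by auto
  then have "PI (ACT (ORD x)) (2 * m) R1 A1 L1" using PI_mono[OF L1] unfolding Gn by blast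
  moreover have "8 + t <= work x * (220 * (h + 1)) + 40 * (k + 1)"
  proof -
   have "T <= W n' * (220 * (h + 1)) + 25 * n'" using T(2) unfolding I_def by blast
   moreover have "n' <= k" unfolding n'_def using s1 by simp
   ultimately show ?thesis unfolding Wn T(1) by simp
  qed
  ultimately show ?case using T l1 unfolding Q_def I_def by auto
 qed
 then have "runs PUSHALL R A Q" unfolding PUSHALL_def
  by (intro runs_SqA runs_Asg) (use r sk in "simp_all add: s_def rs_def ac_simps")
 then show ?thesis unfolding Q_def .
qed

end

section \<open>Long borders and the last unbordered end of a start\<close>

definition WALKB :: stm where
 "WALKB = NEXT ;;
  Ite (Lt (Var 33) (Twice (Var 0)))
   (31 ::= Ar 3 (Var 33) ;;
    Ite (Lt (Var 30) (Var 31))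
     (Ite (Eq (Ar 2 (Var 31)) (Ar 2 (Var 30))) (REACH ;; 12 ::= Var 31 ;; 13 ::= Plus (Var 32) (Num 1) ;; RR) Nop) Nop ;;
    inc 33) Nop ;;
  inc 47"

definition WALK :: stm where
 "WALK = 47 ::= Num 0 ;; Wh (Lt (Var 47) (Var 3)) WALKB"

definition NEARB :: stm where
 "NEARB = Ite (Eq (Ar 2 (Var 31)) (Ar 2 (Var 30))) (REACH ;; Ite (Lt (Var 49) (Var 32)) (49 ::= Var 32) Nop) Nop ;;
  Ite (Lt (Var 49) (Var 31)) (48 ::= Var 31) Nop ;; inc 31"

definition NEAR :: stm where
 "NEAR = 48 ::= Num 0 ;; 49 ::= Num 0 ;; 50 ::= Plus (Var 30) (Var 3) ;; Ite (Lt (Var 0) (Var 50)) (50 ::= Var 0) Nop ;;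
  31 ::= Plus (Var 30) (Num 1) ;; Wh (Lt (Var 31) (Var 50)) NEARB"

text \<open>The tree is consulted only for ends from \<open>i + k\<close> on, where every candidate
  starts behind \<open>i\<close>. If the last free end lies below this bound, all farther ends are
  bordered and \<open>NEAR\<close> settles the rest. The default 0 for a fully blocked tree leads
  there as well.\<close>

definition QUERY :: stm where
 "QUERY = 48 ::= Num 0 ;; 16 ::= Var 34 ;; Ite (Lt (Ar 5 (Num 1)) (Var 16)) (FIND ;; 48 ::= Var 17) Nop ;;
  Ite (Lt (Var 48) (Plus (Var 30) (Var 3))) NEAR Nop"

definition RECORD :: stm where
 "RECORD = Ite (Lt (Num 0) (Var 48))
  (51 ::= Minus (Ar 12 (Plus (Var 48) (Num 1))) (Ar 12 (Var 30)) ;;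
   Ite (Lt (Var 52) (Var 51)) (52 ::= Var 51 ;; 53 ::= Num 0) Nop ;;
   Ite (Eq (Var 51) (Var 52))
    (Sto 13 (Twice (Var 53)) (Plus (Ar 12 (Var 30)) (Num 1)) ;;
    Sto 13 (Plus (Twice (Var 53)) (Num 1)) (Ar 12 (Plus (Var 48) (Num 1))) ;; inc 53) Nop) Nop"

text \<open>The request \<open>2 * m + 2\<close> of the walks exceeds every agreement of
  neighbouring ranks, so their entries are the first to be undone at the next rank. Position
  \<open>2 * m - x\<close>, where the second walk begins, is the reflected place of rank
  \<open>x - 1\<close>.\<close>

definition MAINB :: stm where
 "MAINB = 30 ::= Ar 3 (Var 40) ;; 42 ::= Ar 11 (Var 40) ;; POP ;; PUSHALL ;;
  34 ::= len_of (Var 30) ;; 9 ::= Plus (Twice (Var 0)) (Num 2) ;; 14 ::= Var 5 ;;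
  33 ::= Plus (Var 40) (Num 1) ;; WALK ;; 33 ::= Minus (Twice (Var 0)) (Var 40) ;; WALK ;; QUERY ;; RECORD ;; inc 40"

definition MAIN :: stm where
 "MAIN = INIT ;; 40 ::= Num 0 ;; 52 ::= Num 0 ;; 53 ::= Num 0 ;; Wh (Lt (Var 40) (Var 0)) MAINB"

context tables begin

lemma match_Cn: "match i p r ==> i < m ==> p < m ==> Cn p = Cn i"
 using Cn_eq[of p i] by (simp add: match_def)

lemma bord_iff: "i < j ==> bord i j <-> (EX p. i < p & p <= j & match i p (j + 1 - p))"
proof -
 assume ij: "i < j"
 show ?thesis
 proof
  assume "bord i j"
  then obtain r where r: "1 <= r" "r + i <= j" "match i (j + 1 - r) r" unfolding bord_def by blast
  then have "i < j + 1 - r" "j + 1 - r <= j" "j + 1 - (j + 1 - r) = r" by auto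
  then show "EX p. i < p & p <= j & match i p (j + 1 - p)" using r(3) by (intro exI[of _ "j + 1 - r"]) simp
 next
  assume "EX p. i < p & p <= j & match i p (j + 1 - p)"
  then obtain p where p: "i < p" "p <= j" "match i p (j + 1 - p)" by blast
  then have "1 <= j + 1 - p" "j + 1 - p + i <= j" "j + 1 - (j + 1 - p) = p" by auto
  then show "bord i j" unfolding bord_def using p(3) by (intro exI[of _ "j + 1 - p"]) simp
 qed
qed

definition cov :: "nat => nat => nat => bool" where
 "cov i p j <-> i < p & Cn p = Cn i & p <= j & j < m & match i p (j + 1 - p)"

abbreviation H2 :: nat where "H2 \<equiv> 2 * (h + 1) * (h + 1)"

lemma WALKB:
 assumes r: "env R" "R 30 = i" "R 34 = y" "R 9 = g" "R 14 = top" "R 33 = x" "R 47 = z" and t: "tabs A"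
  and x: "1 <= x" "x <= 2 * m + N" "z < m" and im: "i < m"
  and L: "logr R A L" "length L + H2 <= LG" "hp (A 5)"
 shows "runs WALKB R A (%t R' A'. t <= 700 * (h + 1) * (h + 1) & (EX q L' U. x <= q & q <= 2 * m + N &
   (ALL u. x <= u & u < q & u < 2 * m --> e (OD u) < y) & (q < 2 * m --> y <= e (OD q)) & R' 33 = (if q < 2 * m then q + 1 else q) &
   raised g top U H2 A L R' A' L' & (ALL j<N. j \<in> U <-> q < 2 * m & cov i (OD q) j)) & R' 47 = z + 1 &
  sm {6, 7, 8, 10, 11, 12, 13, 15, 24, 25, 26, 27, 28, 29, 31, 32, 33, 35, 36, 47} R' R)"
  (is "runs _ _ _ ?Q")
proof -
 define Q where "Q = ?Q"
 define H where "H = (h + 1) * (h + 1)"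
 have H1: "1 <= H" "h + 1 <= H" unfolding H_def by (simp_all add: One_nat_def)
 have HH: "700 * (h + 1) * (h + 1) = 700 * H" "400 * (h + 1) * (h + 1) = 400 * H" unfolding H_def by (simp_all only: mult.assoc)
 have e0: "R 0 = m" "R 1 = N" "R 2 = h" using r by (auto simp: env_def)
 have bt: "base_tabs A" "ALL t<=h. row A t" using t unfolding tabs_def by auto
 have "runs WALKB R A Q" unfolding WALKB_def
 proof (rule runs_SqM'[OF _ NEXT[where x = x and y = y]], goal_cases)
  case (1 t1 R1 A1) note a1 = this
  define q where "q = R1 33"
  have q: "x <= q" "q <= 2 * m + N" "!!u. x <= u ==> u < q ==> u < 2 * m ==> e (OD u) < y" "q < 2 * m ==> y <= e (OD q)" using a1 unfolding q_def by auto
  have e1: "R1 0 = m" "R1 1 = N" "R1 2 = h" "R1 30 = i" "R1 47 = z" "A1 = A" "env R1" "R1 9 = g" "R1 14 = top" "R1 33 = q"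
   using a1 e0 r by (auto simp: env_def q_def)
  have t1: "t1 <= 70 * H" by (rule le_trans[OF conjunct1[OF a1]]) (use H1 in simp)
  have fin: "Q v R3 A3" if "v <= 700 * H" "R3 33 = (if q < 2 * m then q + 1 else q)" "R3 47 = z + 1"
    "raised g top U H2 A L R3 A3 L'" "!!j. j < N ==> j \<in> U <-> q < 2 * m & cov i (OD q) j"
    "!!y. y ~: {6, 7, 8, 10, 11, 12, 13, 15, 24, 25, 26, 27, 28, 29, 31, 32, 33, 35, 36, 47} ==> R3 y = R y" for v R3 A3 U L'
   unfolding Q_def HH using that q by (intro conjI exI[of _ q] exI[of _ L'] exI[of _ U]) auto
  have rf: "raised g top {} H2 A L R3 A L" if "R3 6 = R 6" for R3
   using raised_regs[OF raised_mono[OF raised_refl[OF L(3,1)]]] that by blast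
  have w1: "q + 1 < 2 ^ w" "z + 1 < 2 ^ w" "2 * m < 2 ^ w" using q(2) x m_small by linarith+
  let ?C = "REACH ;; 12 ::= Var 31 ;; 13 ::= Plus (Var 32) (Num 1) ;; RR"
  let ?J = "Ite (Lt (Var 30) (Var 31)) (Ite (Eq (Ar 2 (Var 31)) (Ar 2 (Var 30))) ?C Nop) Nop"
  let ?B = "31 ::= Ar 3 (Var 33) ;; ?J ;; inc 33"
  show ?case
  proof (cases "q < 2 * m")
   case False
   have "Q (t1 + 10) (R1(47 := z + 1)) A"
    by (rule fin[where U = "{}" and L' = L]) (use t1 H1 False e1 a1 rf in auto)
   then show ?thesis
    by (intro runs_Sq runs_Ite runs_Nop runs_Asg) (use e1 False w1 in simp_all)
  next
   case qm: True
   define p where "p = OD q"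
   have pm: "p < m" unfolding p_def by (rule OD_lt[OF qm])
   have a31: "A 3 q = p" "A 2 p = Cn p" "A 2 i = Cn i" using tabs_simps[OF t] qm pm im unfolding p_def by auto
   define P where "P = (%(v::nat) R3 A3. v <= 600 * H & R3 33 = q & R3 47 = z & (EX U L'. raised g top U H2 A L R3 A3 L' & (ALL j<N. j \<in> U <-> cov i p j)) &
    sm {6, 7, 8, 10, 11, 12, 13, 15, 24, 25, 26, 27, 28, 29, 31, 32, 33, 35, 36, 47} R3 R)"
   let ?R = "R1(31 := p)"
   have J: "runs ?J ?R A P"
   proof (cases "i < p & Cn p = Cn i")
    case False
    have "\<not> cov i p j" for j using False unfolding cov_def by auto
    then have "P v ?R A" if "v <= 100 * H" for v unfolding P_def using that e1 a1 rf[of ?R] by auto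
    then show ?thesis using False
     by (intro runs_Ite runs_Nop) (use e1 H1 a31 pm im in "auto simp: lens")
   next
    case True
    have "runs ?C ?R A (%t. P (10 + t))"
    proof (rule runs_SqM'[OF _ REACH[where i = i and p = p]], goal_cases)
     case (1 t2 R2 A2) note a2 = this
     define u where "u = R2 32"
     have u: "p <= u" "u < m" "!!j. p <= j ==> j < m ==> match i p (j + 1 - p) <-> j <= u" using a2 unfolding reach_def u_def by auto
     define R3 where "R3 = R2(12 := p, 13 := u + 1)"
     have e3: "R3 9 = g" "R3 14 = top" "R3 12 = p" "R3 13 = u + 1" "R3 1 = N" "R3 2 = h" "R3 6 = R 6" using a2 e1 a1 unfolding R3_def by auto
     have lg: "logr R3 A L" using L(1) e3(7) by (simp add: logr_def)
     have "runs RR R3 A (%t'. P (10 + (t2 + (6 + t'))))"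
     proof (rule runs_mono'[OF _ RR[where g = g and x = top and a = p and b = "u + 1" and L = L]], goal_cases)
      case (1 t4 R4 A4) note a4 = this
      then obtain L' U where LU: "raised g top U H2 A L R4 A4 L'" "ALL j<N. j \<in> U <-> p <= j & j < u + 1" by blast
      have "p <= j & j < u + 1 <-> cov i p j" for j using u True unfolding cov_def by auto
      then have "EX U L'. raised g top U H2 A L R4 A4 L' & (ALL j<N. j \<in> U <-> cov i p j)" using LU by auto
      moreover have "t2 <= 140 * H" by (rule le_trans[OF conjunct1[OF a2]]) (use H1 in simp)
      then have "10 + (t2 + (6 + t4)) <= 600 * H" using conjunct1[OF a4] H1 unfolding HH by linarith
      moreover have "R4 33 = q" "R4 47 = z" using a4 a2 e1 unfolding R3_def by auto
      moreover have "sm {6, 7, 8, 10, 11, 12, 13, 15, 24, 25, 26, 27, 28, 29, 31, 32, 33, 35, 36, 47} R4 R"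
       using a4 a2 a1 unfolding R3_def by auto
      ultimately show ?case unfolding P_def by blast
     qed (use e3 lg L pm u mN in auto)
     moreover have "u + 1 < 2 ^ w" using u m_small by linarith
     ultimately show ?case
      by (intro runs_SqA runs_Asg) (use a2 u_def in "simp_all add: R3_def")
    qed (use e1 True pm bt in "auto simp: env_def")
    then show ?thesis using True
     by (intro runs_Ite) (use e1 a31 pm im in "auto simp: lens ac_simps")
   qed
   have "runs (?J ;; inc 33) ?R A (%t R' A'. runs (inc 47) R' A' (%t'. Q (t1 + (4 + t + 5 + t'))))"
   proof (rule runs_SqM'[OF _ J], goal_cases)
    case (1 t2 R2 A2) note a2 = this
    then obtain U L' where UL: "raised g top U H2 A L R2 A2 L'" "ALL j<N. j \<in> U <-> cov i p j" unfolding P_def by blast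
    have b2: "R2 33 = q" "R2 47 = z" "t2 <= 600 * H" using a2 unfolding P_def by auto
    have "Q (t1 + (4 + (t2 + 4) + 5 + 4)) (R2(33 := q + 1, 47 := z + 1)) A2"
    proof (rule fin[where U = U and L' = L'])
     show "raised g top U H2 A L (R2(33 := q + 1, 47 := z + 1)) A2 L'" using UL(1) by (rule raised_regs) simp
     show "t1 + (4 + (t2 + 4) + 5 + 4) <= 700 * H" using t1 b2 H1 by linarith
    qed (use UL qm a2 in "auto simp: P_def p_def")
    then show ?case
     by (intro runs_Asg) (use b2 w1 in "simp_all add: ac_simps")
   qed
   then show ?thesis
    by (intro runs_SqA runs_Sq[of "Ite (Lt (Var 33) _) _ _"] runs_Ite runs_Asg) (use e1 qm w1 a31 in "simp_all add: lens ac_simps")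
  qed
 qed (use r x bt in auto)
 then show ?thesis unfolding Q_def .
qed

text \<open>The positions that a walk from \<open>s\<close> with threshold \<open>y\<close> visits
  before it arrives at \<open>x\<close>.\<close>

definition EV :: "nat => nat => nat => nat set" where
 "EV y s x = {q. s <= q & q < x & q < 2 * m & y <= e (OD q)}"

lemma finite_EV [simp]: "finite (EV y s x)"
 by (rule finite_subset[of _ "{..<2 * m}"]) (auto simp: EV_def)

lemma EV_step:
 assumes "s <= x" "x <= q" "!!u. x <= u ==> u < q ==> u < 2 * m ==> e (OD u) < y" "q < 2 * m ==> y <= e (OD q)"
 shows "EV y s (if q < 2 * m then q + 1 else q) = EV y s x \<union> (if q < 2 * m then {q} else {})"
proof -
 have "u \<in> EV y s q <-> u \<in> EV y s x" for u
  using assms(1,2) assms(3)[of u] unfolding EV_def by (cases "u < x") auto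
 then have "EV y s q = EV y s x" by blast
 moreover have "EV y s (q + 1) = insert q (EV y s q)" if "q < 2 * m" using assms that unfolding EV_def by (auto simp: less_Suc_eq simp flip: Suc_eq_plus1)
 ultimately show ?thesis by auto
qed

lemma WALK:
 assumes r: "env R" "R 30 = i" "R 34 = y" "R 9 = g" "R 14 = top" "R 33 = s" and t: "tabs A"
  and s: "1 <= s" "s <= 2 * m" and im: "i < m"
  and L: "logr R A L" "length L + k * H2 + H2 <= LG" "hp (A 5)"
 shows "runs WALK R A (%t R' A'. t <= k * (710 * (h + 1) * (h + 1)) + 10 & (EX x L' U. (2 * m <= x \<or> k <= card (EV y s x)) &
   raised g top U (k * H2) A L R' A' L' & (ALL j<N. j \<in> U <-> (EX q:EV y s x. cov i (OD q) j))) &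
  sm {6, 7, 8, 10, 11, 12, 13, 15, 24, 25, 26, 27, 28, 29, 31, 32, 33, 35, 36, 47} R' R)"
  (is "runs _ _ _ ?Q")
proof -
 define Q where "Q = ?Q"
 define B where "B = 700 * (h + 1) * (h + 1)"
 have e0: "R 3 = k" using r by (simp add: env_def)
 define I where "I = (%z R1 A1. R1 47 = z & s <= R1 33 & R1 33 <= 2 * m + N & (2 * m <= R1 33 \<or> z <= card (EV y s (R1 33))) &
  (EX L' U. raised g top U (z * H2) A L R1 A1 L' & (ALL j<N. j \<in> U <-> (EX q:EV y s (R1 33). cov i (OD q) j))) &
  sm {6, 7, 8, 10, 11, 12, 13, 15, 24, 25, 26, 27, 28, 29, 31, 32, 33, 35, 36, 47} R1 R)"
 let ?c = "Lt (Var 47) (Var 3)"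
 have loop: "runs (Wh ?c WALKB) (R(47 := 0)) A (%t R' A'. t <= k * (B + xk ?c + 1) + xk ?c + 1 & I k R' A')"
 proof (rule runs_For)
  have "raised g top {} (0 * H2) A L (R(47 := 0)) A L" using raised_regs[OF raised_refl[OF L(3,1)]] by simp
  moreover have "EV y s s = {}" by (auto simp: EV_def)
  ultimately show "I 0 (R(47 := 0)) A" using r s unfolding I_def by (auto intro!: exI[of _ L] exI[of _ "{}"])
 next
  fix z R1 A1 assume z: "z < k" and i: "I z R1 A1"
  obtain L1 U1 where LU: "raised g top U1 (z * H2) A L R1 A1 L1" "ALL j<N. j \<in> U1 <-> (EX q:EV y s (R1 33). cov i (OD q) j)" using i unfolding I_def by blast
  have e1: "env R1" "R1 30 = i" "R1 34 = y" "R1 9 = g" "R1 14 = top" "R1 47 = z" "R1 3 = k" using i r unfolding I_def env_def by auto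
  have ar: "!!b. b ~: {5, 6, 7, 8} ==> A1 b = A b" "logr R1 A1 L1" "hp (A1 5)" using LU(1) unfolding raised_def by auto
  have t1: "tabs A1" by (rule tabs_cong[OF t]) (use ar in simp)
  have "z * H2 <= k * H2" using z by (intro mult_le_mono1) simp
  then have ln: "length L1 + H2 <= LG" using raised_length[OF LU(1)] L(2) by linarith
  have x1: "1 <= R1 33" "R1 33 <= 2 * m + N" "s <= R1 33" "z < m" using i s z k1 unfolding I_def by auto
  have "runs WALKB R1 A1 (%t R' A'. t <= B & I (Suc z) R' A')"
  proof (rule runs_mono'[OF _ WALKB[where i = i and y = y and g = g and x = "R1 33" and z = z and L = L1]], goal_cases)
   case (1 t2 R2 A2) note a2 = this
   from conjunct1[OF conjunct2[OF a2]] obtain q L2 U2 where "R1 33 <= q & q <= 2 * m + N &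
    (ALL u. R1 33 <= u & u < q & u < 2 * m --> e (OD u) < y) & (q < 2 * m --> y <= e (OD q)) & R2 33 = (if q < 2 * m then q + 1 else q) &
    raised g top U2 H2 A1 L1 R2 A2 L2 & (ALL j<N. j \<in> U2 <-> q < 2 * m & cov i (OD q) j)" by (elim exE) (rule that)
   then have q: "R1 33 <= q" "q <= 2 * m + N" "!!u. R1 33 <= u ==> u < q ==> u < 2 * m ==> e (OD u) < y" "q < 2 * m ==> y <= e (OD q)"
    "R2 33 = (if q < 2 * m then q + 1 else q)" "raised g top U2 H2 A1 L1 R2 A2 L2" "ALL j<N. j \<in> U2 <-> q < 2 * m & cov i (OD q) j" by simp_all
   have E: "EV y s (R2 33) = EV y s (R1 33) \<union> (if q < 2 * m then {q} else {})" unfolding q(5) by (rule EV_step[OF x1(3) q(1,3,4)])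
   have "raised g top (U1 \<union> U2) (z * H2 + H2) A L R2 A2 L2" by (rule raised_trans[OF LU(1) q(6)])
   then have ra: "raised g top (U1 \<union> U2) (Suc z * H2) A L R2 A2 L2" by (simp add: add.commute)
   moreover have "ALL j<N. j \<in> U1 \<union> U2 <-> (EX q:EV y s (R2 33). cov i (OD q) j)" unfolding E using LU(2) q(7) by auto
   moreover have "2 * m <= R2 33 \<or> Suc z <= card (EV y s (R2 33))"
   proof (cases "q < 2 * m")
    case True
    have "q ~: EV y s (R1 33)" using q(1) by (simp add: EV_def)
    then have "card (EV y s (R2 33)) = Suc (card (EV y s (R1 33)))" unfolding E using True by simp
    moreover have "\<not> 2 * m <= R1 33" using True q(1) by simp
    ultimately show ?thesis using i unfolding I_def by auto
   qed (use q(5) in simp)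
   moreover have "s <= R2 33" "R2 33 <= 2 * m + N" using q x1 by auto
   moreover have "R2 47 = Suc z" using a2 by simp
   moreover have "sm {6, 7, 8, 10, 11, 12, 13, 15, 24, 25, 26, 27, 28, 29, 31, 32, 33, 35, 36, 47} R2 R" using a2 i unfolding I_def by simp
   ultimately show ?case using conjunct1[OF a2] unfolding I_def B_def by blast
  qed (use e1 t1 x1 im ar ln in auto)
  then show "okc R1 A1 ?c & holds R1 A1 ?c & runs WALKB R1 A1 (%t R' A'. t <= B & I (Suc z) R' A')" using e1 z by simp
 next
  fix R1 A1 assume "I k R1 A1"
  then show "okc R1 A1 ?c & \<not> holds R1 A1 ?c" using e0 by (simp add: I_def)
 qed
 have "runs (Wh ?c WALKB) (R(47 := 0)) A (%t. Q (2 + t))"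
 proof (rule runs_mono'[OF _ loop], goal_cases)
  case (1 t2 R2 A2) note a = this
  have s1: "B + xk ?c + 1 <= 710 * (h + 1) * (h + 1)" unfolding B_def by (simp add: algebra_simps)
  have "2 + t2 <= k * (710 * (h + 1) * (h + 1)) + 10" using conjunct1[OF a] mult_le_mono2[OF s1, of k] unfolding xk.simps xc.simps by linarith
  then show ?case using a unfolding Q_def I_def by blast
 qed
 then have "runs WALK R A Q" unfolding WALK_def by (intro runs_SqA runs_Asg) simp_all
 then show ?thesis unfolding Q_def .
qed

text \<open>A border of at most \<open>k\<close> runs is an active candidate whose weight reaches
  \<open>e i\<close>; a longer one is met by one of the two walks. Conversely, an active candidate
  with an end from \<open>i + k\<close> on has at most \<open>k\<close> runs and so starts behind
  \<open>i\<close>, which makes it a border, and a walk raises only ends of borders.\<close>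

lemma far:
 assumes x: "x < m" and i: "i = ORD x" and j: "i + k <= j" "j < m"
  and u1: "2 * m <= x1 \<or> k <= card (EV (e i) (x + 1) x1)" and u2: "2 * m <= x2 \<or> k <= card (EV (e i) (2 * m - x) x2)"
 shows "bord i j <-> e i <= FG (ACT i) (2 * m) j \<or> (EX q:EV (e i) (x + 1) x1. cov i (OD q) j) \<or> (EX q:EV (e i) (2 * m - x) x2. cov i (OD q) j)"
  (is "_ <-> ?F \<or> ?U1 \<or> ?U2")
proof
 have ij: "i < j" "i < m" using j k1 by auto
 have e1: "1 <= e i" using e_pos ij(2) by (simp add: Suc_leI One_nat_def)
 {
  assume b: "bord i j"
  show "?F \<or> ?U1 \<or> ?U2"
  proof (cases "EX r. 1 <= r & r <= k & r + i <= j & match i (j + 1 - r) r")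
   case True
   then obtain r where r: "1 <= r" "r <= k" "r + i <= j" "match i (j + 1 - r) r" by blast
   then have "act i (j + 1 - r) r" "r = 1 \<or> e i <= e (j + 1 - r)" using act_iff_match[of i "j + 1 - r" r] j by auto
   moreover have "req r <= 2 * m" using r k1 by (auto simp: req_def)
   ultimately have "(j + 1 - r, r) \<in> ACT i & j + 1 - r + r = j + 1 & req r <= 2 * m & e i <= wt (j + 1 - r) r"
    using r j e_INF[OF ij(2)] by (auto simp: ACT_def wt_def)
   then have ?F unfolding le_FG[OF finite_ACT] using j by auto
   then show ?thesis by blast
  next
   case False
   obtain y where y: "y < m" "i < ORD y" "ORD y <= j" "match i (ORD y) (j + 1 - ORD y)" "e i <= e (ORD y)"
    and c: "x < y & card {z. x < z & z < y & e i <= e (ORD z)} < k \<or> y < x & card {z. y < z & z < x & e i <= e (ORD z)} < k"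
    using long_visited[OF x i ij(1) j(2) b] False by blast
   have cv: "cov i (ORD y) j" unfolding cov_def using y j ij match_Cn[OF y(4)] ORD_lt by auto
   show ?thesis
   proof (cases "x < y")
    case True
    \<comment> \<open>Otherwise the \<open>k\<close> hits of the walk would all lie strictly between
      \<open>x\<close> and \<open>y\<close>, where fewer than \<open>k\<close> are possible.\<close>
    have "y < x1"
    proof (rule ccontr)
     assume n: "\<not> y < x1"
     have "EV (e i) (x + 1) x1 \<subseteq> {z. x < z & z < y & e i <= e (ORD z)}"
     proof
      fix u assume "u \<in> EV (e i) (x + 1) x1"
      then have u: "x + 1 <= u" "u < x1" "e i <= e (OD u)" unfolding EV_def by auto
      then have "u < m" using n y(1) by simp
      then show "u \<in> {z. x < z & z < y & e i <= e (ORD z)}" using u n by (simp add: OD_def)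
     qed
     then have "card (EV (e i) (x + 1) x1) <= card {z. x < z & z < y & e i <= e (ORD z)}" by (intro card_mono) auto
     then show False using u1 c True n y(1) by auto
    qed
    then have "y \<in> EV (e i) (x + 1) x1" using True y by (auto simp: EV_def OD_def)
    then show ?thesis using cv y(1) by (auto simp: OD_def)
   next
    case False
    then have yx: "y < x" "card {z. y < z & z < x & e i <= e (ORD z)} < k" using c by auto
    \<comment> \<open>The reflected place of rank \<open>y\<close>, which turns the downward case
      into the upward one.\<close>
    define q where "q = 2 * m - 1 - y"
    have q: "2 * m - x <= q" "q < 2 * m" "OD q = ORD y" "m <= q" using yx y(1) x unfolding q_def OD_def by auto
    have "q < x2"
    proof (rule ccontr)
     assume n: "\<not> q < x2"
     have "(%u. 2 * m - 1 - u) ` EV (e i) (2 * m - x) x2 \<subseteq> {z. y < z & z < x & e i <= e (ORD z)}"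
     proof
      fix v assume "v \<in> (%u. 2 * m - 1 - u) ` EV (e i) (2 * m - x) x2"
      then obtain u where u: "v = 2 * m - 1 - u" "2 * m - x <= u" "u < x2" "u < 2 * m" "e i <= e (OD u)" unfolding EV_def by auto
      have "m <= u" using u(2) x by simp
      then have "OD u = ORD v" using u(1) by (simp add: OD_def)
      moreover have "y < v" "v < x" using u n x yx unfolding q_def by auto
      ultimately show "v \<in> {z. y < z & z < x & e i <= e (ORD z)}" using u(5) by simp
     qed
     then have "card ((%u. 2 * m - 1 - u) ` EV (e i) (2 * m - x) x2) <= card {z. y < z & z < x & e i <= e (ORD z)}" by (intro card_mono) auto
     moreover have "card ((%u. 2 * m - 1 - u) ` EV (e i) (2 * m - x) x2) = card (EV (e i) (2 * m - x) x2)"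
      by (rule card_image) (auto simp: inj_on_def EV_def)
     ultimately show False using u2 yx n q by auto
    qed
    then have "q \<in> EV (e i) (2 * m - x) x2" using q y by (auto simp: EV_def)
    then have ?U2 using cv q(3) by (intro bexI[of _ q]) simp_all
    then show ?thesis by blast
   qed
  qed
 }
 assume "?F \<or> ?U1 \<or> ?U2"
 then consider ?F | q where "cov i (OD q) j" by blast
 then show "bord i j"
 proof cases
  case 1
  then obtain p r where pr: "(p, r) \<in> ACT i" "p + r = j + 1" "e i <= wt p r" using e1 j unfolding le_FG[OF finite_ACT] by auto
  have r: "1 <= r" "r <= k" "act i p r" using pr by (auto simp: ACT_def)
  have "match i p r" using act_iff_match[of i p r] pr r j by (auto simp: wt_def split: if_splits)
  moreover have "j + 1 - p = r" "i < p" "p <= j" using pr r j by auto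
  ultimately show ?thesis unfolding bord_iff[OF ij(1)] by blast
 next
  case (2 q)
  then show ?thesis unfolding bord_iff[OF ij(1)] cov_def by blast
 qed
qed

text \<open>The last unbordered end of start \<open>i\<close>. The value 0 stands for none, which is
  unambiguous because every end exceeds \<open>i\<close>.\<close>

definition isJ :: "nat => nat => bool" where
 "isJ i v <-> v = 0 & (ALL j. i < j & j < m --> bord i j) \<or> i < v & v < m & \<not> bord i v & (ALL j. v < j & j < m --> bord i j)"

lemma isJ_unique: "isJ i v ==> isJ i v' ==> v = v'"
 unfolding isJ_def by (metis linorder_neqE_nat)

text \<open>One scan over the starts \<open>p\<close> suffices. As each start serves an interval of
  ends that begins at itself, an end from \<open>p\<close> on is covered by an earlier start exactly
  if it is at most the farthest reach so far.\<close>

lemma NEAR: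
 assumes r: "env R" "R 30 = i" and t: "tabs A" and im: "i < m" and fr: "!!j. i + k <= j ==> j < m ==> bord i j"
 shows "runs NEAR R A (%t R' A'. t <= k * (180 * (h + 1)) + 40 & isJ i (R' 48) &
  sm {24, 25, 26, 27, 28, 29, 31, 32, 48, 49, 50} R' R & A' = A)"
  (is "runs _ _ _ ?Q")
proof -
 define Q where "Q = ?Q"
 have e0: "R 0 = m" "R 3 = k" using r by (auto simp: env_def)
 have bt: "base_tabs A" using t unfolding tabs_def by auto
 define b where "b = min (i + k) m"
 have b: "i + 1 <= b" "b <= m" "b <= i + k" unfolding b_def using im k1 by auto
 define n' where "n' = b - (i + 1)"
 define pre where "pre = (%s j. EX p. i < p & p < s & match i p (j + 1 - p))"
 define nJ where "nJ = (%s v. v = 0 & (ALL j. i < j & j < s --> bord i j) \<or> i < v & v < s & \<not> bord i v & (ALL j. v < j & j < s --> bord i j))"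
 define I where "I = (%z R1 A1. R1 31 = i + 1 + z & R1 50 = b & (ALL j. i + 1 + z <= j & j < m --> (pre (i + 1 + z) j <-> j <= R1 49)) &
  nJ (i + 1 + z) (R1 48) & sm {24, 25, 26, 27, 28, 29, 31, 32, 48, 49, 50} R1 R & A1 = A)"
 let ?c = "Lt (Var 31) (Var 50)"
 define B where "B = 140 * (h + 1) + 30"
 have loop: "runs (Wh ?c NEARB) R1 A1 (%t R' A'. t <= n' * (B + xk ?c + 1) + xk ?c + 1 & I n' R' A')" if I0: "I 0 R1 A1" for R1 A1
 proof (rule runs_For)
  show "I 0 R1 A1" by (rule I0)
 next
  fix z R1 A1 assume z: "z < n'" and i: "I z R1 A1"
  define p where "p = i + 1 + z"
  have p: "i < p" "p < b" "p < m" using z b unfolding p_def n'_def by auto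
  have e1: "env R1" "R1 30 = i" "R1 31 = p" "R1 50 = b" "A1 = A" using i r unfolding I_def p_def env_def by auto
  have pr: "!!j. p <= j ==> j < m ==> pre p j <-> j <= R1 49" and nj: "nJ p (R1 48)" using i unfolding I_def p_def by auto
  have ps: "pre (p + 1) j <-> pre p j \<or> match i p (j + 1 - p)" for j
  proof -
   have "i < u & u < p + 1 <-> i < u & u < p \<or> u = p" for u using p(1) by auto
   then show ?thesis unfolding pre_def by metis
  qed
  have a2: "A 2 p = Cn p" "A 2 i = Cn i" using tabs_simps(2)[OF t] p im by auto
  define P1 where "P1 = (%(u::nat) R2 A2. u <= 140 * (h + 1) + 15 & (ALL j. p <= j & j < m --> (pre (p + 1) j <-> j <= R2 49)) &
   sm {24, 25, 26, 27, 28, 29, 32, 49} R2 R1 & A2 = A)"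
  let ?D = "Ite (Lt (Var 49) (Var 32)) (49 ::= Var 32) Nop"
  have st1: "runs (Ite (Eq (Ar 2 (Var 31)) (Ar 2 (Var 30))) (REACH ;; ?D) Nop) R1 A P1"
  proof (cases "Cn p = Cn i")
   case False
   then have "\<not> match i p u" for u using match_Cn[of i p u] im p by blast
   then have "P1 8 R1 A" unfolding P1_def using pr ps by simp
   then show ?thesis
    by (intro runs_Ite runs_Nop) (use e1 a2 p im False in "simp_all add: lens")
  next
   case True
   have "runs (REACH ;; ?D) R1 A (%t. P1 (7 + t))"
   proof (rule runs_SqM'[OF _ REACH[where i = i and p = p]], goal_cases)
    case (1 t2 R2 A2) note a2 = this
    have rc: "match i p (j + 1 - p) <-> j <= R2 32" if "p <= j" "j < m" for j using a2 that unfolding reach_def by blast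
    have c: "pre (p + 1) j <-> j <= R2 49 \<or> j <= R2 32" if "p <= j" "j < m" for j
     using ps[of j] pr[OF that] rc[OF that] a2 by simp
    show ?case
    proof (cases "R2 49 < R2 32")
     case lt: True
     have "P1 (7 + (t2 + 5)) (R2(49 := R2 32)) A2" unfolding P1_def using c lt a2 by auto
     then show ?thesis by (intro runs_Ite runs_Asg) (use lt in simp_all)
    next
     case lt: False
     have "P1 (7 + (t2 + 4)) R2 A2" unfolding P1_def using c lt a2 by auto
     then show ?thesis by (intro runs_Ite runs_Nop) (use lt in simp_all)
    qed
   qed (use e1 p True bt in auto)
   then show ?thesis
    by (intro runs_Ite) (use e1 a2 p im True in "simp_all add: lens ac_simps")
  qed
  define P where "P = (%(t::nat) R' A'. t <= B & I (Suc z) R' A')"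
  have "runs NEARB R1 A P" unfolding NEARB_def
  proof (rule runs_SqM'[OF _ st1], goal_cases)
   case (1 t2 R2 A2) note a2 = this
   then have q: "t2 <= 140 * (h + 1) + 15" "!!j. p <= j ==> j < m ==> pre (p + 1) j <-> j <= R2 49" "R2 31 = p" "R2 48 = R1 48" "R2 50 = b" "A2 = A"
    "!!y. y ~: {24, 25, 26, 27, 28, 29, 32, 49} ==> R2 y = R1 y" using e1 unfolding P1_def by auto
   have "bord i p <-> pre (p + 1) p" unfolding bord_iff[OF p(1)] pre_def by (auto simp: less_Suc_eq_le simp flip: Suc_eq_plus1)
   then have bp: "bord i p <-> p <= R2 49" using q(2)[of p] p by simp
   have ip: "i + 1 + Suc z = p + 1" unfolding p_def by simp
   have fin: "I (Suc z) R3 A2" if "R3 31 = p + 1" "R3 49 = R2 49" "R3 48 = (if R2 49 < p then p else R1 48)" "!!y. y ~: {31, 48} ==> R3 y = R2 y" for R3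
   proof -
    have jp: "j < p + 1 <-> j < p \<or> j = p" for j by auto
    have "nJ (p + 1) (R3 48)"
    proof (cases "R2 49 < p")
     case True
     then show ?thesis using that(3) bp p(1) unfolding nJ_def by auto
    next
     case False
     then have "bord i p" using bp by simp
     then show ?thesis using that(3) False nj unfolding nJ_def jp by auto
    qed
    moreover have "pre (p + 1) j <-> j <= R3 49" if "p + 1 <= j" "j < m" for j using q(2)[of j] that \<open>R3 49 = R2 49\<close> by simp
    ultimately show ?thesis unfolding I_def ip using that q i unfolding I_def by auto
   qed
   have w1: "p + 1 < 2 ^ w" using p m_small by linarith
   show ?case
   proof (cases "R2 49 < p")
    case True
    have "I (Suc z) (R2(48 := p, 31 := p + 1)) A2" by (rule fin) (use True in auto)
    then show ?thesis
     by (intro runs_intros) (use q(1,3) w1 True in "simp_all add: P_def B_def")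
   next
    case False
    have "I (Suc z) (R2(31 := p + 1)) A2" by (rule fin) (use False q in auto)
    then show ?thesis
     by (intro runs_intros) (use q(1,3) w1 False in "simp_all add: P_def B_def")
   qed
  qed
  then show "okc R1 A1 ?c & holds R1 A1 ?c & runs NEARB R1 A1 (%t R' A'. t <= B & I (Suc z) R' A')"
   using e1 p unfolding P_def by simp
 next
  fix R1 A1 assume "I n' R1 A1"
  then show "okc R1 A1 ?c & \<not> holds R1 A1 ?c" using b by (simp add: I_def n'_def)
 qed
 let ?R = "R(48 := 0, 49 := 0, 50 := b, 31 := i + 1)"
 have I0: "I 0 ?R A" unfolding I_def pre_def nJ_def by auto
 have "runs (Wh ?c NEARB) R3 A (%t. Q (v + t))" if "R3 = ?R" "v <= 25" for R3 v
 proof (rule runs_mono)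
  show "runs (Wh ?c NEARB) R3 A (%t R' A'. t <= n' * (B + xk ?c + 1) + xk ?c + 1 & I n' R' A')" unfolding that(1) by (rule loop[OF I0])
  fix t R1 A1 assume a: "t <= n' * (B + xk ?c + 1) + xk ?c + 1 & I n' R1 A1"
  have s1: "B + xk ?c + 1 <= 180 * (h + 1)" unfolding B_def by simp
  have "n' <= k" using b unfolding n'_def by simp
  then have "n' * (B + xk ?c + 1) <= k * (180 * (h + 1))" using s1 by (rule mult_le_mono)
  then have "v + t <= k * (180 * (h + 1)) + 40" using conjunct1[OF a] that(2) unfolding xk.simps xc.simps by linarith
  moreover have "nJ b (R1 48)" using a b unfolding I_def n'_def by simp
  then have "isJ i (R1 48)"
  proof -
   have "bord i j" if "b <= j" "j < m" for j using fr[of j] that unfolding b_def by (simp add: min_def split: if_splits)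
   then show ?thesis using \<open>nJ b (R1 48)\<close> b unfolding nJ_def isJ_def by (meson leI order_less_le_trans)
  qed
  ultimately show "Q (v + t) R1 A1" using a unfolding Q_def I_def by blast
 qed
 note lp = this
 have w1: "i + k < 2 ^ w" "i + 1 < 2 ^ w" using im k1 m_small by linarith+
 have "runs NEAR R A Q"
 proof (cases "m < i + k")
  case True
  then have "b = m" by (simp add: b_def)
  then show ?thesis unfolding NEAR_def
   by (intro runs_SqA runs_Sq[of "Ite _ _ _"] runs_Ite runs_Asg)
    (use e0 r w1 True lp in "simp_all flip: add.assoc")
 next
  case False
  then have "b = i + k" by (simp add: b_def)
  then show ?thesis unfolding NEAR_def
   by (intro runs_SqA runs_Sq[of "Ite _ _ _"] runs_Ite runs_Asg runs_Nop)
    (use e0 r w1 False lp in "simp_all flip: add.assoc")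
 qed
 then show ?thesis unfolding Q_def .
qed

lemma QUERY:
 assumes r: "env R" "R 30 = i" "R 34 = e i" and t: "tabs A" and im: "i < m" and hp: "hp (A 5)"
  and out: "!!j. m <= j ==> j < N ==> blk (A 5) (e i) j" and fr: "!!j. i + k <= j ==> j < m ==> blk (A 5) (e i) j <-> bord i j"
 shows "runs QUERY R A (%t R' A'. t <= k * (180 * (h + 1)) + 40 * (h + 1) + 80 & isJ i (R' 48) &
  sm {16, 17, 24, 25, 26, 27, 28, 29, 31, 32, 48, 49, 50} R' R & A' = A)"
  (is "runs _ _ _ ?Q")
proof -
 define Q where "Q = ?Q"
 have e0: "R 0 = m" "R 1 = N" "R 3 = k" using r by (auto simp: env_def)
 have w1: "i + k < 2 ^ w" using im k1 m_small by linarith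
 let ?N = "Ite (Lt (Var 48) (Plus (Var 30) (Var 3))) NEAR Nop"
 have fin: "runs ?N R2 A (%t. Q (v + t))"
  if a: "v <= 40 * (h + 1) + 20" "R2 48 < N" "R2 48 < i + k \<or> \<not> blk (A 5) (e i) (R2 48)" "!!j. R2 48 < j ==> j < N ==> blk (A 5) (e i) j"
   "!!y. y ~: {16, 17, 48} ==> R2 y = R y" for R2 v
 proof -
  have e2: "env R2" "R2 30 = i" "R2 3 = k" using a(5) r e0 by (auto simp: env_def)
  show ?thesis
  proof (cases "R2 48 < i + k")
   case True
   have bd: "bord i j" if "i + k <= j" "j < m" for j using fr[OF that] a(4)[of j] True that mN by simp
   have "runs NEAR R2 A (%t. Q (v + (t + 5)))"
    by (rule runs_mono[OF NEAR[OF e2(1,2) t im bd]]) (use a in "auto simp: Q_def")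
   then show ?thesis by (intro runs_Ite) (use e2 w1 True in "simp_all add: ac_simps")
  next
   case False
   have nb: "\<not> blk (A 5) (e i) (R2 48)" using a(3) False by blast
   then have lt: "R2 48 < m" using out[of "R2 48"] a(2) by (meson leI)
   have "\<not> bord i (R2 48)" using fr[of "R2 48"] nb False lt by simp
   moreover have "bord i j" if "R2 48 < j" "j < m" for j using fr[of j] a(4)[of j] that False mN by simp
   moreover have "i < R2 48" using False k1 by simp
   ultimately have "isJ i (R2 48)" using lt unfolding isJ_def by blast
   then have "Q (v + 6) R2 A" unfolding Q_def using a by auto
   then show ?thesis by (intro runs_Ite runs_Nop) (use e2 w1 False in simp_all)
  qed
 qed
 have "runs QUERY R A Q"
 proof (cases "A 5 1 < e i")
  case True
  let ?R = "R(48 := 0, 16 := e i)"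
  have "runs (FIND ;; 48 ::= Var 17) ?R A (%u R' A'. runs ?N R' A' (%t. Q (4 + (u + 5 + t))))"
  proof (rule runs_SqM'[OF _ FIND[where y = "e i"]], goal_cases)
   case (1 t2 R2 A2) note a2 = this
   have "runs ?N (R2(48 := R2 17)) A (%t. Q (4 + (t2 + 2 + 5) + t))" by (rule fin) (use a2 in auto)
   then show ?case
    by (intro runs_Asg) (use a2 in "simp_all add: ac_simps")
  qed (use e0 hp True in auto)
  then show ?thesis unfolding QUERY_def
   by (intro runs_SqA runs_Sq[of "Ite _ _ _"] runs_Ite runs_Asg)
    (use r True N_pos in "simp_all add: lens ac_simps")
 next
  case False
  have "runs ?N (R(48 := 0, 16 := e i)) A (%t. Q (10 + t))"
   by (rule fin) (use False root_le[of _ "e i" "A 5"] N_pos k1 in auto)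
  then show ?thesis unfolding QUERY_def
   by (intro runs_SqA runs_Sq[of "Ite _ _ _"] runs_Ite[where c = "Lt (Ar 5 (Num 1)) (Var 16)"] runs_Asg runs_Nop)
    (use r False N_pos in "simp_all add: lens ac_simps")
 qed
 then show ?thesis unfolding Q_def .
qed

section \<open>Recording the longest occurrences\<close>

definition recs :: "nat => nat => (nat \<times> nat) set" where
 "recs z l = {(Suc (pos (ORD y)), pos (Suc v)) |y v. y < z & isJ (ORD y) v & v ~= 0 & pos (Suc v) - pos (ORD y) = l}"

definition RI :: "nat => regs => arrs => bool" where
 "RI z R A <-> (EX xs. distinct xs & set xs = recs z (R 52) & R 53 = length xs & length xs <= z &
  (ALL u<length xs. A 13 (2 * u) = fst (xs ! u) & A 13 (2 * u + 1) = snd (xs ! u)) &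
  (ALL y v. y < z & isJ (ORD y) v & v ~= 0 --> pos (Suc v) - pos (ORD y) <= R 52) & (R 52 ~= 0 --> xs ~= []))"

lemma RI_cong: "RI z R A ==> R' 52 = R 52 ==> R' 53 = R 53 ==> A' 13 = A 13 ==> RI z R' A'"
 unfolding RI_def by simp

lemma RI_0: "R 52 = 0 ==> R 53 = 0 ==> RI 0 R A"
 unfolding RI_def recs_def by (intro exI[of _ "[]"]) simp

lemma recs_Suc:
 assumes "isJ (ORD z) v"
 shows "recs (Suc z) l = recs z l \<union> (if v ~= 0 & pos (Suc v) - pos (ORD z) = l then {(Suc (pos (ORD z)), pos (Suc v))} else {})"
proof -
 have "isJ (ORD z) v' <-> v' = v" for v' using isJ_unique assms by blast
 then show ?thesis unfolding recs_def less_Suc_eq by auto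
qed

lemma RECORD:
 assumes r: "R 30 = ORD z" "R 48 = v" and t: "tabs A" and z: "z < m" and v: "isJ (ORD z) v" and I: "RI z R A"
 shows "runs RECORD R A (%t R' A'. t <= 70 & RI (Suc z) R' A' & sm {51, 52, 53} R' R & (ALL b. b ~= 13 --> A' b = A b))"
  (is "runs _ _ _ ?Q")
proof -
 define Q where "Q = ?Q"
 define i where "i = ORD z"
 have im: "i < m" unfolding i_def by (rule ORD_lt[OF z])
 obtain xs where xs: "distinct xs" "set xs = recs z (R 52)" "R 53 = length xs" "length xs <= z"
  "!!u. u < length xs ==> A 13 (2 * u) = fst (xs ! u) & A 13 (2 * u + 1) = snd (xs ! u)"
  "!!y v. y < z ==> isJ (ORD y) v ==> v ~= 0 ==> pos (Suc v) - pos (ORD y) <= R 52" "R 52 ~= 0 ==> xs ~= []" using I unfolding RI_def by blast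
 have "runs RECORD R A Q"
 proof (cases "v = 0")
  case True
  have "recs (Suc z) (R 52) = recs z (R 52)" using recs_Suc[OF v] True by simp
  moreover have "pos (Suc v') - pos (ORD y) <= R 52" if "y < Suc z" "isJ (ORD y) v'" "v' ~= 0" for y v'
   using xs(6)[of y v'] that isJ_unique[OF v] True by (auto simp: less_Suc_eq)
  ultimately have "RI (Suc z) R A" unfolding RI_def using xs by (intro exI[of _ xs]) auto
  then have "Q 4 R A" unfolding Q_def by simp
  then show ?thesis unfolding RECORD_def by (intro runs_Ite runs_Nop) (use r True in simp_all)
 next
  case v0: False
  have iv: "i < v" "v < m" using v v0 unfolding isJ_def i_def by auto
  define l where "l = pos (Suc v) - pos i"
  define new where "new = (Suc (pos i), pos (Suc v))"
  have pl: "pos i < pos (Suc v)" using iv by (intro pos_less) auto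
  then have l0: "0 < l" unfolding l_def by simp
  have a0: "A 12 (v + 1) = pos (Suc v)" "A 12 i = pos i" using tabs_simps(6)[OF t, of "v + 1"] tabs_simps(6)[OF t, of i] iv im by (simp_all add: One_nat_def)
  have pn: "pos (Suc v) <= n" unfolding n_pos using iv by (intro pos_mono) simp
  have w1: "pos i + 1 < 2 ^ w" "v + 1 < 2 ^ w" using pn pl iv m_small lin_bound[of "n + 2"] by simp_all
  have rc: "recs (Suc z) l' = recs z l' \<union> (if l = l' then {new} else {})" for l' using recs_Suc[OF v] v0 unfolding l_def new_def i_def by simp
  have all: "pos (Suc v') - pos (ORD y) <= M" if "y < Suc z" "isJ (ORD y) v'" "v' ~= 0" "l <= M" "R 52 <= M" for y v' M
   using xs(6)[of y v'] that isJ_unique[OF v] unfolding l_def i_def by (auto simp: less_Suc_eq)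
  \<comment> \<open>Different ranks belong to different starts, so an occurrence is never listed
    twice.\<close>
  have nin: "new ~: recs z l'" for l'
  proof
   assume "new \<in> recs z l'"
   then obtain y where y: "y < z" "pos (ORD y) = pos i" unfolding recs_def new_def by auto
   have ne: "ORD y ~= i" unfolding i_def using ORD_inj[of y z] y z by auto
   have "ORD y < m" using ORD_lt y z by simp
   then show False using y(2) ne im pos_less[of "ORD y" i] pos_less[of i "ORD y"] by (metis less_imp_le linorder_neqE_nat nat_less_le)
  qed
  define A' where "A' = (%u. A(13 := (A 13)(2 * u := pos i + 1, 2 * u + 1 := pos (Suc v))))"
  have nw: "RI (Suc z) R' (A' (length ys))" if ys: "distinct ys" "set ys = recs z l" "length ys <= z" "!!u. u < length ys ==> A 13 (2 * u) = fst (ys ! u) & A 13 (2 * u + 1) = snd (ys ! u)"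
   and R': "R' 52 = l" "R' 53 = length ys + 1" and le: "R 52 <= l" for ys R'
   unfolding RI_def
  proof (intro exI[of _ "ys @ [new]"] conjI allI impI)
   show "distinct (ys @ [new])" using ys nin by auto
   show "set (ys @ [new]) = recs (Suc z) (R' 52)" using ys rc[of l] R' by simp
   show "R' 53 = length (ys @ [new])" "length (ys @ [new]) <= Suc z" "ys @ [new] ~= []" using R' ys by auto
   fix u assume u: "u < length (ys @ [new])"
   have odd: "2 * u ~= 2 * length ys + 1" "2 * u + 1 ~= 2 * length ys" by arith+
   have "A' (length ys) 13 (2 * u) = fst ((ys @ [new]) ! u) & A' (length ys) 13 (2 * u + 1) = snd ((ys @ [new]) ! u)"
   proof (cases "u < length ys")
    case False
    then have "u = length ys" using u by simp
    then show ?thesis unfolding A'_def new_def by simp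
   qed (use ys(4)[of u] odd in "simp add: A'_def nth_append")
   then show "A' (length ys) 13 (2 * u) = fst ((ys @ [new]) ! u)" "A' (length ys) 13 (2 * u + 1) = snd ((ys @ [new]) ! u)" by auto
  next
   fix y v' assume "y < Suc z & isJ (ORD y) v' & v' ~= 0"
   then show "pos (Suc v') - pos (ORD y) <= R' 52" using all[of y v' l] le R' by simp
  qed
  have xm: "2 * length xs + 1 < 2 * m" using xs(4) z by simp
  have base: "R 30 = i" "R 48 = v" "R 53 = length xs" "i <= m" "v + 1 <= m" using r xs iv im unfolding i_def by auto
  consider "R 52 < l" | "R 52 = l" | "l < R 52" by linarith
  then show ?thesis
  proof cases
   case 1
   have "recs z l = {}"
   proof (rule ccontr)
    assume "recs z l ~= {}"
    then obtain y v' where "y < z" "isJ (ORD y) v'" "v' ~= 0" "pos (Suc v') - pos (ORD y) = l" unfolding recs_def by auto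
    then show False using xs(6)[of y v'] 1 by simp
   qed
   then have "RI (Suc z) (R(51 := l, 52 := l, 53 := 1)) (A' (length ([] :: (nat \<times> nat) list)))" using 1 by (intro nw) auto
   then have "Q u (R(51 := l, 52 := l, 53 := 1)) (A' 0)" if "u <= 70" for u unfolding Q_def A'_def using that by auto
   then show ?thesis unfolding RECORD_def
    by (intro runs_intros) (use base a0 w1 v0 1 pl m2 m_small in "simp_all add: lens l_def[symmetric] A'_def del: pos_Suc")
  next
   case 2
   then have "RI (Suc z) (R(51 := l, 53 := length xs + 1)) (A' (length xs))" using xs(1-5) by (intro nw) auto
   then have "Q u (R(51 := l, 53 := length xs + 1)) (A' (length xs))" if "u <= 70" for u unfolding Q_def A'_def using that by auto
   then show ?thesis unfolding RECORD_def
    by (intro runs_intros) (use base a0 w1 v0 2 pl xm m_small in "simp_all add: lens l_def[symmetric] A'_def del: pos_Suc")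
  next
   case 3
   have "RI (Suc z) (R(51 := l)) A" unfolding RI_def
    using xs rc[of "R 52"] 3 all[where M = "R 52"] by (intro exI[of _ xs]) auto
   then have "Q u (R(51 := l)) A" if "u <= 70" for u unfolding Q_def using that by auto
   then show ?thesis unfolding RECORD_def
    by (intro runs_intros) (use base a0 w1 v0 3 pl m_small in "simp_all add: lens l_def[symmetric] del: pos_Suc")
  qed
 qed
 then show ?thesis unfolding Q_def .
qed

lemma isJ_ex: "i < m ==> EX v. isJ i v"
proof -
 assume im: "i < m"
 let ?S = "{j. i < j & j < m & \<not> bord i j}"
 have f: "finite ?S" by simp
 show ?thesis
 proof (cases "?S = {}")
  case True
  then show ?thesis unfolding isJ_def by blast
 next
  case False
  have "Max ?S \<in> ?S" using Max_in[OF f False] .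
  moreover have "bord i j" if "Max ?S < j" "j < m" for j
  proof (rule ccontr)
   assume "\<not> bord i j"
   then have "j \<in> ?S" using that calculation by auto
   then have "j <= Max ?S" by (rule Max_ge[OF f])
   then show False using that(1) by simp
  qed
  ultimately show ?thesis unfolding isJ_def by blast
 qed
qed

text \<open>For a fixed start a farther end gives a longer factor. Hence every longest factor ends
  at the last unbordered end of its start, and one entry per start loses nothing.\<close>

lemma RI_final:
 assumes "RI m R A"
 shows "EX xs. distinct xs & set xs = {(Suc (pos x), pos (Suc y)) |x y. x < y & y < m & \<not> bord x y &
   (ALL x' y'. x' < y' & y' < m & \<not> bord x' y' --> pos (Suc y') - pos x' <= pos (Suc y) - pos x)} &
  R 53 = length xs & length xs <= m & (ALL u<length xs. A 13 (2 * u) = fst (xs ! u) & A 13 (2 * u + 1) = snd (xs ! u))"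
proof -
 obtain xs where xs: "distinct xs" "set xs = recs m (R 52)" "R 53 = length xs" "length xs <= m"
  "ALL u<length xs. A 13 (2 * u) = fst (xs ! u) & A 13 (2 * u + 1) = snd (xs ! u)"
  "!!y v. y < m ==> isJ (ORD y) v ==> v ~= 0 ==> pos (Suc v) - pos (ORD y) <= R 52" "R 52 ~= 0 ==> xs ~= []" using assms unfolding RI_def by blast
 have ub: "pos (Suc y') - pos x' <= R 52" if xy: "x' < y'" "y' < m" "\<not> bord x' y'" for x' y'
 proof -
  have xm: "x' < m" using xy by simp
  obtain v where v: "isJ x' v" using isJ_ex[OF xm] by blast
  from v[unfolded isJ_def] have "y' <= v & v ~= 0 & v < m"
  proof
   assume "v = 0 & (ALL j. x' < j & j < m --> bord x' j)"
   then show ?thesis using xy by blast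
  next
   assume b: "x' < v & v < m & \<not> bord x' v & (ALL j. v < j & j < m --> bord x' j)"
   then have "\<not> v < y'" using xy by blast
   then show ?thesis using b by simp
  qed
  then have yv: "y' <= v" "v ~= 0" "v < m" by auto
  obtain u where u: "u < m" "ORD u = x'" using ORD_surj[OF xm] by blast
  have "pos (Suc y') <= pos (Suc v)" using yv by (intro pos_mono) simp
  then have "pos (Suc y') - pos x' <= pos (Suc v) - pos x'" by (rule diff_le_mono)
  also have "\<dots> <= R 52" using xs(6)[of u v] u v yv by simp
  finally show ?thesis .
 qed
 have "recs m (R 52) = {(Suc (pos x), pos (Suc y)) |x y. x < y & y < m & \<not> bord x y &
   (ALL x' y'. x' < y' & y' < m & \<not> bord x' y' --> pos (Suc y') - pos x' <= pos (Suc y) - pos x)}" (is "_ = ?S")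
 proof (intro equalityI subsetI)
  fix o' assume "o' \<in> recs m (R 52)"
  then obtain y v where y: "o' = (Suc (pos (ORD y)), pos (Suc v))" "y < m" "isJ (ORD y) v" "v ~= 0" "pos (Suc v) - pos (ORD y) = R 52" unfolding recs_def by blast
  have "ORD y < v" "v < m" "\<not> bord (ORD y) v" using y unfolding isJ_def by auto
  moreover have "ALL x' y'. x' < y' & y' < m & \<not> bord x' y' --> pos (Suc y') - pos x' <= pos (Suc v) - pos (ORD y)" unfolding y(5) using ub by blast
  ultimately show "o' \<in> ?S" using y(1) by blast
 next
  fix o' assume "o' \<in> ?S"
  then obtain x y where o: "o' = (Suc (pos x), pos (Suc y))" and xy: "x < y" "y < m" "\<not> bord x y"
   and bst: "!!x' y'. x' < y' ==> y' < m ==> \<not> bord x' y' ==> pos (Suc y') - pos x' <= pos (Suc y) - pos x" by blast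
  have xm: "x < m" using xy by simp
  have pp: "pos x < pos (Suc y)" using xy by (intro pos_less) auto
  have J: "isJ x y" unfolding isJ_def
  proof (intro disjI2 conjI allI impI)
   fix j assume j: "y < j & j < m"
   show "bord x j"
   proof (rule ccontr)
    assume "\<not> bord x j"
    then have "pos (Suc j) - pos x <= pos (Suc y) - pos x" using bst[of x j] j xy by simp
    moreover have "pos (Suc y) < pos (Suc j)" using j by (intro pos_less) auto
    ultimately show False using pp by simp
   qed
  qed (use xy in auto)
  obtain u where u: "u < m" "ORD u = x" using ORD_surj[OF xm] by blast
  have le: "pos (Suc y) - pos x <= R 52" using ub xy by blast
  then have "R 52 ~= 0" using pp by simp
  then have "recs m (R 52) ~= {}" using xs(2,7) by auto
  then obtain y2 v2 where y2: "y2 < m" "isJ (ORD y2) v2" "v2 ~= 0" "pos (Suc v2) - pos (ORD y2) = R 52" unfolding recs_def by auto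
  have "ORD y2 < v2" "v2 < m" "\<not> bord (ORD y2) v2" using y2 unfolding isJ_def by auto
  then have "R 52 <= pos (Suc y) - pos x" using bst y2(4) by metis
  then have "pos (Suc y) - pos (ORD u) = R 52" using le u by simp
  moreover have "isJ (ORD u) y" using J u by simp
  ultimately show "o' \<in> recs m (R 52)" unfolding recs_def o using u xy by (intro CollectI exI[of _ u] exI[of _ y]) simp
 qed
 then show ?thesis using xs by auto
qed

text \<open>Within \<open>2 * m\<close> tokens the later of two different starts runs past the last
  run and reads the sentinel, while the earlier one reads a letter.\<close>

lemma Xr_le: "Xr x <= 2 * m"
proof (cases "x = 0 \<or> m <= x")
 case False
 then have x: "0 < x" "x < m" by auto
 define p q where "p = ORD (x - 1)" and "q = ORD x"
 have "x - 1 < m" "x - 1 ~= x" using x by auto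
 then have pq: "p < m" "q < m" "p ~= q" unfolding p_def q_def using ORD_lt ORD_inj x by blast+
 have *: False if "eqd (2 * m) a b" "a < b" "b < m" for a b
 proof -
  have "2 * (m - b) - 1 < 2 * m" using that by simp
  then have "tk a (2 * (m - b) - 1) = tk b (2 * (m - b) - 1)" using that(1) unfolding eqd_def by blast
  then have "Cn (a + (m - b)) = Cn (b + (m - b))" using tk_c[of "m - b"] that by simp
  moreover have "Cn (b + (m - b)) = 0" using that by (intro Cn_out) simp
  moreover have "1 <= Cn (a + (m - b))" using that by (intro Cn_pos) simp
  ultimately show False by simp
 qed
 have "\<not> eqd (2 * m) p q" using *[of p q] *[of q p] pq eqd_sym by (metis linorder_neqE_nat)
 then show ?thesis using le_Xr[OF x, of "2 * m"] unfolding p_def q_def by simp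
qed (auto simp: Xr_def)

section \<open>The invariant of the sweep and its amortised cost\<close>

definition PRE :: "nat => (nat \<times> nat) set" where
 "PRE z = (if z = 0 then {} else ACT (ORD (z - 1)))"

text \<open>The state between two ranks. Only the versions up to request \<open>2 * m\<close> are
  described, for what lies above stems from the walks of the preceding rank and is about to be
  undone.\<close>

definition SI :: "nat => regs => arrs => (nat \<times> nat \<times> nat) list => bool" where
 "SI z R A L <-> (EX F C. logr R A L & stk (A 5) L F C & (ALL q<=2 * m. F q = FG (PRE z) q & C q = CN (PRE z) q) &
  (ALL u:set L. fst (snd u) < 2 * N) & L ~= [] & fst (last L) = 0 & length L <= LG)"

lemma OLD_PRE: "OLD z = {(p, r). (p, r) \<in> PRE z & req r <= Xr z}"
 unfolding OLD_def PRE_def by auto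

lemma above_sorted: "sorted_wrt (%x y. fst y <= fst x) L ==> ALL z:set (dropWhile (above x) L). fst z <= x"
 by (induction L) auto

lemma SI_ne:
 assumes "SI z R A L"
 shows "dropWhile (above x) L ~= []" "last (dropWhile (above x) L) = last L"
proof -
 have l: "L ~= []" "fst (last L) = 0" using assms unfolding SI_def by auto
 show ne: "dropWhile (above x) L ~= []"
 proof
  assume "dropWhile (above x) L = []"
  then have "above x (last L)" using l(1) last_in_set[of L] unfolding dropWhile_eq_Nil_conv by blast
  then show False using l(2) by simp
 qed
 have "last (takeWhile (above x) L @ dropWhile (above x) L) = last (dropWhile (above x) L)" using ne by (rule last_appendR)
 then show "last (dropWhile (above x) L) = last L" by simp
qed

text \<open>Cutting the log at \<open>Xr z\<close> leaves the candidates of the preceding rank with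
  request at most \<open>Xr z\<close>, and these are the members of \<open>OLD z\<close>.\<close>

lemma SI_pop:
 assumes S: "SI z R A L" and lg: "logr R1 A1 (dropWhile (above (Xr z)) L)" and V: "A1 5 = undo (takeWhile (above (Xr z)) L) (A 5)"
 shows "PI (OLD z) (Xr z) R1 A1 (dropWhile (above (Xr z)) L)"
proof -
 let ?x = "Xr z"
 obtain F C where FC: "stk (A 5) L F C" "ALL q<=2 * m. F q = FG (PRE z) q & C q = CN (PRE z) q" "ALL u:set L. fst (snd u) < 2 * N" "L ~= []" "fst (last L) = 0"
  using S unfolding SI_def by blast
 have F: "F (min q ?x) = FG (OLD z) q" for q
 proof -
  have "F (min q ?x) = FG (PRE z) (min q ?x)" using FC(2) Xr_le[of z] by (simp add: min.coboundedI2)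
  moreover have "{wt p r |p r. (p, r) \<in> PRE z & p + r = j + 1 & req r <= min q ?x} = {wt p r |p r. (p, r) \<in> OLD z & p + r = j + 1 & req r <= q}" for j
   unfolding OLD_PRE by auto
  ultimately show ?thesis unfolding FG_def by (simp only:)
 qed
 have C: "C (min q ?x) = CN (OLD z) q" for q
 proof -
  have "C (min q ?x) = CN (PRE z) (min q ?x)" using FC(2) Xr_le[of z] by (simp add: min.coboundedI2)
  moreover have "{(p, r). (p, r) \<in> PRE z & \<not> bord p (p + r - 1) & req r <= min q ?x} = {(p, r). (p, r) \<in> OLD z & \<not> bord p (p + r - 1) & req r <= q}"
   unfolding OLD_PRE by auto
  ultimately show ?thesis unfolding CN_def by (simp only:)
 qed
 have "stk (A1 5) (dropWhile (above ?x) L) (FG (OLD z)) (CN (OLD z))" using stk_pop[OF FC(1), of ?x] unfolding F C V .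
 moreover have "ALL u:set (dropWhile (above ?x) L). fst u <= ?x" using FC(1) unfolding stk_def by (intro above_sorted) blast
 moreover have "ALL u:set (dropWhile (above ?x) L). fst (snd u) < 2 * N" using FC(3) by (meson set_dropWhileD)
 moreover have "ALL (p, r):OLD z. req r <= ?x" unfolding OLD_PRE by auto
 ultimately show ?thesis unfolding PI_def using lg SI_ne[OF S, of ?x] FC(5) by auto
qed

lemma SI_end:
 assumes P: "PI (ACT (ORD z)) (2 * m) R1 A1 L1" and ra: "raised (2 * m + 2) top U B A1 L1 R2 A2 L2" and l: "length L2 <= LG"
 shows "SI (Suc z) R2 A2 L2"
proof -
 let ?G = "ACT (ORD z)"
 define f where "f = (%j. if j \<in> U then max (FG ?G (2 * m) j) top else FG ?G (2 * m) j)"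
 have tr: "tr (A1 5) (FG ?G (2 * m))" using PI_tr[OF P] by blast
 have t: "tr (A2 5) f" unfolding tr_def
 proof (intro conjI allI impI)
  fix v assume "1 <= v & v < N"
  then show "heap_at (A2 5) v" using ra unfolding raised_def by blast
 next
  fix j y assume "j < N"
  then have "blk (A1 5) y j <-> y <= FG ?G (2 * m) j" using tr unfolding tr_def by blast
  moreover have "blk (A2 5) y j <-> blk (A1 5) y j \<or> j \<in> U & y <= top" using ra unfolding raised_def by blast
  ultimately show "blk (A2 5) y j <-> y <= f j" unfolding f_def by (simp add: le_max_iff_disj)
 qed
 have ex: "ext (2 * m + 2) (A1 5) L1 (A2 5) L2 B" and lg: "logr R2 A2 L2" using ra unfolding raised_def by auto
 have st: "stk (A1 5) L1 (FG ?G) (CN ?G)" "ALL u:set L1. fst u <= 2 * m & fst (snd u) < 2 * N" "L1 ~= []" "fst (last L1) = 0" using P unfolding PI_def by auto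
 have le: "ALL u:set L1. fst u <= 2 * m + 2" using st(2) by (meson le_add1 le_trans)
 note s' = stk_push[OF st(1) le ex t]
 obtain K where K: "L2 = K @ L1" using ex unfolding ext_def by blast
 have "ALL u:set L2. fst (snd u) < 2 * N" by (rule ext_adr[OF ex]) (use st(2) in blast)
 moreover have "PRE (Suc z) = ?G" by (simp add: PRE_def)
 ultimately show ?thesis unfolding SI_def using s' lg l K st(3,4) by (intro exI conjI) (assumption | simp)+
qed

lemma SI_init:
 assumes hp: "hp (A 5)" and b: "ALL j<N. ALL y. blk (A 5) y j <-> y = 0 \<or> m <= j & y <= top" and lg: "logr R A L"
  and L: "ALL u:set L. fst u = 0 & fst (snd u) < 2 * N" "L ~= []" "length L <= 2 * (h + 1) * (h + 1) + 1"
 shows "SI 0 R A L"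
proof -
 have ab: "takeWhile (above q) L = [] & dropWhile (above q) L = L" for q by (rule above_none) (use L(1) in simp)
 have t: "tr (A 5) (FG {} q)" for q unfolding tr_def
 proof (intro conjI allI impI)
  fix j y assume "j < N"
  then show "blk (A 5) y j <-> y <= FG {} q j" using b by (auto simp: FG_def)
 qed (use hp in blast)
 have so: "sorted_wrt (%x y. fst y <= fst x) L" using L(1) by (induction L) auto
 have c: "CN {} q = 2 * (h + 1) * (h + 1) + 1" for q by (simp add: CN_def)
 have "stk (A 5) L (FG {}) (CN {})" unfolding stk_def using so t L(3) by (simp add: ab c)
 moreover have "length L <= LG" using L(3) CN_ACT[of "{}" 0 0] unfolding c by simp
 moreover have "fst (last L) = 0" using L by simp
 ultimately show ?thesis unfolding SI_def using lg L by (intro exI[of _ "FG {}"] exI[of _ "CN {}"]) (simp add: PRE_def)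
qed

text \<open>Undoing is amortised: an entry is popped once, at a cost of at most 30, so
  \<open>30 * length L\<close> serves as potential.\<close>

lemma MAINB:
 assumes r: "env R" "R 40 = z" and t: "tabs A" and z: "z < m" and S: "SI z R A L" and I: "RI z R A"
 shows "runs MAINB R A (%t R' A'. (EX L'. SI (Suc z) R' A' L' & t + 30 * length L' <= 30 * length L + work z * (250 * (h + 1)) + 2500 * ((k + 1) * ((h + 1) * (h + 1)))) &
  RI (Suc z) R' A' & tabs A' & R' 40 = Suc z & (ALL y. y < 6 \<or> 60 <= y --> R' y = R y))"
  (is "runs _ _ _ ?Q")
proof -
 define Q where "Q = ?Q"
 define i where "i = ORD z"
 define H where "H = (h + 1) * (h + 1)"
 have H1: "1 <= H" "h + 1 <= H" unfolding H_def by (simp_all add: One_nat_def)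
 have im: "i < m" unfolding i_def by (rule ORD_lt[OF z])
 have e0: "R 0 = m" using r by (auto simp: env_def)
 have a0: "A 3 z = i" "A 11 z = Xr z" using tabs_simps[OF t] z unfolding i_def by auto
 have ei: "e i <= top" "e i < 2 ^ w" using e_INF[OF im] by linarith+
 let ?rest2 = "33 ::= Minus (Twice (Var 0)) (Var 40) ;; WALK ;; QUERY ;; RECORD ;; inc 40"
 let ?rest1 = "34 ::= len_of (Var 30) ;; 9 ::= Plus (Twice (Var 0)) (Num 2) ;; 14 ::= Var 5 ;; 33 ::= Plus (Var 40) (Num 1) ;; WALK ;; ?rest2"
 let ?R = "R(30 := i, 42 := Xr z)"
 have lgS: "logr ?R A L" "length L <= LG" "ALL u:set L. fst (snd u) < 2 * N" using S unfolding SI_def by (auto simp: logr_def)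
 have kb: "H2 = 2 * H" unfolding H_def by (simp only: mult.assoc)
 have w1: "z + 1 < 2 ^ w" "2 * m + 2 < 2 ^ w" using z m_small by linarith+
 define pl where "pl = length (takeWhile (above (Xr z)) L)"
 define L1 where "L1 = dropWhile (above (Xr z)) L"
 have pl: "pl + length L1 = length L"
  unfolding pl_def L1_def by (metis length_append takeWhile_dropWhile_id)
 have "runs (POP ;; PUSHALL ;; ?rest1) ?R A (%t. Q (8 + t))"
 proof (rule runs_SqM'[OF _ POP[where x = "Xr z" and L = L, OF _ lgS SI_ne(1)[OF S]]], goal_cases)
  case (1 t1 R1 A1) note a1 = this
  have P1: "PI (OLD z) (Xr z) R1 A1 L1" unfolding L1_def by (rule SI_pop[OF S]) (use a1 in auto)
  have e1: "env R1" "R1 40 = z" "R1 42 = Xr z" "R1 30 = i" using a1 r by (auto simp: env_def)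
  have t1: "t1 <= 30 * pl + 10" using a1 unfolding pl_def by blast
  have tb1: "tabs A1" by (rule tabs_cong[OF t]) (use a1 in simp)
  show ?case
  proof (rule runs_SqM'[OF _ PUSHALL[where x = z and L = L1]], goal_cases)
   case (1 t2 R2 A2) note a2 = this
   then obtain L2 where L2: "PI (ACT i) (2 * m) R2 A2 L2" "length L2 <= length L1 + work z * (h + 1)" unfolding i_def by blast
   have tb2: "tabs A2" by (rule tabs_cong[OF tb1]) (use a2 in simp)
   define R3 where "R3 = R2(34 := e i, 9 := 2 * m + 2, 14 := top, 33 := z + 1)"
   have k3: "!!y. y ~: {6, 7, 8, 9, 10, 11, 14, 30, 33, 34, 37, 38, 42, 43, 44, 45, 46} ==> R3 y = R y" using a2 a1 unfolding R3_def by auto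
   have e3: "env R3" "R3 40 = z" "R3 30 = i" "R3 34 = e i" "R3 9 = 2 * m + 2" "R3 14 = top" "R3 33 = z + 1"
    using a2 e1 unfolding R3_def env_def by auto
   have tr2: "tr (A2 5) (FG (ACT i) (2 * m))" "length L2 <= CN (ACT i) (2 * m)" using PI_tr[OF L2(1)] by auto
   have LGk: "length L2 + 4 * ((k + 1) * H) <= LG" using tr2(2) CN_ACT[OF order_refl, of i "2 * m"] unfolding H_def by (simp only: mult.assoc)
   have kH: "(k + 1) * H = k * H + H" "k * H2 = 2 * (k * H)" unfolding kb add_mult_distrib mult_1 by simp_all
   have lg3: "logr R3 A2 L2" "hp (A2 5)" using L2(1) tr2(1) unfolding PI_def R3_def tr_def by (auto simp: logr_def)
   have "runs (WALK ;; ?rest2) R3 A2 (%t'. Q (8 + (t1 + (t2 + (20 + t')))))"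
   proof (rule runs_SqM'[OF _ WALK[where i = i and y = "e i" and g = "2 * m + 2" and s = "z + 1" and L = L2]], goal_cases)
    case (1 t4 R4 A4) note a4 = this
    then obtain x1 L4 U1 where u1: "2 * m <= x1 \<or> k <= card (EV (e i) (z + 1) x1)" "raised (2 * m + 2) top U1 (k * H2) A2 L2 R4 A4 L4"
     "ALL j<N. j \<in> U1 <-> (EX q:EV (e i) (z + 1) x1. cov i (OD q) j)" by blast
    have ar4: "!!b. b ~: {5, 6, 7, 8} ==> A4 b = A2 b" "logr R4 A4 L4" "hp (A4 5)" using u1(2) unfolding raised_def by auto
    have tb4: "tabs A4" by (rule tabs_cong[OF tb2]) (use ar4 in simp)
    define R5 where "R5 = R4(33 := 2 * m - z)"
    have k5: "R5 y = R3 y" if "y ~: {6, 7, 8, 10, 11, 12, 13, 15, 24, 25, 26, 27, 28, 29, 31, 32, 33, 35, 36, 47}" for y using a4 that unfolding R5_def by simp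
    have e5: "env R5" "R5 40 = z" "R5 30 = i" "R5 34 = e i" "R5 9 = 2 * m + 2" "R5 14 = top" "R5 33 = 2 * m - z" "R5 6 = R4 6"
     using k5 e3 unfolding env_def by (simp_all add: R5_def)
    have l4: "length L4 <= length L2 + 2 * (k * H)" using raised_length[OF u1(2)] unfolding kH by simp
    have lg5: "logr R5 A4 L4" using ar4(2) e5(8) by (simp add: logr_def)
    have "runs (WALK ;; QUERY ;; RECORD ;; inc 40) R5 A4 (%t'. Q (8 + (t1 + (t2 + (20 + (t4 + (6 + t')))))))"
    proof (rule runs_SqM'[OF _ WALK[where i = i and y = "e i" and g = "2 * m + 2" and s = "2 * m - z" and L = L4]], goal_cases)
     case (1 t6 R6 A6) note a6 = this
     then obtain x2 L6 U2 where u2: "2 * m <= x2 \<or> k <= card (EV (e i) (2 * m - z) x2)" "raised (2 * m + 2) top U2 (k * H2) A4 L4 R6 A6 L6"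
      "ALL j<N. j \<in> U2 <-> (EX q:EV (e i) (2 * m - z) x2. cov i (OD q) j)" by blast
     have ra: "raised (2 * m + 2) top (U1 \<union> U2) (k * H2 + k * H2) A2 L2 R6 A6 L6" by (rule raised_trans[OF u1(2) u2(2)])
     have ar6: "!!b. b ~: {5, 6, 7, 8} ==> A6 b = A2 b" "hp (A6 5)" using ra unfolding raised_def by auto
     have tb6: "tabs A6" by (rule tabs_cong[OF tb2]) (use ar6 in simp)
     have k6: "R6 y = R3 y" if "y ~: {6, 7, 8, 10, 11, 12, 13, 15, 24, 25, 26, 27, 28, 29, 31, 32, 33, 35, 36, 47}" for y using a6 k5[OF that] that by simp
     have e6: "env R6" "R6 40 = z" "R6 30 = i" "R6 34 = e i" using k6 e3 unfolding env_def by simp_all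
     have l6: "length L6 <= length L2 + 4 * (k * H)" using raised_length[OF ra] unfolding kH by linarith
     have bk: "blk (A6 5) (e i) j <-> e i <= FG (ACT i) (2 * m) j \<or> j \<in> U1 \<or> j \<in> U2" if j: "j < N" for j
     proof -
      have "blk (A6 5) (e i) j <-> blk (A2 5) (e i) j \<or> j \<in> U1 \<union> U2 & e i <= top" using ra unfolding raised_def by blast
      moreover have "blk (A2 5) (e i) j <-> e i <= FG (ACT i) (2 * m) j" using tr2(1) j unfolding tr_def by blast
      ultimately show ?thesis using ei(1) by auto
     qed
     have out: "blk (A6 5) (e i) j" if "m <= j" "j < N" for j using bk[OF that(2)] that ei(1) by (simp add: FG_def)
     have frb: "blk (A6 5) (e i) j <-> bord i j" if j: "i + k <= j" "j < m" for j
     proof -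
      have jN: "j < N" using j mN by simp
      show ?thesis unfolding bk[OF jN] far[OF z i_def j u1(1) u2(1)] using u1(3) u2(3) jN by blast
     qed
     show ?case
     proof (rule runs_SqM'[OF _ QUERY[OF e6(1,3,4) tb6 im ar6(2) out frb]], goal_cases)
      case (1 t7 R7 A7) note a7 = this
      have r7: "R7 30 = ORD z" "isJ (ORD z) (R7 48)" "R7 40 = z" using a7 e6 unfolding i_def by auto
      have "A6 13 = A 13" using ar6 a2 a1 by simp
      moreover have "R7 52 = R 52" "R7 53 = R 53" using a7 k6[of 52] k6[of 53] k3[of 52] k3[of 53] by auto
      ultimately have I7: "RI z R7 A7" using I a7 by (auto intro: RI_cong)
      show ?case
      proof (rule runs_SqM'[OF _ RECORD[OF r7(1) refl _ z r7(2) I7]], goal_cases)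
       show "tabs A7" using tb6 a7 by simp
       case (1 t8 R8 A8) note a8 = this
       define R9 where "R9 = R8(40 := z + 1)"
       have A85: "A8 5 = A6 5" "!!b. b \<in> {6, 7, 8} ==> A8 b = A6 b" using a8 a7 by auto
       have "length L6 <= LG" using l6 LGk kH by linarith
       then have lg6: "SI (Suc z) R6 A6 L6" by (rule SI_end[OF L2(1)[unfolded i_def] ra])
       have "R9 6 = R6 6" using a8 a7 unfolding R9_def by simp
       then have S9: "SI (Suc z) R9 A8 L6" using lg6 A85 unfolding SI_def logr_def by simp
       have I9: "RI (Suc z) R9 A8" using a8 unfolding R9_def by (auto intro: RI_cong)
       have t9: "tabs A8" by (rule tabs_cong[OF tb6]) (use a8 a7 in simp)
       have k9: "R9 y = R y" if "y < 6 \<or> 60 <= y" for y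
       proof -
        have "R9 y = R6 y" using a8 a7 that unfolding R9_def by auto
        also have "\<dots> = R3 y" using that by (intro k6) auto
        also have "\<dots> = R y" using that by (intro k3) auto
        finally show ?thesis .
       qed
       \<comment> \<open>With \<open>kH0\<close> for \<open>k * H\<close>, the walks cost 710
         \<open>kH0\<close> each and the scan of near ends 180 \<open>kH0\<close>; the walks also
         raise the potential by 30 for each of at most 4 \<open>kH0\<close> new entries. A push
         costs 220 per unit of \<open>W\<close> plus 30 for its entry.\<close>
       have tm: "8 + (t1 + (t2 + (20 + (t4 + (6 + (t6 + (t7 + (t8 + 4)))))))) + 30 * length L6 <= 30 * length L + work z * (250 * (h + 1)) + 2500 * ((k + 1) * H)"
       proof -
        define kH0 where "kH0 = k * H"
        define W where "W = work z * (h + 1)"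
        have "k * 1 <= k * H" using H1 by (intro mult_le_mono2)
        then have kk: "k <= kH0" "1 <= kH0" unfolding kH0_def using k1 by linarith+
        have q2: "t2 <= 220 * W + 40 * k + 40" using conjunct1[OF a2] unfolding W_def by (simp add: algebra_simps)
        have q4: "t4 <= 710 * kH0 + 10" "t6 <= 710 * kH0 + 10" using conjunct1[OF a4] conjunct1[OF a6] unfolding kH0_def H_def by (simp_all only: ac_simps)
        have "k * (180 * (h + 1)) <= k * (180 * H)" using H1 by (intro mult_le_mono2) simp
        then have "k * (180 * (h + 1)) <= 180 * kH0" unfolding kH0_def by (simp only: ac_simps)
        moreover have "40 * (h + 1) <= 40 * H" using H1 by (intro mult_le_mono2)
        ultimately have q7: "t7 <= 180 * kH0 + 40 * H + 80" using conjunct1[OF a7] by linarith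
        have q8: "t8 <= 70" using a8 by blast
        have q6: "length L6 <= length L1 + W + 4 * kH0" using l6 L2(2) unfolding W_def kH0_def by linarith
        have "8 + (t1 + (t2 + (20 + (t4 + (6 + (t6 + (t7 + (t8 + 4)))))))) + 30 * length L6 <= 30 * length L + 250 * W + 2500 * kH0 + 2500 * H"
         using t1 q2 q4 q7 q8 q6 pl kk H1 by linarith
        also have "\<dots> = 30 * length L + work z * (250 * (h + 1)) + 2500 * ((k + 1) * H)" unfolding W_def kH0_def by (simp add: algebra_simps)
        finally show ?thesis .
       qed
       have "Q (8 + (t1 + (t2 + (20 + (t4 + (6 + (t6 + (t7 + (t8 + 4))))))))) R9 A8"
        unfolding Q_def using S9 I9 t9 k9 tm unfolding H_def by (intro conjI exI[of _ L6]) (auto simp: R9_def)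
       then show ?case
        by (intro runs_Asg) (use a8 r7 w1 in "simp_all add: R9_def")
      qed
     qed
    qed (use e5 tb4 z im lg5 ar4 l4 LGk kH kb in auto)
    then show ?case
     by (intro runs_SqA runs_Asg) (use a4 e3 z w1 in "simp_all add: R5_def env_def")
   qed (use e3 tb2 z im lg3 LGk kH kb in auto)
   moreover have "A2 0 (2 * i + 1) = e i" using tabs_simps(1)[OF tb2 im] .
   ultimately show ?case
    by (intro runs_SqA runs_Asg)
     (use a2 e1 im w1 m_small in "simp_all add: R3_def env_def")
  qed (use e1 tb1 z Xr_le P1 in auto)
 qed simp
 then have "runs MAINB R A Q" unfolding MAINB_def
  by (intro runs_SqA runs_Asg) (use r z a0 in "simp_all add: lens ac_simps")
 then show ?thesis unfolding Q_def .
qed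

text \<open>The pushes amount to \<open>k * m\<close> tree operations by \<open>sum_work\<close>.
  The dominant term comes from the walks, with up to \<open>k\<close> interval raises in each of two
  directions for every rank.\<close>

lemma MAIN:
 assumes r: "env R" and t: "tabs A"
 shows "runs MAIN R A (%t R' A'. t <= 4000 * ((m + 1) * ((k + 1) * ((h + 1) * (h + 1)))) & RI m R' A' & (ALL y. y < 6 \<or> 60 <= y --> R' y = R y))"
  (is "runs _ _ _ ?Q")
proof -
 define Q where "Q = ?Q"
 define H where "H = (h + 1) * (h + 1)"
 have H1: "1 <= H" "h + 1 <= H" unfolding H_def by (simp_all add: One_nat_def)
 have e0: "R 0 = m" using r by (auto simp: env_def)
 define W where "W = (%z. \<Sum>x<z. work x)"
 define I where "I = (%z R1 A1 T. R1 40 = z & tabs A1 & RI z R1 A1 & (ALL y. y < 6 \<or> 60 <= y --> R1 y = R y) &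
  (EX L. SI z R1 A1 L & T + 30 * length L <= 30 * (2 * H + 1) + W z * (250 * (h + 1)) + z * (2500 * ((k + 1) * H) + 3)))"
 let ?c = "Lt (Var 40) (Var 0)"
 have loop: "runs (Wh ?c MAINB) R1 A1 (%t R' A'. EX T. t = T + xk ?c + 1 & I m R' A' T)" if I0: "I 0 R1 A1 0" for R1 A1
 proof (rule runs_Wh)
  show "I 0 R1 A1 0" by (rule I0)
 next
  fix z R1 A1 T assume z: "z < m" and i: "I z R1 A1 T"
  obtain L where L: "SI z R1 A1 L" "T + 30 * length L <= 30 * (2 * H + 1) + W z * (250 * (h + 1)) + z * (2500 * ((k + 1) * H) + 3)" using i unfolding I_def by blast
  have e1: "env R1" "R1 40 = z" "tabs A1" "RI z R1 A1" "R1 0 = m" using i r unfolding I_def env_def by auto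
  have WS: "W (Suc z) = W z + work z" unfolding W_def by simp
  have "runs MAINB R1 A1 (%t R' A'. I (Suc z) R' A' (T + (t + xk ?c + 1)))"
  proof (rule runs_mono'[OF _ MAINB[OF e1(1,2,3) z L(1) e1(4)]], goal_cases)
   case (1 t2 R2 A2) note a2 = this
   then obtain L2 where L2: "SI (Suc z) R2 A2 L2" "t2 + 30 * length L2 <= 30 * length L + work z * (250 * (h + 1)) + 2500 * ((k + 1) * H)" unfolding H_def by blast
   define X Y where "X = work z * (250 * (h + 1))" and "Y = 2500 * ((k + 1) * H)"
   have "T + (t2 + xk ?c + 1) + 30 * length L2 <= 30 * (2 * H + 1) + W (Suc z) * (250 * (h + 1)) + Suc z * (Y + 3)"
   proof -
    have "W (Suc z) * (250 * (h + 1)) = W z * (250 * (h + 1)) + X" "Suc z * (Y + 3) = z * (Y + 3) + Y + 3" unfolding WS X_def by (simp_all add: add_mult_distrib)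
    then show ?thesis using L(2)[folded Y_def] L2(2)[folded X_def Y_def] unfolding xk.simps xc.simps by linarith
   qed
   then show ?case unfolding I_def Y_def using L2(1) a2 i unfolding I_def by auto
  qed
  then show "okc R1 A1 ?c & holds R1 A1 ?c & runs MAINB R1 A1 (%t R' A'. I (Suc z) R' A' (T + (t + xk ?c + 1)))" using e1 z by simp
 next
  fix R1 A1 T assume "I m R1 A1 T"
  then show "okc R1 A1 ?c & \<not> holds R1 A1 ?c" using e0 by (simp add: I_def)
 qed
 have "runs MAIN R A Q" unfolding MAIN_def
 proof (rule runs_SqM'[OF _ INIT[OF r]], goal_cases)
  case (1 t1 R1 A1) note a1 = this
  then obtain L where L: "hp (A1 5)" "ALL j<N. ALL y. blk (A1 5) y j <-> y = 0 \<or> m <= j & y <= top" "logr R1 A1 L"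
   "ALL e:set L. fst e = 0 & fst (snd e) < 2 * N" "L ~= []" "length L <= 2 * (h + 1) * (h + 1) + 1" by blast
  define R2 where "R2 = R1(40 := 0, 52 := 0, 53 := 0)"
  have "SI 0 R1 A1 L" by (rule SI_init[OF L])
  then have S2: "SI 0 R2 A1 L" unfolding SI_def R2_def logr_def by simp
  have tb: "tabs A1" by (rule tabs_cong[OF t]) (use a1 in simp)
  have "length L <= 2 * H + 1" using L(6) unfolding H_def by (simp only: mult.assoc)
  then have I0: "I 0 R2 A1 0" unfolding I_def using S2 tb a1 RI_0[of R2 A1] by (auto simp: R2_def W_def)
  have "runs (Wh ?c MAINB) R2 A1 (%t'. Q (t1 + (6 + t')))"
  proof (rule runs_mono'[OF _ loop[OF I0]], goal_cases)
   case (1 t3 R3 A3)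
   then obtain T where T: "t3 = T + 3" "I m R3 A3 T" by auto
   define M K where "M = m + 1" and "K = (k + 1) * H"
   have K1: "H <= K" "k * (h + 1) <= K" "1 <= K"
   proof -
    show K: "H <= K" unfolding K_def by simp
    then show "1 <= K" using H1 by linarith
    show "k * (h + 1) <= K" unfolding K_def using H1 by (intro mult_le_mono) auto
   qed
   have MK: "M * 1 <= M * K" "M * H <= M * K" using K1 by (intro mult_le_mono2; simp)+
   have "H <= M * H" unfolding M_def by simp
   then have HM: "H <= M * K" using MK by linarith
   have "T <= 30 * (2 * H + 1) + W m * (250 * (h + 1)) + m * (2500 * K + 3)" using T(2) unfolding I_def K_def by auto
   also have "W m * (250 * (h + 1)) <= k * m * (250 * (h + 1))" unfolding W_def using sum_work by (intro mult_le_mono1)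
   also have "k * m * (250 * (h + 1)) = 250 * (m * (k * (h + 1)))" by (simp only: ac_simps)
   also have "m * (k * (h + 1)) <= M * K" using K1 unfolding M_def by (intro mult_le_mono) auto
   also have "m * (2500 * K + 3) <= 2500 * (M * K) + 3 * M" unfolding M_def by (simp add: algebra_simps)
   finally have "T <= 60 * H + 30 + 250 * (M * K) + (2500 * (M * K) + 3 * M)" by simp
   moreover have "t1 <= 500 * H + 100 * M"
   proof -
    have "500 * (h + 1) * (h + 1) = 500 * H" unfolding H_def by (simp only: mult.assoc)
    moreover have "N <= 2 * M" using mN unfolding M_def by simp
    ultimately show ?thesis using conjunct1[OF a1] by linarith
   qed
   moreover have "1 <= M" unfolding M_def by simp
   ultimately have "t1 + (6 + t3) <= 4000 * (M * K)" using MK HM T(1) by linarith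
   then have "t1 + (6 + t3) <= 4000 * ((m + 1) * ((k + 1) * ((h + 1) * (h + 1))))" unfolding M_def K_def H_def .
   then show ?case unfolding Q_def using T(2) unfolding I_def by blast
  qed
  then show ?case
   by (intro runs_SqA runs_Asg) (simp_all add: R2_def ac_simps)
 qed
 then show ?thesis unfolding Q_def .
qed

end

section \<open>Composition of the phases\<close>

definition BODY :: stm where
 "BODY = POSL ;; NAMES ;; LEVELS ;; ORDER ;; REFL ;; MX ;; XT ;; MAIN ;; 0 ::= Var 53 ;; 1 ::= Var 73"

context prog_in begin

lemma BODY:
 assumes r: "R 0 = m" "R 1 = N" "R 2 = h" "R 3 = k" "R 5 = top" and A: "inp A"
 shows "runs BODY R A (%t R' A'. t <= 15000 * ((m + 1) * ((h + 1 + (k + 1)) * ((h + 1) * (h + 1)))) & R' 1 = R 73 &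
  (EX xs. distinct xs & set xs = {(Suc (pos x), pos (Suc y)) |x y. x < y & y < m & \<not> bord x y &
   (ALL x' y'. x' < y' & y' < m & \<not> bord x' y' --> pos (Suc y') - pos x' <= pos (Suc y) - pos x)} &
  R' 0 = length xs & length xs <= m & (ALL u<length xs. A' 13 (2 * u) = fst (xs ! u) & A' 13 (2 * u + 1) = snd (xs ! u))))"
  (is "runs _ _ _ ?Q")
proof -
 define Q where "Q = ?Q"
 define M H where "M = m + 1" and "H = (h + 1) * (h + 1)"
 have "runs BODY R A Q" unfolding BODY_def
 proof (rule runs_SqM'[OF _ POSL[where R = R and A = A, OF r(1) A]], goal_cases)
  case (1 t1 R1 A1) note a1 = this
  have e1: "env R1" using a1 r unfolding env_def by auto
  have i1: "inp A1" using A a1 unfolding inp_def by simp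
  show ?case
  proof (rule runs_SqM'[OF _ NAMES[OF e1 i1]], goal_cases)
   case (1 t2 R2 A2) note a2 = this
   have e2: "env R2" using a2 e1 unfolding env_def by auto
   have i2: "inp A2" using i1 a2 unfolding inp_def by simp
   define Cn where "Cn = (%x. if x <= m then A2 2 x else 0)"
   have C1: "1 <= Cn x & Cn x <= m" if "x < m" for x using a2 that unfolding named_def Cn_def by simp
   have C0: "Cn x = 0" if "m <= x" for x using a2 that unfolding named_def Cn_def by auto
   have ord: "ordered m c e Cn k top"
   proof (unfold_locales)
    fix x y assume "x < m" "y < m"
    then show "Cn x = Cn y <-> c x = c y" using a2 unfolding named_def Cn_def by auto
   next
    fix x assume "x < m"
    then show "1 <= Cn x" using C1 by blast
   next
    fix x assume "x < m"
    then have "e x <= n" by (rule e_le)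
    then show "e x < top" using quad[of 0 0 "e x"] by simp
   qed (use C0 k1 in auto)
   define f where "f = (%x. Cn x * (n + 1) + (if x < m then e x else 0))"
   have Cx: "ALL x<m. A2 2 x = Cn x" unfolding Cn_def by simp
   show ?case
   proof (rule runs_SqM'[OF _ LEVELS[where R = R2 and A = A2 and Cn = Cn and f = f, OF e2 i2 Cx C1 C0 f_def]], goal_cases)
    case (1 t3 R3 A3) note a3 = this
    have e3: "env R3" using a3 e2 unfolding env_def by auto
    have Cx3: "ALL x<m. A3 2 x = Cn x" using Cx a3 by simp
    show ?case
    proof (rule runs_SqM'[OF _ ORDER[where R = R3 and A = A3 and Cn = Cn and f = f, OF e3 Cx3 _ ord _ f_def]], goal_cases)
     case (1 t4 R4 A4) note a4 = this
     interpret tb: tables w S base len h N m n k LG c e Cn "A4 3"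
      by (intro tables.intro prog_in_axioms) (use a4 in blast)
     have e4: "env R4" "R4 0 = m" using a4 e3 unfolding env_def by auto
     have fl: "f = tb.ltr n" unfolding f_def tb.ltr_def tb.ee_def by simp
     have bt4: "tb.base_tabs A4" unfolding tb.base_tabs_def
     proof (intro conjI allI impI)
      show "inp A4" using i2 a3 a4 unfolding inp_def by simp
      show "A4 2 x = Cn x" if "x <= m" for x using that a3 a4 unfolding Cn_def by simp
      show "levels (tb.ltr n) h A4" using a3 a4 unfolding fl[symmetric] levels_def by simp
     qed
     have p4: "ALL x<=m. A4 12 x = pos x" using a1 a2 a3 a4 by simp
     show ?case
     proof (rule runs_SqM'[OF _ tb.REFL[where R = R4 and A = A4, OF e4(2)]], goal_cases)
      case (1 t5 R5 A5) note a5 = this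
      have e5: "env R5" using a5 e4 unfolding env_def by auto
      have bt5: "tb.base_tabs A5" using bt4 a5 unfolding tb.base_tabs_def inp_def levels_def by simp
      have i5: "inp A5" using bt5 unfolding tb.base_tabs_def by blast
      show ?case
      proof (rule runs_SqM'[OF _ tb.MX[where R = R5 and A = A5, OF e5 _ i5]], goal_cases)
       show "tb.tab_O A5" using a5 by blast
       case (1 t6 R6 A6) note a6 = this
       have e6: "env R6" using a6 e5 unfolding env_def by auto
       have bt6: "tb.base_tabs A6" using bt5 a6 unfolding tb.base_tabs_def inp_def levels_def by simp
       have o6: "tb.tab_O A6" using a5 a6 unfolding tb.tab_O_def by simp
       show ?case
       proof (rule runs_SqM'[OF _ tb.XT[where R = R6 and A = A6, OF e6 bt6 o6]], goal_cases)
        case (1 t7 R7 A7) note a7 = this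
        have e7: "env R7" using a7 e6 unfolding env_def by auto
        have t7: "tb.tabs A7"
        proof -
         have "tb.base_tabs A7" using bt6 a7 unfolding tb.base_tabs_def inp_def levels_def by simp
         moreover have "tb.tab_O A7" using o6 a7 unfolding tb.tab_O_def by simp
         moreover have "ALL t<=h. tb.row A7 t" using a6 a7 unfolding tb.row_def by simp
         moreover have "ALL x<=m. A7 12 x = pos x" using p4 a5 a6 a7 by simp
         ultimately show ?thesis unfolding tb.tabs_def using a7 by blast
        qed
        show ?case
        proof (rule runs_SqM'[OF _ tb.MAIN[where R = R7 and A = A7, OF e7 t7]], goal_cases)
         case (1 t8 R8 A8) note a8 = this
         have r73: "R8 73 = R 73" using a8 a7 a6 a5 a4 a3 a2 a1 by simp
         define K where "K = h + 1 + (k + 1)"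
         have "t1 + (t2 + (t3 + (t4 + (t5 + (t6 + (t7 + (t8 + 4))))))) <= 15000 * (M * (K * H))"
         proof -
          define u where "u = M * (K * H)"
          have H1: "1 <= H" "h + 1 <= H" unfolding H_def by (simp_all add: One_nat_def)
          have K1: "1 <= K" "h + 1 <= K" "k + 1 <= K" unfolding K_def by auto
          have "1 * H <= K * H" using K1 by (intro mult_le_mono1)
          then have KH: "H <= K * H" by simp
          have b1: "M <= u" unfolding u_def using mult_le_mono2[of 1 "K * H" M] KH H1 by simp
          have b2: "M * H <= u" unfolding u_def using KH by (intro mult_le_mono2)
          have b3: "M * ((h + 1) * H) <= u" unfolding u_def using K1 by (intro mult_le_mono2 mult_le_mono1)
          have b4: "M * ((k + 1) * H) <= u" unfolding u_def using K1 by (intro mult_le_mono2 mult_le_mono1)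
          have b5: "M * (h + 1) <= M * H" using H1 by (intro mult_le_mono2)
          have "t1 <= 50 * M" "t5 <= 30 * M" "t2 <= 2800 * (M * H)" "t4 <= 1400 * (M * H)" "t3 <= 1600 * (M * ((h + 1) * H))"
           "t6 <= 250 * (M * (h + 1))" "t7 <= 160 * (M * (h + 1))" "t8 <= 4000 * (M * ((k + 1) * H))"
           using a1 a2 a3 a4 a5 a6 a7 a8 unfolding M_def H_def by (simp_all only: mult.assoc)
          moreover have "1 <= M" unfolding M_def by simp
          ultimately show ?thesis unfolding u_def[symmetric] using b1 b2 b3 b4 b5 by linarith
         qed
         moreover note tb.RI_final[of R8 A8]
         ultimately have "Q (t1 + (t2 + (t3 + (t4 + (t5 + (t6 + (t7 + (t8 + 4)))))))) (R8(0 := R8 53, 1 := R 73)) A8"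
          unfolding Q_def M_def K_def H_def using a8 by (simp del: pos_Suc)
         then show ?case
          by (intro runs_Sq runs_Asg) (use r73 in "simp_all")
        qed
       qed
      qed
     qed simp
    qed (use a3 C1 in blast)+
   qed
  qed
 qed
 then show ?thesis unfolding Q_def .
qed

end

section \<open>Memory layout and the whole program\<close>

text \<open>The binary logarithm and, in the next definition, the square root of \<open>m\<close>,
  both rounded up.\<close>

definition hm :: "nat => nat" where "hm m = (LEAST h. m <= 2 ^ h)"
definition km :: "nat => nat" where "km m = (LEAST k. m <= k * k)"
definition lgm :: "nat => nat" where "lgm m = 32 * (hm m + 2) * (hm m + 2) * (m + 2)"

definition lay :: "nat => nat => nat" where
 "lay m l = (if l < 14 then
  [2 * m, m, m + 1, 2 * m, m, 2 * 2 ^ hm m, lgm m, lgm m, lgm m, (hm m + 1) * (2 * 2 ^ hm m), (hm m + 1) * (2 * m), m + 1, m + 1, 2 * m] ! l else 0)"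

definition lbase :: "nat => nat => nat" where "lbase m l = (\<Sum>j<l. lay m j)"

lemma hm: "m <= 2 ^ hm m" "h < hm m ==> 2 ^ h < m"
proof -
 have "EX h. m <= 2 ^ h" using less_exp[of m] by (meson less_imp_le)
 then show "m <= 2 ^ hm m" unfolding hm_def by (rule LeastI_ex)
 show "2 ^ h < m" if "h < hm m" using not_less_Least[of h "%h. m <= 2 ^ h"] that unfolding hm_def by simp
qed

lemma hm_bound: "2 <= m ==> 1 <= hm m & 2 ^ (hm m - 1) < m & 2 ^ hm m <= 2 * m & hm m <= m"
proof -
 assume m: "2 <= m"
 have "hm m ~= 0"
 proof
  assume "hm m = 0"
  then show False using hm(1)[of m] m by simp
 qed
 then have p: "hm m - 1 < hm m" by simp
 then have l: "2 ^ (hm m - 1) < m" by (rule hm(2))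
 have "2 ^ hm m = 2 * (2::nat) ^ (hm m - 1)" using p by (simp add: power_eq_if)
 then have "2 ^ hm m <= 2 * m" using l by simp
 moreover have "hm m <= m" unfolding hm_def by (rule Least_le) (simp add: less_imp_le)
 ultimately show ?thesis using l p by simp
qed

lemma km: "m <= km m * km m" "k < km m ==> k * k < m" "km m <= m" "1 <= m ==> 1 <= km m"
proof -
 have e: "m <= m * m" by simp
 show k: "m <= km m * km m" unfolding km_def by (rule LeastI[of _ m]) (rule e)
 show "k * k < m" if "k < km m" using not_less_Least[of k "%k. m <= k * k"] that unfolding km_def by simp
 show "km m <= m" unfolding km_def by (rule Least_le) (rule e)
 show "1 <= km m" if "1 <= m" using k that by (cases "km m") auto
qed

text \<open>Building the tables costs \<open>m * h ^ 3\<close> up to a constant, one sort for each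
  level. This comparison lets the square root absorb one of the three logarithms; it holds since
  \<open>2 ^ (hm m - 1)\<close> is less than \<open>m\<close>, hence less than 4 to the power
  \<open>km m\<close>.\<close>

lemma hm_km: "2 <= m ==> hm m + 1 <= 2 * (km m + 1)"
proof -
 assume m: "2 <= m"
 have k: "km m < 2 ^ km m" by (rule less_exp)
 have "2 ^ (hm m - 1) < m" using hm_bound[OF m] by blast
 also have "\<dots> <= km m * km m" by (rule km)
 also have "\<dots> <= 2 ^ km m * 2 ^ km m" using k by (intro mult_le_mono) auto
 also have "\<dots> = 2 ^ (km m + km m)" by (simp add: power_add)
 finally have "hm m - 1 < km m + km m" by (rule power_less_imp_less_exp[rotated]) simp
 then show ?thesis by simp
qed

lemma lbase_Suc: "lbase m (Suc l) = lbase m l + lay m l"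
 by (simp add: lbase_def)

lemma lbase_mono: "l <= l' ==> lbase m l <= lbase m l'"
 unfolding lbase_def by (rule sum_mono2) auto

lemma lbase_disj:
 assumes "k ~= l" "x < lay m k" "y < lay m l"
 shows "lbase m k + x ~= lbase m l + y"
proof -
 have *: "lbase m k + x < lbase m l + y" if "k < l" "x < lay m k" for k l x y
 proof -
  have "lbase m k + x < lbase m (Suc k)" using that by (simp add: lbase_Suc)
  also have "\<dots> <= lbase m l" using that by (intro lbase_mono) simp
  finally show ?thesis by simp
 qed
 show ?thesis using *[of k l x y] *[of l k y x] assms by (metis less_irrefl linorder_neqE_nat)
qed

lemma lay_simps:
 "lay m 0 = 2 * m" "lay m 1 = m" "lay m 2 = m + 1" "lay m 3 = 2 * m" "lay m 4 = m" "lay m 5 = 2 * 2 ^ hm m"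
 "lay m 6 = lgm m" "lay m 7 = lgm m" "lay m 8 = lgm m" "lay m 9 = (hm m + 1) * (2 * 2 ^ hm m)" "lay m 10 = (hm m + 1) * (2 * m)"
 "lay m 11 = m + 1" "lay m 12 = m + 1" "lay m 13 = 2 * m"
 by (simp_all add: lay_def)

lemma lbase_steps:
 "lbase m 0 = 0" "lbase m 1 = 2 * m" "lbase m 2 = lbase m 1 + m" "lbase m 3 = lbase m 2 + (m + 1)" "lbase m 4 = lbase m 3 + 2 * m"
 "lbase m 5 = lbase m 4 + m" "lbase m 6 = lbase m 5 + 2 * 2 ^ hm m" "lbase m 7 = lbase m 6 + lgm m" "lbase m 8 = lbase m 7 + lgm m"
 "lbase m 9 = lbase m 8 + lgm m" "lbase m 10 = lbase m 9 + (hm m + 1) * (2 * 2 ^ hm m)" "lbase m 11 = lbase m 10 + (hm m + 1) * (2 * m)"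
 "lbase m 12 = lbase m 11 + (m + 1)" "lbase m 13 = lbase m 12 + (m + 1)" "lbase m 14 = lbase m 13 + 2 * m"
proof -
 have s: "lbase m (l + 1) = lbase m l + lay m l" for l using lbase_Suc[of m l] by (simp only: Suc_eq_plus1)
 show "lbase m 0 = 0" by (simp add: lbase_def)
 then show "lbase m 1 = 2 * m" using s[of 0] by (simp add: lay_simps)
 show "lbase m 2 = lbase m 1 + m" "lbase m 3 = lbase m 2 + (m + 1)" "lbase m 4 = lbase m 3 + 2 * m"
  "lbase m 5 = lbase m 4 + m" "lbase m 6 = lbase m 5 + 2 * 2 ^ hm m" "lbase m 7 = lbase m 6 + lgm m" "lbase m 8 = lbase m 7 + lgm m"
  "lbase m 9 = lbase m 8 + lgm m" "lbase m 10 = lbase m 9 + (hm m + 1) * (2 * 2 ^ hm m)" "lbase m 11 = lbase m 10 + (hm m + 1) * (2 * m)"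
  "lbase m 12 = lbase m 11 + (m + 1)" "lbase m 13 = lbase m 12 + (m + 1)" "lbase m 14 = lbase m 13 + 2 * m"
  using s[of 1] s[of 2] s[of 3] s[of 4] s[of 5] s[of 6] s[of 7] s[of 8] s[of 9] s[of 10] s[of 11] s[of 12] s[of 13] by (simp_all add: lay_simps)
qed

lemma lbase_14: "lbase m 14 = 11 * m + 3 + 2 * 2 ^ hm m + 3 * lgm m + (hm m + 1) * (2 * 2 ^ hm m) + (hm m + 1) * (2 * m)"
 unfolding lbase_steps by simp

lemma lbase_20: "l <= 20 ==> lbase m l <= lbase m 14"
proof -
 assume "l <= 20"
 have "lbase m l <= (\<Sum>j\<in>{..<14} \<union> {14..<20}. lay m j)" unfolding lbase_def using \<open>l <= 20\<close> by (intro sum_mono2) auto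
 also have "\<dots> = lbase m 14 + (\<Sum>j\<in>{14..<20}. lay m j)" unfolding lbase_def by (rule sum.union_disjoint) auto
 also have "(\<Sum>j\<in>{14..<20}. lay m j) = 0" by (simp add: lay_def)
 finally show ?thesis by simp
qed

definition LAY :: stm where
 "LAY = 5 ::= Ones ;;
  54 ::= Times (Times (Times (Num 32) (Plus (Var 2) (Num 2))) (Plus (Var 2) (Num 2))) (Plus (Var 0) (Num 2)) ;;
  61 ::= Twice (Var 0) ;; 62 ::= Plus (Var 61) (Var 0) ;; 63 ::= Plus (Var 62) (Plus (Var 0) (Num 1)) ;;
  64 ::= Plus (Var 63) (Twice (Var 0)) ;; 65 ::= Plus (Var 64) (Var 0) ;; 66 ::= Plus (Var 65) (Twice (Var 1)) ;;
  67 ::= Plus (Var 66) (Var 54) ;; 68 ::= Plus (Var 67) (Var 54) ;; 69 ::= Plus (Var 68) (Var 54) ;;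
  70 ::= Plus (Var 69) (Times (Plus (Var 2) (Num 1)) (Twice (Var 1))) ;;
  71 ::= Plus (Var 70) (Times (Plus (Var 2) (Num 1)) (Twice (Var 0))) ;;
  72 ::= Plus (Var 71) (Plus (Var 0) (Num 1)) ;; 73 ::= Plus (Var 72) (Plus (Var 0) (Num 1))"

definition PRO :: stm where
 "PRO = 1 ::= Num 1 ;; 2 ::= Num 0 ;; Wh (Lt (Var 1) (Var 0)) (1 ::= Twice (Var 1) ;; inc 2) ;;
  3 ::= Num 1 ;; Wh (Lt (Times (Var 3) (Var 3)) (Var 0)) (inc 3) ;; LAY"

context machine begin

lemma asg_step:
 assumes "okx R A a" "x < 80" "x < 60 \<or> len (x - 60) = 0" "ev R A a = v"
  and p: "runs b (R(x := v)) A (%t R' A'. t <= d & R' = Rf & A' = A)" and d: "xc a + 1 + d <= d'"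
 shows "runs (x ::= a ;; b) R A (%t R' A'. t <= d' & R' = Rf & A' = A)"
proof (rule runs_Sq, rule runs_Asg)
 show "runs b (R(x := ev R A a)) A (%t' R' A'. xc a + 1 + t' <= d' & R' = Rf & A' = A)"
  unfolding assms(4) by (rule runs_mono[OF p]) (use assms in auto)
qed (use assms in auto)

lemma LAY:
 assumes len0: "!!l. 0 < l ==> len l = 0" and r: "R 0 = m" "R 1 = 2 ^ hm m" "R 2 = hm m" "R 60 = 0"
  and S: "lbase m 14 < 2 ^ w" "64 < (2::nat) ^ w"
 shows "runs LAY R A (%t R' A'. t <= 170 & R' 5 = 2 ^ w - 1 & (ALL l<14. R' (60 + l) = lbase m l) & (ALL y<5. R' y = R y) & A' = A)"
  (is "runs _ _ _ ?Q")
proof -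
 define Q where "Q = ?Q"
 have lt: "lbase m l < 2 ^ w" if "l <= 14" for l using lbase_mono[OF that, of m] S(1) by linarith
 note b = lt[of 1] lt[of 2] lt[of 3] lt[of 4] lt[of 5] lt[of 6] lt[of 7] lt[of 8] lt[of 9] lt[of 10] lt[of 11] lt[of 12] lt[of 13]
 have L: "lgm m < 2 ^ w" using S(1) unfolding lbase_14 by linarith
 define a1 where "a1 = 32 * (hm m + 2)"
 define a2 where "a2 = a1 * (hm m + 2)"
 have a: "lgm m = a2 * (m + 2)" "a1 <= a2" "a2 <= lgm m" unfolding a2_def a1_def lgm_def by simp_all
 have "hm m + 2 <= a1" "1 <= a1" unfolding a1_def by simp_all
 moreover have "1 * (m + 2) <= lgm m" unfolding a(1) using a(2) calculation(2) by (intro mult_le_mono1) linarith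
 then have "m + 2 <= lgm m" by (simp only: mult_1)
 ultimately have w1: "a1 < 2 ^ w" "a2 < 2 ^ w" "hm m + 2 < 2 ^ w" "m + 2 < 2 ^ w" using a L by linarith+
 have w2: "(hm m + 1) * (2 * 2 ^ hm m) < 2 ^ w" "(hm m + 1) * (2 * m) < 2 ^ w" "2 * 2 ^ hm m < (2::nat) ^ w" "2 * m < 2 ^ w" "m + 1 < 2 ^ w" "hm m + 1 < 2 ^ w"
  using S(1) w1 unfolding lbase_14 by linarith+
 \<comment> \<open>Each register state of the straight-line program receives a name, and the
   specification is assembled from the last assignment backwards; so every goal concerns a single
   update.\<close>
 define R0 where "R0 = R(5 := 2 ^ w - 1, 54 := lgm m)"
 define R1 where "R1 = R0(61 := lbase m 1)"
 define R2 where "R2 = R1(62 := lbase m 2)"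
 define R3 where "R3 = R2(63 := lbase m 3)"
 define R4 where "R4 = R3(64 := lbase m 4)"
 define R5 where "R5 = R4(65 := lbase m 5)"
 define R6 where "R6 = R5(66 := lbase m 6)"
 define R7 where "R7 = R6(67 := lbase m 7)"
 define R8 where "R8 = R7(68 := lbase m 8)"
 define R9 where "R9 = R8(69 := lbase m 9)"
 define R10 where "R10 = R9(70 := lbase m 10)"
 define R11 where "R11 = R10(71 := lbase m 11)"
 define R12 where "R12 = R11(72 := lbase m 12)"
 define R13 where "R13 = R12(73 := lbase m 13)"
 have Rv: "R0 0 = m" "R0 1 = 2 ^ hm m" "R0 2 = hm m" "R0 54 = lgm m" unfolding R0_def using r by simp_all
 have Rv1: "R1 0 = m" "R1 1 = 2 ^ hm m" "R1 2 = hm m" "R1 54 = lgm m" "R1 61 = lbase m 1" unfolding R1_def using Rv by simp_all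
 have Rv2: "R2 0 = m" "R2 1 = 2 ^ hm m" "R2 2 = hm m" "R2 54 = lgm m" "R2 62 = lbase m 2" unfolding R2_def using Rv1 by simp_all
 have Rv3: "R3 0 = m" "R3 1 = 2 ^ hm m" "R3 2 = hm m" "R3 54 = lgm m" "R3 63 = lbase m 3" unfolding R3_def using Rv2 by simp_all
 have Rv4: "R4 0 = m" "R4 1 = 2 ^ hm m" "R4 2 = hm m" "R4 54 = lgm m" "R4 64 = lbase m 4" unfolding R4_def using Rv3 by simp_all
 have Rv5: "R5 0 = m" "R5 1 = 2 ^ hm m" "R5 2 = hm m" "R5 54 = lgm m" "R5 65 = lbase m 5" unfolding R5_def using Rv4 by simp_all
 have Rv6: "R6 0 = m" "R6 1 = 2 ^ hm m" "R6 2 = hm m" "R6 54 = lgm m" "R6 66 = lbase m 6" unfolding R6_def using Rv5 by simp_all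
 have Rv7: "R7 0 = m" "R7 1 = 2 ^ hm m" "R7 2 = hm m" "R7 54 = lgm m" "R7 67 = lbase m 7" unfolding R7_def using Rv6 by simp_all
 have Rv8: "R8 0 = m" "R8 1 = 2 ^ hm m" "R8 2 = hm m" "R8 54 = lgm m" "R8 68 = lbase m 8" unfolding R8_def using Rv7 by simp_all
 have Rv9: "R9 0 = m" "R9 1 = 2 ^ hm m" "R9 2 = hm m" "R9 54 = lgm m" "R9 69 = lbase m 9" unfolding R9_def using Rv8 by simp_all
 have Rv10: "R10 0 = m" "R10 1 = 2 ^ hm m" "R10 2 = hm m" "R10 54 = lgm m" "R10 70 = lbase m 10" unfolding R10_def using Rv9 by simp_all
 have Rv11: "R11 0 = m" "R11 1 = 2 ^ hm m" "R11 2 = hm m" "R11 54 = lgm m" "R11 71 = lbase m 11" unfolding R11_def using Rv10 by simp_all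
 have Rv12: "R12 0 = m" "R12 1 = 2 ^ hm m" "R12 2 = hm m" "R12 54 = lgm m" "R12 72 = lbase m 12" unfolding R12_def using Rv11 by simp_all
 have Rv13: "R13 0 = m" "R13 1 = 2 ^ hm m" "R13 2 = hm m" "R13 54 = lgm m" "R13 73 = lbase m 13" unfolding R13_def using Rv12 by simp_all
 have "R13 (60 + l) = lbase m l" if "l < 14" for l
 proof -
  have "l = 0 \<or> l = 1 \<or> l = 2 \<or> l = 3 \<or> l = 4 \<or> l = 5 \<or> l = 6 \<or> l = 7 \<or> l = 8 \<or> l = 9 \<or> l = 10 \<or> l = 11 \<or> l = 12 \<or> l = 13" using that by presburger
  then show ?thesis using r(4) lbase_steps(1)[of m] unfolding R0_def R1_def R2_def R3_def R4_def R5_def R6_def R7_def R8_def R9_def R10_def R11_def R12_def R13_def by (elim disjE) simp_all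
 qed
 moreover have "ALL y<5. R13 y = R y" unfolding R0_def R1_def R2_def R3_def R4_def R5_def R6_def R7_def R8_def R9_def R10_def R11_def R12_def R13_def by simp
 moreover have "R13 5 = 2 ^ w - 1" unfolding R0_def R1_def R2_def R3_def R4_def R5_def R6_def R7_def R8_def R9_def R10_def R11_def R12_def R13_def by simp
 ultimately have q: "Q t R' A'" if "t <= 170 & R' = R13 & A' = A" for t R' A' unfolding Q_def using that by blast
 let ?s13 = "73 ::= Plus (Var 72) (Plus (Var 0) (Num 1))"
 let ?s12 = "72 ::= Plus (Var 71) (Plus (Var 0) (Num 1)) ;; ?s13"
 let ?s11 = "71 ::= Plus (Var 70) (Times (Plus (Var 2) (Num 1)) (Twice (Var 0))) ;; ?s12"
 let ?s10 = "70 ::= Plus (Var 69) (Times (Plus (Var 2) (Num 1)) (Twice (Var 1))) ;; ?s11"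
 let ?s9 = "69 ::= Plus (Var 68) (Var 54) ;; ?s10"
 let ?s8 = "68 ::= Plus (Var 67) (Var 54) ;; ?s9"
 let ?s7 = "67 ::= Plus (Var 66) (Var 54) ;; ?s8"
 let ?s6 = "66 ::= Plus (Var 65) (Twice (Var 1)) ;; ?s7"
 let ?s5 = "65 ::= Plus (Var 64) (Var 0) ;; ?s6"
 let ?s4 = "64 ::= Plus (Var 63) (Twice (Var 0)) ;; ?s5"
 let ?s3 = "63 ::= Plus (Var 62) (Plus (Var 0) (Num 1)) ;; ?s4"
 let ?s2 = "62 ::= Plus (Var 61) (Var 0) ;; ?s3"
 let ?s1 = "61 ::= Twice (Var 0) ;; ?s2"
 have p13: "runs (?s13) R12 A (%t R' A'. t <= 11 & R' = R13 & A' = A)"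
  by (rule runs_Asg) (use Rv12 lbase_steps(14)[of m] lt[of 13] len0 S(2) w2 in "simp_all add: R13_def")
 have p12: "runs (?s12) R11 A (%t R' A'. t <= 22 & R' = R13 & A' = A)"
  by (rule asg_step[OF _ _ _ _ p13[unfolded R12_def]]) (use Rv11 lbase_steps(13)[of m] lt[of 12] len0 S(2) w1 w2 in simp_all)
 have p11: "runs (?s11) R10 A (%t R' A'. t <= 33 & R' = R13 & A' = A)"
  by (rule asg_step[OF _ _ _ _ p12[unfolded R11_def]]) (use Rv10 lbase_steps(12)[of m] lt[of 11] len0 S(2) w1 w2 in simp_all)
 have p10: "runs (?s10) R9 A (%t R' A'. t <= 44 & R' = R13 & A' = A)"
  by (rule asg_step[OF _ _ _ _ p11[unfolded R10_def]]) (use Rv9 lbase_steps(11)[of m] lt[of 10] len0 S(2) w1 w2 in simp_all)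
 have p9: "runs (?s9) R8 A (%t R' A'. t <= 55 & R' = R13 & A' = A)"
  by (rule asg_step[OF _ _ _ _ p10[unfolded R9_def]]) (use Rv8 lbase_steps(10)[of m] lt[of 9] len0 S(2) w1 w2 in simp_all)
 have p8: "runs (?s8) R7 A (%t R' A'. t <= 66 & R' = R13 & A' = A)"
  by (rule asg_step[OF _ _ _ _ p9[unfolded R8_def]]) (use Rv7 lbase_steps(9)[of m] lt[of 8] len0 S(2) w1 w2 in simp_all)
 have p7: "runs (?s7) R6 A (%t R' A'. t <= 77 & R' = R13 & A' = A)"
  by (rule asg_step[OF _ _ _ _ p8[unfolded R7_def]]) (use Rv6 lbase_steps(8)[of m] lt[of 7] len0 S(2) w1 w2 in simp_all)
 have p6: "runs (?s6) R5 A (%t R' A'. t <= 88 & R' = R13 & A' = A)"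
  by (rule asg_step[OF _ _ _ _ p7[unfolded R6_def]]) (use Rv5 lbase_steps(7)[of m] lt[of 6] len0 S(2) w1 w2 in simp_all)
 have p5: "runs (?s5) R4 A (%t R' A'. t <= 99 & R' = R13 & A' = A)"
  by (rule asg_step[OF _ _ _ _ p6[unfolded R5_def]]) (use Rv4 lbase_steps(6)[of m] lt[of 5] len0 S(2) w1 w2 in simp_all)
 have p4: "runs (?s4) R3 A (%t R' A'. t <= 110 & R' = R13 & A' = A)"
  by (rule asg_step[OF _ _ _ _ p5[unfolded R4_def]]) (use Rv3 lbase_steps(5)[of m] lt[of 4] len0 S(2) w1 w2 in simp_all)
 have p3: "runs (?s3) R2 A (%t R' A'. t <= 121 & R' = R13 & A' = A)"
  by (rule asg_step[OF _ _ _ _ p4[unfolded R3_def]]) (use Rv2 lbase_steps(4)[of m] lt[of 3] len0 S(2) w1 w2 in simp_all)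
 have p2: "runs (?s2) R1 A (%t R' A'. t <= 132 & R' = R13 & A' = A)"
  by (rule asg_step[OF _ _ _ _ p3[unfolded R2_def]]) (use Rv1 lbase_steps(3)[of m] lt[of 2] len0 S(2) w1 w2 in simp_all)
 have p1: "runs (?s1) R0 A (%t R' A'. t <= 143 & R' = R13 & A' = A)"
  by (rule asg_step[OF _ _ _ _ p2[unfolded R1_def]]) (use Rv lbase_steps(2)[of m] lt[of 1] len0 S(2) w1 w2 in simp_all)
 have w3: "32 * (hm m + 2) < 2 ^ w" "32 * (hm m + 2) * (hm m + 2) < 2 ^ w" "32 * (hm m + 2) * (hm m + 2) * (m + 2) < 2 ^ w"
  using w1(1,2) L unfolding a2_def a1_def lgm_def by blast+
 note p54 = asg_step[where A = A and R = "R(5 := 2 ^ w - 1)" and x = 54 and v = "lgm m" and d' = 160, OF _ _ _ _ p1[unfolded R0_def]]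
 have "runs LAY R A (%t R' A'. t <= 170 & R' = R13 & A' = A)" unfolding LAY_def
  by (rule asg_step[OF _ _ _ _ p54]) (use r w1(3,4) w3 S(2) in "simp_all add: lgm_def")
 then have "runs LAY R A Q" by (rule runs_mono) (rule q)
 then show ?thesis unfolding Q_def .
qed

lemma PRO:
 assumes len0: "!!l. 0 < l ==> len l = 0" and r: "R 0 = m" "R 60 = 0" and m: "2 <= m"
  and S: "lbase m 14 < 2 ^ w" "64 * (m + 2) * (m + 2) <= (2::nat) ^ w"
 shows "runs PRO R A (%t R' A'. t <= 30 * hm m + 30 * km m + 200 & R' 0 = m & R' 1 = 2 ^ hm m & R' 2 = hm m & R' 3 = km m & R' 5 = 2 ^ w - 1 &
  (ALL l<14. R' (60 + l) = lbase m l) & A' = A)"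
  (is "runs _ _ _ ?Q")
proof -
 define Q where "Q = ?Q"
 have P: "64 * ((m + 2) * (m + 2)) <= 2 ^ w" using S(2) by (simp only: mult.assoc)
 have mm: "m * m + 2 * m + 4 <= (m + 2) * (m + 2)" by (simp add: algebra_simps)
 have w1: "m * m < 2 ^ w" "2 * (2 * m) < 2 ^ w" "64 < (2::nat) ^ w" "m + 2 < 2 ^ w" using P mm m by linarith+
 have hb: "2 ^ hm m <= 2 * m" "hm m <= m" using hm_bound[OF m] by auto
 define I where "I = (%z R1 A1. R1 1 = 2 ^ z & R1 2 = z & sm {1, 2} R1 R & A1 = A)"
 let ?c = "Lt (Var 1) (Var 0)" and ?b = "1 ::= Twice (Var 1) ;; inc 2"
 have loop: "runs (Wh ?c ?b) (R(1 := 1, 2 := 0)) A (%t R' A'. t <= hm m * (20 + xk ?c + 1) + xk ?c + 1 & I (hm m) R' A')"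
 proof (rule runs_For)
  show "I 0 (R(1 := 1, 2 := 0)) A" by (simp add: I_def)
 next
  fix z R1 A1 assume z: "z < hm m" and i: "I z R1 A1"
  have zm: "2 ^ z < m" by (rule hm(2)[OF z])
  have "I (Suc z) (R1(1 := 2 * 2 ^ z, 2 := z + 1)) A1" using i by (simp add: I_def)
  then have "runs ?b R1 A1 (%t R' A'. t <= 20 & I (Suc z) R' A')"
   by (intro runs_Sq runs_Asg) (use i zm z hb w1 in "simp_all add: I_def")
  then show "okc R1 A1 ?c & holds R1 A1 ?c & runs ?b R1 A1 (%t R' A'. t <= 20 & I (Suc z) R' A')" using i zm r by (simp add: I_def)
 next
  fix R1 A1 assume "I (hm m) R1 A1"
  then show "okc R1 A1 ?c & \<not> holds R1 A1 ?c" using r hm(1)[of m] by (simp add: I_def)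
 qed
 define J where "J = (%R0 z R1 A1. R1 3 = z + 1 & (ALL y. y ~= 3 --> R1 y = (R0 :: regs) y) & A1 = A)"
 let ?d = "Lt (Times (Var 3) (Var 3)) (Var 0)"
 have k1: "1 <= km m" "km m <= m" using km[of m] m by auto
 have loop2: "runs (Wh ?d (inc 3)) (R0(3 := 1)) A (%t R' A'. t <= (km m - 1) * (20 + xk ?d + 1) + xk ?d + 1 & J R0 (km m - 1) R' A')" if R0: "R0 0 = m" for R0
 proof (rule runs_For)
  show "J R0 0 (R0(3 := 1)) A" by (simp add: J_def)
 next
  fix z R1 A1 assume z: "z < km m - 1" and i: "J R0 z R1 A1"
  have zm: "(z + 1) * (z + 1) < m" by (rule km(2)) (use z in simp)
  have "J R0 (Suc z) (R1(3 := z + 1 + 1)) A1" using i by (simp add: J_def)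
  moreover have "z + 1 + 1 < 2 ^ w" using z k1 w1 by linarith
  ultimately have "runs (inc 3) R1 A1 (%t R' A'. t <= 20 & J R0 (Suc z) R' A')"
   by (intro runs_Asg) (use i w1 in "simp_all add: J_def")
  moreover have "(z + 1) * (z + 1) < 2 ^ w" using zm w1 by linarith
  ultimately show "okc R1 A1 ?d & holds R1 A1 ?d & runs (inc 3) R1 A1 (%t R' A'. t <= 20 & J R0 (Suc z) R' A')"
   using i zm R0 by (simp add: J_def)
 next
  fix R1 A1 assume i: "J R0 (km m - 1) R1 A1"
  have "km m * km m <= m * m" using k1 by (intro mult_le_mono) auto
  then have "km m * km m < 2 ^ w" using w1 by linarith
  moreover have "R1 3 = km m" using i k1 by (simp add: J_def)
  ultimately show "okc R1 A1 ?d & \<not> holds R1 A1 ?d" using i R0 km(1)[of m] by (simp add: J_def)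
 qed
 have "runs (Wh ?c ?b ;; 3 ::= Num 1 ;; Wh ?d (inc 3) ;; LAY) (R(1 := 1, 2 := 0)) A (%t. Q (4 + t))"
 proof (rule runs_SqM'[OF _ loop], goal_cases)
  case (1 t1 R1 A1) note a1 = this
  have e1: "R1 0 = m" "R1 1 = 2 ^ hm m" "R1 2 = hm m" "R1 60 = 0" "A1 = A" using a1 r by (auto simp: I_def)
  have "runs (Wh ?d (inc 3) ;; LAY) (R1(3 := 1)) A (%t. Q (4 + (t1 + (2 + t))))"
  proof (rule runs_SqM'[OF _ loop2[of R1, OF e1(1)]], goal_cases)
   case (1 t2 R2 A2) note a2 = this
   have e2: "R2 0 = m" "R2 1 = 2 ^ hm m" "R2 2 = hm m" "R2 60 = 0" "A2 = A" "R2 3 = km m" using a2 e1 k1 by (auto simp: J_def)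
   show ?case
   proof (rule runs_mono'[OF _ LAY[where m = m, OF len0 e2(1-4) S(1) w1(3)]], goal_cases)
    case (1 t3 R3 A3) note a3 = this
    have "t2 <= (km m - 1) * 25 + 5" "t1 <= hm m * 23 + 3" using conjunct1[OF a2] conjunct1[OF a1] by simp_all
    moreover have "(km m - 1) * 25 <= km m * 25" by simp
    ultimately have "4 + (t1 + (2 + (t2 + t3))) <= 30 * hm m + 30 * km m + 200" using conjunct1[OF a3] by linarith
    then show ?case unfolding Q_def using a3 e2 by simp
   qed
  qed
  then show ?case
   by (intro runs_SqA runs_Asg) (use e1 w1 in simp_all)
 qed
 then have "runs PRO R A Q" unfolding PRO_def
  by (intro runs_SqA runs_Asg) (use w1 in simp_all)
 then show ?thesis unfolding Q_def .
qed

end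

text \<open>Register 60 is the base of the input array. It holds an arbitrary word at first and has
  to be 0 before any compiled program can be specified.\<close>

definition algorithm :: com where
 "algorithm = Seq (Move 60 (Const 0)) (Seq (comp PRO) (comp BODY))"

definition time_bound :: "nat => nat" where
 "time_bound m = 1 + (30 * hm m + 30 * km m + 200) + 15000 * ((m + 1) * ((hm m + 1 + (km m + 1)) * ((hm m + 1) * (hm m + 1))))"

definition space_bound :: "nat => nat" where
 "space_bound m = lbase m 14"

lemma algorithm_correct:
 assumes T: "\<not> unary T" and m: "m = length (rle T)" and w: "length T ^ 20 <= 2 ^ w" and inp: "rle_input w (rle T) (R0, M0)"
 shows "EX t s'. exec w (space_bound m) algorithm (R0, M0) t s' & t <= time_bound m & occs_output (space_bound m) (longest_unbordered_occs T) s'"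
proof -
 define c e where "c = (%x. fst (rle T ! x))" and "e = (%x. snd (rle T ! x))"
 define n where "n = length T"
 interpret rt: runtext m c e T using runtext_rle[OF T] unfolding m c_def e_def .
 have m2: "2 <= m" by (rule rt.m_ge)
 have npos: "n = rt.pos m" unfolding n_def by (rule rt.T_len)
 have "(\<Sum>y<m. 1) <= (\<Sum>y<m. e y)" using rt.e_pos by (intro sum_mono) simp
 then have mn: "m <= n" unfolding npos rt.pos_def by simp
 then have n2: "2 <= n" using m2 by simp
 have w20: "n ^ 20 <= 2 ^ w" using w unfolding n_def .
 \<comment> \<open>Since \<open>n\<close> is at least 2, constants can be traded for powers of
   \<open>n\<close>. The largest instance is \<open>2 ^ 10 * n ^ 3\<close> for the size of the
   memory, well within the exponent 20.\<close>
 have pw: "2 ^ a * n ^ b <= 2 ^ w" if "a + b <= 20" for a b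
 proof -
  have "2 ^ a * n ^ b <= n ^ a * n ^ b" using n2 by (intro mult_le_mono1 power_mono) auto
  also have "\<dots> = n ^ (a + b)" by (simp add: power_add)
  also have "\<dots> <= n ^ 20" using n2 that by (intro power_increasing) auto
  finally show ?thesis using w20 by simp
 qed
 have big: "64 * (n + 2) * (n + 2) <= 2 ^ w"
 proof -
  have "64 * (n + 2) * (n + 2) <= 64 * (2 * n) * (2 * n)" using n2 by (intro mult_le_mono) auto
  also have "\<dots> = 2 ^ 8 * n ^ 2" by (simp add: power2_eq_square)
  also have "\<dots> <= 2 ^ w" by (rule pw) simp
  finally show ?thesis .
 qed
 have hb: "2 ^ hm m <= 2 * m" "hm m <= m" using hm_bound[OF m2] by auto
 define S where "S = lbase m 14"
 have S: "S < 2 ^ w"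
 proof -
  define x where "x = m + 2"
  have x: "2 ^ hm m <= 2 * x" "hm m + 2 <= x" "hm m + 1 <= x" "m <= x" "4 <= x" using hb m2 unfolding x_def by auto
  have "lgm m <= 32 * x * x * x" unfolding lgm_def x_def[symmetric] using x by (intro mult_le_mono) auto
  moreover have "(hm m + 1) * (2 * 2 ^ hm m) <= x * (2 * (2 * x))" using x by (intro mult_le_mono) auto
  moreover have "(hm m + 1) * (2 * m) <= x * (2 * x)" using x by (intro mult_le_mono) auto
  ultimately have "S <= 11 * x + 3 + 2 * (2 * x) + 3 * (32 * x * x * x) + x * (2 * (2 * x)) + x * (2 * x)" unfolding S_def lbase_14 using x by linarith
  also have "\<dots> = 15 * x + 3 + 96 * (x * (x * x)) + 6 * (x * x)" by (simp add: algebra_simps)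
  also have "\<dots> < 128 * (x * (x * x))"
  proof -
   have a: "4 * x <= x * x" using x by (intro mult_le_mono1)
   have "4 * (x * x) <= x * (x * x)" using x by (intro mult_le_mono1)
   then show ?thesis using a x(5) by linarith
  qed
  also have "128 * (x * (x * x)) <= 128 * ((2 * n) * ((2 * n) * (2 * n)))" using mn m2 unfolding x_def by (intro mult_le_mono) auto
  also have "\<dots> = 2 ^ 10 * n ^ 3" by (simp add: power3_eq_cube)
  also have "\<dots> <= 2 ^ w" by (rule pw) simp
  finally show ?thesis .
 qed
 have w0: "0 < w"
 proof (rule ccontr)
  assume "\<not> 0 < w"
  then show False using pw[of 1 0] by simp
 qed
 have S20: "lbase m l <= S" if "l <= 20" for l using lbase_20[OF that] unfolding S_def .
 have mach: "machine w S (lbase m) (lay m)"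
 proof
  fix l assume l: "l < 20" "0 < lay m l"
  have "lbase m l + lay m l = lbase m (Suc l)" by (simp add: lbase_Suc)
  then show "lbase m l + lay m l <= S" using S20[of "Suc l"] l by simp
 next
  fix k l x y assume "k ~= l" "x < lay m k" "y < lay m l"
  then show "lbase m k + x ~= lbase m l + y" by (rule lbase_disj)
 qed (use S w0 in auto)
 have wd: "!!r. R0 r < 2 ^ w" "!!a. M0 a < 2 ^ w" "R0 0 = m" "!!x. x < m ==> M0 (2 * x) = c x & M0 (2 * x + 1) = e x"
  using inp unfolding rle_input_def m c_def e_def by auto
 \<comment> \<open>The machine seen by the prologue: only the input array has positive length, so
   all other base registers may be written.\<close>
 interpret p0: machine w S "%_. 0" "%l. if l = 0 then 2 * m else 0"
 proof
  have "2 * m <= S" unfolding S_def lbase_14 by simp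
  then show "(0::nat) + (if l = 0 then 2 * m else 0) <= S" for l :: nat by simp
 qed (use S w0 in "auto split: if_splits")
 interpret pr: prog_in w S "lbase m" "lay m" "hm m" "2 ^ hm m" m n "km m" "lgm m" c e
 proof (intro prog_in.intro prog.intro mach segtree.intro refl prog_axioms.intro prog_in_axioms.intro)
  show "runseq m c e" by unfold_locales
  show "c x < 2 ^ w" if "x < m" for x using wd(2)[of "2 * x"] wd(4)[OF that] by simp
 qed (use lay_simps[of m] hm(1)[of m] hb m2 km[of m] mn lgm_def S big npos in auto)
 define Ra where "Ra = R0(60 := 0)"
 have x0: "exec w S (Move 60 (Const 0)) (R0, M0) 1 (Ra, M0)" using exec.Move[of w S 60 "Const 0" R0 M0] unfolding Ra_def by simp
 have ag0: "p0.agree Ra M0 Ra (%k x. M0 x)" unfolding p0.agree_def Ra_def using wd by auto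
 have "64 * (m + 2) * (m + 2) <= 64 * (n + 2) * (n + 2)" using mn by (intro mult_le_mono) auto
 then have bigm: "64 * (m + 2) * (m + 2) <= 2 ^ w" using big by linarith
 have PRO: "p0.runs PRO Ra (%k x. M0 x) (%t R' A'. t <= 30 * hm m + 30 * km m + 200 & R' 0 = m & R' 1 = 2 ^ hm m & R' 2 = hm m & R' 3 = km m & R' 5 = 2 ^ w - 1 &
  (ALL l<14. R' (60 + l) = lbase m l) & A' = (%k x. M0 x))"
  by (rule p0.PRO) (use wd(3) m2 S bigm in "auto simp: Ra_def S_def")
 then obtain t1 R1 M1 R1' A1' where x1: "exec w S (comp PRO) (Ra, M0) t1 (R1, M1)" and ag1: "p0.agree R1 M1 R1' A1'"
  and q1: "t1 <= 30 * hm m + 30 * km m + 200 & R1' 0 = m & R1' 1 = 2 ^ hm m & R1' 2 = hm m & R1' 3 = km m & R1' 5 = 2 ^ w - 1 &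
   (ALL l<14. R1' (60 + l) = lbase m l) & A1' = (%k x. M0 x)"
  using ag0 unfolding p0.runs_def by blast
 have ag4: "ALL k<20. ALL x<(if k = 0 then 2 * m else 0). R1 (60 + k) = 0 & M1 (0 + x) = A1' k x" using ag1 unfolding p0.agree_def by blast
 have r1: "!!r. r < 80 ==> R1 r = R1' r" "!!r. R1 r < 2 ^ w" "!!a. M1 a < 2 ^ w" using ag1 unfolding p0.agree_def by blast+
 have r1m: "M1 x = M0 x" if "x < 2 * m" for x using ag4[rule_format, of 0 x] q1 that by simp
 have b1: "R1 (60 + l) = lbase m l" if "l < 14" for l using r1(1)[of "60 + l"] q1 that by simp
 \<comment> \<open>The same memory seen through the final layout. The cells outside the input hold
   arbitrary words, which the phases overwrite before they rely on them.\<close>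
 define A where "A = (%k x. M1 (lbase m k + x))"
 have ag: "pr.agree R1 M1 R1 A" unfolding pr.agree_def
 proof (intro conjI allI impI)
  fix k x assume "k < 20" "x < lay m k"
  then have "k < 14" by (auto simp: lay_def split: if_splits)
  then show "R1 (60 + k) = lbase m k" by (rule b1)
  show "M1 (lbase m k + x) = A k x" by (simp add: A_def)
 qed (use r1 in auto)
 have in1: "pr.inp A" unfolding pr.inp_def A_def lbase_steps(1) using r1m wd(4) by auto
 have BODY: "pr.runs BODY R1 A (%t R' A'. t <= 15000 * ((m + 1) * ((hm m + 1 + (km m + 1)) * ((hm m + 1) * (hm m + 1)))) & R' 1 = R1 73 &
  (EX xs. distinct xs & set xs = {(Suc (rt.pos x), rt.pos (Suc y)) |x y. x < y & y < m & \<not> rt.bord x y &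
   (ALL x' y'. x' < y' & y' < m & \<not> rt.bord x' y' --> rt.pos (Suc y') - rt.pos x' <= rt.pos (Suc y) - rt.pos x)} &
  R' 0 = length xs & length xs <= m & (ALL u<length xs. A' 13 (2 * u) = fst (xs ! u) & A' 13 (2 * u + 1) = snd (xs ! u))))"
  by (rule pr.BODY[OF _ _ _ _ _ in1]) (use r1(1) q1 in auto)
 then obtain t2 R2 M2 R2' A2' xs where x2: "exec w S (comp BODY) (R1, M1) t2 (R2, M2)" and ag2: "pr.agree R2 M2 R2' A2'"
  and t2: "t2 <= 15000 * ((m + 1) * ((hm m + 1 + (km m + 1)) * ((hm m + 1) * (hm m + 1))))" and r2: "R2' 1 = R1 73" "R2' 0 = length xs"
  and xs: "distinct xs" "set xs = {(Suc (rt.pos x), rt.pos (Suc y)) |x y. x < y & y < m & \<not> rt.bord x y &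
   (ALL x' y'. x' < y' & y' < m & \<not> rt.bord x' y' --> rt.pos (Suc y') - rt.pos x' <= rt.pos (Suc y) - rt.pos x)}"
   "length xs <= m" "!!u. u < length xs ==> A2' 13 (2 * u) = fst (xs ! u) & A2' 13 (2 * u + 1) = snd (xs ! u)"
  using ag unfolding pr.runs_def by (elim allE[of _ R1] allE[of _ M1]) auto
 have set: "set xs = longest_unbordered_occs T" unfolding xs(2) rt.longest_unbordered_occs_eq rt.best_def ..
 have o2: "R2 0 = length xs" "R2 1 = lbase m 13" using ag2 r2 b1[of 13] unfolding pr.agree_def by auto
 have mem: "M2 (lbase m 13 + x) = A2' 13 x" if "x < 2 * m" for x using ag2 that lay_simps(14)[of m] unfolding pr.agree_def by auto
 have out: "occs_output S (longest_unbordered_occs T) (R2, M2)" unfolding occs_output_def prod.case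
 proof (intro exI[of _ xs] conjI allI impI)
  show "R2 1 + 2 * length xs <= S" using xs(3) unfolding o2 S_def lbase_steps(15) by simp
  fix u assume u: "u < length xs"
  then have "2 * u < 2 * m" "2 * u + 1 < 2 * m" using xs(3) by auto
  then show "M2 (R2 1 + 2 * u) = fst (xs ! u)" "M2 (R2 1 + 2 * u + 1) = snd (xs ! u)"
   using mem[of "2 * u"] mem[of "2 * u + 1"] xs(4)[OF u] unfolding o2 by (simp_all add: add.assoc)
 qed (use xs set o2 in auto)
 have "exec w S algorithm (R0, M0) (1 + (t1 + t2)) (R2, M2)" unfolding algorithm_def by (rule exec.Seq[OF x0 exec.Seq[OF x1 x2]])
 moreover have "1 + (t1 + t2) <= time_bound m" using q1 t2 unfolding time_bound_def by linarith
 ultimately show ?thesis using out unfolding space_bound_def S_def[symmetric] by blast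
qed

section \<open>Asymptotic bounds\<close>

lemma log_facts:
 assumes m: "2 <= m"
 shows "1 <= log 2 (real m)" "1 <= sqrt (real m)" "real (hm m + 1) <= 3 * log 2 (real m)" "real (hm m + 2) <= 4 * log 2 (real m)"
  "real (km m + 1) <= 3 * sqrt (real m)"
proof -
 show l: "1 <= log 2 (real m)" using m by simp
 show s: "1 <= sqrt (real m)" using m by simp
 have "2 ^ (hm m - 1) < m" using hm_bound[OF m] by blast
 then have "real (2 ^ (hm m - 1)) < real m" by (simp only: of_nat_less_iff)
 then have "2 powr real (hm m - 1) < real m" by (simp add: powr_realpow)
 then have "real (hm m - 1) < log 2 (real m)" using m by (simp add: less_log_iff)
 then show "real (hm m + 1) <= 3 * log 2 (real m)" "real (hm m + 2) <= 4 * log 2 (real m)" using l hm_bound[OF m] by linarith+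
 have k1: "1 <= km m" using km(4)[of m] m by simp
 have "(km m - 1) * (km m - 1) < m" by (rule km(2)) (use k1 in simp)
 then have "real (km m - 1) ^ 2 <= real m" unfolding power2_eq_square by (metis less_imp_le of_nat_le_iff of_nat_mult)
 then have "real (km m - 1) <= sqrt (real m)" by (rule real_le_rsqrt)
 then show "real (km m + 1) <= 3 * sqrt (real m)" using s k1 by linarith
qed

lemma time_bound_bigo: "(%m. real (time_bound m)) \<in> O(%m. real m * sqrt (real m) * (log 2 (real m))\<^sup>2)"
proof (rule bigoI[where c = 3000000], rule eventually_at_top_linorderI[of 2])
 fix m :: nat assume m: "2 <= m"
 define l s where "l = log 2 (real m)" and "s = sqrt (real m)"
 define x where "x = real m * s * l\<^sup>2"
 note f = log_facts[OF m, folded l_def s_def]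
 have l2: "1 <= l\<^sup>2" by (rule one_le_power[OF f(1)])
 have l3: "l <= l\<^sup>2" using mult_left_mono[OF f(1), of l] f(1) by (simp add: power2_eq_square)
 have m1: "1 <= real m" "real (m + 1) <= 2 * real m" using m by auto
 have ms: "1 * 1 <= real m * s" using m1(1) f(2) by (intro mult_mono) auto
 have "1 * s <= real m * s" using m1(1) f(2) by (intro mult_right_mono) auto
 then have "(1 * s) * 1 <= (real m * s) * l\<^sup>2" using l2 f(2) ms by (intro mult_mono) auto
 then have sx: "s <= x" by (simp add: x_def)
 have "1 * l <= (real m * s) * l\<^sup>2" using ms l3 f(1) by (intro mult_mono) auto
 then have lx: "l <= x" by (simp add: x_def)
 have x1: "1 <= x" using sx f(2) by linarith
 have "hm m + 1 + (km m + 1) <= 3 * (km m + 1)" using hm_km[OF m] by simp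
 then have "real (hm m + 1 + (km m + 1)) <= real (3 * (km m + 1))" by (rule of_nat_mono)
 then have hk: "real (hm m + 1 + (km m + 1)) <= 9 * s" using f(5) by simp
 have "real (hm m + 1) * real (hm m + 1) <= (3 * l) * (3 * l)" using f(1,3) by (intro mult_mono) auto
 then have "real (hm m + 1 + (km m + 1)) * (real (hm m + 1) * real (hm m + 1)) <= (9 * s) * ((3 * l) * (3 * l))" using hk f by (intro mult_mono) auto
 then have "real (m + 1) * (real (hm m + 1 + (km m + 1)) * (real (hm m + 1) * real (hm m + 1))) <= (2 * real m) * ((9 * s) * ((3 * l) * (3 * l)))"
  by (rule mult_mono[OF m1(2)]) auto
 \<comment> \<open>The constant is 2 * 9 * 9: from \<open>m + 1\<close>, from the sum of logarithm
   and square root, and from the square of the logarithm.\<close>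
 also have "\<dots> = 162 * x" by (simp add: x_def power2_eq_square)
 finally have big: "real ((m + 1) * ((hm m + 1 + (km m + 1)) * ((hm m + 1) * (hm m + 1)))) <= 162 * x" by (simp only: of_nat_mult)
 have "real (time_bound m) = 201 + 30 * real (hm m) + 30 * real (km m) + 15000 * real ((m + 1) * ((hm m + 1 + (km m + 1)) * ((hm m + 1) * (hm m + 1))))"
  unfolding time_bound_def of_nat_add by simp
 also have "\<dots> <= 201 + 30 * (3 * l) + 30 * (3 * s) + 15000 * (162 * x)" using big f(3,5) by simp
 also have "\<dots> <= 3000000 * x" using sx lx x1 by linarith
 finally have "real (time_bound m) <= 3000000 * x" .
 then show "norm (real (time_bound m)) <= 3000000 * norm (real m * sqrt (real m) * (log 2 (real m))\<^sup>2)"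
  unfolding x_def l_def s_def by (simp add: abs_mult)
qed

lemma space_bound_bigo: "(%m. real (space_bound m)) \<in> O(%m. real m * (log 2 (real m))\<^sup>2)"
proof (rule bigoI[where c = 4000], rule eventually_at_top_linorderI[of 2])
 fix m :: nat assume m: "2 <= m"
 define l where "l = log 2 (real m)"
 define x where "x = real m * l\<^sup>2"
 note f = log_facts[OF m, folded l_def]
 have l2: "1 <= l\<^sup>2" by (rule one_le_power[OF f(1)])
 have l3: "l <= l\<^sup>2" using mult_left_mono[OF f(1), of l] f(1) by (simp add: power2_eq_square)
 have m1: "2 <= real m" using m by simp
 have mx: "real m <= x" "real m * l <= x" unfolding x_def using l2 l3 m1 mult_left_mono[of 1 "l\<^sup>2" "real m"] mult_left_mono[of l "l\<^sup>2" "real m"] by auto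
 have hb: "real (2 ^ hm m) <= 2 * real m" using hm_bound[OF m] by (metis of_nat_le_iff of_nat_mult of_nat_numeral)
 have h2: "real (hm m + 2) * real (hm m + 2) <= (4 * l) * (4 * l)" using f(1,4) by (intro mult_mono) auto
 have "(real (hm m + 2) * real (hm m + 2)) * real (m + 2) <= ((4 * l) * (4 * l)) * (2 * real m)" by (rule mult_mono[OF h2]) (use m1 in auto)
 also have "\<dots> = 32 * x" by (simp add: x_def power2_eq_square)
 finally have "(real (hm m + 2) * real (hm m + 2)) * real (m + 2) <= 32 * x" .
 moreover have "real (lgm m) = 32 * ((real (hm m + 2) * real (hm m + 2)) * real (m + 2))" unfolding lgm_def by (simp only: of_nat_mult of_nat_numeral mult.assoc)
 ultimately have lg: "real (lgm m) <= 1024 * x" by linarith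
 have "real ((hm m + 1) * (2 * 2 ^ hm m)) = real (hm m + 1) * real (2 * 2 ^ hm m)" by (rule of_nat_mult)
 also have "\<dots> <= (3 * l) * (4 * real m)" using f(1,3) hb by (intro mult_mono) auto
 also have "\<dots> = 12 * (real m * l)" by simp
 also have "\<dots> <= 12 * x" using mx(2) by simp
 finally have a9: "real ((hm m + 1) * (2 * 2 ^ hm m)) <= 12 * x" .
 have "real ((hm m + 1) * (2 * m)) = real (hm m + 1) * real (2 * m)" by (rule of_nat_mult)
 also have "\<dots> <= (3 * l) * (2 * real m)" using f(1,3) by (intro mult_mono) auto
 also have "\<dots> = 6 * (real m * l)" by simp
 also have "\<dots> <= 6 * x" using mx(2) by simp
 finally have a10: "real ((hm m + 1) * (2 * m)) <= 6 * x" .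
 have "real (space_bound m) = 11 * real m + 3 + 2 * real (2 ^ hm m) + 3 * real (lgm m) + real ((hm m + 1) * (2 * 2 ^ hm m)) + real ((hm m + 1) * (2 * m))"
  unfolding space_bound_def lbase_14 of_nat_add by simp
 also have "\<dots> <= 4000 * x" using hb lg a9 a10 mx(1) m1 by linarith
 finally have "real (space_bound m) <= 4000 * x" .
 then show "norm (real (space_bound m)) <= 4000 * norm (real m * (log 2 (real m))\<^sup>2)"
  unfolding x_def l_def by (simp add: abs_mult)
qed

theorem theorem1:
  shows "\<exists>(P :: com) (\<kappa> :: nat) (time :: nat \<Rightarrow> nat) (space :: nat \<Rightarrow> nat).
    (\<lambda>m. real (time m)) \<in> O(\<lambda>m. real m * sqrt (real m) * (log 2 (real m))\<^sup>2) \<and>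
    (\<lambda>m. real (space m)) \<in> O(\<lambda>m. real m * (log 2 (real m))\<^sup>2) \<and>
    (\<forall>(T :: nat list) (w :: nat) (s :: state) (m :: nat).
       \<not> unary T \<longrightarrow>
       m = length (rle T) \<longrightarrow>
       real \<kappa> * log 2 (real (length T)) \<le> real w \<longrightarrow>
       (\<forall>c\<in>set T. c < 2 ^ w) \<longrightarrow>
       rle_input w (rle T) s \<longrightarrow>
       2 * m \<le> space m \<and>
       (\<exists>t s'. exec w (space m) P s t s' \<and>
               t \<le> time m \<and>
               occs_output (space m) (longest_unbordered_occs T) s'))"
proof (rule exI[of _ algorithm], rule exI[of _ 20], rule exI[of _ time_bound], rule exI[of _ space_bound], intro conjI allI impI)
 show "(%m. real (time_bound m)) \<in> O(%m. real m * sqrt (real m) * (log 2 (real m))\<^sup>2)" by (rule time_bound_bigo)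
 show "(%m. real (space_bound m)) \<in> O(%m. real m * (log 2 (real m))\<^sup>2)" by (rule space_bound_bigo)
 fix T :: "nat list" and w :: nat and s :: state and m :: nat
 assume T: "\<not> unary T" and m: "m = length (rle T)" and w: "real 20 * log 2 (real (length T)) <= real w" and inp: "rle_input w (rle T) s"
 show "2 * m <= space_bound m" unfolding space_bound_def lbase_14 by simp
 have "T ~= []" using T by (auto simp: unary_def)
 then have n0: "0 < real (length T)" by simp
 have "real (length T) ^ 20 = 2 powr (real 20 * log 2 (real (length T)))"
  using n0 by (simp add: powr_realpow[symmetric] powr_def log_def)
 also have "\<dots> <= 2 powr real w" using w by (intro powr_mono) auto
 also have "\<dots> = 2 ^ w" by (simp add: powr_realpow)
 finally have "real (length T ^ 20) <= real (2 ^ w)" by simp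
 then have "length T ^ 20 <= 2 ^ w" by (simp only: of_nat_le_iff)
 then show "EX t s'. exec w (space_bound m) algorithm s t s' & t <= time_bound m & occs_output (space_bound m) (longest_unbordered_occs T) s'"
  using algorithm_correct[OF T m, of w "fst s" "snd s"] inp by simp
qed

end
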